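(* Let $\omega=K_1\cup K_2\subset\mathbb{R}^d$ be the union of two simplices $K_1,K_2$ with common face $E=K_1\cap K_2$, let $\ell\ge1$ and $\varepsilon>0$. For any $u\in H^1(\omega)$, let $P_E\in S|_\omega$ be the best approximation to $u$ in $S|_\omega$ with respect to $|||\cdot|||_\omega$. Then $$ |||u-P_E|||_\omega\le C\sum_{i=1}^2\ \inf_{P\in\mathbb{P}_\ell(K_i)}\Big(|||u-P|||_{K_i}^2+\frac{|K_i|}{|\partial K_i|}\|u-P\|_{\partial K_i}^2\Big)^{1/2}, $$ where the constant $C$ depends on $\ell$, $d$ and $\sigma_E$, but is independent of $\varepsilon$.
   Context: $\|\cdot\|_A$ is the $L^2(A)$-norm (on $\partial K_i$ with respect to the $(d-1)$-dimensional Hausdorff measure) and $|||v|||_A=(\|v\|_A^2+\varepsilon\|\nabla v\|_A^2)^{1/2}$. $\mathbb{P}_\ell(K)$ is the space of polynomials of degree at most $\ell$ on $K$; $S|_\omega$ is the space of continuous functions on $\omega$ whose restriction to each $K_i$ is in $\mathbb{P}_\ell(K_i)$. $|K_i|$ is the $d$-dimensional Lebesgue measure and $|\partial K_i|$ the $(d-1)$-dimensional Hausdorff measure. $\sigma_E=\max\{h_1,h_2\}/\min\{\rho_1,\rho_2\}$ with $h_i=\mathrm{diam}(K_i)$ and $\rho_i$ the maximum diameter of a ball inscribed in $K_i$. *)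

theory Defs
  imports "HOL-Analysis.Analysis"
begin

section \<open>Square-integrable functions\<close>

definition L2 :: "'a measure \<Rightarrow> ('a \<Rightarrow> 'b::euclidean_space) set" where
  "L2 M = {f \<in> borel_measurable M. integrable M (\<lambda>x. (norm (f x))\<^sup>2)}"

text \<open>Meaningful for members of \<open>L2 M\<close> only: the Bochner integral of a non-integrable
  function is 0.\<close>

definition L2_norm :: "'a measure \<Rightarrow> ('a \<Rightarrow> 'b::euclidean_space) \<Rightarrow> real" where
  "L2_norm M f = sqrt (\<integral>x. (norm (f x))\<^sup>2 \<partial>M)"

section \<open>Weak gradients and \<open>H\<^sup>1\<close>\<close>

definition partial_deriv :: "'n::finite \<Rightarrow> (real^'n \<Rightarrow> real) \<Rightarrow> real^'n \<Rightarrow> real" where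
  "partial_deriv i f x = frechet_derivative f (at x) (axis i 1)"

text \<open>\<open>k\<close> times continuously differentiable on the whole space.\<close>

primrec C_k :: "nat \<Rightarrow> (real^'n::finite \<Rightarrow> real) \<Rightarrow> bool" where
  "C_k 0 f \<longleftrightarrow> continuous_on UNIV f"
| "C_k (Suc k) f \<longleftrightarrow> (\<forall>x. f differentiable (at x)) \<and> (\<forall>i. C_k k (partial_deriv i f))"

definition smooth :: "(real^'n::finite \<Rightarrow> real) \<Rightarrow> bool" where
  "smooth f \<longleftrightarrow> (\<forall>k. C_k k f)"

definition test_functions :: "(real^'n::finite) set \<Rightarrow> (real^'n \<Rightarrow> real) set" where
  "test_functions \<Omega> = {\<phi>. smooth \<phi> \<and> compact (closure {x. \<phi> x \<noteq> 0}) \<and> closure {x. \<phi> x \<noteq> 0} \<subseteq> \<Omega>}"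

definition is_weak_grad ::
    "(real^'n::finite) set \<Rightarrow> (real^'n \<Rightarrow> real) \<Rightarrow> (real^'n \<Rightarrow> real^'n) \<Rightarrow> bool" where
  "is_weak_grad \<Omega> u G \<longleftrightarrow> (\<forall>\<phi>\<in>test_functions \<Omega>. \<forall>i.
     (\<integral>x. u x * partial_deriv i \<phi> x \<partial>lebesgue_on \<Omega>) = - (\<integral>x. G x $ i * \<phi> x \<partial>lebesgue_on \<Omega>))"

text \<open>Functions are representatives, so everything below is meant up to null sets.
  For a closed simplex, or a union of such, \<open>A\<close>, the space \<open>H\<^sup>1(A)\<close> is that of the
  interior of \<open>A\<close>.\<close>

definition H1 :: "(real^'n::finite) set \<Rightarrow> (real^'n \<Rightarrow> real) set" where
  "H1 A = {u \<in> L2 (lebesgue_on (interior A)).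
     \<exists>G \<in> L2 (lebesgue_on (interior A)). is_weak_grad (interior A) u G}"

definition weak_grad :: "(real^'n::finite) set \<Rightarrow> (real^'n \<Rightarrow> real) \<Rightarrow> real^'n \<Rightarrow> real^'n" where
  "weak_grad A u = (SOME G. G \<in> L2 (lebesgue_on (interior A)) \<and> is_weak_grad (interior A) u G)"

text \<open>The norm \<open>|||v|||\<^sub>A\<close>. The gradient is defined on the interior; for the sets used
  here the boundary is Lebesgue-null, so all integrals may be taken over the interior.\<close>

definition energy_norm :: "real \<Rightarrow> (real^'n::finite) set \<Rightarrow> (real^'n \<Rightarrow> real) \<Rightarrow> real" where
  "energy_norm \<epsilon> A v = sqrt ((L2_norm (lebesgue_on (interior A)) v)\<^sup>2
     + \<epsilon> * (L2_norm (lebesgue_on (interior A)) (weak_grad A v))\<^sup>2)"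

section \<open>Hausdorff measure\<close>

text \<open>The standard normalization: the \<open>s\<close>-dimensional measure of a set of diameter \<open>t\<close> is
  estimated by the volume of the \<open>s\<close>-dimensional ball of diameter \<open>t\<close>. For \<open>s = 0\<close> every
  nonempty covering set contributes 1, giving the counting measure.\<close>

definition hausdorff_premeasure :: "nat \<Rightarrow> real \<Rightarrow> 'a::metric_space set \<Rightarrow> ennreal" where
  "hausdorff_premeasure s \<delta> A =
     (INF C \<in> {C :: nat \<Rightarrow> 'a set. A \<subseteq> (\<Union>j. C j) \<and> (\<forall>j. bounded (C j) \<and> diameter (C j) \<le> \<delta>)}.
        \<Sum>j. if C j = {} then 0
            else ennreal (unit_ball_vol (real s) * (diameter (C j) / 2) ^ s))"

definition hausdorff_outer :: "nat \<Rightarrow> 'a::metric_space set \<Rightarrow> ennreal" where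
  "hausdorff_outer s A = (SUP \<delta> \<in> {0<..}. hausdorff_premeasure s \<delta> A)"

text \<open>Hausdorff outer measure is a metric outer measure, hence countably additive on the Borel
  sets; so \<open>measure_of\<close> yields its restriction to them and not the null measure.\<close>

definition hausdorff :: "nat \<Rightarrow> 'a::metric_space measure" where
  "hausdorff s = measure_of UNIV (sets borel) (hausdorff_outer s)"

definition surface_on :: "(real^'n::finite) set \<Rightarrow> (real^'n) measure" where
  "surface_on K = restrict_space (hausdorff (CARD('n) - 1)) (frontier K)"

section \<open>Traces\<close>

text \<open>The trace on \<open>\<partial>K\<close> is the continuous extension of the restriction
  \<open>\<phi> \<mapsto> \<phi>|\<^sub>\<partial>\<^sub>K\<close> from smooth functions to \<open>H\<^sup>1(K)\<close>. On a simplex it exists for every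
  \<open>u \<in> H\<^sup>1(K)\<close> and is unique up to surface-null sets; \<open>bdry_trace\<close> picks a representative.
  \<open>energy_norm 1\<close> is the \<open>H\<^sup>1\<close> norm.\<close>

definition is_trace :: "(real^'n::finite) set \<Rightarrow> (real^'n \<Rightarrow> real) \<Rightarrow> (real^'n \<Rightarrow> real) \<Rightarrow> bool" where
  "is_trace K u g \<longleftrightarrow> u \<in> H1 K \<and> g \<in> L2 (surface_on K) \<and>
     (\<exists>\<phi> :: nat \<Rightarrow> real^'n \<Rightarrow> real. (\<forall>k. smooth (\<phi> k)) \<and>
        (\<lambda>k. energy_norm 1 K (\<lambda>x. \<phi> k x - u x)) \<longlonglongrightarrow> 0 \<and>
        (\<lambda>k. L2_norm (surface_on K) (\<lambda>x. \<phi> k x - g x)) \<longlonglongrightarrow> 0)"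

definition bdry_trace :: "(real^'n::finite) set \<Rightarrow> (real^'n \<Rightarrow> real) \<Rightarrow> real^'n \<Rightarrow> real" where
  "bdry_trace K u = (SOME g. is_trace K u g)"

section \<open>Polynomial and continuous piecewise polynomial functions\<close>

definition polys :: "nat \<Rightarrow> (real^'n::finite \<Rightarrow> real) set" where
  "polys l = {p. \<exists>c :: ('n \<Rightarrow> nat) \<Rightarrow> real.
     p = (\<lambda>x. \<Sum>\<alpha> | (\<Sum>i\<in>UNIV. \<alpha> i) \<le> l. c \<alpha> * (\<Prod>i\<in>UNIV. (x $ i) ^ \<alpha> i))}"

text \<open>\<open>S|\<^sub>\<omega>\<close> for \<open>\<omega> = K\<^sub>1 \<union> K\<^sub>2\<close>; values outside \<open>\<omega>\<close> are irrelevant.\<close>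

definition cont_pw_polys ::
    "nat \<Rightarrow> (real^'n::finite) set \<Rightarrow> (real^'n) set \<Rightarrow> (real^'n \<Rightarrow> real) set" where
  "cont_pw_polys l K1 K2 = {v. continuous_on (K1 \<union> K2) v \<and>
     (\<forall>K\<in>{K1, K2}. \<exists>p\<in>polys l. \<forall>x\<in>K. v x = p x)}"

definition best_approx ::
    "real \<Rightarrow> nat \<Rightarrow> (real^'n::finite) set \<Rightarrow> (real^'n) set \<Rightarrow> (real^'n \<Rightarrow> real) \<Rightarrow> (real^'n \<Rightarrow> real) \<Rightarrow> bool"
  where
  "best_approx \<epsilon> l K1 K2 u P \<longleftrightarrow> P \<in> cont_pw_polys l K1 K2 \<and>
     (\<forall>Q\<in>cont_pw_polys l K1 K2.
        energy_norm \<epsilon> (K1 \<union> K2) (\<lambda>x. u x - P x) \<le> energy_norm \<epsilon> (K1 \<union> K2) (\<lambda>x. u x - Q x))"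

text \<open>The infimum over \<open>P \<in> \<P>\<^sub>l(K)\<close>. A polynomial is its own trace.\<close>

definition local_error :: "real \<Rightarrow> nat \<Rightarrow> (real^'n::finite) set \<Rightarrow> (real^'n \<Rightarrow> real) \<Rightarrow> real" where
  "local_error \<epsilon> l K u = (INF P\<in>polys l.
     sqrt ((energy_norm \<epsilon> K (\<lambda>x. u x - P x))\<^sup>2
       + measure lebesgue K / measure (hausdorff (CARD('n) - 1)) (frontier K)
         * (L2_norm (surface_on K) (\<lambda>x. bdry_trace K u x - P x))\<^sup>2))"

section \<open>Shape regularity\<close>

definition inball_diam :: "(real^'n::finite) set \<Rightarrow> real" where
  "inball_diam K = Sup {diameter (cball x r) | x r. cball x r \<subseteq> K}"

definition shape_const :: "(real^'n::finite) set \<Rightarrow> (real^'n) set \<Rightarrow> real" where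
  "shape_const K1 K2 =
     max (diameter K1) (diameter K2) / min (inball_diam K1) (inball_diam K2)"

end

theory Submission imports Defs begin

text \<open>The best approximation is at least as good as every other function in \<open>S|\<^sub>\<omega>\<close>. So it suffices to
construct from two polynomials, one on each simplex, a continuous piecewise polynomial whose error is
bounded by the local errors of the two polynomials, uniformly in \<open>\<epsilon>\<close>.

First let \<open>u\<close> be smooth. Keep the polynomial \<open>q1\<close> on the first simplex. On the second one add to \<open>q2\<close> the
jump \<open>q1 - q2\<close> on the common facet, extended constantly along the direction from a point of the facet to the
opposite vertex. The extension is a polynomial of the same degree, its square integral is at most \<open>h\<close> times
that of the jump over the facet (\<open>oblique_extension_bound\<close>), and an inverse inequality on an inscribed ball
(\<open>polys_inverse_inequality\<close>) bounds its gradient at the price of \<open>1 / h\<close>. What remains is to bound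
\<open>h + \<epsilon> / h\<close> times the square of the error on the facet (\<open>facet_local_estimate\<close>). If \<open>\<epsilon> \<le> h\<^sup>2\<close> the boundary
term of the local error does this, because volume over area is of the order \<open>h\<close>. If \<open>\<epsilon> \<ge> h\<^sup>2\<close> the
polynomials are first shifted by constants; then the Poincare inequality and the trace inequality bound everything by
the gradient, which the energy norm contains with the large factor \<open>\<epsilon>\<close>. Neither case needs a constant
that depends on \<open>\<epsilon>\<close>. The result is \<open>conforming_estimate\<close>.

A general \<open>u\<close> is approximated by smooth functions. The union of the two simplices need not be convex, but it
is star-shaped with respect to a small ball around a point of the common facet (\<open>simplex_pair\<close>), and on such
sets smooth functions are dense (\<open>smooth_dense_H1\<close>): dilate towards the centre, then mollify. Weak gradients
are unique up to null sets, so the energy norm may be computed with any of them (\<open>energy_norm_eq\<close>); for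
the glued piecewise polynomial this is the piecewise gradient, since the function is locally Lipschitz
(\<open>locally_lipschitz_weak_grad\<close>, \<open>glued_error\<close>). The trace inequality makes restriction to the boundary
continuous in the \<open>H\<^sup>1\<close> norm. Hence traces exist, and the boundary terms of the smooth
approximations converge to those of \<open>u\<close> (\<open>trace_close\<close>).

Surface integrals enter through one fact only (\<open>slicing_exists\<close>): Hausdorff measure on a hyperplane is
translation invariant and locally finite, hence integrating over parallel hyperplanes gives a multiple of
Lebesgue measure. The trace inequality and the bound for the extension follow by slicing along
suitable directions.\<close>

section \<open>Hausdorff measure is a Borel measure\<close>

definition cover_weight :: "nat => 'a::metric_space set => ennreal" where
 "cover_weight s X = (if X = {} then 0 else ennreal (unit_ball_vol (real s) * (diameter X / 2) ^ s))"

definition fine_covers :: "real => 'a::metric_space set => (nat => 'a set) set" where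
 "fine_covers dl A = {C. A \<subseteq> (\<Union>j. C j) & (\<forall>j. bounded (C j) & diameter (C j) <= dl)}"

lemma premeasure_eq: "hausdorff_premeasure s dl A = (INF C\<in>fine_covers dl A. \<Sum>j. cover_weight s (C j))"
 unfolding hausdorff_premeasure_def cover_weight_def fine_covers_def ..

lemma cover_weight_empty [simp]: "cover_weight s {} = 0"
 by (simp add: cover_weight_def)

lemma premeasure_le: "C : fine_covers dl A ==> hausdorff_premeasure s dl A <= (\<Sum>j. cover_weight s (C j))"
 unfolding premeasure_eq by (rule INF_lower)

lemma premeasure_mono: "A \<subseteq> B ==> hausdorff_premeasure s dl A <= hausdorff_premeasure s dl B"
 unfolding premeasure_eq by (rule INF_superset_mono) (auto simp: fine_covers_def)

lemma premeasure_antimono: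
 assumes "dl <= dl'"
 shows "hausdorff_premeasure s dl' A <= hausdorff_premeasure s dl A"
 unfolding premeasure_eq
proof (rule INF_superset_mono)
 show "fine_covers dl A \<subseteq> fine_covers dl' A"
  unfolding fine_covers_def using order_trans[OF _ assms] by blast
qed simp

lemma premeasure_empty: "dl > 0 ==> hausdorff_premeasure s dl {} = 0"
 using premeasure_le[of "%_. {}" dl "{}" s] by (simp add: fine_covers_def)

lemma premeasure_close:
 assumes "0 < e" "hausdorff_premeasure s dl A < \<infinity>"
 obtains C where "C : fine_covers dl A" "(\<Sum>j. cover_weight s (C j)) <= hausdorff_premeasure s dl A + e"
proof -
 have "hausdorff_premeasure s dl A < hausdorff_premeasure s dl A + e"
  using assms by simp
 then obtain C where "C : fine_covers dl A" "(\<Sum>j. cover_weight s (C j)) < hausdorff_premeasure s dl A + e"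
  unfolding premeasure_eq by (metis INF_less_iff)
 then show ?thesis using that by (simp add: less_imp_le)
qed

lemma premeasure_countably_subadditive:
 "hausdorff_premeasure s dl (\<Union>i. A i) <= (\<Sum>i::nat. hausdorff_premeasure s dl (A i))"
proof (rule ennreal_le_epsilon)
 fix e :: real assume fin: "(\<Sum>i. hausdorff_premeasure s dl (A i)) < top" and e: "0 < e"
 have fin': "hausdorff_premeasure s dl (A i) < \<infinity>" for i
  using fin by (metis ennreal_suminf_lessD infinity_ennreal_def top.not_eq_extremum)
 have "\<exists>C. C : fine_covers dl (A i) \<and>
  (\<Sum>j. cover_weight s (C j)) <= hausdorff_premeasure s dl (A i) + ennreal (e * (1/2)^Suc i)" for i
  using premeasure_close[OF _ fin'[of i], of "ennreal (e * (1/2)^Suc i)"] e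
  by (metis ennreal_less_zero_iff mult_pos_pos zero_less_divide_1_iff zero_less_numeral zero_less_power)
 then obtain C where C: "!!i. C i : fine_covers dl (A i)"
  and le: "!!i. (\<Sum>j. cover_weight s (C i j)) <= hausdorff_premeasure s dl (A i) + ennreal (e * (1/2)^Suc i)"
  by metis
 define D where "D n = (case prod_decode n of (i, j) => C i j)" for n
 have "D : fine_covers dl (\<Union>i. A i)"
 proof -
  have "\<exists>n. x : D n" if xA: "x : A i" for x i
  proof -
   have "A i \<subseteq> (\<Union>j. C i j)" using C[of i] by (simp add: fine_covers_def)
   with xA obtain j where "x : C i j" by blast
   then have "x : D (prod_encode (i, j))" by (simp add: D_def)
   then show ?thesis ..
  qed
  then show ?thesis
   using C by (auto simp: fine_covers_def D_def split: prod.split)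
 qed
 then have "hausdorff_premeasure s dl (\<Union>i. A i) <= (\<Sum>n. cover_weight s (D n))" by (rule premeasure_le)
 also have "... = (\<Sum>n. (%(i, j). cover_weight s (C i j)) (prod_decode n))"
  by (intro suminf_cong) (auto simp: D_def split: prod.split)
 also have "... = (\<Sum>i. \<Sum>j. cover_weight s (C i j))"
  by (rule suminf_ennreal_2dimen) simp
 also have "... <= (\<Sum>i. hausdorff_premeasure s dl (A i) + ennreal (e * (1/2)^Suc i))"
  by (intro suminf_le le) auto
 also have "... = (\<Sum>i. hausdorff_premeasure s dl (A i)) + (\<Sum>i. ennreal (e * (1/2)^Suc i))"
  by (rule suminf_add[symmetric]) auto
 also have "(\<Sum>i. ennreal (e * (1/2)^Suc i)) = ennreal e"
 proof (rule suminf_ennreal_eq)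
  show "(%i. e * (1 / 2) ^ Suc i) sums e"
   using sums_mult[OF power_half_series, of e] by simp
 qed (use e in auto)
 finally show "hausdorff_premeasure s dl (\<Union>i. A i) <= (\<Sum>i. hausdorff_premeasure s dl (A i)) + ennreal e" .
qed

lemma premeasure_metric_additive:
 assumes "dl < d" and sep: "!!a b. a : A ==> b : B ==> d <= dist a b"
 shows "hausdorff_premeasure s dl A + hausdorff_premeasure s dl B <= hausdorff_premeasure s dl (A \<union> B)"
 unfolding premeasure_eq[of s dl "A \<union> B"]
proof (rule INF_greatest)
 fix C assume C: "C : fine_covers dl (A \<union> B)"
 then have pos: "0 <= dl"
  by (auto simp: fine_covers_def) (meson diameter_ge_0 order_trans)
 define C1 where "C1 j = (if C j \<inter> A ~= {} then C j else {})" for j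
 define C2 where "C2 j = (if C j \<inter> A = {} then C j else {})" for j
 have 1: "C1 : fine_covers dl A" using C pos by (auto simp: fine_covers_def C1_def) blast
 have "\<exists>j. b : C2 j" if b: "b : B" for b
 proof -
  obtain j where j: "b : C j" using C b by (auto simp: fine_covers_def)
  have "C j \<inter> A = {}"
  proof (rule ccontr)
   assume "C j \<inter> A ~= {}"
   then obtain a where a: "a : C j" "a : A" by auto
   have "dist a b <= diameter (C j)"
    using C a j by (intro diameter_bounded_bound) (auto simp: fine_covers_def)
   moreover have "diameter (C j) <= dl" using C by (auto simp: fine_covers_def)
   ultimately show False using sep[OF a(2) b] assms(1) by linarith
  qed
  then show ?thesis using j by (auto simp: C2_def)
 qed
 then have "B \<subseteq> (\<Union>j. C2 j)" by blast
 then have 2: "C2 : fine_covers dl B" using C pos by (auto simp: fine_covers_def C2_def)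
 have "hausdorff_premeasure s dl A + hausdorff_premeasure s dl B
  <= (\<Sum>j. cover_weight s (C1 j)) + (\<Sum>j. cover_weight s (C2 j))"
  by (intro add_mono premeasure_le 1 2)
 also have "... = (\<Sum>j. cover_weight s (C1 j) + cover_weight s (C2 j))"
  by (rule suminf_add) auto
 also have "... = (\<Sum>j. cover_weight s (C j))"
  by (intro suminf_cong) (auto simp: C1_def C2_def)
 finally show "hausdorff_premeasure s dl A + hausdorff_premeasure s dl B <= (\<Sum>j. cover_weight s (C j))" .
qed

lemma premeasure_le_outer: "0 < dl ==> hausdorff_premeasure s dl A <= hausdorff_outer s A"
 unfolding hausdorff_outer_def by (rule SUP_upper) auto

lemma hausdorff_outer_mono: "A \<subseteq> B ==> hausdorff_outer s A <= hausdorff_outer s B"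
 unfolding hausdorff_outer_def by (intro SUP_mono) (auto intro: premeasure_mono)

lemma hausdorff_outer_empty [simp]: "hausdorff_outer s {} = 0"
 unfolding hausdorff_outer_def by (simp add: premeasure_empty cong: SUP_cong_simp)

lemma hausdorff_outer_countably_subadditive:
 "hausdorff_outer s (\<Union>i. A i) <= (\<Sum>i::nat. hausdorff_outer s (A i))"
 unfolding hausdorff_outer_def[of s "\<Union>i. A i"]
proof (rule SUP_least)
 fix dl :: real assume "dl : {0<..}"
 then have "(\<Sum>i. hausdorff_premeasure s dl (A i)) <= (\<Sum>i. hausdorff_outer s (A i))"
  by (intro suminf_le premeasure_le_outer) auto
 then show "hausdorff_premeasure s dl (\<Union>i. A i) <= (\<Sum>i. hausdorff_outer s (A i))"
  using premeasure_countably_subadditive[of s dl A] by (rule order_trans[rotated])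
qed

lemma hausdorff_outer_Un: "hausdorff_outer s (A \<union> B) <= hausdorff_outer s A + hausdorff_outer s B"
proof -
 have "(\<Sum>i. hausdorff_outer s (if i = 0 then A else if i = Suc 0 then B else {})) =
  (\<Sum>i\<in>{0, Suc 0}. hausdorff_outer s (if i = 0 then A else if i = Suc 0 then B else {}))"
  by (rule suminf_finite) auto
 moreover have "(\<Union>i. (if i = 0 then A else if i = Suc 0 then B else {})) = A \<union> B"
  by (auto split: if_splits)
 ultimately show ?thesis
  using hausdorff_outer_countably_subadditive[of s "%i. if i = 0 then A else if i = Suc 0 then B else {}"]
  by simp
qed

lemma hausdorff_outer_metric:
 assumes "0 < d" and sep: "!!a b. a : A ==> b : B ==> d <= dist a b"
 shows "hausdorff_outer s A + hausdorff_outer s B <= hausdorff_outer s (A \<union> B)"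
proof -
 have *: "hausdorff_premeasure s dl1 A + hausdorff_premeasure s dl2 B <= hausdorff_outer s (A \<union> B)"
  if "0 < dl1" "0 < dl2" for dl1 dl2
 proof -
  define dl where "dl = min (min dl1 dl2) (d/2)"
  have dl: "0 < dl" "dl <= dl1" "dl <= dl2" "dl < d" using that assms(1) by (auto simp: dl_def)
  have "hausdorff_premeasure s dl1 A + hausdorff_premeasure s dl2 B
   <= hausdorff_premeasure s dl A + hausdorff_premeasure s dl B"
   by (intro add_mono premeasure_antimono dl)
  also have "... <= hausdorff_premeasure s dl (A \<union> B)"
   by (rule premeasure_metric_additive[OF dl(4) sep])
  also have "... <= hausdorff_outer s (A \<union> B)" by (rule premeasure_le_outer[OF dl(1)])
  finally show ?thesis .
 qed
 have **: "hausdorff_outer s A + hausdorff_premeasure s dl2 B <= hausdorff_outer s (A \<union> B)" if "0 < dl2" for dl2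
 proof -
  have "hausdorff_outer s A + hausdorff_premeasure s dl2 B
   = (SUP dl1\<in>{0<..}. hausdorff_premeasure s dl1 A + hausdorff_premeasure s dl2 B)"
   unfolding hausdorff_outer_def by (rule ennreal_SUP_add_left[symmetric]) auto
  also have "... <= hausdorff_outer s (A \<union> B)" by (rule SUP_least) (simp add: * that)
  finally show ?thesis .
 qed
 have "hausdorff_outer s A + hausdorff_outer s B
   = (SUP dl2\<in>{0<..}. hausdorff_outer s A + hausdorff_premeasure s dl2 B)"
  unfolding hausdorff_outer_def[of s B]
  by (rule ennreal_SUP_add_right) auto
 also have "... <= hausdorff_outer s (A \<union> B)" by (rule SUP_least) (simp add: **)
 finally show ?thesis .
qed

text \<open>Caratheodory's argument. The shells between consecutive distances from the closed set \<open>F\<close>,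
  taken every other one, have positive distance from each other, so that the outer measures
  of all shells have a finite sum and those of the tails of the sequence vanish.\<close>

lemma hausdorff_outer_closed_split:
 fixes F :: "'a::metric_space set"
 assumes "closed F"
 shows "hausdorff_outer s (X \<inter> F) + hausdorff_outer s (X - F) <= hausdorff_outer s X"
proof (cases "hausdorff_outer s X < \<infinity> & F ~= {}")
 case False
 then show ?thesis by (auto simp: not_less top_unique)
next
 case True
 let ?h = "hausdorff_outer s"
 have ne: "F ~= {}" and fin: "?h X < \<infinity>" using True by auto
 define Y where "Y k = {x : X. 1 / real (Suc k) <= infdist x F}" for k
 define R where "R k = Y (Suc k) - Y k" for k
 have inv: "1 / real (Suc (Suc k)) < 1 / real (Suc k)" for k by (simp add: field_simps)
 have Ymono: "Y k \<subseteq> Y (Suc k)" for k using inv[of k] by (auto simp: Y_def)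
 have Ymono': "k <= m ==> Y k \<subseteq> Y m" for k m by (rule lift_Suc_mono_le[of Y, OF Ymono])
 have XF: "X - F = Y k \<union> (\<Union>j. R (j + k))" for k
 proof (intro equalityI subsetI)
  fix x assume x: "x : X - F"
  then have "infdist x F > 0"
   using assms ne in_closed_iff_infdist_zero[of F x] infdist_nonneg[of x F] by auto
  then obtain m where m: "inverse (real (Suc m)) < infdist x F" using reals_Archimedean by blast
  define P where "P i \<longleftrightarrow> x : Y i" for i
  have Pm: "P m" using x m by (auto simp: P_def Y_def divide_inverse)
  define l where "l = (LEAST i. P i)"
  have Pl: "P l" unfolding l_def by (rule LeastI[of P, OF Pm])
  show "x : Y k \<union> (\<Union>j. R (j + k))"
  proof (cases "l <= k")
   case True then show ?thesis using Pl Ymono' by (auto simp: P_def)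
  next
   case False
   then obtain i where i: "l = Suc i" "k <= i" by (cases l) auto
   have "\<not> P i" using not_less_Least[of i P] i by (simp add: l_def)
   then have "x : R i" using Pl i by (simp add: R_def P_def)
   then have "x : R ((i - k) + k)" using i by simp
   then show ?thesis by blast
  qed
 next
  fix x assume "x : Y k \<union> (\<Union>j. R (j + k))"
  then obtain m where "x : Y m" unfolding R_def by blast
  then have "x : X" "1 / real (Suc m) <= infdist x F" by (simp_all add: Y_def)
  moreover have "0 < 1 / real (Suc m)" by simp
  ultimately have "x : X" "0 < infdist x F" by linarith+
  then show "x : X - F" by auto
 qed
 have far: "\<exists>d>0. \<forall>a\<in>Y k. \<forall>b\<in>B. d <= dist a b" if "!!b. b : B ==> infdist b F <= 1 / real (Suc (Suc k))" for k B
 proof (intro exI[of _ "1 / real (Suc k) - 1 / real (Suc (Suc k))"] conjI ballI)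
  fix a b assume "a : Y k" "b : B"
  then show "1 / real (Suc k) - 1 / real (Suc (Suc k)) <= dist a b"
   using that[of b] infdist_triangle[of a F b] by (auto simp: Y_def)
 qed (use inv in simp)
 have Yle: "?h (X \<inter> F) + ?h (Y k) <= ?h X" for k
 proof -
  have "\<exists>d>0. \<forall>a\<in>Y k. \<forall>b\<in>X \<inter> F. d <= dist a b"
   by (rule far) (auto)
  then obtain d where "d > 0" "!!a b. a : X \<inter> F ==> b : Y k ==> d <= dist a b" by (metis dist_commute)
  then have "?h (X \<inter> F) + ?h (Y k) <= ?h (X \<inter> F \<union> Y k)" by (rule hausdorff_outer_metric)
  also have "... <= ?h X" by (rule hausdorff_outer_mono) (auto simp: Y_def)
  finally show ?thesis .
 qed
 have RX: "(\<Sum>i<m. ?h (R (Suc (2 * i + p)))) <= ?h (Y (2 * m + p))" for m p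
 proof (induction m)
  case 0 then show ?case by simp
 next
  case (Suc m)
  have "\<exists>d>0. \<forall>a\<in>Y (2*m+p). \<forall>b\<in>R (Suc (2 * m + p)). d <= dist a b"
   by (rule far) (auto simp: R_def Y_def)
  then obtain d where "d > 0" "!!a b. a : Y (2*m+p) ==> b : R (Suc (2 * m+p)) ==> d <= dist a b"
   by blast
  then have "?h (Y (2*m+p)) + ?h (R (Suc (2 * m+p))) <= ?h (Y (2*m+p) \<union> R (Suc (2 * m+p)))"
   by (rule hausdorff_outer_metric)
  also have "... <= ?h (Y (2 * Suc m + p))"
   by (rule hausdorff_outer_mono) (use Ymono'[of "2*m+p" "2*Suc m+p"] in \<open>auto simp: R_def\<close>)
  finally have step: "?h (Y (2*m+p)) + ?h (R (Suc (2 * m+p))) <= ?h (Y (2 * Suc m + p))" .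
  have "(\<Sum>i<Suc m. ?h (R (Suc (2 * i + p)))) <= ?h (Y (2*m+p)) + ?h (R (Suc (2 * m+p)))"
   using Suc by (simp add: add_right_mono)
  then show ?case using step by (rule order_trans)
 qed
 have YX: "?h (Y k) <= ?h X" for k by (rule hausdorff_outer_mono) (auto simp: Y_def)
 have dbl: "(\<Sum>j<2*m. ?h (R (Suc j))) = (\<Sum>i<m. ?h (R (Suc (2 * i + 0)))) + (\<Sum>i<m. ?h (R (Suc (2 * i + 1))))" for m
  by (induction m) (simp_all add: ac_simps)
 have sumle: "(\<Sum>j<m. ?h (R (Suc j))) <= ?h X + ?h X" for m
 proof -
  have "(\<Sum>j<m. ?h (R (Suc j))) <= (\<Sum>j<2*m. ?h (R (Suc j)))" by (rule sum_mono2) auto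
  also have "... <= ?h X + ?h X"
   unfolding dbl by (intro add_mono order_trans[OF RX YX])
  finally show ?thesis .
 qed
 define a where "a j = enn2real (?h (R (Suc j)))" for j
 have fin2: "?h X + ?h X < top" using fin by simp
 have a: "?h (R (Suc j)) = ennreal (a j)" for j
 proof -
  have "?h (R (Suc j)) <= (\<Sum>j<Suc j. ?h (R (Suc j)))"
   by (rule member_le_sum[where f = "%j. ?h (R (Suc j))"]) auto
  then have "?h (R (Suc j)) < top" using sumle[of "Suc j"] fin2 by (metis order_trans le_less_trans)
  then show ?thesis by (simp add: a_def)
 qed
 have a0: "0 <= a j" for j by (simp add: a_def)
 have "summable a"
 proof (rule summableI_nonneg_bounded)
  show "(\<Sum>j<n. a j) <= enn2real (?h X + ?h X)" for n
  proof -
   have "ennreal (\<Sum>j<n. a j) <= ?h X + ?h X"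
    using sumle[of n] by (simp add: a sum_ennreal a0)
   then have "enn2real (ennreal (\<Sum>j<n. a j)) <= enn2real (?h X + ?h X)"
    by (rule enn2real_mono) (rule fin2)
   then show ?thesis by (simp add: sum_nonneg a0)
  qed
 qed (rule a0)
 show ?thesis
 proof (rule ennreal_le_epsilon)
  fix e :: real assume "0 < e"
  then obtain N where N: "norm (\<Sum>i. a (i + N)) < e"
   using suminf_exist_split[OF _ \<open>summable a\<close>] by blast
  have sN: "summable (%i. a (i + N))" using \<open>summable a\<close> by (rule summable_ignore_initial_segment)
  have "?h (X - F) <= ?h (Y (Suc N)) + ?h (\<Union>j. R (j + Suc N))"
   unfolding XF[of "Suc N"] by (rule hausdorff_outer_Un)
  also have "?h (\<Union>j. R (j + Suc N)) <= (\<Sum>j. ?h (R (j + Suc N)))"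
   by (rule hausdorff_outer_countably_subadditive)
  also have "(\<Sum>j. ?h (R (j + Suc N))) = ennreal (\<Sum>j. a (j + N))"
   by (simp add: a suminf_ennreal2[OF a0 sN])
  also have "... <= ennreal e" using N by (intro ennreal_leI) simp
  finally have "?h (X - F) <= ?h (Y (Suc N)) + ennreal e" by simp
  then have "?h (X \<inter> F) + ?h (X - F) <= ?h (X \<inter> F) + (?h (Y (Suc N)) + ennreal e)"
   by (rule add_left_mono)
  also have "... <= ?h X + ennreal e"
   using Yle[of "Suc N"] by (simp add: add.assoc[symmetric] add_right_mono)
  finally show "?h (X \<inter> F) + ?h (X - F) <= ?h X + ennreal e" .
 qed
qed

lemma outer_measure_space_hausdorff: "outer_measure_space UNIV (hausdorff_outer s)"
 unfolding outer_measure_space_def positive_def increasing_def countably_subadditive_def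
 by (auto intro: hausdorff_outer_mono hausdorff_outer_countably_subadditive)

lemma emeasure_hausdorff:
 assumes "A : sets borel"
 shows "emeasure (hausdorff s) A = hausdorff_outer s (A :: 'a::metric_space set)"
proof -
 interpret U: sigma_algebra UNIV "UNIV :: 'a set set"
  using sigma_algebra_Pow[of "UNIV :: 'a set"] by simp
 let ?L = "lambda_system UNIV UNIV (hausdorff_outer s) :: 'a set set"
 have ms: "measure_space UNIV ?L (hausdorff_outer s)"
  by (rule U.caratheodory_lemma[OF outer_measure_space_hausdorff])
 have "F : ?L" if "closed F" for F :: "'a set"
  unfolding U.lambda_system_eq
  using hausdorff_outer_closed_split[OF that, of s]
  by (auto intro!: antisym) (metis Int_Diff_Un hausdorff_outer_Un)
 then have "sigma_sets UNIV {F. closed F} \<subseteq> ?L"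
  using ms by (intro sigma_algebra.sigma_sets_subset) (auto simp: measure_space_def)
 then have sub: "sets borel \<subseteq> ?L"
  unfolding borel_eq_closed by (simp add: sets_measure_of)
 have "measure_space UNIV (sets borel) (hausdorff_outer s :: 'a set => _)"
  using measure_down[OF ms _ sub] sets.sigma_algebra_axioms[of "borel :: 'a measure"] by simp
 then have "emeasure (measure_of UNIV (sets borel) (hausdorff_outer s)) A = hausdorff_outer s A"
  using assms sets.sigma_algebra_axioms[of "borel :: 'a measure"]
  by (intro emeasure_measure_of_sigma) (auto simp: measure_space_def)
 then show ?thesis by (simp add: hausdorff_def)
qed

lemma sets_hausdorff [measurable_cong, simp]: "sets (hausdorff s :: 'a::metric_space measure) = sets borel"
 using sets.sigma_sets_eq[of "borel :: 'a measure"] by (simp add: hausdorff_def sets_measure_of_conv)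

lemma space_hausdorff [simp]: "space (hausdorff s) = UNIV"
 by (simp add: hausdorff_def space_measure_of_conv)

subsection \<open>Isometries\<close>

lemma diameter_isometry:
 assumes "!!x y. dist (f x) (f y) = dist x (y :: 'a::metric_space)"
 shows "diameter (f ` X) = diameter X" "bounded (f ` X) \<longleftrightarrow> bounded X"
proof -
 have "(%(x, y). dist x y) ` (f ` X \<times> f ` X) = (%(x, y). dist x y) ` (X \<times> X)"
  by (force simp: assms image_iff)
 then show "diameter (f ` X) = diameter X" by (simp add: diameter_def)
 show "bounded (f ` X) \<longleftrightarrow> bounded X"
  by (auto simp: bounded_two_points assms)
qed

lemma hausdorff_outer_isometry_le:
 assumes iso: "!!x y. dist (f x) (f y) = dist x (y :: 'a::metric_space)"
 shows "hausdorff_outer s (f ` A) <= hausdorff_outer s A"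
 unfolding hausdorff_outer_def
proof (rule SUP_mono', unfold premeasure_eq, rule INF_greatest)
 fix dl and C :: "nat => 'a set" assume C: "C : fine_covers dl A"
 have "(%j. f ` C j) : fine_covers dl (f ` A)"
  using C by (force simp: fine_covers_def diameter_isometry[of f, OF iso])
 then have "(INF C\<in>fine_covers dl (f ` A). \<Sum>j. cover_weight s (C j)) <= (\<Sum>j. cover_weight s (f ` C j))"
  by (rule INF_lower2) simp
 also have "... = (\<Sum>j. cover_weight s (C j))"
  by (simp add: cover_weight_def diameter_isometry[of f, OF iso] cong: if_cong)
 finally show "(INF C\<in>fine_covers dl (f ` A). \<Sum>j. cover_weight s (C j)) <= (\<Sum>j. cover_weight s (C j))" .
qed

lemma hausdorff_outer_isometry:
 assumes "!!x y. dist (f x) (f y) = dist x (y :: 'a::metric_space)" "!!x. g (f x) = x"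
  "!!x y. dist (g x) (g y) = dist x y"
 shows "hausdorff_outer s (f ` A) = hausdorff_outer s A"
proof (rule antisym[OF hausdorff_outer_isometry_le[OF assms(1)]])
 have "g ` f ` A = A" using assms(2) by (force simp: image_image)
 then show "hausdorff_outer s A <= hausdorff_outer s (f ` A)"
  using hausdorff_outer_isometry_le[of g s "f ` A"] assms(3) by simp
qed

section \<open>Slicing Lebesgue measure by hyperplanes\<close>

lemma nn_integral_lborel_affine:
 fixes f :: "'a::euclidean_space => ennreal"
 assumes [measurable]: "f : borel_measurable borel" and c: "c ~= 0"
 shows "(\<integral>\<^sup>+x. f x \<partial>lborel) = ennreal (\<bar>c\<bar> ^ DIM('a)) * (\<integral>\<^sup>+x. f (t + c *\<^sub>R x) \<partial>lborel)"
 by (subst lborel_affine[OF c, of t])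
  (simp add: nn_integral_density nn_integral_distr nn_integral_cmult)

lemma nn_integral_lborel_reflect:
 fixes f :: "'a::euclidean_space => ennreal"
 assumes [measurable]: "f : borel_measurable borel"
 shows "(\<integral>\<^sup>+x. f (t - x) \<partial>lborel) = (\<integral>\<^sup>+x. f x \<partial>lborel)"
 using nn_integral_lborel_affine[OF assms, of "-1" t] by simp

lemma nn_integral_lborel_shift:
 fixes f :: "'a::euclidean_space => ennreal"
 assumes [measurable]: "f : borel_measurable borel"
 shows "(\<integral>\<^sup>+x. f (t + x) \<partial>lborel) = (\<integral>\<^sup>+x. f x \<partial>lborel)"
 using nn_integral_lborel_affine[OF assms, of 1 t] by simp

lemma emeasure_lborel_cbox_cart:
 assumes "!!i. a $ i <= b $ i"
 shows "emeasure lborel (cbox a b) = ennreal (\<Prod>i\<in>UNIV. b $ i - a $ i)"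
proof -
 have "cbox a b ~= {}" using assms by (simp add: interval_ne_empty_cart)
 then show ?thesis
  by (subst emeasure_eq_ennreal_measure) (auto simp: content_cbox_cart emeasure_lborel_cbox_eq)
qed

lemma lborel_reflect: "distr lborel borel (%z. s - z) = (lborel :: 'a::euclidean_space measure)"
proof (rule measure_eqI)
 fix A assume "A : sets (distr lborel borel (%z::'a. s - z))"
 then have [measurable]: "A : sets borel" by simp
 have "emeasure (distr lborel borel (%z. s - z)) A = (\<integral>\<^sup>+z. indicator A (s - z) \<partial>lborel)"
  using nn_integral_distr[of "%z. s - z" lborel borel "indicator A"] by simp
 also have "... = emeasure lborel A" by (subst nn_integral_lborel_reflect) auto
 finally show "emeasure (distr lborel borel (%z. s - z)) A = emeasure lborel A" .
qed simp

lemma translation_invariant_proportional: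
 fixes M :: "'a::euclidean_space measure"
 assumes sets [measurable_cong]: "sets M = sets borel" and sf: "sigma_finite_measure M"
  and inv: "!!z. distr M borel (%x. x + z) = M"
  and A [measurable]: "A : sets borel" and B [measurable]: "B : sets borel"
 shows "emeasure M A * emeasure lborel B = emeasure M B * emeasure lborel A"
proof -
 interpret M: sigma_finite_measure M by (rule sf)
 interpret pair_sigma_finite M lborel ..
 have ind: "indicator A x * indicator B (x + y) = (indicator A x * indicator B (x + y) :: ennreal)" for x y :: 'a ..
 have "emeasure M A * emeasure lborel B = (\<integral>\<^sup>+x. indicator A x * (\<integral>\<^sup>+y. indicator B (x + y) \<partial>lborel) \<partial>M)"
  by (subst nn_integral_lborel_shift) (simp_all add: nn_integral_multc sets)
 also have "... = (\<integral>\<^sup>+x. (\<integral>\<^sup>+y. indicator A x * indicator B (x + y) \<partial>lborel) \<partial>M)"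
  by (simp add: nn_integral_cmult)
 also have "... = (\<integral>\<^sup>+y. (\<integral>\<^sup>+x. indicator A x * indicator B (x + y) \<partial>M) \<partial>lborel)"
  by (rule Fubini'[symmetric]) measurable
 also have "... = (\<integral>\<^sup>+y. (\<integral>\<^sup>+x. indicator A (x - y) * indicator B x \<partial>M) \<partial>lborel)"
 proof (rule nn_integral_cong)
  fix y :: 'a
  have "(\<integral>\<^sup>+x. indicator A (x - y) * indicator B x \<partial>M)
   = (\<integral>\<^sup>+x. indicator A (x - y) * indicator B x \<partial>(distr M borel (%x. x + y)))"
   by (simp add: inv)
  also have "... = (\<integral>\<^sup>+x. indicator A x * indicator B (x + y) \<partial>M)"
   by (subst nn_integral_distr) (auto simp: )
  finally show "(\<integral>\<^sup>+x. indicator A x * indicator B (x + y) \<partial>M)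
   = (\<integral>\<^sup>+x. indicator A (x - y) * indicator B x \<partial>M)" by simp
 qed
 also have "... = (\<integral>\<^sup>+x. (\<integral>\<^sup>+y. indicator A (x - y) * indicator B x \<partial>lborel) \<partial>M)"
  by (rule Fubini') measurable
 also have "... = (\<integral>\<^sup>+x. indicator B x * (\<integral>\<^sup>+y. indicator A (x - y) \<partial>lborel) \<partial>M)"
  by (simp add: nn_integral_cmult mult.commute)
 also have "... = emeasure M B * emeasure lborel A"
  by (subst nn_integral_lborel_reflect) (simp_all add: nn_integral_multc sets)
 finally show ?thesis .
qed

subsection \<open>Surface measure on a hyperplane\<close>

definition hyperplane_measure :: "real^'n => real => (real^'n) measure" where
 "hyperplane_measure a b = density (hausdorff (CARD('n) - 1)) (indicator {x. a \<bullet> x = b})"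

lemma sets_hyperplane_measure [measurable_cong, simp]: "sets (hyperplane_measure a b) = sets borel"
 and space_hyperplane_measure [simp]: "space (hyperplane_measure a b) = UNIV"
 by (simp_all add: hyperplane_measure_def)

lemma borel_hyperplane [measurable]: "{x. a \<bullet> x = (b::real)} : sets (borel :: (real^'n) measure)"
 by (intro borel_closed closed_hyperplane)

lemma emeasure_hyperplane_measure:
 assumes [measurable]: "A : sets borel"
 shows "emeasure (hyperplane_measure a b) A
  = hausdorff_outer (CARD('n) - 1) (A \<inter> {x. a \<bullet> x = b} :: (real^'n) set)"
proof -
 have "A \<inter> {x. a \<bullet> x = b} : sets borel" by measurable
 then show ?thesis
  by (simp add: hyperplane_measure_def emeasure_density emeasure_hausdorff[symmetric]
    indicator_inter_arith[symmetric] Int_commute nn_integral_indicator)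
qed

lemma distr_hyperplane_measure:
 fixes f :: "real^'n => real^'n"
 assumes f: "!!x y. dist (f x) (f y) = dist x y" and g: "!!x y. dist (g x) (g y) = dist x y"
  and gf: "!!x. g (f x) = x" and fg: "!!x. f (g x) = x" and pl: "!!x. a' \<bullet> f x = b' \<longleftrightarrow> a \<bullet> x = b"
 shows "distr (hyperplane_measure a b) borel f = hyperplane_measure a' b'"
proof (rule measure_eqI)
 fix A assume "A : sets (distr (hyperplane_measure a b) borel f)"
 then have A [measurable]: "A : sets borel" by simp
 have "continuous_on UNIV f" by (auto simp: continuous_on_iff f)
 then have [measurable]: "f : borel_measurable borel" by (rule borel_measurable_continuous_onI)
 have fA: "f -` A : sets borel" using measurable_sets[of f borel borel A] by simp
 have "f ` (f -` A \<inter> {x. a \<bullet> x = b}) = A \<inter> {x. a' \<bullet> x = b'}"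
  using fg pl by (force simp: image_iff)
 then have "hausdorff_outer (CARD('n) - 1) (f -` A \<inter> {x. a \<bullet> x = b})
  = hausdorff_outer (CARD('n) - 1) (A \<inter> {x. a' \<bullet> x = b'})"
  using hausdorff_outer_isometry[of f g, OF f gf g] by metis
 then show "emeasure (distr (hyperplane_measure a b) borel f) A = emeasure (hyperplane_measure a' b') A"
  by (simp add: emeasure_distr emeasure_hyperplane_measure[OF A] emeasure_hyperplane_measure[OF fA])
qed simp

lemma premeasure_finite_cover:
 assumes "finite I" "A \<subseteq> (\<Union>i\<in>I. C i)" "0 <= dl" "!!i. i : I ==> bounded (C i) & diameter (C i) <= dl"
  "!!i. i : I ==> cover_weight s (C i) <= w"
 shows "hausdorff_premeasure s dl A <= of_nat (card I) * w"
proof -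
 obtain h where h: "bij_betw h {0..<card I} I" using ex_bij_betw_nat_finite[OF assms(1)] by blast
 define D where "D j = (if j < card I then C (h j) else {})" for j
 have hI: "j < card I ==> h j : I" for j using h by (auto simp: bij_betw_def)
 have "\<exists>j. x : D j" if xA: "x : A" for x
 proof -
  obtain i where "i : I" "x : C i" using subsetD[OF assms(2) xA] by blast
  moreover from this h obtain j where "j < card I" "h j = i"
   unfolding bij_betw_def by (metis imageE atLeastLessThan_iff)
  ultimately have "x : D j" by (simp add: D_def)
  then show ?thesis ..
 qed
 then have "A \<subseteq> (\<Union>j. D j)" by blast
 then have "D : fine_covers dl A"
  using assms(3,4) hI by (auto simp: fine_covers_def D_def)
 then have "hausdorff_premeasure s dl A <= (\<Sum>j. cover_weight s (D j))" by (rule premeasure_le)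
 also have "... = (\<Sum>j<card I. cover_weight s (D j))"
  by (rule suminf_finite) (auto simp: D_def)
 also have "... <= (\<Sum>j<card I. w)"
  by (intro sum_mono) (auto simp: D_def intro!: assms(5) hI)
 finally show ?thesis by simp
qed

text \<open>A fine grid of cubes covers the flat ball; refining the grid does not change the sum of the weights.\<close>

lemma hausdorff_coordinate_ball_le:
 fixes k :: "'n::finite" and R :: real
 assumes R: "0 < R"
 defines "n \<equiv> CARD('n)"
 shows "hausdorff_outer (n - 1) ({x. axis k 1 \<bullet> x = 0} \<inter> cball 0 R :: (real^'n) set)
  <= ennreal (unit_ball_vol (real (n - 1)) * (2 * real n * R) ^ (n - 1))"
 unfolding hausdorff_outer_def
proof (rule SUP_least)
 fix dl :: real assume "dl : {0<..}"
 then have dl: "0 < dl" by simp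
 have npos: "0 < n" by (simp add: n_def)
 obtain N0 :: nat where N0: "real n * (2 * R) / dl < real N0" using reals_Archimedean2 by blast
 define N where "N = Suc N0"
 have N: "0 < N" "real n * (2 * R) / real N <= dl"
  using N0 dl R by (auto simp: N_def field_simps)
 define I where "I = PiE (UNIV - {k}) (%_. {..N})"
 define C :: "('n => nat) => (real^'n) set" where
  "C m = {x. x $ k = 0 & (\<forall>i. i ~= k --> -R + 2*R*real (m i) / N <= x $ i & x $ i <= -R + 2*R*(real (m i) + 1) / N)}" for m
 have close: "norm (x - y) <= real n * (2 * R) / real N" if "x : C m" "y : C m" for x y m
 proof -
  have "norm (x - y) <= (\<Sum>i\<in>UNIV. \<bar>(x - y) $ i\<bar>)" by (rule norm_le_l1_cart)
  also have "... <= (\<Sum>i\<in>(UNIV::'n set). 2 * R / N)"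
  proof (rule sum_mono)
   fix i :: 'n
   show "\<bar>(x - y) $ i\<bar> <= 2 * R / N"
   proof (cases "i = k")
    case True then show ?thesis using that R by (simp add: C_def)
   next
    case False
    have "2*R*(real (m i) + 1) / N = 2*R*real (m i) / N + 2 * R / N"
     by (simp add: distrib_left add_divide_distrib)
    moreover have "-R + 2*R*real (m i) / N <= x $ i" "x $ i <= -R + 2*R*(real (m i) + 1) / N"
     "-R + 2*R*real (m i) / N <= y $ i" "y $ i <= -R + 2*R*(real (m i) + 1) / N"
     using that False by (auto simp: C_def)
    ultimately show ?thesis by (simp add: abs_le_iff)
   qed
  qed
  finally show ?thesis by (simp add: n_def)
 qed
 have bd: "bounded (C m)" for m
 proof (cases "C m = {}")
  case False
  then obtain y where "y : C m" by blast
  then show ?thesis unfolding bounded_def dist_norm using close by blast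
 qed simp
 have diam: "diameter (C m) <= real n * (2 * R) / real N" for m
  by (rule diameter_le) (use close R in auto)
 have "hausdorff_premeasure (n-1) dl ({x. axis k 1 \<bullet> x = 0} \<inter> cball 0 R :: (real^'n) set)
  <= of_nat (card I) * ennreal (unit_ball_vol (real (n-1)) * (real n * R / real N) ^ (n-1))"
 proof (rule premeasure_finite_cover[where C=C])
  show "finite I" by (auto simp: I_def intro!: finite_PiE)
  show "{x. axis k 1 \<bullet> x = 0} \<inter> cball 0 R \<subseteq> (\<Union>m\<in>I. C m)"
  proof
   fix x :: "real^'n" assume x: "x : {x. axis k 1 \<bullet> x = 0} \<inter> cball 0 R"
   define m where "m i = (if i = k then undefined else nat \<lfloor>(x $ i + R) * N / (2 * R)\<rfloor>)" for i
   have xi: "\<bar>x $ i\<bar> <= R" for i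
    using component_le_norm_cart[of x i] x by simp
   have m: "real (m i) <= (x $ i + R) * N / (2 * R)" "(x $ i + R) * N / (2 * R) <= real (m i) + 1" if "i ~= k" for i
   proof -
    have "0 <= (x $ i + R) * N / (2 * R)" using xi[of i] R by (auto simp: abs_le_iff)
    then show "real (m i) <= (x $ i + R) * N / (2 * R)" "(x $ i + R) * N / (2 * R) <= real (m i) + 1"
     using that by (auto simp: m_def of_nat_nat le_floor_iff)
   qed
   have "m i <= N" if "i ~= k" for i
   proof -
    have "(x $ i + R) * N / (2 * R) <= (R + R) * N / (2 * R)"
     using xi[of i] R by (intro divide_right_mono mult_right_mono) (auto simp: abs_le_iff)
    also have "... = N" using R by simp
    finally have "real (m i) <= real N" using m(1)[OF that] by linarith
    then show ?thesis by simp
   qed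
   then have "m : I" by (auto simp: I_def PiE_def extensional_def m_def)
   moreover have "x : C m"
    using x m R N(1) by (auto simp: C_def inner_axis' field_simps)
   ultimately show "x : (\<Union>m\<in>I. C m)" by blast
  qed
  fix m
  show "bounded (C m) & diameter (C m) <= dl" using bd diam N(2) order_trans by blast
  show "cover_weight (n - 1) (C m) <= ennreal (unit_ball_vol (real (n-1)) * (real n * R / real N) ^ (n-1))"
  proof -
   define q where "q = real n * R / real N"
   have "real n * (2 * R) / real N = 2 * q" by (simp add: q_def)
   then have "diameter (C m) / 2 <= q" using diam[of m] by simp
   then have "diameter (C m) / 2 <= real n * R / real N" by (simp add: q_def)
   then show ?thesis
    by (auto simp: cover_weight_def intro!: ennreal_leI mult_left_mono power_mono diameter_ge_0 bd)
  qed
 qed (use dl in simp)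
 also have "card I = (N + 1) ^ (n - 1)"
  by (simp add: I_def card_PiE n_def)
 also have "of_nat ((N + 1) ^ (n-1)) * ennreal (unit_ball_vol (real (n-1)) * (real n * R / real N) ^ (n-1))
  = ennreal (real ((N + 1) ^ (n-1)) * (unit_ball_vol (real (n-1)) * (real n * R / real N) ^ (n-1)))"
  by (subst ennreal_mult') (simp_all add: ennreal_of_nat_eq_real_of_nat)
 also have "real ((N + 1) ^ (n-1)) * (unit_ball_vol (real (n-1)) * (real n * R / real N) ^ (n-1))
  = unit_ball_vol (real (n-1)) * ((real N + 1) * (real n * R / real N)) ^ (n-1)"
  by (subst power_mult_distrib) (simp add: add.commute)
 also have "ennreal ... <= ennreal (unit_ball_vol (real (n - 1)) * (2 * real n * R) ^ (n - 1))"
 proof (intro ennreal_leI mult_left_mono power_mono)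
  show "(real N + 1) * (real n * R / real N) <= 2 * real n * R"
   using N(1) R npos by (simp add: field_simps)
 qed (use R N in auto)
 finally show "hausdorff_premeasure (n-1) dl ({x. axis k 1 \<bullet> x = 0} \<inter> cball 0 R :: (real^'n) set)
  <= ennreal (unit_ball_vol (real (n - 1)) * (2 * real n * R) ^ (n - 1))" .
qed

text \<open>Thicken every set of a covering of the face to a box of height one. The boxes cover the unit cube, and the
volume of each is a constant times the weight of the set.\<close>

lemma hausdorff_unit_cube_face_pos:
 fixes k :: "'n::finite"
 defines "n \<equiv> CARD('n)"
 shows "0 < hausdorff_outer (n - 1) ({x. axis k 1 \<bullet> x = 0} \<inter> cbox 0 (\<chi> i. 1) :: (real^'n) set)"
proof -
 let ?F = "{x. axis k 1 \<bullet> x = 0} \<inter> cbox 0 (\<chi> i. 1) :: (real^'n) set"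
 let ?v = "unit_ball_vol (real (n - 1))"
 have v: "0 < ?v" by simp
 have "ennreal (?v / 4 ^ (n - 1)) <= hausdorff_premeasure (n-1) 1 ?F"
  unfolding premeasure_eq
 proof (rule INF_greatest)
  fix C :: "nat => (real^'n) set" assume C: "C : fine_covers 1 ?F"
  define d where "d j = diameter (C j)" for j
  have bd: "bounded (C j)" for j using C by (auto simp: fine_covers_def)
  have d0: "0 <= d j" for j using bd by (simp add: d_def diameter_ge_0)
  define y where "y j = (SOME y. y : C j)" for j
  define B :: "nat => (real^'n) set" where
   "B j = (if C j = {} then {} else cbox (\<chi> i. if i = k then 0 else y j $ i - d j) (\<chi> i. if i = k then 1 else y j $ i + d j))" for j
  have Bsets: "B j : sets lborel" for j by (auto simp: B_def)
  have mB: "emeasure lborel (B j) <= ennreal (4 ^ (n-1) / ?v) * cover_weight (n-1) (C j)" for j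
  proof (cases "C j = {}")
   case False
   have "emeasure lborel (B j) = ennreal (\<Prod>i\<in>UNIV. if i = k then 1 else 2 * d j)"
   proof -
    show ?thesis using False d0[of j]
     by (simp add: B_def emeasure_lborel_cbox_cart) (intro arg_cong[where f=ennreal] prod.cong, auto)
   qed
   also have "(\<Prod>i\<in>UNIV. if i = k then 1 else 2 * d j) = (2 * d j) ^ (n - 1)"
    by (subst prod.remove[of UNIV k]) (auto simp: n_def card_Diff_singleton)
   also have "... = (4 * (d j / 2)) ^ (n - 1)" by simp
   also have "... = 4 ^ (n-1) * (d j / 2) ^ (n - 1)" by (rule power_mult_distrib)
   also have "... = 4 ^ (n-1) / ?v * (?v * (d j / 2) ^ (n - 1))"
   proof -
    have "p * y = p / w * (w * y)" if "w ~= 0" for p y w :: real using that by simp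
    moreover have "?v ~= 0" using v by linarith
    ultimately show ?thesis by blast
   qed
   also have "ennreal ... = ennreal (4 ^ (n-1) / ?v) * ennreal (?v * (d j / 2) ^ (n - 1))"
    by (rule ennreal_mult) (use v d0[of j] in auto)
   also have "ennreal (?v * (d j / 2) ^ (n - 1)) = cover_weight (n-1) (C j)"
    using False by (simp add: cover_weight_def d_def)
   finally show ?thesis by simp
  qed (simp add: B_def)
  have cov: "cbox 0 (\<chi> i. 1) \<subseteq> (\<Union>j. B j)"
  proof
   fix x :: "real^'n" assume x: "x : cbox 0 (\<chi> i. 1)"
   define x' where "x' = (\<chi> i. if i = k then 0 else x $ i)"
   have "x' : ?F" using x by (auto simp: x'_def mem_box_cart inner_axis')
   then obtain j where j: "x' : C j" using C by (auto simp: fine_covers_def)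
   then have "y j : C j" unfolding y_def by (rule someI)
   then have "norm (x' - y j) <= d j"
    using diameter_bounded_bound[OF bd j] by (simp add: d_def dist_norm)
   then have near: "\<bar>x' $ i - y j $ i\<bar> <= d j" for i
    using order_trans[OF component_le_norm_cart[of "x' - y j" i]] by simp
   have ne: "C j ~= {}" using j by blast
   have "0 <= x $ i & x $ i <= 1" for i using x by (simp add: mem_box_cart)
   moreover have "y j $ i - d j <= x $ i & x $ i <= y j $ i + d j" if "i ~= k" for i
    using near[of i] that by (simp add: x'_def abs_le_iff)
   ultimately have "x : B j"
    using ne by (simp add: B_def mem_box_cart)
   then show "x : (\<Union>j. B j)" by blast
  qed
  have "1 = emeasure lborel (cbox 0 (\<chi> i. 1) :: (real^'n) set)"
   by (subst emeasure_lborel_cbox_cart) auto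
  also have "... <= emeasure lborel (\<Union>j. B j)" using Bsets by (intro emeasure_mono cov) auto
  also have "... <= (\<Sum>j. emeasure lborel (B j))"
   using Bsets by (intro emeasure_subadditive_countably) auto
  also have "... <= (\<Sum>j. ennreal (4 ^ (n-1) / ?v) * cover_weight (n-1) (C j))"
   by (intro suminf_le mB) auto
  also have "... = ennreal (4 ^ (n-1) / ?v) * (\<Sum>j. cover_weight (n-1) (C j))" by simp
  finally have "ennreal (?v / 4 ^ (n - 1)) * 1 <= ennreal (?v / 4 ^ (n - 1)) * (ennreal (4 ^ (n-1) / ?v) * (\<Sum>j. cover_weight (n-1) (C j)))"
   by (rule mult_left_mono) simp
  also have "... = ennreal (?v / 4 ^ (n - 1) * (4 ^ (n-1) / ?v)) * (\<Sum>j. cover_weight (n-1) (C j))"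
   using v by (subst ennreal_mult) (simp_all add: mult.assoc)
  also have "?v / 4 ^ (n - 1) * (4 ^ (n-1) / ?v) = 1" using v by (simp del: unit_ball_vol_pos)
  finally show "ennreal (?v / 4 ^ (n - 1)) <= (\<Sum>j. cover_weight (n-1) (C j))" by simp
 qed
 moreover have "0 < ennreal (?v / 4 ^ (n - 1))" using v by simp
 ultimately have "0 < hausdorff_premeasure (n-1) 1 ?F" by (rule less_le_trans[rotated])
 then show ?thesis
  using premeasure_le_outer[of 1 "n-1" ?F] by (meson less_le_trans zero_less_one)
qed

text \<open>All hyperplanes are isometric images of one coordinate hyperplane, which makes the
  constants below independent of the hyperplane.\<close>

lemma isometry_onto_hyperplane:
 fixes a :: "real^'n" and k :: 'n
 assumes "norm a = 1"
 shows "\<exists>(f :: real^'n => real^'n) g. (\<forall>x y. dist (f x) (f y) = dist x y) & (\<forall>x y. dist (g x) (g y) = dist x y) \<and>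
  (\<forall>x. g (f x) = x) & (\<forall>x. f (g x) = x) & (\<forall>x. a \<bullet> f x = b \<longleftrightarrow> axis k 1 \<bullet> x = (0::real)) \<and>
  (\<forall>x t. f (x + t *\<^sub>R axis k 1) = f x + t *\<^sub>R a) & f 0 = b *\<^sub>R a"
proof -
 obtain U :: "real^'n => real^'n" where U: "orthogonal_transformation U" "U (axis k 1) = a"
  using orthogonal_transformation_exists_1[of "axis k 1 :: real^'n" a] assms by (auto simp: norm_axis_1)
 have lin: "linear U" and inj: "inj U" and surj: "surj U" and inn: "!!x y. U x \<bullet> U y = x \<bullet> y"
  using U(1) by (auto simp: orthogonal_transformation_def orthogonal_transformation_inj[OF U(1)]
   orthogonal_transformation_surj[OF U(1)])
 have dU: "dist (U x) (U y) = dist x y" for x y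
  using U(1) by (simp add: orthogonal_transformation_isometry)
 define f where "f x = U x + b *\<^sub>R a" for x
 define g where "g x = inv U (x - b *\<^sub>R a)" for x
 have fg: "f (g x) = x" for x by (simp add: f_def g_def surj_f_inv_f[OF surj])
 have gf: "g (f x) = x" for x by (simp add: f_def g_def inj)
 have df: "dist (f x) (f y) = dist x y" for x y by (simp add: f_def dU)
 have dg: "dist (g x) (g y) = dist x y" for x y by (metis df fg)
 have "a \<bullet> U x = axis k 1 \<bullet> x" for x using inn[of "axis k 1" x] U(2) by simp
 moreover have "a \<bullet> a = 1" using assms by (simp add: norm_eq_1)
 ultimately have pl: "a \<bullet> f x = b \<longleftrightarrow> axis k 1 \<bullet> x = (0::real)" for x
  by (simp add: f_def inner_add_right)
 have "f (x + t *\<^sub>R axis k 1) = f x + t *\<^sub>R a" for x t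
  by (simp add: f_def linear_add[OF lin] linear_scale[OF lin] U(2))
 moreover have "f 0 = b *\<^sub>R a" by (simp add: f_def linear_0[OF lin])
 ultimately show ?thesis using df dg gf fg pl by (intro exI[of _ f] exI[of _ g]) simp
qed

lemma hausdorff_hyperplane_ball_le:
 fixes a y :: "real^'n" and R :: real
 assumes R: "0 < R" and a: "norm a = 1"
 shows "hausdorff_outer (CARD('n) - 1) ({x. a \<bullet> x = b} \<inter> cball y R)
  <= ennreal (unit_ball_vol (real (CARD('n) - 1)) * (4 * real CARD('n) * R) ^ (CARD('n) - 1))"
proof (cases "{x. a \<bullet> x = b} \<inter> cball y R = {}")
 case False
 then have "\<exists>z. a \<bullet> z = b & dist y z <= R" by auto
 then obtain z where z: "a \<bullet> z = b" "dist y z <= R" by blast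
 obtain k :: 'n where True by blast
 obtain f g :: "real^'n => real^'n" where fg0:
  "\<forall>x y. dist (f x) (f y) = dist x y" "\<forall>x y. dist (g x) (g y) = dist x y"
  "\<forall>x. g (f x) = x" "\<forall>x. f (g x) = x" "\<forall>x. a \<bullet> f x = 0 \<longleftrightarrow> axis k 1 \<bullet> x = (0::real)"
  "\<forall>x t. f (x + t *\<^sub>R axis k 1) = f x + t *\<^sub>R a" "f 0 = 0 *\<^sub>R a"
  using isometry_onto_hyperplane[OF a, of 0 k] by blast
 note fg = fg0[rule_format]
 define h where "h x = f (x + g 0) + z" for x
 define h' where "h' x = g (x - z) - g 0" for x
 let ?S = "{x. axis k 1 \<bullet> x = 0} \<inter> cball 0 (2 * R) :: (real^'n) set"
 have sub: "{x. a \<bullet> x = b} \<inter> cball y R \<subseteq> h ` ?S"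
 proof
  fix x assume x: "x : {x. a \<bullet> x = b} \<inter> cball y R"
  have h: "h (h' x) = x" by (simp add: h_def h'_def fg)
  have "a \<bullet> (x - z) = 0" using x z by (simp add: inner_diff_right)
  then have "axis k 1 \<bullet> g (x - z) = 0" using fg(5)[of "g (x - z)"] fg(4) by simp
  moreover have "axis k 1 \<bullet> g 0 = 0" using fg(5)[of "g 0"] fg(4) by simp
  ultimately have "axis k 1 \<bullet> h' x = 0" by (simp add: h'_def inner_diff_right)
  moreover have "norm (h' x) = dist (x - z) 0" unfolding h'_def using fg(2) by (metis dist_norm)
  moreover have "dist (x - z) 0 <= 2 * R"
   using x z dist_triangle[of x z y] by (simp add: dist_norm norm_minus_commute)
  ultimately show "x : h ` ?S" using h by (intro image_eqI[of _ _ "h' x"]) auto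
 qed
 have "hausdorff_outer (CARD('n) - 1) ({x. a \<bullet> x = b} \<inter> cball y R) <= hausdorff_outer (CARD('n) - 1) (h ` ?S)"
  by (rule hausdorff_outer_mono[OF sub])
 also have "... <= hausdorff_outer (CARD('n) - 1) ?S"
  by (rule hausdorff_outer_isometry_le) (simp add: h_def fg)
 also have "... <= ennreal (unit_ball_vol (real (CARD('n) - 1)) * (2 * real CARD('n) * (2 * R)) ^ (CARD('n) - 1))"
  by (rule hausdorff_coordinate_ball_le) (use R in simp)
 finally show ?thesis by (simp add: mult.assoc mult.left_commute)
qed simp

lemma sigma_finite_hyperplane_measure:
 fixes a :: "real^'n"
 assumes a: "norm a = 1"
 shows "sigma_finite_measure (hyperplane_measure a b)"
proof
 have "emeasure (hyperplane_measure a b) (cball 0 (real (Suc m))) ~= \<infinity>" for m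
  using hausdorff_hyperplane_ball_le[of "real (Suc m)" a b 0] a
  by (simp add: emeasure_hyperplane_measure Int_commute del: of_nat_Suc) (metis ennreal_less_top infinity_ennreal_def not_less top.not_eq_extremum order_refl le_less_trans)
 then show "\<exists>A. countable A & A \<subseteq> sets (hyperplane_measure a b) & \<Union> A = space (hyperplane_measure a b)
   & (\<forall>a'\<in>A. emeasure (hyperplane_measure a b) a' ~= \<infinity>)"
 proof (intro exI[of _ "range (%m. cball 0 (real (Suc m)))"] conjI)
  show "\<Union> (range (%m. cball 0 (real (Suc m)))) = space (hyperplane_measure a b)"
  proof (auto simp del: of_nat_Suc)
   fix x :: "real^'n"
   obtain m :: nat where "norm x <= real m" using real_arch_simple by blast
   then show "\<exists>m. norm x <= real (Suc m)" by (intro exI[of _ m]) simp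
  qed
 qed auto
qed

lemma AE_hyperplane_measure: "AE x in hyperplane_measure a b. a \<bullet> x = b"
 unfolding hyperplane_measure_def by (subst AE_density) (auto simp: indicator_def)

lemma nn_integral_hyperplane_shift:
 fixes f :: "real^'n => ennreal"
 assumes [measurable]: "f : borel_measurable borel" and w: "a \<bullet> w = b' - b"
 shows "(\<integral>\<^sup>+x. f (x + w) \<partial>hyperplane_measure a b) = (\<integral>\<^sup>+x. f x \<partial>hyperplane_measure a b')"
proof -
 have "distr (hyperplane_measure a b) borel (%x. x + w) = hyperplane_measure a b'"
  by (rule distr_hyperplane_measure[where g = "%x. x - w"]) (use w in \<open>auto simp: inner_add_right dist_norm\<close>)
 then have "(\<integral>\<^sup>+x. f x \<partial>hyperplane_measure a b') = (\<integral>\<^sup>+x. f x \<partial>distr (hyperplane_measure a b) borel (%x. x + w))"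
  by simp
 also have "... = (\<integral>\<^sup>+x. f (x + w) \<partial>hyperplane_measure a b)"
  by (rule nn_integral_distr) auto
 finally show ?thesis ..
qed

definition slab_measure :: "real^'n => (real^'n) measure" where
 "slab_measure a = distr (hyperplane_measure a 0 \<Otimes>\<^sub>M lborel) borel (%(x, t). x + t *\<^sub>R a)"

lemma sets_slab_measure [measurable_cong, simp]: "sets (slab_measure a) = sets borel"
 by (simp add: slab_measure_def)

lemma nn_integral_slab_measure:
 assumes [measurable]: "F : borel_measurable borel"
 shows "(\<integral>\<^sup>+x. F x \<partial>slab_measure a) = (\<integral>\<^sup>+x. \<integral>\<^sup>+t. F (x + t *\<^sub>R a) \<partial>lborel \<partial>hyperplane_measure a 0)"
 unfolding slab_measure_def
 by (subst nn_integral_distr) (auto simp: lborel.nn_integral_fst[symmetric])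

lemma slab_measure_shift:
 fixes a :: "real^'n"
 assumes a: "norm a = 1"
 shows "distr (slab_measure a) borel (%x. x + z) = slab_measure a"
proof (rule measure_eqI)
 fix A assume "A : sets (distr (slab_measure a) borel (%x. x + z))"
 then have A [measurable]: "A : sets borel" by simp
 define z0 where "z0 = z - (a \<bullet> z) *\<^sub>R a"
 have z: "z = z0 + (a \<bullet> z) *\<^sub>R a" by (simp add: z0_def)
 have az0: "a \<bullet> z0 = 0 - 0" using a by (simp add: z0_def inner_diff_right norm_eq_1)
 have "emeasure (distr (slab_measure a) borel (%x. x + z)) A = (\<integral>\<^sup>+x. indicator A x \<partial>distr (slab_measure a) borel (%x. x + z))"
  by simp
 also have "... = (\<integral>\<^sup>+x. indicator A (x + z) \<partial>slab_measure a)"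
  by (subst nn_integral_distr) auto
 also have "... = (\<integral>\<^sup>+x. \<integral>\<^sup>+t. indicator A (x + t *\<^sub>R a + z) \<partial>lborel \<partial>hyperplane_measure a 0)"
  by (rule nn_integral_slab_measure) measurable
 also have "... = (\<integral>\<^sup>+x. \<integral>\<^sup>+t. indicator A ((x + z0) + t *\<^sub>R a) \<partial>lborel \<partial>hyperplane_measure a 0)"
 proof (rule nn_integral_cong)
  fix x
  have "(\<integral>\<^sup>+t. indicator A ((x + z0) + t *\<^sub>R a) \<partial>lborel) = (\<integral>\<^sup>+t. indicator A ((x + z0) + ((a \<bullet> z) + t) *\<^sub>R a) \<partial>lborel)"
   by (rule nn_integral_lborel_shift[symmetric]) measurable
  also have "... = (\<integral>\<^sup>+t. indicator A (x + t *\<^sub>R a + z) \<partial>lborel)"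
   by (subst (2) z) (simp add: algebra_simps)
  finally show "(\<integral>\<^sup>+t. indicator A (x + t *\<^sub>R a + z) \<partial>lborel) = (\<integral>\<^sup>+t. indicator A ((x + z0) + t *\<^sub>R a) \<partial>lborel)" ..
 qed
 also have "... = (\<integral>\<^sup>+x. \<integral>\<^sup>+t. indicator A (x + t *\<^sub>R a) \<partial>lborel \<partial>hyperplane_measure a 0)"
  by (rule nn_integral_hyperplane_shift[OF _ az0]) measurable
 also have "... = (\<integral>\<^sup>+x. indicator A x \<partial>slab_measure a)"
  by (rule nn_integral_slab_measure[symmetric]) measurable
 finally show "emeasure (distr (slab_measure a) borel (%x. x + z)) A = emeasure (slab_measure a) A" by simp
qed (simp add: slab_measure_def)

lemma slab_measure_ball_finite:
 fixes a :: "real^'n"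
 assumes a: "norm a = 1" and R: "0 < R"
 shows "emeasure (slab_measure a) (cball 0 R) < \<infinity>"
proof -
 have [measurable]: "cball (0::real^'n) R : sets borel" by simp
 have "emeasure (slab_measure a) (cball 0 R) = (\<integral>\<^sup>+x. indicator (cball 0 R) x \<partial>slab_measure a)" by simp
 also have "... = (\<integral>\<^sup>+x. \<integral>\<^sup>+t. indicator (cball 0 R) (x + t *\<^sub>R a) \<partial>lborel \<partial>hyperplane_measure a 0)"
  by (rule nn_integral_slab_measure) measurable
 also have "... <= (\<integral>\<^sup>+x. indicator (cball 0 R) x * (\<integral>\<^sup>+t. indicator {-R..R} t \<partial>lborel) \<partial>hyperplane_measure a 0)"
 proof (rule nn_integral_mono_AE)
  show "AE x in hyperplane_measure a 0. (\<integral>\<^sup>+t. indicator (cball 0 R) (x + t *\<^sub>R a) \<partial>lborel)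
   <= indicator (cball 0 R) x * (\<integral>\<^sup>+t. indicator {-R..R} t \<partial>lborel)"
   using AE_hyperplane_measure[of a 0]
  proof eventually_elim
   fix x assume x: "a \<bullet> x = 0"
   have sq: "(norm (x + t *\<^sub>R a))^2 = (norm x)^2 + t^2" for t
    using x a unfolding power2_norm_eq_inner
    by (simp add: inner_add_left inner_add_right inner_commute norm_eq_1 power2_eq_square)
   have "indicator (cball 0 R) (x + t *\<^sub>R a) <= (indicator (cball 0 R) x * indicator {-R..R} t :: ennreal)" for t
   proof (cases "norm (x + t *\<^sub>R a) <= R")
    case True
    then have "(norm (x + t *\<^sub>R a))^2 <= R^2" by (rule power_mono) simp
    then have "(norm x)^2 <= R^2" "t^2 <= R^2"
     unfolding sq using zero_le_power2[of "norm x"] zero_le_power2[of t] by linarith+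
    then have "norm x <= R" "\<bar>t\<bar> <= R" using R by (auto simp: abs_le_square_iff intro: power2_le_imp_le)
    then show ?thesis by (auto simp: indicator_def abs_le_iff)
   qed (auto simp: indicator_def)
   then have "(\<integral>\<^sup>+t. indicator (cball 0 R) (x + t *\<^sub>R a) \<partial>lborel) <= (\<integral>\<^sup>+t. indicator (cball 0 R) x * indicator {-R..R} t \<partial>lborel)"
    by (intro nn_integral_mono) auto
   then show "(\<integral>\<^sup>+t. indicator (cball 0 R) (x + t *\<^sub>R a) \<partial>lborel) <= indicator (cball 0 R) x * (\<integral>\<^sup>+t. indicator {-R..R} t \<partial>lborel)"
    by (subst (asm) nn_integral_cmult) auto
  qed
 qed
 also have "... = emeasure (hyperplane_measure a 0) (cball 0 R) * ennreal (2 * R)"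
  using R by (subst nn_integral_multc) (auto simp: emeasure_lborel_Icc_eq)
 also have "... < \<infinity>"
  using hausdorff_hyperplane_ball_le[OF R a, of 0 0]
  by (auto simp: emeasure_hyperplane_measure Int_commute ennreal_mult_less_top le_less_trans)
 finally show ?thesis .
qed

lemma slab_measure_eq:
 fixes a :: "real^'n"
 assumes a: "norm a = 1" and [measurable]: "B : sets borel"
 shows "emeasure (slab_measure a) B = emeasure (slab_measure a) (cbox 0 (\<chi> i. 1)) * emeasure lborel B"
proof -
 have "sigma_finite_measure (slab_measure a)"
 proof (standard, intro exI[of _ "range (%m. cball 0 (real (Suc m)))"] conjI ballI)
  show "\<Union> (range (%m. cball 0 (real (Suc m)))) = space (slab_measure a)"
  proof (auto simp: slab_measure_def simp del: of_nat_Suc)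
   fix x :: "real^'n"
   obtain m :: nat where "norm x <= real m" using real_arch_simple by blast
   then show "\<exists>m. norm x <= real (Suc m)" by (intro exI[of _ m]) simp
  qed
  fix A assume "A : range (%m. cball (0::real^'n) (real (Suc m)))"
  then obtain m where "A = cball 0 (real (Suc m))" by blast
  then show "emeasure (slab_measure a) A ~= \<infinity>"
   using slab_measure_ball_finite[OF a, of "real (Suc m)"] by (simp del: of_nat_Suc)
 qed auto
 from translation_invariant_proportional[OF sets_slab_measure this slab_measure_shift[OF a], of B "cbox 0 (\<chi> i. 1)"]
 have "emeasure (slab_measure a) B * emeasure lborel (cbox 0 (\<chi> i. 1) :: (real^'n) set)
  = emeasure (slab_measure a) (cbox 0 (\<chi> i. 1)) * emeasure lborel B" by simp
 moreover have "emeasure lborel (cbox 0 (\<chi> i. 1) :: (real^'n) set) = 1"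
  by (subst emeasure_lborel_cbox_cart) auto
 ultimately show ?thesis by simp
qed

lemma nn_integral_slab_measure_eq:
 fixes a :: "real^'n"
 assumes a: "norm a = 1" and F [measurable]: "F : borel_measurable borel"
 shows "(\<integral>\<^sup>+x. F x \<partial>slab_measure a) = emeasure (slab_measure a) (cbox 0 (\<chi> i. 1)) * (\<integral>\<^sup>+x. F x \<partial>lborel)"
proof -
 have "slab_measure a = scale_measure (emeasure (slab_measure a) (cbox 0 (\<chi> i. 1))) lborel"
 proof (rule measure_eqI)
  fix A assume "A : sets (slab_measure a)"
  then have "A : sets borel" by simp
  from slab_measure_eq[OF a this]
  show "emeasure (slab_measure a) A = emeasure (scale_measure (emeasure (slab_measure a) (cbox 0 (\<chi> i. 1))) lborel) A"
   by simp
 qed simp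
 from arg_cong[OF this, of "%M. nn_integral M F"] show ?thesis
  by (simp add: nn_integral_scale_measure)
qed

lemma slab_measure_cube_pos:
 fixes k :: "'n::finite"
 shows "0 < emeasure (slab_measure (axis k 1)) (cbox 0 (\<chi> i. 1) :: (real^'n) set)"
proof -
 let ?Q = "cbox 0 (\<chi> i. 1) :: (real^'n) set" and ?H = "hyperplane_measure (axis k 1 :: real^'n) 0"
 have "0 < emeasure ?H ?Q"
  using hausdorff_unit_cube_face_pos[of k] by (simp add: emeasure_hyperplane_measure Int_commute)
 also have "... = (\<integral>\<^sup>+x. indicator ?Q x * (\<integral>\<^sup>+t. indicator {0..1::real} t \<partial>lborel) \<partial>?H)"
  by (simp add: emeasure_lborel_Icc_eq)
 also have "... <= (\<integral>\<^sup>+x. \<integral>\<^sup>+t. indicator ?Q (x + t *\<^sub>R axis k 1) \<partial>lborel \<partial>?H)"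
 proof (rule nn_integral_mono_AE)
  show "AE x in ?H. indicator ?Q x * (\<integral>\<^sup>+t. indicator {0..1::real} t \<partial>lborel)
   <= (\<integral>\<^sup>+t. indicator ?Q (x + t *\<^sub>R axis k 1) \<partial>lborel)"
   using AE_hyperplane_measure[of "axis k 1" 0]
  proof eventually_elim
   fix x :: "real^'n" assume "axis k 1 \<bullet> x = 0"
   then have xk: "x $ k = 0" by (simp add: inner_axis')
   have "indicator ?Q x * indicator {0..1} t <= (indicator ?Q (x + t *\<^sub>R axis k 1) :: ennreal)" for t
    using xk by (auto simp: indicator_def mem_box_cart axis_def)
   then have "(\<integral>\<^sup>+t. indicator ?Q x * indicator {0..1::real} t \<partial>lborel) <= (\<integral>\<^sup>+t. indicator ?Q (x + t *\<^sub>R axis k 1) \<partial>lborel)"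
    by (intro nn_integral_mono) auto
   then show "indicator ?Q x * (\<integral>\<^sup>+t. indicator {0..1::real} t \<partial>lborel)
   <= (\<integral>\<^sup>+t. indicator ?Q (x + t *\<^sub>R axis k 1) \<partial>lborel)"
    by (subst (asm) nn_integral_cmult) auto
  qed
 qed
 also have "... = (\<integral>\<^sup>+x. indicator ?Q x \<partial>slab_measure (axis k 1))"
  by (rule nn_integral_slab_measure[symmetric]) measurable
 finally show ?thesis by simp
qed

lemma slab_measure_const:
 fixes a :: "real^'n" and k :: 'n
 assumes a: "norm a = 1"
 shows "emeasure (slab_measure a) (cbox 0 (\<chi> i. 1)) = emeasure (slab_measure (axis k 1)) (cbox 0 (\<chi> i. 1))"
proof -
 obtain f g :: "real^'n => real^'n" where fg0:
  "\<forall>x y. dist (f x) (f y) = dist x y" "\<forall>x y. dist (g x) (g y) = dist x y"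
  "\<forall>x. g (f x) = x" "\<forall>x. f (g x) = x" "\<forall>x. a \<bullet> f x = 0 \<longleftrightarrow> axis k 1 \<bullet> x = (0::real)"
  "\<forall>x t. f (x + t *\<^sub>R axis k 1) = f x + t *\<^sub>R a" "f 0 = 0 *\<^sub>R a"
  using isometry_onto_hyperplane[OF a, of 0 k] by blast
 note fg = fg0[rule_format]
 have "continuous_on UNIV f" by (auto simp: continuous_on_iff fg)
 then have [measurable]: "f : borel_measurable borel" by (rule borel_measurable_continuous_onI)
 let ?B = "cball 0 1 :: (real^'n) set"
 have [measurable]: "?B : sets borel" by simp
 have fB: "f x : ?B \<longleftrightarrow> x : ?B" for x
  using fg(1)[of 0 x] fg(7) by simp
 have "emeasure (slab_measure a) ?B = (\<integral>\<^sup>+x. indicator ?B x \<partial>slab_measure a)" by simp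
 also have "... = (\<integral>\<^sup>+x. \<integral>\<^sup>+t. indicator ?B (x + t *\<^sub>R a) \<partial>lborel \<partial>hyperplane_measure a 0)"
  by (rule nn_integral_slab_measure) measurable
 also have "... = (\<integral>\<^sup>+x. \<integral>\<^sup>+t. indicator ?B (x + t *\<^sub>R a) \<partial>lborel \<partial>distr (hyperplane_measure (axis k 1) 0) borel f)"
  by (subst distr_hyperplane_measure[of f g, OF fg(1-5)]) auto
 also have "... = (\<integral>\<^sup>+x. \<integral>\<^sup>+t. indicator ?B (f x + t *\<^sub>R a) \<partial>lborel \<partial>hyperplane_measure (axis k 1) 0)"
  by (rule nn_integral_distr) measurable
 also have "... = (\<integral>\<^sup>+x. \<integral>\<^sup>+t. indicator ?B (x + t *\<^sub>R axis k 1) \<partial>lborel \<partial>hyperplane_measure (axis k 1) 0)"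
  by (simp only: fg(6)[symmetric] indicator_def fB)
 also have "... = (\<integral>\<^sup>+x. indicator ?B x \<partial>slab_measure (axis k 1))"
  by (rule nn_integral_slab_measure[symmetric]) measurable
 finally have eq: "emeasure (slab_measure a) ?B = emeasure (slab_measure (axis k 1)) ?B" by simp
 have ball: "emeasure lborel ?B = ennreal (unit_ball_vol (real CARD('n)))" "0 < unit_ball_vol (real CARD('n))"
  by (simp_all add: emeasure_cball)
 have "emeasure (slab_measure a) (cbox 0 (\<chi> i. 1)) * emeasure lborel ?B
  = emeasure (slab_measure (axis k 1)) (cbox 0 (\<chi> i. 1)) * emeasure lborel ?B"
  using eq slab_measure_eq[OF a, of ?B] slab_measure_eq[of "axis k 1" ?B] by (simp add: norm_axis_1)
 then show ?thesis
  unfolding ball(1) using ball(2) by (subst (asm) (1 2) mult.commute) (simp add: ennreal_mult_cancel_left)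
qed

text \<open>Integrating over a hyperplane and then along a transversal direction recovers
  Lebesgue measure up to a constant that depends on the dimension only.\<close>

theorem slicing_exists:
 "\<exists>c>0. \<forall>(a::real^'n) b d F. norm a = 1 --> a \<bullet> d > 0 --> F : borel_measurable borel -->
  ennreal (a \<bullet> d) * (\<integral>\<^sup>+x. \<integral>\<^sup>+t. F (x + t *\<^sub>R d) \<partial>lborel \<partial>hyperplane_measure a b)
   = ennreal c * (\<integral>\<^sup>+x. F x \<partial>lborel)"
proof -
 obtain k :: 'n where True by blast
 let ?c = "emeasure (slab_measure (axis k 1)) (cbox 0 (\<chi> i. 1) :: (real^'n) set)"
 define c where "c = enn2real ?c"
 have "emeasure (slab_measure (axis k 1)) (cbox 0 (\<chi> i. 1) :: (real^'n) set) <= emeasure (slab_measure (axis k 1 :: real^'n)) (cball 0 (real CARD('n)))"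
 proof (rule emeasure_mono)
  show "cbox 0 (\<chi> i. 1) \<subseteq> (cball 0 (real CARD('n)) :: (real^'n) set)"
  proof
   fix x :: "real^'n" assume x: "x : cbox 0 (\<chi> i. 1)"
   have "norm x <= (\<Sum>i\<in>UNIV. \<bar>x $ i\<bar>)" by (rule norm_le_l1_cart)
   also have "... <= (\<Sum>i\<in>(UNIV::'n set). 1)"
    using x by (intro sum_mono) (auto simp: mem_box_cart abs_le_iff intro: order_trans[of _ 0])
   finally show "x : cball 0 (real CARD('n))" by simp
  qed
 qed simp
 also have "... < \<infinity>" by (rule slab_measure_ball_finite) (simp_all add: norm_axis_1)
 finally have cfin: "?c < \<infinity>" .
 then have c: "?c = ennreal c" by (simp add: c_def)
 then have cpos: "c > 0" using slab_measure_cube_pos[of k] by simp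
 show ?thesis
 proof (intro exI[of _ c] conjI cpos allI impI)
  fix a d :: "real^'n" and b and F :: "real^'n => ennreal"
  assume a: "norm a = 1" and ad: "a \<bullet> d > 0" and F [measurable]: "F : borel_measurable borel"
  interpret sigma_finite_measure "hyperplane_measure a b" by (rule sigma_finite_hyperplane_measure[OF a])
  interpret pair_sigma_finite "hyperplane_measure a b" lborel ..
  define w where "w = d - (a \<bullet> d) *\<^sub>R a"
  have aa: "a \<bullet> a = 1" using a by (simp add: norm_eq_1)
  have d: "d = w + (a \<bullet> d) *\<^sub>R a" and aw: "a \<bullet> w = 0" by (simp_all add: w_def inner_diff_right aa)
  have "(\<integral>\<^sup>+x. \<integral>\<^sup>+t. F (x + t *\<^sub>R d) \<partial>lborel \<partial>hyperplane_measure a b)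
   = (\<integral>\<^sup>+t. \<integral>\<^sup>+x. F (x + t *\<^sub>R d) \<partial>hyperplane_measure a b \<partial>lborel)"
   by (rule Fubini'[symmetric]) measurable
  also have "... = (\<integral>\<^sup>+t. \<integral>\<^sup>+x. F (x + (t * (a \<bullet> d)) *\<^sub>R a) \<partial>hyperplane_measure a b \<partial>lborel)"
  proof (rule nn_integral_cong)
   fix t :: real
   have "(\<integral>\<^sup>+x. F (x + t *\<^sub>R w + (t * (a \<bullet> d)) *\<^sub>R a) \<partial>hyperplane_measure a b)
    = (\<integral>\<^sup>+x. F (x + (t * (a \<bullet> d)) *\<^sub>R a) \<partial>hyperplane_measure a b)"
    by (rule nn_integral_hyperplane_shift) (simp_all add: aw)
   note shift = this
   have eqx: "x + t *\<^sub>R d = x + t *\<^sub>R w + (t * (a \<bullet> d)) *\<^sub>R a" for x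
    by (subst d) (simp add: algebra_simps)
   show "(\<integral>\<^sup>+x. F (x + t *\<^sub>R d) \<partial>hyperplane_measure a b)
    = (\<integral>\<^sup>+x. F (x + (t * (a \<bullet> d)) *\<^sub>R a) \<partial>hyperplane_measure a b)" unfolding eqx by (rule shift)
  qed
  also have "... = (\<integral>\<^sup>+x. \<integral>\<^sup>+t. F (x + (t * (a \<bullet> d)) *\<^sub>R a) \<partial>lborel \<partial>hyperplane_measure a b)"
   by (rule Fubini') measurable
  finally have 1: "(\<integral>\<^sup>+x. \<integral>\<^sup>+t. F (x + t *\<^sub>R d) \<partial>lborel \<partial>hyperplane_measure a b) = ..." .
  have "ennreal (a \<bullet> d) * (\<integral>\<^sup>+x. \<integral>\<^sup>+t. F (x + (t * (a \<bullet> d)) *\<^sub>R a) \<partial>lborel \<partial>hyperplane_measure a b)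
   = (\<integral>\<^sup>+x. ennreal (a \<bullet> d) * (\<integral>\<^sup>+t. F (x + (t * (a \<bullet> d)) *\<^sub>R a) \<partial>lborel) \<partial>hyperplane_measure a b)"
   by (rule nn_integral_cmult[symmetric]) measurable
  also have "... = (\<integral>\<^sup>+x. (\<integral>\<^sup>+t. F (x + t *\<^sub>R a) \<partial>lborel) \<partial>hyperplane_measure a b)"
  proof (rule nn_integral_cong)
   fix x
   show "ennreal (a \<bullet> d) * (\<integral>\<^sup>+t. F (x + (t * (a \<bullet> d)) *\<^sub>R a) \<partial>lborel) = (\<integral>\<^sup>+t. F (x + t *\<^sub>R a) \<partial>lborel)"
    using nn_integral_lborel_affine[of "%t. F (x + t *\<^sub>R a)" "a \<bullet> d" 0] ad
    by (simp add: mult.commute)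
  qed
  also have "... = (\<integral>\<^sup>+x. (\<integral>\<^sup>+t. F (x + b *\<^sub>R a + t *\<^sub>R a) \<partial>lborel) \<partial>hyperplane_measure a 0)"
   by (rule nn_integral_hyperplane_shift[symmetric]) (auto simp: aa)
  also have "... = (\<integral>\<^sup>+x. F (x + b *\<^sub>R a) \<partial>slab_measure a)"
   by (subst nn_integral_slab_measure) (auto simp: algebra_simps)
  also have "... = ennreal c * (\<integral>\<^sup>+x. F (x + b *\<^sub>R a) \<partial>lborel)"
   by (subst nn_integral_slab_measure_eq[OF a]) (auto simp: slab_measure_const[OF a, of k] c)
  also have "(\<integral>\<^sup>+x. F (x + b *\<^sub>R a) \<partial>lborel) = (\<integral>\<^sup>+x. F x \<partial>lborel)"
   using nn_integral_lborel_shift[OF F, of "b *\<^sub>R a"] by (simp add: add.commute)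
  finally show "ennreal (a \<bullet> d) * (\<integral>\<^sup>+x. \<integral>\<^sup>+t. F (x + t *\<^sub>R d) \<partial>lborel \<partial>hyperplane_measure a b)
   = ennreal c * (\<integral>\<^sup>+x. F x \<partial>lborel)"
   unfolding 1 .
 qed
qed

section \<open>Smooth functions\<close>

definition grad :: "(real^'n => real) => real^'n => real^'n" where
 "grad f x = (\<chi> i. partial_deriv i f x)"

lemma grad_nth [simp]: "grad f x $ i = partial_deriv i f x"
 by (simp add: grad_def)

lemma partial_deriv_eq: "(f has_derivative f') (at x) ==> partial_deriv i f x = f' (axis i 1)"
 by (metis frechet_derivative_at partial_deriv_def)

lemma has_derivative_grad:
 fixes f :: "real^'n => real"
 assumes "f differentiable (at x)"
 shows "(f has_derivative (%h. grad f x \<bullet> h)) (at x)"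
proof -
 let ?D = "frechet_derivative f (at x)"
 have D: "(f has_derivative ?D) (at x)" using assms by (simp add: frechet_derivative_works)
 then have lin: "linear ?D" by (rule has_derivative_linear)
 have "?D h = grad f x \<bullet> h" for h
 proof -
  have "?D h = ?D (\<Sum>i\<in>UNIV. h $ i *\<^sub>R axis i 1)" using basis_expansion[of h] by (simp add: scalar_mult_eq_scaleR)
  also have "... = (\<Sum>i\<in>UNIV. h $ i * ?D (axis i 1))"
   by (simp add: linear_sum[OF lin] linear_scale[OF lin])
  also have "... = grad f x \<bullet> h" by (simp add: inner_vec_def partial_deriv_def mult.commute)
  finally show ?thesis .
 qed
 then have "?D = (%h. grad f x \<bullet> h)" by (rule ext)
 then show ?thesis using D by simp
qed

lemma smooth_differentiable: "smooth f ==> f differentiable (at x)"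
 unfolding smooth_def using C_k.simps(2) by blast

lemma smooth_partial_deriv: "smooth f ==> smooth (partial_deriv i f)"
 unfolding smooth_def using C_k.simps(2) by blast

lemma smooth_continuous: "smooth f ==> continuous_on S f"
 unfolding smooth_def using C_k.simps(1) continuous_on_subset by blast

lemma smooth_has_derivative: "smooth f ==> (f has_derivative (%h. grad f x \<bullet> h)) (at x)"
 by (intro has_derivative_grad smooth_differentiable)

lemma continuous_grad: "smooth f ==> continuous_on S (grad f)"
 unfolding grad_def by (intro continuous_on_vec_lambda smooth_continuous smooth_partial_deriv)

lemma smooth_borel [measurable_dest, intro]: "smooth f ==> f : borel_measurable borel"
 by (intro borel_measurable_continuous_onI smooth_continuous)

lemma grad_borel: "smooth f ==> grad f : borel_measurable borel"
 by (intro borel_measurable_continuous_onI continuous_grad)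

text \<open>A set of differentiable functions that is closed under partial derivatives consists of
  smooth functions; all smoothness proofs below exhibit such a set.\<close>

lemma smoothI_closed:
 assumes "f : D" "!!f x. f : D ==> f differentiable (at x)" "!!f i. f : D ==> partial_deriv i f : D"
 shows "smooth f"
proof -
 have "\<forall>f\<in>D. C_k k f" for k
 proof (induction k)
  case 0
  then show ?case using assms(2)
   by (auto simp: continuous_on_eq_continuous_at intro: differentiable_imp_continuous_within)
 next
  case (Suc k) then show ?case using assms(2,3) by auto
 qed
 then show ?thesis using assms(1) by (auto simp: smooth_def)
qed

subsection \<open>Bump functions\<close>

definition flat :: "nat => real => real" where
 "flat m t = (if t <= 0 then 0 else exp (- (1 / t)) / t ^ m)"

lemma flat_nonneg: "0 <= flat m t" by (simp add: flat_def)

lemma flat_le_square: "\<exists>C. \<forall>t. \<bar>flat m t\<bar> <= C * t^2"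
proof (intro exI allI)
 fix t :: real
 define C :: real where "C = fact (m + 2)"
 have C: "0 < C" by (simp add: C_def)
 have "\<bar>flat m t\<bar> <= C * t^2"
 proof (cases "t <= 0")
  case False
  then have t: "0 < t" by simp
  have "(1 / t) ^ (m + 2) / C <= exp (1 / t)"
  proof -
   have "(\<Sum>k\<in>{m + 2}. (1 / t) ^ k /\<^sub>R fact k) <= (\<Sum>k. (1 / t) ^ k /\<^sub>R fact k)"
    by (rule sum_le_suminf) (use t summable_exp_generic[of "1 / t"] in auto)
   then show ?thesis by (simp add: exp_def divide_inverse mult.commute C_def del: fact_Suc)
  qed
  moreover have "(1 / t) ^ k / C = 1 / (C * t ^ k)" for k by (simp add: power_one_over mult.commute)
  ultimately have "1 / (C * t ^ (m + 2)) <= exp (1 / t)" by metis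
  moreover have "0 < C * t ^ (m + 2)" using C t by simp
  ultimately have "1 <= C * t ^ (m + 2) * exp (1 / t)"
   by (simp add: divide_le_eq mult.commute)
  then have "exp (- (1 / t)) <= C * t ^ (m + 2)"
   by (simp add: exp_minus inverse_eq_divide divide_le_eq)
  then have "exp (- (1 / t)) / t ^ m <= C * t ^ (m + 2) / t ^ m"
   using t by (intro divide_right_mono) auto
  also have "... = C * t^2" using t by (simp add: power_add power2_eq_square)
  finally show ?thesis using t by (simp add: flat_def)
 qed (use C in \<open>simp add: flat_def\<close>)
 then show "\<bar>flat m t\<bar> <= fact (m + 2) * t^2" unfolding C_def .
qed

lemma flat_has_derivative:
 "(flat m has_real_derivative (flat (m + 2) t - real m * flat (m + 1) t)) (at t)"
proof -
 consider "t < 0" | "t = 0" | "t > 0" by linarith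
 then show ?thesis
 proof cases
  case 1
  have "((%_. 0) has_real_derivative 0) (at t)" by simp
  then have "(flat m has_real_derivative 0) (at t)"
   by (rule has_field_derivative_transform_within_open[where S = "{..<0}"]) (use 1 in \<open>auto simp: flat_def\<close>)
  then show ?thesis using 1 by (simp add: flat_def)
 next
  case 2
  obtain C where C: "!!t. \<bar>flat m t\<bar> <= C * t^2" using flat_le_square by blast
  have "((%h. flat m h / h) \<longlongrightarrow> 0) (at 0)"
  proof (rule Lim_null_comparison)
   show "((%h. C * \<bar>h\<bar>) \<longlongrightarrow> 0) (at (0::real))"
    by (auto intro!: tendsto_eq_intros)
   have "norm (flat m h / h) <= C * \<bar>h\<bar>" for h
   proof (cases "h = 0")
    case False
    have "\<bar>flat m h\<bar> <= C * \<bar>h\<bar> * \<bar>h\<bar>" using C[of h] by (simp add: power2_eq_square mult.assoc)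
    then show ?thesis using False by (simp add: divide_le_eq)
   qed simp
   then show "\<forall>\<^sub>F h in at 0. norm (flat m h / h) <= C * \<bar>h\<bar>" by simp
  qed
  then have "(flat m has_real_derivative 0) (at 0)"
   by (simp add: has_field_derivative_iff flat_def)
  then show ?thesis using 2 by (simp add: flat_def)
 next
  case 3
  have d1: "((%t. exp (- (1 / t))) has_real_derivative exp (- (1 / t)) * (1 / t^2)) (at t)"
   by (rule derivative_eq_intros refl | use 3 in \<open>simp add: power2_eq_square\<close>)+
  have d2: "((%t. t ^ m) has_real_derivative real m * t ^ (m - 1)) (at t)"
   using DERIV_pow[of m t] by simp
  have alg: "((e * (1 / t^2)) * t ^ m - e * (real m * t ^ (m - 1))) / (t ^ m * t ^ m)
   = e / t ^ (m + 2) - real m * (e / t ^ (m + 1))" for e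
  proof (cases m)
   case (Suc k)
   define p where "p = t ^ k"
   have "p ~= 0" using 3 by (simp add: p_def)
   then show ?thesis using 3 by (simp add: Suc p_def[symmetric] power_add power2_eq_square field_simps)
  qed (simp add: power2_eq_square)
  have "((%t. exp (- (1 / t)) / t ^ m) has_real_derivative
   (flat (m + 2) t - real m * flat (m + 1) t)) (at t)"
   using DERIV_divide[OF d1 d2] 3 unfolding alg by (simp add: flat_def)
  then show ?thesis
   by (rule has_field_derivative_transform_within_open[where S = "{0<..}"]) (use 3 in \<open>auto simp: flat_def\<close>)
 qed
qed

inductive_set elementary :: "(real^'n => real) set" where
 const: "(%_. c) : elementary"
| coord: "(%x. x $ i) : elementary"
| flat: "(%x. flat m (r - (norm (x - z))^2)) : elementary"
| add: "f : elementary ==> g : elementary ==> (%x. f x + g x) : elementary"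
| mult: "f : elementary ==> g : elementary ==> (%x. f x * g x) : elementary"

lemma elementary_derivative:
 "f : elementary ==> (\<forall>x. f differentiable (at x)) & (\<forall>i. partial_deriv i f : elementary)"
proof (induction rule: elementary.induct)
 case (const c)
 have "partial_deriv i (%_. c) = (%_. 0)" for i :: 'a
  by (rule ext, subst partial_deriv_eq) (rule has_derivative_const, simp)
 then show ?case by (auto intro: elementary.const)
next
 case (coord j)
 have D: "((%x. x $ j) has_derivative (%h. h $ j)) (at x)" for x :: "real^'a"
  by (rule bounded_linear_imp_has_derivative[OF bounded_linear_vec_nth])
 then have "partial_deriv i (%x. x $ j) = (%_. axis i 1 $ j)" for i :: 'a
  by (intro ext) (rule partial_deriv_eq)
 then show ?case using D by (auto intro: elementary.const simp: differentiable_def)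
next
 case (flat m r z)
 let ?f = "%x. flat m (r - (norm (x - z))^2)"
 let ?g = "%x. flat (m + 2) (r - (norm (x - z))^2) - real m * flat (m + 1) (r - (norm (x - z))^2)"
 have D: "(?f has_derivative (%h. ?g x * (- 2 * ((x - z) \<bullet> h)))) (at x)" for x
 proof -
  have "((%x. r - (norm (x - z))^2) has_derivative (%h. - 2 * ((x - z) \<bullet> h))) (at x)"
   unfolding power2_norm_eq_inner
   by (auto intro!: derivative_eq_intros simp: inner_commute)
  from has_derivative_compose[OF this flat_has_derivative[unfolded has_field_derivative_def]]
  show ?thesis by simp
 qed
 have "partial_deriv i ?f = (%x. (flat (m + 2) (r - (norm (x - z))^2) + (- real m) * flat (m + 1) (r - (norm (x - z))^2))
   * ((-2) * (x $ i + - (z $ i))))" for i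
  by (rule ext, subst partial_deriv_eq[OF D]) (simp add: inner_axis)
 also have "... i : elementary" for i
  by (intro elementary.intros)
 finally show ?case using D by (auto simp: differentiable_def)
next
 case (add f g)
 have "partial_deriv i (%x. f x + g x) = (%x. partial_deriv i f x + partial_deriv i g x)" for i
 proof
  fix x
  have "((%x. f x + g x) has_derivative (%h. grad f x \<bullet> h + grad g x \<bullet> h)) (at x)"
   using add by (intro has_derivative_add has_derivative_grad) auto
  from partial_deriv_eq[OF this, of i]
  show "partial_deriv i (%x. f x + g x) x = partial_deriv i f x + partial_deriv i g x"
   by (simp add: inner_axis)
 qed
 then have "partial_deriv i (%x. f x + g x) : elementary" for i
  using add by (simp add: elementary.add)
 then show ?case using add by (simp add: differentiable_add)
next
 case (mult f g)
 have "partial_deriv i (%x. f x * g x) = (%x. f x * partial_deriv i g x + partial_deriv i f x * g x)" for i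
 proof
  fix x
  have "((%x. f x * g x) has_derivative (%h. f x * (grad g x \<bullet> h) + (grad f x \<bullet> h) * g x)) (at x)"
   using mult by (intro has_derivative_mult has_derivative_grad) auto
  from partial_deriv_eq[OF this, of i]
  show "partial_deriv i (%x. f x * g x) x = f x * partial_deriv i g x + partial_deriv i f x * g x"
   by (simp add: inner_axis)
 qed
 then have "partial_deriv i (%x. f x * g x) : elementary" for i
  using mult by (simp add: elementary.add elementary.mult)
 then show ?case using mult by (simp add: differentiable_mult)
qed

lemma elementary_smooth: "f : elementary ==> smooth f"
 by (rule smoothI_closed[of f elementary]) (use elementary_derivative in blast)+

lemma smooth_const: "smooth (%_. c)"
 by (rule elementary_smooth, rule elementary.const)

lemma smooth_combine:
 assumes f: "smooth f" and g: "smooth g"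
 shows smooth_add: "smooth (%x. f x + g x)" and smooth_mult: "smooth (%x. f x * g x)"
  and partial_deriv_add: "partial_deriv i (%x. f x + g x) x = partial_deriv i f x + partial_deriv i g x"
  and partial_deriv_mult: "partial_deriv i (%x. f x * g x) x = f x * partial_deriv i g x + partial_deriv i f x * g x"
proof -
 have da: "((%x. f x + g x) has_derivative (%h. grad f x \<bullet> h + grad g x \<bullet> h)) (at x)" 
  if "smooth f" "smooth g" for f g and x :: "real^'a"
  using that by (intro has_derivative_add smooth_has_derivative)
 have dm: "((%x. f x * g x) has_derivative (%h. f x * (grad g x \<bullet> h) + (grad f x \<bullet> h) * g x)) (at x)" 
  if "smooth f" "smooth g" for f g and x :: "real^'a"
  using that by (intro has_derivative_mult smooth_has_derivative)
 have pa: "partial_deriv i (%x. f x + g x) x = partial_deriv i f x + partial_deriv i g x"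
  if "smooth f" "smooth g" for f g i and x :: "real^'a"
  by (subst partial_deriv_eq[OF da[OF that]]) (simp add: inner_axis)
 have pm: "partial_deriv i (%x. f x * g x) x = f x * partial_deriv i g x + partial_deriv i f x * g x"
  if "smooth f" "smooth g" for f g i and x :: "real^'a"
  by (subst partial_deriv_eq[OF dm[OF that]]) (simp add: inner_axis)
 show "partial_deriv i (%x. f x + g x) x = partial_deriv i f x + partial_deriv i g x" by (rule pa[OF f g])
 show "partial_deriv i (%x. f x * g x) x = f x * partial_deriv i g x + partial_deriv i f x * g x"
  by (rule pm[OF f g])
 define S where "S = {h :: real^'a => real. \<exists>(N::nat) a b. (\<forall>k. smooth (a k) & smooth (b k)) & h = (%x. \<Sum>k<N. a k x * b k x)}"
 have ds: "((%x. \<Sum>k<N. a k x * b k x) has_derivative (%h. \<Sum>k<N. a k x * (grad (b k) x \<bullet> h) + (grad (a k) x \<bullet> h) * b k x)) (at x)"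
  if "\<forall>k. smooth (a k) & smooth (b k)" for N :: nat and a b and x :: "real^'a"
  using that by (intro has_derivative_sum dm) auto
 have S: "h differentiable (at x) & partial_deriv i h : S" if hS: "h : S" for h x i
 proof -
  obtain N :: nat and a b where h: "\<forall>k. smooth (a k) & smooth (b k)" "h = (%x. \<Sum>k<N. a k x * b k x)"
   using hS unfolding S_def by blast
  define a' where "a' k = (if even k then a (k div 2) else partial_deriv i (a (k div 2)))" for k
  define b' where "b' k = (if odd k then b (k div 2) else partial_deriv i (b (k div 2)))" for k
  have dbl: "(\<Sum>k<2*N. F k) = (\<Sum>k<N. F (2*k) + F (2*k+1))" for F :: "nat => real" and N
   by (induction N) (simp_all add: ac_simps)
  have "partial_deriv i h = (%x. \<Sum>k<2*N. a' k x * b' k x)"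
   unfolding h(2) by (rule ext, subst partial_deriv_eq[OF ds[OF h(1)]]) (simp add: dbl a'_def b'_def inner_axis)
  moreover have "\<forall>k. smooth (a' k) & smooth (b' k)"
   using h(1) by (auto simp: a'_def b'_def intro: smooth_partial_deriv)
  ultimately have "partial_deriv i h : S" unfolding S_def by blast
  moreover have "h differentiable (at x)" unfolding h(2) using ds[OF h(1)] by (auto simp: differentiable_def)
  ultimately show ?thesis by blast
 qed
 have Ssm: "h : S ==> smooth h" for h using S by (intro smoothI_closed[of h S]) auto
 have "(%x. f x * g x) = (%x. \<Sum>k<(1::nat). (%_. f) k x * (%_. g) k x)" by simp
 then have "(%x. f x * g x) : S" unfolding S_def using f g
  by (intro CollectI exI[of _ 1] exI[of _ "%_. f"] exI[of _ "%_. g"]) auto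
 then show "smooth (%x. f x * g x)" by (rule Ssm)
 have "(%x. f x + g x) : S" unfolding S_def using f g
  by (intro CollectI exI[of _ "2::nat"] exI[of _ "%k. if k = 0 then f else g"] exI[of _ "%_ _. 1"])
   (auto simp: smooth_const numeral_2_eq_2)
 then show "smooth (%x. f x + g x)" by (rule Ssm)
qed

lemma smooth_diff: "smooth f ==> smooth g ==> smooth (%x. f x - g x)"
 using smooth_add[of f "%x. (-1) * g x"] smooth_mult[of "%_. -1" g] by (simp add: smooth_const)

lemma grad_diff: "smooth f ==> smooth g ==> grad (%x. f x - g x) x = grad f x - grad g x"
proof -
 assume fg: "smooth f" "smooth g"
 have "((%x. f x - g x) has_derivative (%h. grad f x \<bullet> h - grad g x \<bullet> h)) (at x)"
  using fg by (intro has_derivative_diff smooth_has_derivative)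
 then show ?thesis by (simp add: vec_eq_iff partial_deriv_eq inner_axis)
qed

lemma polys_smooth: "p : polys l ==> smooth p"
proof -
 assume "p : polys l"
 then obtain c where p: "p = (%x. \<Sum>al | (\<Sum>i\<in>UNIV. al i) <= l. c al * (\<Prod>i\<in>UNIV. (x $ i) ^ al i))"
  by (auto simp: polys_def)
 have pow: "(%x::real^'a. (x $ i) ^ k) : elementary" for i k
  by (induction k) (auto intro: elementary.intros)
 have prod: "finite A ==> (%x::real^'a. (\<Prod>i\<in>A. (x $ i) ^ al i)) : elementary" for A and al :: "'a => nat"
  by (induction A rule: finite_induct) (auto intro: elementary.intros pow)
 have "(%x::real^'a. \<Sum>al\<in>S. c al * (\<Prod>i\<in>UNIV. (x $ i) ^ al i)) : elementary" for S
 proof (cases "finite S")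
  case True
  then show ?thesis
   by (induction S rule: finite_induct)
    (simp_all add: elementary.const elementary.add elementary.mult prod[OF finite])
 qed (auto intro: elementary.const)
 then show ?thesis unfolding p by (rule elementary_smooth)
qed

section \<open>Polynomials\<close>

definition multi_indices :: "nat => ('n::finite => nat) set" where
 "multi_indices l = {al. (\<Sum>i\<in>UNIV. al i) <= l}"

definition monomial :: "('n::finite => nat) => real^'n => real" where
 "monomial al x = (\<Prod>i\<in>UNIV. (x $ i) ^ al i)"

lemma polys_eq: "polys l = {p. \<exists>c. p = (%x. \<Sum>al\<in>multi_indices l. c al * monomial al x)}"
 by (simp add: polys_def multi_indices_def monomial_def)

lemma finite_multi_indices [simp]: "finite (multi_indices l :: ('n::finite => nat) set)"
proof (rule finite_subset)
 show "multi_indices l \<subseteq> PiE UNIV (%_::'n. {..l})"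
 proof
  fix al :: "'n => nat" assume "al : multi_indices l"
  then have "al i <= l" for i
   using member_le_sum[of i UNIV al] by (simp add: multi_indices_def)
  then show "al : PiE UNIV (%_. {..l})" by (intro PiE_I) auto
 qed
qed (simp add: finite_PiE)

lemma polys_add: "p : polys l ==> q : polys l ==> (%x. p x + q x) : polys l"
proof -
 assume "p : polys l" "q : polys l"
 then obtain c d where "p = (%x. \<Sum>al\<in>multi_indices l. c al * monomial al x)"
  "q = (%x. \<Sum>al\<in>multi_indices l. d al * monomial al x)" by (auto simp: polys_eq)
 then have "(%x. p x + q x) = (%x. \<Sum>al\<in>multi_indices l. (c al + d al) * monomial al x)"
  by (simp add: distrib_right sum.distrib)
 then show ?thesis unfolding polys_eq by (intro CollectI exI)
qed

lemma polys_cmult: "p : polys l ==> (%x. k * p x) : polys l"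
proof -
 assume "p : polys l"
 then obtain c where "p = (%x. \<Sum>al\<in>multi_indices l. c al * monomial al x)" by (auto simp: polys_eq)
 then have "(%x. k * p x) = (%x. \<Sum>al\<in>multi_indices l. (k * c al) * monomial al x)"
  by (simp add: sum_distrib_left mult.assoc)
 then show ?thesis unfolding polys_eq by (intro CollectI exI)
qed

lemma polys_monomial:
 assumes "al : multi_indices l"
 shows "(%x. k * monomial al x) : polys l"
proof -
 have "(%x. k * monomial al x) = (%x. \<Sum>\<beta>\<in>multi_indices l. (if \<beta> = al then k else 0) * monomial \<beta> x)"
 proof
  fix x
  have "(\<Sum>\<beta>\<in>multi_indices l. (if \<beta> = al then k else 0) * monomial \<beta> x)
   = (\<Sum>\<beta>\<in>multi_indices l. if \<beta> = al then k * monomial al x else 0)"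
   by (rule sum.cong) auto
  then show "k * monomial al x = (\<Sum>\<beta>\<in>multi_indices l. (if \<beta> = al then k else 0) * monomial \<beta> x)"
   using assms by simp
 qed
 then show ?thesis unfolding polys_eq by (intro CollectI exI)
qed

lemma polys_const: "(%_. k) : polys l"
 using polys_monomial[of "%_. 0" l k] by (simp add: multi_indices_def monomial_def)

lemma polys_sum: "finite A ==> (!!k. k : A ==> f k : polys l) ==> (%x. \<Sum>k\<in>A. f k x) : polys l"
 by (induction A rule: finite_induct) (simp_all add: polys_const polys_add)

lemma polys_diff: "p : polys l ==> q : polys l ==> (%x. p x - q x) : polys l"
 using polys_add[of p l "%x. (-1) * q x"] polys_cmult[of q l "-1"] by simp

lemma polys_mult:
 fixes p q :: "real^'n => real"
 assumes "p : polys a" "q : polys b"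
 shows "(%x. p x * q x) : polys (a + b)"
proof -
 obtain c d where pq: "p = (%x. \<Sum>al\<in>multi_indices a. c al * monomial al x)"
  "q = (%x. \<Sum>\<beta>\<in>multi_indices b. d \<beta> * monomial \<beta> x)" using assms by (auto simp: polys_eq)
 have mm: "(c al * monomial al x) * (d \<beta> * monomial \<beta> x) = (c al * d \<beta>) * monomial (%i. al i + \<beta> i) x" for al \<beta> x
  by (simp add: monomial_def power_add prod.distrib mult.assoc mult.left_commute)
 have eq: "(%x. p x * q x) = (%x. \<Sum>al\<in>multi_indices a. \<Sum>\<beta>\<in>multi_indices b. (c al * d \<beta>) * monomial (%i. al i + \<beta> i) x)"
  unfolding pq by (simp only: sum_product mm)
 have "(%i. al i + \<beta> i) : multi_indices (a + b)" if "al : multi_indices a" "\<beta> : multi_indices b" for al \<beta> :: "'n => nat"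
  using that by (simp add: multi_indices_def sum.distrib)
 then show ?thesis unfolding eq by (intro polys_sum polys_monomial finite_multi_indices)
qed

lemma polys_coord: "(%x. x $ i) : polys (Suc 0)"
proof -
 have e: "(%j. if j = i then 1 else 0) : multi_indices (Suc 0)" by (simp add: multi_indices_def)
 have "monomial (%j. if j = i then 1 else 0) x = (\<Prod>j\<in>UNIV. if j = i then x $ i else 1)" for x :: "real^'a"
  unfolding monomial_def by (rule prod.cong) auto
 then show ?thesis using polys_monomial[OF e, of 1] by simp
qed

lemma polys_power: "p : polys a ==> (%x. p x ^ k) : polys (k * a)"
proof (induction k)
 case 0 then show ?case by (simp add: polys_const)
next
 case (Suc k)
 then show ?case using polys_mult[of p a "%x. p x ^ k" "k * a"] by simp
qed

lemma polys_prod: "finite A ==> (!!k. k : A ==> f k : polys (d k)) ==> (%x. \<Prod>k\<in>A. f k x) : polys (\<Sum>k\<in>A. d k)"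
 by (induction A rule: finite_induct) (simp_all add: polys_const polys_mult)

lemma polys_mono:
 assumes "p : polys a" "a <= b"
 shows "p : polys b"
 using polys_mult[OF assms(1) polys_const[of 1 "b - a"]] assms(2) by simp

lemma polys_affine_comp:
 assumes p: "p : polys l" and A: "!!i. (%x. A x $ i) : polys (Suc 0)"
 shows "(%x. p (A x)) : polys l"
proof -
 obtain c where c: "p = (%x. \<Sum>al\<in>multi_indices l. c al * monomial al x)" using p by (auto simp: polys_eq)
 have "(%x. monomial al (A x)) : polys l" if "al : multi_indices l" for al
 proof -
  have "(%x. \<Prod>i\<in>UNIV. A x $ i ^ al i) : polys (\<Sum>i\<in>UNIV. al i * Suc 0)"
   by (intro polys_prod polys_power A) simp
  moreover have "(\<Sum>i\<in>UNIV. al i * Suc 0) <= l" using that by (simp add: multi_indices_def)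
  ultimately show ?thesis unfolding monomial_def by (rule polys_mono)
 qed
 then show ?thesis unfolding c by (simp add: polys_sum polys_cmult)
qed

lemma polys_along_line:
 fixes p :: "real^'n => real"
 assumes "p : polys l"
 shows "\<exists>q :: real poly. degree q <= l & (\<forall>t. p (x + t *\<^sub>R y) = poly q t)"
proof -
 obtain c where c: "p = (%x. \<Sum>al\<in>multi_indices l. c al * monomial al x)" using assms by (auto simp: polys_eq)
 define q where "q = (\<Sum>al\<in>multi_indices l. smult (c al) (\<Prod>i\<in>UNIV. [:x $ i, y $ i:] ^ al i))"
 have "degree (\<Prod>i\<in>UNIV. [:x $ i, y $ i:] ^ al i) <= l" if "al : multi_indices l" for al
 proof -
  have "degree (\<Prod>i\<in>UNIV. [:x $ i, y $ i:] ^ al i) <= (\<Sum>i\<in>UNIV. degree ([:x $ i, y $ i:] ^ al i))"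
   using degree_prod_sum_le[of UNIV "%i. [:x $ i, y $ i:] ^ al i"] by (simp add: o_def)
  also have "... <= (\<Sum>i\<in>UNIV. al i)"
  proof (rule sum_mono)
   fix i
   have "degree ([:x $ i, y $ i:] ^ al i) <= degree [:x $ i, y $ i:] * al i" by (rule degree_power_le)
   also have "... <= 1 * al i" by (intro mult_right_mono) auto
   finally show "degree ([:x $ i, y $ i:] ^ al i) <= al i" by simp
  qed
  finally show ?thesis using that by (simp add: multi_indices_def)
 qed
 then have "degree q <= l" unfolding q_def
  by (intro degree_sum_le) (auto intro: order_trans[OF degree_smult_le])
 moreover have "p (x + t *\<^sub>R y) = poly q t" for t
  by (simp add: c q_def poly_sum monomial_def poly_prod)
 ultimately show ?thesis by blast
qed

subsection \<open>Inverse inequalities\<close>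

text \<open>On a line a polynomial is controlled everywhere by its values on any interval: remove one
  zero of \<open>q - q(a)\<close> and use induction on the degree.\<close>

lemma poly_extrapolation:
 assumes "a < (b::real)"
 shows "\<exists>C\<ge>0. \<forall>q M. degree q <= l --> (\<forall>t\<in>{a..b}. \<bar>poly q t\<bar> <= M) --> (\<forall>t\<in>{-R..R}. \<bar>poly q t\<bar> <= C * M)"
 using assms
proof (induction l arbitrary: a)
 case 0
 have "\<bar>poly q t\<bar> <= 1 * M" if "degree q <= 0" "\<forall>t\<in>{a..b}. \<bar>poly q t\<bar> <= M" for q M t
 proof -
  from that(1) have "degree q = 0" by simp
  then obtain c where "q = [:c:]" by (rule degree_eq_zeroE)
  then show ?thesis using that(2) 0 by auto
 qed
 then show ?case by (intro exI[of _ 1]) auto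
next
 case (Suc l)
 define m where "m = (a + b) / 2"
 have m: "a < m" "m < b" using Suc.prems by (auto simp: m_def)
 obtain C where C: "0 <= C" and ext: "!!q M t. degree q <= l ==> \<forall>t\<in>{m..b}. \<bar>poly q t\<bar> <= M ==> t : {-R..R} ==> \<bar>poly q t\<bar> <= C * M"
  using Suc.IH[OF m(2)] by blast
 show ?case
 proof (intro exI[of _ "1 + (\<bar>R\<bar> + \<bar>a\<bar>) * (C * (2 / (m - a)))"] conjI allI impI ballI)
  show "0 <= 1 + (\<bar>R\<bar> + \<bar>a\<bar>) * (C * (2 / (m - a)))" using C m by simp
  fix q :: "real poly" and M t
  assume q: "degree q <= Suc l" and M: "\<forall>t\<in>{a..b}. \<bar>poly q t\<bar> <= M" and t: "t : {-R..R}"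
  define q' where "q' = synthetic_div q a"
  have "[:-a, 1:] * q' + [:poly q a:] = q" unfolding q'_def by (rule synthetic_div_correct')
  then have q': "poly q s = (s - a) * poly q' s + poly q a" for s
   by (metis (no_types, lifting) poly_add poly_mult poly_pCons poly_0 add.commute diff_conv_add_uminus mult.right_neutral mult_zero_right add_0_right)
  have a: "\<bar>poly q a\<bar> <= M" using M Suc.prems by auto
  have "\<bar>poly q' s\<bar> <= 2 / (m - a) * M" if s: "s : {m..b}" for s
  proof -
   have "\<bar>poly q s\<bar> <= M" using M s m by auto
   then have "\<bar>(s - a) * poly q' s\<bar> <= 2 * M" using a q'[of s] by linarith
   then have 1: "(s - a) * \<bar>poly q' s\<bar> <= 2 * M" using s m by (simp add: abs_mult)
   have "(m - a) * \<bar>poly q' s\<bar> <= (s - a) * \<bar>poly q' s\<bar>" using s by (intro mult_right_mono) auto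
   with 1 have "(m - a) * \<bar>poly q' s\<bar> <= 2 * M" by linarith
   then show ?thesis using m by (simp add: field_simps)
  qed
  moreover have "degree q' <= l" using q by (simp add: q'_def degree_synthetic_div)
  ultimately have "\<bar>poly q' t\<bar> <= C * (2 / (m - a) * M)" using ext t by blast
  then have "\<bar>t - a\<bar> * \<bar>poly q' t\<bar> <= (\<bar>R\<bar> + \<bar>a\<bar>) * (C * (2 / (m - a) * M))"
   using t by (intro mult_mono) auto
  then have "\<bar>poly q t\<bar> <= (\<bar>R\<bar> + \<bar>a\<bar>) * (C * (2 / (m - a) * M)) + M"
   using a unfolding q'[of t] by (simp add: abs_mult[symmetric])
  then show "\<bar>poly q t\<bar> <= (1 + (\<bar>R\<bar> + \<bar>a\<bar>) * (C * (2 / (m - a)))) * M" by (simp add: algebra_simps)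
 qed
qed

lemma poly_derivative_bound:
 "\<exists>C\<ge>0. \<forall>q M. degree q <= l --> (\<forall>t\<in>{0..1}. \<bar>poly q t\<bar> <= M) --> \<bar>poly (pderiv q) (0::real)\<bar> <= C * M"
proof -
 obtain C where C: "0 <= C" and ext: "!!(q::real poly) M t. degree q <= l ==> \<forall>t\<in>{1/2..1}. \<bar>poly q t\<bar> <= M ==> t : {-1..1} ==> \<bar>poly q t\<bar> <= C * M"
  using poly_extrapolation[of "1/2" 1 l 1] by (auto simp del: atLeastAtMost_iff)
 have "\<bar>poly (pderiv q) 0\<bar> <= (C * 4) * M" if q: "degree q <= l" and M: "\<forall>t\<in>{0..1}. \<bar>poly q t\<bar> <= M" for q M
 proof -
  define q' where "q' = synthetic_div q 0"
  have e: "[:0, 1:] * q' + [:poly q 0:] = q" unfolding q'_def using synthetic_div_correct'[of 0 q] by simp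
  then have q': "poly q s = s * poly q' s + poly q 0" for s
   by (metis (no_types, lifting) poly_add poly_mult poly_pCons poly_0 mult.right_neutral mult_zero_right add_0_right add_0)
  have "poly (pderiv q) 0 = poly q' 0" by (subst e[symmetric]) (simp add: pderiv_add pderiv_mult pderiv_pCons)
  moreover have "\<bar>poly q' s\<bar> <= 4 * M" if s: "s : {1/2..1}" for s
  proof -
   have "\<bar>poly q s\<bar> <= M" "\<bar>poly q 0\<bar> <= M" using M s by auto
   then have "\<bar>s * poly q' s\<bar> <= 2 * M" using q'[of s] by linarith
   then have 1: "s * \<bar>poly q' s\<bar> <= 2 * M" using s by (simp add: abs_mult)
   have "1/2 * \<bar>poly q' s\<bar> <= s * \<bar>poly q' s\<bar>" using s by (intro mult_right_mono) auto
   with 1 show ?thesis by linarith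
  qed
  moreover have "degree q' <= l" using q by (simp add: q'_def degree_synthetic_div)
  ultimately show ?thesis using ext[of q' "4 * M" 0] by (simp add: mult.assoc)
 qed
 then show ?thesis using C by (intro exI[of _ "C * 4"]) auto
qed

lemma smooth_bounded_on_cball:
 assumes "smooth f"
 shows "\<exists>M. \<forall>y\<in>cball x R. \<bar>f y\<bar> <= M"
proof -
 have "compact (f ` cball x R)"
  using smooth_continuous[OF assms] by (intro compact_continuous_image) auto
 then show ?thesis using compact_imp_bounded by (fastforce simp: bounded_iff)
qed

lemma polys_extrapolation:
 fixes \<sigma> :: real
 shows "\<exists>C\<ge>0. \<forall>(p :: real^'n => real) x r M y. p : polys l --> 0 < r --> (\<forall>z\<in>cball x r. \<bar>p z\<bar> <= M)
  --> y : cball x (\<sigma> * r) --> \<bar>p y\<bar> <= C * M"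
proof -
 obtain C where C: "0 <= C" and ext: "!!q M t. degree q <= l ==> \<forall>t\<in>{0..1}. \<bar>poly q t\<bar> <= M ==> t : {-\<bar>\<sigma>\<bar>..\<bar>\<sigma>\<bar>} ==> \<bar>poly q t\<bar> <= C * M"
  using poly_extrapolation[of 0 1 l "\<bar>\<sigma>\<bar>"] by (auto simp del: atLeastAtMost_iff)
 have "\<bar>p y\<bar> <= max 1 C * M" if p: "p : polys l" and r: "0 < r" and M: "\<forall>z\<in>cball x r. \<bar>p z\<bar> <= M"
  and y: "y : cball x (\<sigma> * r)" for p :: "real^'n => real" and x r M y
 proof -
  have "\<bar>p x\<bar> <= M" using M r by simp
  then have M0: "0 <= M" by linarith
  show ?thesis
  proof (cases "y = x")
   case True
   have "\<bar>p y\<bar> <= M" using \<open>\<bar>p x\<bar> <= M\<close> True by simp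
   also have "... <= max 1 C * M" using mult_right_mono[of 1 "max 1 C" M] M0 by simp
   finally show ?thesis .
  next
   case False
   define d where "d = norm (y - x)"
   have d: "0 < d" "d <= \<sigma> * r" using False y by (auto simp: d_def dist_norm norm_minus_commute)
   define v where "v = (r / d) *\<^sub>R (y - x)"
   obtain q where q: "degree q <= l" "!!t. p (x + t *\<^sub>R v) = poly q t"
    using polys_along_line[OF p, of x v] by blast
   have "norm v = r" using d r by (simp add: v_def d_def[symmetric])
   then have qM: "\<forall>t\<in>{0..1}. \<bar>poly q t\<bar> <= M"
    unfolding q(2)[symmetric] using r \<open>norm v = r\<close>
    by (intro ballI bspec[OF M]) (simp add: dist_norm mult_left_le_one_le)
   moreover have "d / r : {-\<bar>\<sigma>\<bar>..\<bar>\<sigma>\<bar>}"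
   proof -
    have "d / r <= \<sigma>" using d r by (simp add: divide_le_eq)
    moreover have "0 < d / r" using d r by simp
    ultimately show ?thesis unfolding atLeastAtMost_iff by linarith
   qed
   ultimately have "\<bar>poly q (d / r)\<bar> <= C * M" using ext q(1) by blast
   moreover have "x + (d / r) *\<^sub>R v = y" using d r by (simp add: v_def)
   ultimately have "\<bar>p y\<bar> <= C * M" using q(2)[of "d / r"] by simp
   also have "... <= max 1 C * M" using M0 by (intro mult_right_mono) auto
   finally show ?thesis .
  qed
 qed
 then show ?thesis by (intro exI[of _ "max 1 C"]) auto
qed

lemma polys_grad_bound:
 "\<exists>C\<ge>0. \<forall>(p :: real^'n => real) x r M. p : polys l --> 0 < r --> (\<forall>z\<in>cball x r. \<bar>p z\<bar> <= M)
  --> r * norm (grad p x) <= C * M"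
proof -
 obtain C where C: "0 <= C" and der: "!!q M. degree q <= l ==> \<forall>t\<in>{0..1}. \<bar>poly q t\<bar> <= M ==> \<bar>poly (pderiv q) (0::real)\<bar> <= C * M"
  using poly_derivative_bound[of l] by blast
 have "r * norm (grad p x) <= C * M" if p: "p : polys l" and r: "0 < r" and M: "\<forall>z\<in>cball x r. \<bar>p z\<bar> <= M"
  for p :: "real^'n => real" and x r M
 proof (cases "grad p x = 0")
  case True
  have "\<bar>p x\<bar> <= M" using M r by simp
  then have M0: "0 <= M" by linarith
  then show ?thesis using True C by simp
 next
  case False
  define v where "v = (r / norm (grad p x)) *\<^sub>R grad p x"
  obtain q where q: "degree q <= l" "!!t. p (x + t *\<^sub>R v) = poly q t"
   using polys_along_line[OF p, of x v] by blast
  have nv: "norm v = r" using False r by (simp add: v_def)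
  then have "\<forall>t\<in>{0..1}. \<bar>poly q t\<bar> <= M"
   unfolding q(2)[symmetric] using r \<open>norm v = r\<close>
   by (intro ballI bspec[OF M]) (simp add: dist_norm mult_left_le_one_le)
  then have "\<bar>poly (pderiv q) 0\<bar> <= C * M" using der q(1) by blast
  moreover have "poly (pderiv q) 0 = grad p x \<bullet> v"
  proof -
   have "((%t. x + t *\<^sub>R v) has_derivative (%t. t *\<^sub>R v)) (at 0)" by (auto intro!: derivative_eq_intros)
   moreover have "(p has_derivative (%h. grad p x \<bullet> h)) (at (x + 0 *\<^sub>R v))"
    using smooth_has_derivative[OF polys_smooth[OF p]] by simp
   ultimately have "((%t. p (x + t *\<^sub>R v)) has_derivative (%t. grad p x \<bullet> (t *\<^sub>R v))) (at 0)"
    by (rule has_derivative_compose)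
   then have "(poly q has_real_derivative grad p x \<bullet> v) (at 0)"
    unfolding q(2) has_field_derivative_def by (simp add: mult_commute_abs)
   then show ?thesis using poly_DERIV[of q 0] DERIV_unique by blast
  qed
  moreover have "grad p x \<bullet> v = r * norm (grad p x)"
   using False by (simp add: v_def dot_square_norm power2_eq_square)
  ultimately show ?thesis by linarith
 qed
 then show ?thesis using C by blast
qed

text \<open>The maximum of \<open>\<bar>p\<bar>\<close> over a ball is attained at a point around which \<open>\<bar>p\<bar>\<close> stays above half
  of the maximum, on a ball of comparable radius because the gradient is under control.\<close>

lemma polys_sup_le_L2:
 "\<exists>C>0. \<forall>(p :: real^'n => real) x r y. p : polys l --> 0 < r --> y : cball x r -->
  r ^ CARD('n) * (p y)^2 <= C * (\<integral>z. (p z)^2 * indicator (cball x r) z \<partial>lborel)"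
proof -
 obtain C1 where C1: "0 <= C1" and ext: "!!(p :: real^'n => real) x r M y. p : polys l ==> 0 < r ==> \<forall>z\<in>cball x r. \<bar>p z\<bar> <= M
  ==> y : cball x (2 * r) ==> \<bar>p y\<bar> <= C1 * M"
  using polys_extrapolation[where 'n='n, of l 2] by blast
 obtain C2 where C2: "0 <= C2" and gr: "!!(p :: real^'n => real) x r M. p : polys l ==> 0 < r ==> \<forall>z\<in>cball x r. \<bar>p z\<bar> <= M
  ==> r * norm (grad p x) <= C2 * M"
  using polys_grad_bound[where 'n='n, of l] by blast
 define L where "L = 1 + C2 * C1"
 have L: "1 <= L" using C1 C2 by (simp add: L_def)
 define V where "V = unit_ball_vol (real CARD('n))"
 have V: "0 < V" by (simp add: V_def)
 define \<kappa> where "\<kappa> = 1 / (4 * L)"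
 have \<kappa>: "0 < \<kappa>" "\<kappa> <= 1/4" using L by (auto simp: \<kappa>_def field_simps)
 have main: "r ^ CARD('n) * (p y)^2 <= 4 / (V * \<kappa> ^ CARD('n)) * (\<integral>z. (p z)^2 * indicator (cball x r) z \<partial>lborel)"
  if p: "p : polys l" and r: "0 < r" and y: "y : cball x r" for p :: "real^'n => real" and x r y
 proof -
  have sm: "smooth p" by (rule polys_smooth[OF p])
  have "\<exists>z\<in>cball x r. \<forall>w\<in>cball x r. \<bar>p w\<bar> <= \<bar>p z\<bar>"
   using r by (intro continuous_attains_sup continuous_on_rabs smooth_continuous sm) auto
  then obtain z where z: "z : cball x r" "!!w. w : cball x r ==> \<bar>p w\<bar> <= \<bar>p z\<bar>" by blast
  define M where "M = \<bar>p z\<bar>"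
  have gradM: "norm (grad p w) <= L * M / r" if w: "w : cball x r" for w
  proof -
   have "\<bar>p v\<bar> <= C1 * M" if "v : cball w r" for v
   proof (rule ext[OF p r])
    show "\<forall>z\<in>cball x r. \<bar>p z\<bar> <= M" using z by (simp add: M_def)
    show "v : cball x (2 * r)" using that w dist_triangle[of x v w] by auto
   qed
   then have "r * norm (grad p w) <= C2 * (C1 * M)" by (intro gr[OF p r]) blast
   also have "... <= L * M" by (simp add: L_def M_def algebra_simps)
   finally show ?thesis using r by (simp add: field_simps)
  qed
  have lip: "\<bar>p w - p z\<bar> <= L * M / r * norm (w - z)" if "w : cball x r" for w
  proof -
   have "norm (p w - p z) <= L * M / r * norm (w - z)"
   proof (rule differentiable_bound[of "cball x r" p "%v h. grad p v \<bullet> h"])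
    show "(p has_derivative (%h. grad p v \<bullet> h)) (at v within cball x r)" for v
     by (rule has_derivative_at_withinI[OF smooth_has_derivative[OF sm]])
    show "onorm (%h. grad p v \<bullet> h) <= L * M / r" if "v : cball x r" for v
    proof (rule onorm_le)
     fix h :: "real^'n"
     have "norm (grad p v \<bullet> h) <= norm (grad p v) * norm h" by (simp add: Cauchy_Schwarz_ineq2)
     also have "... <= L * M / r * norm h" by (intro mult_right_mono gradM[OF that]) simp
     finally show "norm (grad p v \<bullet> h) <= L * M / r * norm h" .
    qed
   qed (use that z in auto)
   then show ?thesis by simp
  qed
  define w0 where "w0 = z + \<kappa> *\<^sub>R (x - z)"
  let ?B = "cball w0 (\<kappa> * r)"
  have B1: "w : cball x r" "norm (w - z) <= 2 * \<kappa> * r" if "w : ?B" for w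
  proof -
   have zx: "norm (x - z) <= r" using z(1) by (simp add: dist_norm)
   have w: "norm (w - w0) <= \<kappa> * r" using that by (simp add: dist_norm norm_minus_commute)
   have "x - w = (1 - \<kappa>) *\<^sub>R (x - z) + (w0 - w)" by (simp add: w0_def algebra_simps)
   then have "norm (x - w) <= (1 - \<kappa>) * norm (x - z) + norm (w0 - w)"
    using \<kappa> by (metis abs_of_nonneg norm_scaleR norm_triangle_ineq diff_ge_0_iff_ge order_trans[of \<kappa> "1/4" 1] divide_le_eq_1 one_le_numeral zero_less_numeral less_imp_le)
   also have "... <= (1 - \<kappa>) * r + \<kappa> * r"
    using zx w \<kappa> by (intro add_mono mult_left_mono) (auto simp: norm_minus_commute)
   finally show "w : cball x r" by (simp add: dist_norm algebra_simps)
   have "w - z = (w - w0) + \<kappa> *\<^sub>R (x - z)" by (simp add: w0_def)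
   then have "norm (w - z) <= norm (w - w0) + norm (\<kappa> *\<^sub>R (x - z))" by (metis norm_triangle_ineq)
   also have "... <= \<kappa> * r + \<kappa> * r" using w zx \<kappa> by (intro add_mono) (auto intro: mult_left_mono)
   finally show "norm (w - z) <= 2 * \<kappa> * r" by simp
  qed
  have low: "M^2 / 4 <= (p w)^2" if "w : ?B" for w
  proof -
   have "\<bar>p w - p z\<bar> <= L * M / r * (2 * \<kappa> * r)"
    using lip[OF B1(1)[OF that]] B1(2)[OF that] L r
    by (elim order_trans) (intro mult_left_mono, auto simp: M_def)
   also have "... = M / 2" using L r by (simp add: \<kappa>_def)
   finally have "\<bar>p w - p z\<bar> <= \<bar>p z\<bar> / 2" by (simp only: M_def)
   then have "M / 2 <= \<bar>p w\<bar>" unfolding M_def by arith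
   then have "(M / 2)^2 <= \<bar>p w\<bar>\<^sup>2" by (rule power_mono) (simp add: M_def)
   then show ?thesis by (simp add: power_divide)
  qed
  have int: "integrable lborel (%z. (p z)^2 * indicator (cball x r) z)"
  proof -
   have "integrable lborel (%z. indicator (cball x r) z *\<^sub>R (p z)\<^sup>2)"
    by (intro borel_integrable_compact continuous_intros smooth_continuous[OF sm]) auto
   then show ?thesis by (simp add: mult.commute)
  qed
  have "M^2 / 4 * (V * (\<kappa> * r) ^ CARD('n)) = (\<integral>z. M^2 / 4 * indicator ?B z \<partial>lborel)"
   using \<kappa> r by (simp add: content_cball V_def)
  also have "... <= (\<integral>z. (p z)^2 * indicator (cball x r) z \<partial>lborel)"
  proof (rule integral_mono[OF _ int])
   show "integrable lborel (%z. M^2 / 4 * indicator ?B z)"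
    using \<kappa> r by (intro integrable_mult_right integrable_real_indicator) (auto simp: emeasure_cball)
   show "M^2 / 4 * indicator ?B z <= (p z)^2 * indicator (cball x r) z" for z
    using low[of z] B1(1)[of z] by (auto simp: indicator_def)
  qed
  finally have "M^2 * (V * \<kappa> ^ CARD('n)) * r ^ CARD('n) <= 4 * (\<integral>z. (p z)^2 * indicator (cball x r) z \<partial>lborel)"
   by (simp add: power_mult_distrib algebra_simps)
  moreover have "(p y)^2 <= M^2" using z(2)[OF y] by (simp add: M_def abs_le_square_iff)
  then have "(p y)^2 * (V * \<kappa> ^ CARD('n)) * r ^ CARD('n) <= M^2 * (V * \<kappa> ^ CARD('n)) * r ^ CARD('n)"
   using V \<kappa> r by (intro mult_right_mono) auto
  ultimately have "(V * \<kappa> ^ CARD('n)) * (r ^ CARD('n) * (p y)^2) <= 4 * (\<integral>z. (p z)^2 * indicator (cball x r) z \<partial>lborel)"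
   by (simp add: algebra_simps)
  then show ?thesis using V \<kappa> by (simp add: field_simps)
 qed
 show ?thesis
  by (intro exI[of _ "4 / (V * \<kappa> ^ CARD('n))"] conjI allI impI main) (use V \<kappa> in auto)
qed

text \<open>The square integral over a ball controls the maximum over the ball, this controls the maximum over a
larger ball, and this controls the gradient.\<close>

theorem polys_inverse_inequality:
 fixes \<sigma> :: real
 shows "\<exists>C>0. \<forall>(p :: real^'n => real) x r y. p : polys l --> 0 < r --> y : cball x (\<sigma> * r) -->
  r ^ CARD('n) * (r * norm (grad p y))^2 <= C * (\<integral>z. (p z)^2 * indicator (cball x r) z \<partial>lborel)"
proof -
 obtain C1 where C1: "0 <= C1" and ext: "!!(p :: real^'n => real) x r M y. p : polys l ==> 0 < r ==> \<forall>z\<in>cball x r. \<bar>p z\<bar> <= M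
  ==> y : cball x ((\<sigma> + 1) * r) ==> \<bar>p y\<bar> <= C1 * M"
  using polys_extrapolation[where 'n='n, of l "\<sigma> + 1"] by blast
 obtain C2 where C2: "0 <= C2" and gr: "!!(p :: real^'n => real) x r M. p : polys l ==> 0 < r ==> \<forall>z\<in>cball x r. \<bar>p z\<bar> <= M
  ==> r * norm (grad p x) <= C2 * M"
  using polys_grad_bound[where 'n='n, of l] by blast
 obtain C3 where C3: "0 < C3" and sup: "!!(p :: real^'n => real) x r y. p : polys l ==> 0 < r ==> y : cball x r ==>
  r ^ CARD('n) * (p y)^2 <= C3 * (\<integral>z. (p z)^2 * indicator (cball x r) z \<partial>lborel)"
  using polys_sup_le_L2[where 'n='n, of l] by blast
 have main: "r ^ CARD('n) * (r * norm (grad p y))^2 <= (1 + (C2 * C1)^2 * C3) * (\<integral>z. (p z)^2 * indicator (cball x r) z \<partial>lborel)"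
  if p: "p : polys l" and r: "0 < r" and y: "y : cball x (\<sigma> * r)" for p :: "real^'n => real" and x r y
 proof -
  let ?I = "\<integral>z. (p z)^2 * indicator (cball x r) z \<partial>lborel"
  have I: "0 <= ?I" by (intro integral_nonneg_AE) auto
  define M where "M = sqrt (C3 * ?I / r ^ CARD('n))"
  have M2: "M^2 = C3 * ?I / r ^ CARD('n)" using C3 I r by (simp add: M_def)
  have "\<bar>p z\<bar> <= M" if "z : cball x r" for z
   unfolding M_def using sup[OF p r that] r
   by (intro real_le_rsqrt) (simp add: field_simps)
  then have "\<bar>p v\<bar> <= C1 * M" if "v : cball y r" for v
   using that y dist_triangle[of x v y] by (intro ext[OF p r, of x]) (auto simp: algebra_simps)
  then have "r * norm (grad p y) <= C2 * (C1 * M)" by (intro gr[OF p r]) blast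
  then have "(r * norm (grad p y))^2 <= (C2 * (C1 * M))^2" using r by (intro power_mono) auto
  also have "... = (C2 * C1)^2 * (C3 * ?I / r ^ CARD('n))" by (simp add: power_mult_distrib M2 mult.assoc)
  finally have "r ^ CARD('n) * (r * norm (grad p y))^2 <= (C2 * C1)^2 * C3 * ?I"
   using r by (simp add: field_simps)
  also have "... <= (1 + (C2 * C1)^2 * C3) * ?I" using I by (simp add: algebra_simps)
  finally show ?thesis .
 qed
 show ?thesis
  by (intro exI[of _ "1 + (C2 * C1)^2 * C3"] conjI allI impI main) (use C3 in \<open>auto intro: add_pos_nonneg\<close>)
qed

section \<open>Square integrals\<close>

definition sq_int :: "(real^'n) set => (real^'n => real) => ennreal" where
 "sq_int A f = (\<integral>\<^sup>+x. ennreal ((f x)^2) * indicator A x \<partial>lborel)"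

lemma sq_int_mono: "(!!x. x : A ==> (f x)^2 <= (g x)^2) ==> sq_int A f <= sq_int A g"
 unfolding sq_int_def by (intro nn_integral_mono) (auto simp: indicator_def intro: ennreal_leI)

lemma sq_int_scale:
 assumes [measurable]: "f : borel_measurable borel" "A : sets borel"
 shows "sq_int A (%x. c * f x) = ennreal (c^2) * sq_int A f"
 unfolding sq_int_def
 by (subst nn_integral_cmult[symmetric]) (auto simp: power_mult_distrib ennreal_mult mult.assoc)

lemma numeral_times_ennreal: "numeral k * ennreal x = ennreal (numeral k * x)"
 by (simp add: ennreal_mult')

lemma sum3_square_le: "(a + b + c)^2 <= 3 * a^2 + 3 * b^2 + 3 * (c::real)^2"
proof -
 have "0 <= (a - b)^2 + (a - c)^2 + (b - c)^2" by simp
 then show ?thesis by (simp add: power2_eq_square algebra_simps)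
qed

lemma sum2_square_le: "(a + b)^2 <= 2 * a^2 + 2 * (b::real)^2"
proof -
 have "0 <= (a - b)^2" by simp
 then show ?thesis by (simp add: power2_eq_square algebra_simps)
qed

lemma sq_int_add3:
 assumes [measurable]: "f : borel_measurable borel" "g : borel_measurable borel" "h : borel_measurable borel" "A : sets borel"
 shows "sq_int A (%x. f x + g x + h x) <= 3 * sq_int A f + 3 * sq_int A g + 3 * sq_int A h"
proof -
 have "sq_int A (%x. f x + g x + h x)
  <= (\<integral>\<^sup>+x. 3 * (ennreal ((f x)^2) * indicator A x) + 3 * (ennreal ((g x)^2) * indicator A x)
    + 3 * (ennreal ((h x)^2) * indicator A x) \<partial>lborel)"
  unfolding sq_int_def
 proof (rule nn_integral_mono)
  fix x
  have "ennreal ((f x + g x + h x)^2) <= ennreal (3 * (f x)^2 + 3 * (g x)^2 + 3 * (h x)^2)"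
   by (intro ennreal_leI sum3_square_le)
  also have "... = 3 * ennreal ((f x)^2) + 3 * ennreal ((g x)^2) + 3 * ennreal ((h x)^2)"
   by (simp add: ennreal_plus ennreal_mult)
  finally show "ennreal ((f x + g x + h x)^2) * indicator A x
   <= 3 * (ennreal ((f x)^2) * indicator A x) + 3 * (ennreal ((g x)^2) * indicator A x)
    + 3 * (ennreal ((h x)^2) * indicator A x)"
   by (simp add: indicator_def)
 qed
 also have "... = 3 * sq_int A f + 3 * sq_int A g + 3 * sq_int A h"
  unfolding sq_int_def by (simp add: nn_integral_add nn_integral_cmult)
 finally show ?thesis .
qed

lemma sq_int_add:
 assumes [measurable]: "f : borel_measurable borel" "g : borel_measurable borel" "A : sets borel"
 shows "sq_int A (%x. f x + g x) <= 2 * sq_int A f + 2 * sq_int A g"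
proof -
 have "sq_int A (%x. f x + g x)
  <= (\<integral>\<^sup>+x. 2 * (ennreal ((f x)^2) * indicator A x) + 2 * (ennreal ((g x)^2) * indicator A x) \<partial>lborel)"
  unfolding sq_int_def
 proof (rule nn_integral_mono)
  fix x
  have "ennreal ((f x + g x)^2) <= ennreal (2 * (f x)^2 + 2 * (g x)^2)"
   by (intro ennreal_leI sum2_square_le)
  also have "... = 2 * ennreal ((f x)^2) + 2 * ennreal ((g x)^2)"
   by (simp add: ennreal_plus ennreal_mult)
  finally show "ennreal ((f x + g x)^2) * indicator A x
   <= 2 * (ennreal ((f x)^2) * indicator A x) + 2 * (ennreal ((g x)^2) * indicator A x)"
   by (simp add: indicator_def)
 qed
 also have "... = 2 * sq_int A f + 2 * sq_int A g"
  unfolding sq_int_def by (simp add: nn_integral_add nn_integral_cmult)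
 finally show ?thesis .
qed

lemma sq_int_eq_integral:
 assumes "integrable lborel (%x. (f x)^2 * indicator A x)"
 shows "sq_int A f = ennreal (\<integral>x. (f x)^2 * indicator A x \<partial>lborel)"
proof -
 have "sq_int A f = (\<integral>\<^sup>+x. ennreal ((f x)^2 * indicator A x) \<partial>lborel)"
  unfolding sq_int_def by (intro nn_integral_cong) (auto simp: indicator_def)
 also have "... = ennreal (\<integral>x. (f x)^2 * indicator A x \<partial>lborel)"
  by (rule nn_integral_eq_integral[OF assms]) auto
 finally show ?thesis .
qed

lemma sq_int_finite_integrable:
 assumes [measurable]: "f : borel_measurable borel" "A : sets borel" and "sq_int A f < \<infinity>"
 shows "integrable lborel (%x. (f x)^2 * indicator A x)"
proof (rule integrableI_bounded)
 have "(\<integral>\<^sup>+x. ennreal (norm ((f x)^2 * indicator A x)) \<partial>lborel) = sq_int A f"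
  unfolding sq_int_def by (intro nn_integral_cong) (auto simp: indicator_def)
 then show "(\<integral>\<^sup>+x. ennreal (norm ((f x)^2 * indicator A x)) \<partial>lborel) < \<infinity>" using assms(3) by simp
qed measurable

section \<open>Continuous functions are dense in L2\<close>

text \<open>A measurable function is almost everywhere the limit of continuous functions. Truncating these at the bound
makes dominated convergence applicable.\<close>

lemma bounded_sq_int_approx:
 fixes w :: "real^'n => real"
 assumes w [measurable]: "w : borel_measurable borel" and A [measurable]: "A : sets borel" and bA: "bounded A"
  and bd: "!!x. \<bar>w x\<bar> <= M" and e: "0 < e"
 shows "\<exists>v. continuous_on UNIV v & sq_int A (%x. w x - v x) <= ennreal e"
proof -
 have "w : borel_measurable lebesgue" using w by (simp add: measurable_completion)
 then have "w measurable_on UNIV" by (intro lebesgue_measurable_imp_measurable_on_real) auto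
 then obtain N g where N: "negligible N" and g: "!!n. continuous_on UNIV (g n)"
  and lim: "!!x. x \<notin> N ==> (%n. g n x) \<longlonglongrightarrow> w x"
  unfolding measurable_on_def by auto
 define h where "h n x = max (- M) (min (g n x) M)" for n :: nat and x
 have hc: "continuous_on UNIV (h n)" for n unfolding h_def by (intro continuous_intros g)
 then have [measurable]: "h n : borel_measurable borel" for n by (rule borel_measurable_continuous_onI)
 have M0: "0 <= M" using bd[of 0] by linarith
 have hb: "\<bar>h n x\<bar> <= M" for n x using M0 by (auto simp: h_def)
 have hlim: "(%n. h n x) \<longlonglongrightarrow> w x" if "x \<notin> N" for x
 proof -
  have "(%n. h n x) \<longlonglongrightarrow> max (- M) (min (w x) M)"
   unfolding h_def by (intro tendsto_max tendsto_min tendsto_const lim that)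
  moreover have "max (- M) (min (w x) M) = w x" using bd[of x] by (auto simp: max_def min_def abs_le_iff)
  ultimately show ?thesis by simp
 qed
 have finA: "emeasure lborel A < \<infinity>" using bA by (rule emeasure_bounded_finite)
 have intb: "integrable lborel (%x. (2 * M)^2 * indicator A x)"
  using finA by (intro integrable_mult_right integrable_real_indicator) auto
 have bnd: "(w x - h n x)^2 * indicator A x <= (2 * M)^2 * indicator A x" for n x
 proof -
  have "\<bar>w x - h n x\<bar> <= 2 * M" using bd[of x] hb[of n x] by linarith
  then have "\<bar>w x - h n x\<bar>\<^sup>2 <= (2 * M)^2" by (rule power_mono) simp
  then show ?thesis by (auto simp: indicator_def)
 qed
 have "(%n. \<integral>x. (w x - h n x)^2 * indicator A x \<partial>lborel) \<longlonglongrightarrow> (\<integral>x. 0 \<partial>(lborel :: (real^'n) measure))"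
 proof (rule integral_dominated_convergence[OF _ _ intb])
  have "AE x in lborel. x \<notin> N"
  proof -
   have "N : null_sets lebesgue" using N by (simp add: negligible_iff_null_sets)
   from AE_not_in[OF this] show ?thesis by (simp only: AE_completion_iff)
  qed
  then show "AE x in lborel. (%n. (w x - h n x)^2 * indicator A x) \<longlonglongrightarrow> 0"
  proof eventually_elim
   fix x assume "x \<notin> N"
   then have "(%n. (w x - h n x)^2 * indicator A x) \<longlonglongrightarrow> (w x - w x)\<^sup>2 * indicator A x"
    by (intro tendsto_intros hlim)
   then show "(%n. (w x - h n x)^2 * indicator A x) \<longlonglongrightarrow> 0" by simp
  qed
  show "!!n. AE x in lborel. norm ((w x - h n x)^2 * indicator A x) <= (2 * M)^2 * indicator A x"
   using bnd by simp
 qed auto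
 from order_tendstoD(2)[OF this, of "e"] e
 have "\<forall>\<^sub>F n in sequentially. (\<integral>x. (w x - h n x)^2 * indicator A x \<partial>lborel) < e" by simp
 then obtain n where n: "(\<integral>x. (w x - h n x)^2 * indicator A x \<partial>lborel) < e"
  using eventually_happens'[OF sequentially_bot] by blast
 have "integrable lborel (%x. (w x - h n x)^2 * indicator A x)"
  by (rule Bochner_Integration.integrable_bound[OF intb]) (use bnd in auto)
 from sq_int_eq_integral[OF this] n have "sq_int A (%x. w x - h n x) <= ennreal e"
  by (simp add: ennreal_leI)
 then show ?thesis using hc by blast
qed

text \<open>Truncation reduces the claim to bounded functions.\<close>

lemma sq_int_approx_continuous:
 fixes w :: "real^'n => real"
 assumes w [measurable]: "w : borel_measurable borel" and A [measurable]: "A : sets borel" and bA: "bounded A"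
  and fin: "sq_int A w < \<infinity>" and e: "0 < e"
 shows "\<exists>v. continuous_on UNIV v & sq_int A (%x. w x - v x) <= ennreal e"
proof -
 define h where "h n x = max (- real n) (min (w x) (real n))" for n :: nat and x
 have [measurable]: "h n : borel_measurable borel" for n unfolding h_def by measurable
 have intw: "integrable lborel (%x. (w x)^2 * indicator A x)"
  by (rule sq_int_finite_integrable[OF w A fin])
 have bnd: "(w x - h n x)^2 * indicator A x <= (w x)^2 * indicator A x" for n x
 proof -
  have "\<bar>w x - h n x\<bar> <= \<bar>w x\<bar>" by (auto simp: h_def max_def min_def)
  then show ?thesis by (auto simp: indicator_def abs_le_square_iff)
 qed
 have "(%n. \<integral>x. (w x - h n x)^2 * indicator A x \<partial>lborel) \<longlonglongrightarrow> (\<integral>x. 0 \<partial>(lborel :: (real^'n) measure))"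
 proof (rule integral_dominated_convergence[OF _ _ intw])
  have "(%n. (w x - h n x)^2 * indicator A x) \<longlonglongrightarrow> 0" for x
  proof (rule tendsto_eventually)
   obtain m :: nat where m: "\<bar>w x\<bar> <= real m" using real_arch_simple by blast
   have "\<forall>n\<ge>m. (w x - h n x)^2 * indicator A x = 0"
    using m by (auto simp: h_def max_def min_def)
   then show "\<forall>\<^sub>F n in sequentially. (w x - h n x)^2 * indicator A x = 0"
    unfolding eventually_sequentially by blast
  qed
  then show "AE x in lborel. (%n. (w x - h n x)^2 * indicator A x) \<longlonglongrightarrow> 0" by simp
  show "!!n. AE x in lborel. norm ((w x - h n x)^2 * indicator A x) <= (w x)^2 * indicator A x"
   using bnd by simp
 qed auto
 from order_tendstoD(2)[OF this, of "e / 4"] e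
 have "\<forall>\<^sub>F n in sequentially. (\<integral>x. (w x - h n x)^2 * indicator A x \<partial>lborel) < e / 4" by simp
 then obtain n where n: "(\<integral>x. (w x - h n x)^2 * indicator A x \<partial>lborel) < e / 4"
  using eventually_happens'[OF sequentially_bot] by blast
 have "integrable lborel (%x. (w x - h n x)^2 * indicator A x)"
  by (rule Bochner_Integration.integrable_bound[OF intw]) (use bnd in auto)
 from sq_int_eq_integral[OF this] n have 1: "sq_int A (%x. w x - h n x) <= ennreal (e / 4)"
  by (simp add: ennreal_leI)
 have "\<bar>h n x\<bar> <= real n" for x by (auto simp: h_def)
 then obtain v where v: "continuous_on UNIV v" and 2: "sq_int A (%x. h n x - v x) <= ennreal (e / 4)"
  using bounded_sq_int_approx[of "h n" A "real n" "e / 4"] bA e by auto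
 have [measurable]: "v : borel_measurable borel" using v by (rule borel_measurable_continuous_onI)
 have "sq_int A (%x. w x - v x) = sq_int A (%x. (w x - h n x) + (h n x - v x))" by simp
 also have "... <= 2 * sq_int A (%x. w x - h n x) + 2 * sq_int A (%x. h n x - v x)"
  by (rule sq_int_add) measurable
 also have "... <= 2 * ennreal (e / 4) + 2 * ennreal (e / 4)"
  by (intro add_mono mult_left_mono 1 2) auto
 also have "... = ennreal (2 * (e / 4) + 2 * (e / 4))"
  using e by (simp only: numeral_times_ennreal) (rule ennreal_plus[symmetric], auto)
 also have "2 * (e / 4) + 2 * (e / 4) = e" by simp
 finally show ?thesis using v by blast
qed

lemma nn_integral_contraction:
 fixes g :: "real^'n => ennreal"
 assumes g [measurable]: "g : borel_measurable borel" and A [measurable]: "A : sets borel"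
  and t: "0 <= t" "t <= 1/2" and S: "!!x. x : A ==> (1 - t) *\<^sub>R x + t *\<^sub>R b : A"
 shows "(\<integral>\<^sup>+x. g ((1 - t) *\<^sub>R x + t *\<^sub>R b) * indicator A x \<partial>lborel)
  <= ennreal (2 ^ CARD('n)) * (\<integral>\<^sup>+x. g x * indicator A x \<partial>lborel)"
proof -
 let ?F = "%x. g x * indicator A x"
 have "(\<integral>\<^sup>+x. g ((1 - t) *\<^sub>R x + t *\<^sub>R b) * indicator A x \<partial>lborel) <= (\<integral>\<^sup>+x. ?F (t *\<^sub>R b + (1 - t) *\<^sub>R x) \<partial>lborel)"
  using S by (intro nn_integral_mono) (auto simp: indicator_def add.commute)
 also have "... = 1 * ..." by simp
 also have "... <= ennreal (2 ^ CARD('n)) * ennreal (\<bar>1 - t\<bar> ^ CARD('n)) * (\<integral>\<^sup>+x. ?F (t *\<^sub>R b + (1 - t) *\<^sub>R x) \<partial>lborel)"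
 proof (rule mult_right_mono)
  have "1 <= (2 * \<bar>1 - t\<bar>) ^ CARD('n)" using t by (intro one_le_power) auto
  then show "1 <= ennreal (2 ^ CARD('n)) * ennreal (\<bar>1 - t\<bar> ^ CARD('n))"
   by (simp add: ennreal_mult[symmetric] power_mult_distrib)
 qed simp
 also have "... = ennreal (2 ^ CARD('n)) * (\<integral>\<^sup>+x. ?F x \<partial>lborel)"
  using t by (subst (2) nn_integral_lborel_affine[of _ "1 - t" "t *\<^sub>R b"]) (auto simp: mult.assoc)
 finally show ?thesis .
qed

lemma sq_int_contraction:
 fixes f :: "real^'n => real"
 assumes f [measurable]: "f : borel_measurable borel" and A: "A : sets borel"
  and t: "0 <= t" "t <= 1/2" and S: "!!x. x : A ==> (1 - t) *\<^sub>R x + t *\<^sub>R b : A"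
 shows "sq_int A (%x. f ((1 - t) *\<^sub>R x + t *\<^sub>R b)) <= ennreal (2 ^ CARD('n)) * sq_int A f"
 unfolding sq_int_def by (rule nn_integral_contraction[OF _ A t S]) measurable

lemma sq_int_le_const:
 assumes [measurable]: "A : sets borel" and "0 <= c" "!!x. x : A ==> \<bar>f x\<bar> <= c"
 shows "sq_int A f <= ennreal (c^2) * emeasure lborel A"
proof -
 have "sq_int A f <= (\<integral>\<^sup>+x. ennreal (c^2) * indicator A x \<partial>lborel)"
  unfolding sq_int_def
 proof (rule nn_integral_mono)
  fix x
  show "ennreal ((f x)^2) * indicator A x <= ennreal (c^2) * indicator A x"
   using power_mono[OF assms(3)[of x] abs_ge_zero, of 2] by (auto simp: indicator_def intro: ennreal_leI)
 qed
 then show ?thesis by (simp add: nn_integral_cmult)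
qed

lemma dilation_sq_int_tendsto:
 fixes w :: "real^'n => real"
 assumes w [measurable]: "w : borel_measurable borel" and A [measurable]: "A : sets borel" and bA: "bounded A"
  and fin: "sq_int A w < \<infinity>" and e: "0 < e"
 shows "\<exists>t0>0. t0 <= 1/2 & (\<forall>t b. 0 <= t --> t <= t0 --> norm b <= R -->
  (\<forall>x\<in>A. (1 - t) *\<^sub>R x + t *\<^sub>R b : A) -->
  sq_int A (%x. w ((1 - t) *\<^sub>R x + t *\<^sub>R b) - w x) <= ennreal e)"
proof -
 define N :: real where "N = 2 ^ CARD('n)"
 have N: "1 <= N" by (simp add: N_def)
 define e1 where "e1 = e / (9 * N)"
 have e1: "0 < e1" using e N by (simp add: e1_def)
 obtain v where v: "continuous_on UNIV v" and wv: "sq_int A (%x. w x - v x) <= ennreal e1"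
  using sq_int_approx_continuous[OF w A bA fin e1] by blast
 have [measurable]: "v : borel_measurable borel" using v by (rule borel_measurable_continuous_onI)
 obtain B0 where B0: "!!x. x : A ==> norm x <= B0" using bA bounded_iff by metis
 define B where "B = \<bar>B0\<bar> + \<bar>R\<bar> + 1"
 have B: "0 < B" "!!x. x : A ==> norm x <= B" using B0 by (auto simp: B_def) (smt (verit))
 define mA where "mA = measure lborel A"
 have mA: "emeasure lborel A = ennreal mA" "0 <= mA"
  using emeasure_bounded_finite[OF bA] by (auto simp: mA_def emeasure_eq_ennreal_measure)
 define c where "c = sqrt (e / (9 * (mA + 1)))"
 have c: "0 < c" "c^2 * mA <= e / 9"
 proof -
  have c2: "c^2 = e / (9 * (mA + 1))" using e mA by (simp add: c_def)
  have "c^2 * mA <= c^2 * (mA + 1)" by (intro mult_left_mono) auto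
  also have "... = e / 9" using mA by (simp add: c2 field_simps)
  finally show "c^2 * mA <= e / 9" .
 qed (use e mA in \<open>simp add: c_def\<close>)
 have "uniformly_continuous_on (cball 0 B) v"
  by (intro compact_uniformly_continuous continuous_on_subset[OF v]) auto
 then obtain d where d: "0 < d" and vd: "!!x y. x : cball 0 B ==> y : cball 0 B ==> dist y x < d ==> dist (v y) (v x) < c"
  unfolding uniformly_continuous_on_def using c(1) by blast
 define t0 where "t0 = min (1/2) (d / (4 * B))"
 have t0: "0 < t0" "t0 <= 1/2" "t0 * (2 * B) < d" using d B by (auto simp: t0_def min_def field_simps)
 show ?thesis
 proof (intro exI[of _ t0] conjI allI impI t0)
  fix t b assume t: "0 <= t" "t <= t0" and b: "norm b <= R" and S: "\<forall>x\<in>A. (1 - t) *\<^sub>R x + t *\<^sub>R b : A"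
  let ?S = "%x. (1 - t) *\<^sub>R x + t *\<^sub>R b"
  have "sq_int A (%x. w (?S x) - w x) = sq_int A (%x. (w (?S x) - v (?S x)) + (v (?S x) - v x) + (- 1) * (w x - v x))"
   by simp
  also have "... <= 3 * sq_int A (%x. w (?S x) - v (?S x)) + 3 * sq_int A (%x. v (?S x) - v x) + 3 * sq_int A (%x. (- 1) * (w x - v x))"
   by (rule sq_int_add3) measurable
  also have "sq_int A (%x. (- 1) * (w x - v x)) = sq_int A (%x. w x - v x)"
   by (subst sq_int_scale) auto
  also have "sq_int A (%x. w (?S x) - v (?S x)) <= ennreal (2 ^ CARD('n)) * sq_int A (%x. w x - v x)"
   by (rule sq_int_contraction[where f = "%x. w x - v x"]) (use t t0 S in auto)
  also have "sq_int A (%x. v (?S x) - v x) <= ennreal (c^2) * emeasure lborel A"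
  proof (rule sq_int_le_const)
   fix x assume x: "x : A"
   have "dist (?S x) x = t * norm (b - x)"
   proof -
    have "?S x - x = t *\<^sub>R (b - x)" by (simp add: algebra_simps)
    then show ?thesis using t(1) by (simp add: dist_norm)
   qed
   also have "... <= t0 * (2 * B)"
   proof (rule mult_mono)
    have "norm (b - x) <= norm b + norm x" by (rule norm_triangle_ineq4)
    also have "... <= 2 * B" using b B(2)[OF x] by (simp add: B_def)
    finally show "norm (b - x) <= 2 * B" .
   qed (use t t0 in auto)
   finally have "dist (?S x) x < d" using t0 by linarith
   moreover have "?S x : cball 0 B" "x : cball 0 B" using B(2) x S by auto
   ultimately have "dist (v (?S x)) (v x) < c" by (intro vd)
   then show "\<bar>v (?S x) - v x\<bar> <= c" by (simp add: dist_real_def)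
  qed (use c in auto)
  also have "ennreal (c^2) * emeasure lborel A <= ennreal (e / 9)"
   unfolding mA(1) using c(2) mA(2) by (subst ennreal_mult[symmetric]) (auto intro: ennreal_leI)
  finally have "sq_int A (%x. w (?S x) - w x) <= 3 * (ennreal N * sq_int A (%x. w x - v x)) + 3 * ennreal (e / 9) + 3 * sq_int A (%x. w x - v x)"
   by (simp add: N_def add_mono mult_left_mono add_right_mono)
  also have "... <= 3 * (ennreal N * ennreal e1) + 3 * ennreal (e / 9) + 3 * ennreal e1"
   by (intro add_mono mult_left_mono wv) auto
  also have "... = ennreal (3 * (N * e1) + 3 * (e / 9) + 3 * e1)"
  proof -
   have "ennreal N * ennreal e1 = ennreal (N * e1)" using e1 N by (simp add: ennreal_mult)
   then show ?thesis using e e1 N by (simp only: numeral_times_ennreal) (simp add: ennreal_plus)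
  qed
  also have "... <= ennreal e"
  proof (rule ennreal_leI)
   have "N * e1 = e / 9" using N by (simp add: e1_def)
   moreover have "e1 <= N * e1" using N e1 by (simp add: mult_le_cancel_right1)
   ultimately show "3 * (N * e1) + 3 * (e / 9) + 3 * e1 <= e" by linarith
  qed
  finally show "sq_int A (%x. w (?S x) - w x) <= ennreal e" .
 qed
qed

section \<open>Mollification\<close>

lemma smooth_zero_deriv:
 assumes "!!x. dl <= norm x ==> \<psi> x = 0" "dl < norm x"
 shows "partial_deriv i \<psi> x = 0" "(\<psi> has_derivative (%_. 0)) (at x)"
proof -
 have "((%_. 0) has_derivative (%_. 0)) (at x)" by (rule has_derivative_const)
 then show D: "(\<psi> has_derivative (%_. 0)) (at x)"
  by (rule has_derivative_transform_within_open[where s = "- cball 0 dl"]) (use assms in auto)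
 show "partial_deriv i \<psi> x = 0" by (subst partial_deriv_eq[OF D]) simp
qed

lemma smooth_supp_partial_deriv:
 assumes sm: "smooth \<psi>" and supp: "!!x. dl <= norm x ==> \<psi> x = 0" and x: "dl <= norm x" and d: "0 < dl"
 shows "partial_deriv i \<psi> x = 0"
proof (cases "dl < norm x")
 case True then show ?thesis using smooth_zero_deriv(1)[of dl \<psi> x, OF supp] by simp
next
 case False
 then have nx: "norm x = dl" using x by simp
 have c: "continuous_on UNIV (partial_deriv i \<psi>)" by (intro smooth_continuous smooth_partial_deriv sm)
 have "(%n. partial_deriv i \<psi> ((1 + 1 / real (Suc n)) *\<^sub>R x)) \<longlonglongrightarrow> partial_deriv i \<psi> ((1 + 0) *\<^sub>R x)"
 proof (rule continuous_on_tendsto_compose[OF c])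
  show "(%n. (1 + 1 / real (Suc n)) *\<^sub>R x) \<longlonglongrightarrow> (1 + 0) *\<^sub>R x"
   by (intro tendsto_intros LIMSEQ_Suc[OF lim_1_over_n])
 qed auto
 moreover have "partial_deriv i \<psi> ((1 + 1 / real (Suc n)) *\<^sub>R x) = 0" for n
 proof (rule smooth_zero_deriv(1)[OF supp])
  have "dl * 1 < dl * (1 + 1 / real (Suc n))" using d by (intro mult_strict_left_mono) auto
  moreover have "norm ((1 + 1 / real (Suc n)) *\<^sub>R x) = dl * (1 + 1 / real (Suc n))"
   unfolding norm_scaleR nx by (simp add: mult.commute)
  ultimately show "dl < norm ((1 + 1 / real (Suc n)) *\<^sub>R x)" by linarith
 qed
 ultimately have "(%n::nat. 0) \<longlonglongrightarrow> partial_deriv i \<psi> x" by simp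
 then show ?thesis by (simp add: LIMSEQ_const_iff)
qed

lemma smooth_supp_bounded:
 assumes sm: "smooth \<psi>" and supp: "!!x. dl <= norm x ==> \<psi> x = 0"
 shows "\<exists>M. \<forall>x. \<bar>\<psi> x\<bar> <= M"
proof -
 obtain M where M: "!!y. y : cball 0 dl ==> \<bar>\<psi> y\<bar> <= M" using smooth_bounded_on_cball[OF sm] by blast
 have "\<bar>\<psi> x\<bar> <= max M 0" for x
  using M[of x] supp[of x] by (cases "norm x <= dl") (auto simp: le_max_iff_disj)
 then show ?thesis by blast
qed

lemma mollifier_exists:
 fixes dl :: real
 assumes dl: "0 < dl"
 shows "\<exists>k :: real^'n => real. smooth k & (\<forall>x. 0 <= k x) & (\<forall>x. dl <= norm x --> k x = 0)
  & integrable lborel k & (\<integral>x. k x \<partial>lborel) = 1"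
proof -
 define g where "g x = flat 0 (dl^2 - (norm (x - 0))^2)" for x :: "real^'n"
 have gel: "g : elementary" unfolding g_def by (rule elementary.flat)
 then have sm: "smooth g" by (rule elementary_smooth)
 have g0: "0 <= g x" for x by (simp add: g_def flat_nonneg)
 have gs: "g x = 0" if "dl <= norm x" for x
  using power_mono[OF that, of 2] dl by (simp add: g_def flat_def)
 have int: "integrable lborel g"
 proof -
  have "integrable lborel (%x. indicator (cball 0 dl) x *\<^sub>R g x)"
   by (intro borel_integrable_compact smooth_continuous sm) auto
  moreover have "(%x. indicator (cball 0 dl) x *\<^sub>R g x) = g"
   by (rule ext) (use gs in \<open>auto simp: indicator_def\<close>)
  ultimately show ?thesis by simp
 qed
 have "(\<integral>x. g x \<partial>lborel) ~= 0"
 proof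
  assume "(\<integral>x. g x \<partial>lborel) = 0"
  then have "AE x in lborel. g x = 0"
   using integral_nonneg_eq_0_iff_AE[OF int] g0 by simp
  then have "AE x in lborel. x \<notin> ball (0::real^'n) dl"
  proof eventually_elim
   fix x :: "real^'n" assume g: "g x = 0"
   show "x \<notin> ball 0 dl"
   proof
    assume "x : ball 0 dl"
    then have "(norm x)^2 < dl^2" by (intro power_strict_mono) auto
    then show False using g by (simp add: g_def flat_def)
   qed
  qed
  then have "emeasure lborel (ball (0::real^'n) dl) = 0"
   by (subst (asm) AE_iff_measurable[of "ball 0 dl"]) auto
  moreover have "unit_ball_vol (real CARD('n)) ~= 0"
   by (metis unit_ball_vol_pos less_irrefl of_nat_0_le_iff)
  ultimately show False using dl by (simp add: emeasure_ball)
 qed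
 moreover have "0 <= (\<integral>x. g x \<partial>lborel)" using g0 by (intro integral_nonneg_AE) auto
 ultimately have I: "0 < (\<integral>x. g x \<partial>lborel)" by simp
 define k where "k x = (1 / (\<integral>x. g x \<partial>lborel)) * g x" for x
 have "smooth k" unfolding k_def by (intro smooth_mult smooth_const sm)
 moreover have "integrable lborel k" unfolding k_def using int by (rule integrable_mult_right)
 ultimately show ?thesis
  using I g0 gs int by (intro exI[of _ k]) (auto simp: k_def)
qed

text \<open>First-order Taylor expansion with a remainder that is uniform in the base point.\<close>

lemma smooth_supp_taylor:
 fixes \<psi> :: "real^'n => real"
 assumes sm: "smooth \<psi>" and supp: "!!x. dl <= norm x ==> \<psi> x = 0" and e: "0 < e"
 shows "\<exists>d>0. \<forall>z h. norm h < d --> \<bar>\<psi> (z + h) - \<psi> z - grad \<psi> z \<bullet> h\<bar> <= e * norm h"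
proof -
 let ?K = "cball 0 (\<bar>dl\<bar> + 2) :: (real^'n) set"
 have "uniformly_continuous_on ?K (grad \<psi>)"
  by (intro compact_uniformly_continuous continuous_grad sm) auto
 then obtain d where d: "0 < d" and gd: "!!x y. x : ?K ==> y : ?K ==> dist y x < d ==> dist (grad \<psi> y) (grad \<psi> x) < e"
  unfolding uniformly_continuous_on_def using e by blast
 have "\<bar>\<psi> (z + h) - \<psi> z - grad \<psi> z \<bullet> h\<bar> <= e * norm h" if h: "norm h < min d 1" for z h
 proof (cases "norm z <= \<bar>dl\<bar> + 1")
  case True
  let ?S = "cball z (norm h)"
  let ?f = "%v. \<psi> v - grad \<psi> z \<bullet> v"
  have "norm (?f (z + h) - ?f z) <= e * norm (z + h - z)"
  proof (rule differentiable_bound[of ?S ?f "%v h. grad \<psi> v \<bullet> h - grad \<psi> z \<bullet> h"])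
   show "(?f has_derivative (%h. grad \<psi> v \<bullet> h - grad \<psi> z \<bullet> h)) (at v within ?S)" for v
    by (intro has_derivative_diff has_derivative_at_withinI[OF smooth_has_derivative[OF sm]]
      bounded_linear_imp_has_derivative bounded_linear_inner_right)
   show "onorm (%h. grad \<psi> v \<bullet> h - grad \<psi> z \<bullet> h) <= e" if v: "v : ?S" for v
   proof (rule onorm_le)
    fix x :: "real^'n"
    have dv: "dist v z < d" using v h by (simp add: dist_commute)
    have nv: "norm v <= norm z + norm h" using v norm_triangle_ineq2[of v z] by (simp add: dist_norm norm_minus_commute)
    have "v : ?K" "z : ?K" using nv True h by auto
    then have "dist (grad \<psi> v) (grad \<psi> z) < e" using gd dv by blast
    then have "norm (grad \<psi> v - grad \<psi> z) <= e" by (simp add: dist_norm)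
    then have "norm (grad \<psi> v - grad \<psi> z) * norm x <= e * norm x" by (rule mult_right_mono) simp
    then show "norm (grad \<psi> v \<bullet> x - grad \<psi> z \<bullet> x) <= e * norm x"
     using Cauchy_Schwarz_ineq2[of "grad \<psi> v - grad \<psi> z" x] by (simp add: inner_diff_left)
   qed
  qed (auto simp: dist_norm)
  then show ?thesis by (simp add: inner_add_right algebra_simps)
 next
  case False
  have "\<psi> z = 0" "partial_deriv i \<psi> z = 0" for i
   using False supp[of z] by (auto intro!: smooth_zero_deriv(1)[of dl] supp)
  moreover have "norm (z + h) >= norm z - norm h" using norm_triangle_ineq2[of z "-h"] by simp
  then have "\<psi> (z + h) = 0" using False h by (intro supp) auto
  ultimately show ?thesis using e by (simp add: grad_def inner_vec_def)
 qed
 then show ?thesis using d by (intro exI[of _ "min d 1"]) auto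
qed

lemma smooth_affine:
 assumes "smooth \<psi>"
 shows "smooth (%x. \<psi> (al *\<^sub>R x + c))"
  and "partial_deriv i (%x. \<psi> (al *\<^sub>R x + c)) x = al * partial_deriv i \<psi> (al *\<^sub>R x + c)"
proof -
 have D: "((%x. \<beta> * \<psi> (al *\<^sub>R x + c)) has_derivative (%h. \<beta> * (grad \<psi> (al *\<^sub>R x + c) \<bullet> (al *\<^sub>R h)))) (at x)"
  if "smooth \<psi>" for \<psi> \<beta> x
 proof -
  have "((%x. al *\<^sub>R x + c) has_derivative (%h. al *\<^sub>R h)) (at x)" by (auto intro!: derivative_eq_intros)
  from has_derivative_compose[OF this smooth_has_derivative[OF that]]
  show ?thesis by (intro has_derivative_mult_right) 
 qed
 have P: "partial_deriv i (%x. \<beta> * \<psi> (al *\<^sub>R x + c)) x = (\<beta> * al) * partial_deriv i \<psi> (al *\<^sub>R x + c)"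
  if "smooth \<psi>" for \<psi> \<beta> x i
  by (subst partial_deriv_eq[OF D[OF that]]) (simp add: inner_axis)
 show "partial_deriv i (%x. \<psi> (al *\<^sub>R x + c)) x = al * partial_deriv i \<psi> (al *\<^sub>R x + c)"
  using P[OF assms, of i 1 x] by simp
 define S where "S = {h. \<exists>\<beta> \<psi>. smooth \<psi> & h = (%x. \<beta> * \<psi> (al *\<^sub>R x + c))}"
 show "smooth (%x. \<psi> (al *\<^sub>R x + c))"
 proof (rule smoothI_closed[of _ S])
  have "(%x. \<psi> (al *\<^sub>R x + c)) = (%x. 1 * \<psi> (al *\<^sub>R x + c))" by simp
  then show "(%x. \<psi> (al *\<^sub>R x + c)) : S" unfolding S_def using assms by blast
  fix f i x assume "f : S"
  then obtain \<beta> \<psi> where f: "smooth \<psi>" "f = (%x. \<beta> * \<psi> (al *\<^sub>R x + c))" unfolding S_def by blast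
  show "f differentiable (at x)" unfolding f(2) using D[OF f(1)] by (auto simp: differentiable_def)
  have "partial_deriv i f = (%x. (\<beta> * al) * partial_deriv i \<psi> (al *\<^sub>R x + c))"
   unfolding f(2) by (rule ext) (rule P[OF f(1)])
  then show "partial_deriv i f : S" unfolding S_def using smooth_partial_deriv[OF f(1)] by blast
 qed
qed

text \<open>Derivatives of a convolution fall on the smooth kernel; the argument of the kernel carries the
  dilation that pulls points into the domain.\<close>

lemma convolution_smooth:
 fixes w :: "real^'n => real"
 assumes w: "integrable lborel w" and sm: "smooth \<psi>" and supp: "!!x. dl <= norm x ==> \<psi> x = 0" and dl: "0 < dl"
 shows "smooth (%x. \<integral>y. w y * \<psi> (al *\<^sub>R x + c - y) \<partial>lborel)"
  and "partial_deriv i (%x. \<integral>y. w y * \<psi> (al *\<^sub>R x + c - y) \<partial>lborel) x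
   = al * (\<integral>y. w y * partial_deriv i \<psi> (al *\<^sub>R x + c - y) \<partial>lborel)"
proof -
 have [measurable]: "w : borel_measurable borel" using w by auto
 have int: "integrable lborel (%y. w y * \<psi> (z - y))" if sm: "smooth \<psi>" and supp: "!!x. dl <= norm x ==> \<psi> x = 0" for \<psi> z
 proof -
  obtain M where M: "!!x. \<bar>\<psi> x\<bar> <= M" using smooth_supp_bounded[OF sm supp] by blast
  have [measurable]: "\<psi> : borel_measurable borel" using sm by (rule smooth_borel)
  have "integrable lborel (%y. M * w y)" using w by (rule integrable_mult_right)
  then show ?thesis
  proof (rule Bochner_Integration.integrable_bound)
   show "AE y in lborel. norm (w y * \<psi> (z - y)) <= norm (M * w y)"
   proof (rule AE_I2)
    fix y
    have "\<bar>w y\<bar> * \<bar>\<psi> (z - y)\<bar> <= \<bar>w y\<bar> * \<bar>M\<bar>" using M[of "z - y"] by (intro mult_left_mono) auto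
    then show "norm (w y * \<psi> (z - y)) <= norm (M * w y)" by (simp add: abs_mult mult.commute)
   qed
  qed measurable
 qed
 have supp': "partial_deriv i \<psi> x = 0" if "smooth \<psi>" "!!x. dl <= norm x ==> \<psi> x = 0" "dl <= norm x" for \<psi> :: "real^'n => real" and i x
  using smooth_supp_partial_deriv[of \<psi> dl x i] that dl by blast
 have D: "((%x. \<integral>y. w y * \<psi> (al *\<^sub>R x + c - y) \<partial>lborel) has_derivative
   (%h. (\<chi> i. al * (\<integral>y. w y * partial_deriv i \<psi> (al *\<^sub>R x + c - y) \<partial>lborel)) \<bullet> h)) (at x)"
  if sm: "smooth \<psi>" and supp: "!!x. dl <= norm x ==> \<psi> x = 0" for \<psi> x
  unfolding has_derivative_at_alt
 proof (intro conjI allI impI bounded_linear_inner_right)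
  fix e :: real assume e: "0 < e"
  define W where "W = (\<integral>y. \<bar>w y\<bar> \<partial>lborel)"
  have W: "0 <= W" unfolding W_def by (intro integral_nonneg_AE) auto
  define e' where "e' = e / ((W + 1) * (\<bar>al\<bar> + 1))"
  have e': "0 < e'" using e W by (simp add: e'_def)
  obtain d where d: "0 < d" and tay: "!!z h. norm h < d ==> \<bar>\<psi> (z + h) - \<psi> z - grad \<psi> z \<bullet> h\<bar> <= e' * norm h"
   using smooth_supp_taylor[OF sm supp e'] by blast
  have int': "integrable lborel (%y. w y * partial_deriv i \<psi> (z - y))" for i z
   by (intro int smooth_partial_deriv sm supp'[OF sm supp])
  show "\<exists>d>0. \<forall>y. norm (y - x) < d -->
   norm ((\<integral>z. w z * \<psi> (al *\<^sub>R y + c - z) \<partial>lborel) - (\<integral>z. w z * \<psi> (al *\<^sub>R x + c - z) \<partial>lborel)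
    - (\<chi> i. al * (\<integral>y. w y * partial_deriv i \<psi> (al *\<^sub>R x + c - y) \<partial>lborel)) \<bullet> (y - x)) <= e * norm (y - x)"
  proof (intro exI[of _ "d / (\<bar>al\<bar> + 1)"] conjI allI impI)
   show "0 < d / (\<bar>al\<bar> + 1)" using d by simp
   fix y assume y: "norm (y - x) < d / (\<bar>al\<bar> + 1)"
   define h where "h = al *\<^sub>R (y - x)"
   have nh: "norm h < d"
   proof -
    have "norm h <= (\<bar>al\<bar> + 1) * norm (y - x)" by (simp add: h_def mult_right_mono)
    also have "... < d" using y by (simp add: pos_less_divide_eq mult.commute)
    finally show ?thesis .
   qed
   have yx: "al *\<^sub>R y + c - z = (al *\<^sub>R x + c - z) + h" for z by (simp add: h_def algebra_simps)
   let ?R = "%z. \<psi> ((al *\<^sub>R x + c - z) + h) - \<psi> (al *\<^sub>R x + c - z) - grad \<psi> (al *\<^sub>R x + c - z) \<bullet> h"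
   have i1: "integrable lborel (%z. w z * \<psi> ((al *\<^sub>R x + c - z) + h))"
    using int[OF sm supp, of "al *\<^sub>R y + c"] by (simp add: yx)
   have i2: "integrable lborel (%z. w z * \<psi> (al *\<^sub>R x + c - z))"
    by (rule int[OF sm supp])
   have wg: "w z * (grad \<psi> (al *\<^sub>R x + c - z) \<bullet> h) = (\<Sum>i\<in>UNIV. (w z * partial_deriv i \<psi> (al *\<^sub>R x + c - z)) * h $ i)" for z
    by (simp add: inner_vec_def sum_distrib_left mult.assoc)
   have i3: "integrable lborel (%z. w z * (grad \<psi> (al *\<^sub>R x + c - z) \<bullet> h))"
    unfolding wg by (intro Bochner_Integration.integrable_sum integrable_mult_left int')
   have "(\<integral>z. w z * (grad \<psi> (al *\<^sub>R x + c - z) \<bullet> h) \<partial>lborel)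
    = (\<Sum>i\<in>UNIV. (\<integral>z. w z * partial_deriv i \<psi> (al *\<^sub>R x + c - z) \<partial>lborel) * h $ i)"
    unfolding wg by (subst Bochner_Integration.integral_sum) (auto intro!: integrable_mult_left int')
   also have "... = (\<chi> i. al * (\<integral>y. w y * partial_deriv i \<psi> (al *\<^sub>R x + c - y) \<partial>lborel)) \<bullet> (y - x)"
    by (simp add: inner_vec_def h_def mult.assoc mult.left_commute mult.commute)
   finally have e3: "(\<chi> i. al * (\<integral>y. w y * partial_deriv i \<psi> (al *\<^sub>R x + c - y) \<partial>lborel)) \<bullet> (y - x)
    = (\<integral>z. w z * (grad \<psi> (al *\<^sub>R x + c - z) \<bullet> h) \<partial>lborel)" ..
   have m1: "(\<integral>z. w z * \<psi> (al *\<^sub>R y + c - z) \<partial>lborel) - (\<integral>z. w z * \<psi> (al *\<^sub>R x + c - z) \<partial>lborel)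
    - (\<integral>z. w z * (grad \<psi> (al *\<^sub>R x + c - z) \<bullet> h) \<partial>lborel) = (\<integral>z. w z * ?R z \<partial>lborel)"
    unfolding yx right_diff_distrib
    by (subst Bochner_Integration.integral_diff, intro Bochner_Integration.integrable_diff i1 i2, rule i3,
      subst Bochner_Integration.integral_diff, rule i1, rule i2, rule refl)
   have m2: "norm (\<integral>z. w z * ?R z \<partial>lborel) <= (\<integral>z. \<bar>w z\<bar> * (e' * norm h) \<partial>lborel)"
   proof (rule order_trans[OF integral_norm_bound integral_mono])
    have "integrable lborel (%z. w z * ?R z)"
     unfolding right_diff_distrib by (intro Bochner_Integration.integrable_diff i1 i2 i3)
    then show "integrable lborel (%z. norm (w z * ?R z))" by (rule integrable_norm)
    show "integrable lborel (%z. \<bar>w z\<bar> * (e' * norm h))" using w by auto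
    show "norm (w z * ?R z) <= \<bar>w z\<bar> * (e' * norm h)" for z
     using tay[OF nh, of "al *\<^sub>R x + c - z"] by (simp add: abs_mult mult_left_mono)
   qed
   have m3: "(\<integral>z. \<bar>w z\<bar> * (e' * norm h) \<partial>lborel) = W * (e' * norm h)" by (simp add: W_def)
   have m4: "W * (e' * norm h) <= e * norm (y - x)"
   proof -
    have "W * (e' * norm h) <= (W + 1) * (e' * ((\<bar>al\<bar> + 1) * norm (y - x)))"
     using W e' by (intro mult_mono) (auto simp: h_def intro: mult_right_mono)
    also have "... = e * norm (y - x)"
    proof -
     have "P * (e / (P * Q) * (Q * m)) = e * m" if "P ~= 0" "Q ~= 0" for P Q m :: real using that by simp
     then show ?thesis using W unfolding e'_def by simp
    qed
    finally show ?thesis .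
   qed
   show "norm ((\<integral>z. w z * \<psi> (al *\<^sub>R y + c - z) \<partial>lborel) - (\<integral>z. w z * \<psi> (al *\<^sub>R x + c - z) \<partial>lborel)
    - (\<chi> i. al * (\<integral>y. w y * partial_deriv i \<psi> (al *\<^sub>R x + c - y) \<partial>lborel)) \<bullet> (y - x)) <= e * norm (y - x)"
    unfolding e3 m1 using m2 m3 m4 by linarith
  qed
 qed
 have P: "partial_deriv i (%x. \<integral>y. w y * \<psi> (al *\<^sub>R x + c - y) \<partial>lborel) x
   = al * (\<integral>y. w y * partial_deriv i \<psi> (al *\<^sub>R x + c - y) \<partial>lborel)"
  if "smooth \<psi>" "!!x. dl <= norm x ==> \<psi> x = 0" for \<psi> i x
  by (subst partial_deriv_eq[OF D[OF that]]) (simp_all add: inner_axis)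
 show "partial_deriv i (%x. \<integral>y. w y * \<psi> (al *\<^sub>R x + c - y) \<partial>lborel) x
   = al * (\<integral>y. w y * partial_deriv i \<psi> (al *\<^sub>R x + c - y) \<partial>lborel)"
  by (rule P[OF sm supp])
 define S where "S = {h. \<exists>\<psi>. smooth \<psi> & (\<forall>x. dl <= norm x --> \<psi> x = 0) & h = (%x. \<integral>y. w y * \<psi> (al *\<^sub>R x + c - y) \<partial>lborel)}"
 show "smooth (%x. \<integral>y. w y * \<psi> (al *\<^sub>R x + c - y) \<partial>lborel)"
 proof (rule smoothI_closed[of _ S])
  show "(%x. \<integral>y. w y * \<psi> (al *\<^sub>R x + c - y) \<partial>lborel) : S"
   unfolding S_def using sm supp by blast
  fix f i x assume "f : S"
  then obtain \<psi> where f: "smooth \<psi>" "!!x. dl <= norm x ==> \<psi> x = 0" "f = (%x. \<integral>y. w y * \<psi> (al *\<^sub>R x + c - y) \<partial>lborel)"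
   unfolding S_def by blast
  show "f differentiable (at x)" unfolding f(3) using D[OF f(1,2)] by (auto simp: differentiable_def)
  define \<psi>' where "\<psi>' = (%z. al * partial_deriv i \<psi> z)"
  have "partial_deriv i f = (%x. \<integral>y. w y * \<psi>' (al *\<^sub>R x + c - y) \<partial>lborel)"
   unfolding f(3) by (rule ext) (simp add: P[OF f(1,2)] \<psi>'_def mult.left_commute[of _ al])
  moreover have "smooth \<psi>'" unfolding \<psi>'_def by (intro smooth_mult smooth_const smooth_partial_deriv f(1))
  moreover have "\<forall>x. dl <= norm x --> \<psi>' x = 0" using supp'[OF f(1,2)] by (simp add: \<psi>'_def)
  ultimately show "partial_deriv i f : S" unfolding S_def by blast
 qed
qed

lemma prob_square_le:
 fixes k f :: "'a::euclidean_space => real"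
 assumes k: "integrable lborel k" "!!x. 0 <= k x" "(\<integral>x. k x \<partial>lborel) = 1"
  and kf: "integrable lborel (%x. k x * f x)" and f [measurable]: "f : borel_measurable borel"
 shows "ennreal ((\<integral>x. k x * f x \<partial>lborel)^2) <= (\<integral>\<^sup>+x. ennreal (k x * (f x)^2) \<partial>lborel)"
proof (cases "(\<integral>\<^sup>+x. ennreal (k x * (f x)^2) \<partial>lborel) < \<infinity>")
 case True
 have [measurable]: "k : borel_measurable borel" using k(1) by auto
 have int: "integrable lborel (%x. k x * (f x)^2)"
  by (rule integrableI_bounded) (use True k(2) in \<open>auto simp: abs_mult\<close>)
 define m where "m = (\<integral>x. k x * f x \<partial>lborel)"
 have eq: "k x * (f x - m)^2 = k x * (f x)^2 - 2 * m * (k x * f x) + m^2 * k x" for x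
  by (simp add: power2_eq_square algebra_simps)
 have "0 <= (\<integral>x. k x * (f x - m)^2 \<partial>lborel)" using k(2) by (intro integral_nonneg_AE) auto
 also have "... = (\<integral>x. k x * (f x)^2 \<partial>lborel) - 2 * m * m + m^2"
  unfolding eq using int kf k by (simp add: m_def)
 finally have "m^2 <= (\<integral>x. k x * (f x)^2 \<partial>lborel)" by (simp add: power2_eq_square)
 then have "ennreal (m^2) <= ennreal (\<integral>x. k x * (f x)^2 \<partial>lborel)" by (rule ennreal_leI)
 also have "... = (\<integral>\<^sup>+x. ennreal (k x * (f x)^2) \<partial>lborel)"
  by (rule nn_integral_eq_integral[symmetric, OF int]) (use k in auto)
 finally show ?thesis by (simp add: m_def)
qed (simp add: not_less top_unique)

definition star_ball :: "(real^'n) set => real^'n => real => bool" where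
 "star_ball A x0 r \<longleftrightarrow> 0 < r & (\<forall>x\<in>A. \<forall>b\<in>cball x0 r. \<forall>t\<in>{0..1}. (1 - t) *\<^sub>R x + t *\<^sub>R b : A)"

lemma mollified_dilation_bound:
 fixes w :: "real^'n => real"
 assumes w [measurable]: "w : borel_measurable borel" and wint: "integrable lborel w" and A [measurable]: "A : sets borel"
  and t: "0 < t" and r: "0 < r"
  and k: "smooth k" "!!x. 0 <= k x" "!!x. t * r <= norm x ==> k x = 0" "integrable lborel k" "(\<integral>x. k x \<partial>lborel) = 1"
  and b: "!!b. b : cball x0 r ==> sq_int A (%x. w ((1 - t) *\<^sub>R x + t *\<^sub>R b) - w x) <= ennreal e"
 shows "sq_int A (%x. (\<integral>y. w y * k ((1 - t) *\<^sub>R x + t *\<^sub>R x0 - y) \<partial>lborel) - w x) <= ennreal e"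
proof -
 let ?S = "%x. (1 - t) *\<^sub>R x + t *\<^sub>R x0"
 have [measurable]: "k : borel_measurable borel" using k(1) by (rule smooth_borel)
 obtain M where M: "!!x. \<bar>k x\<bar> <= M" using smooth_supp_bounded[OF k(1,3)] by blast
 have intwk: "integrable lborel (%z. k z * w (s - z))" for s
 proof -
  have "integrable lborel (%y. w y * k (s - y))"
  proof (rule Bochner_Integration.integrable_bound[where f = "%y. M * w y"])
   show "integrable lborel (%y. M * w y)" using wint by (rule integrable_mult_right)
   show "AE y in lborel. norm (w y * k (s - y)) <= norm (M * w y)"
   proof (rule AE_I2)
    fix y
    have "\<bar>w y\<bar> * \<bar>k (s - y)\<bar> <= \<bar>w y\<bar> * \<bar>M\<bar>" using M[of "s - y"] by (intro mult_left_mono) auto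
    then show "norm (w y * k (s - y)) <= norm (M * w y)" by (simp add: abs_mult mult.commute)
   qed
  qed measurable
  then have "integrable (distr lborel borel (%z. s - z)) (%y. w y * k (s - y))"
   using lborel_reflect[of s] by simp
  then have "integrable lborel (%z. w (s - z) * k (s - (s - z)))"
   by (subst (asm) integrable_distr_eq) auto
  then show ?thesis by (simp add: mult.commute)
 qed
 have refl: "(\<integral>y. w y * k (s - y) \<partial>lborel) = (\<integral>z. k z * w (s - z) \<partial>lborel)" for s
 proof -
  have "(\<integral>y. w y * k (s - y) \<partial>lborel) = (\<integral>y. w y * k (s - y) \<partial>(distr lborel borel (%z. s - z)))"
   using lborel_reflect[of s] by simp
  also have "... = (\<integral>z. w (s - z) * k (s - (s - z)) \<partial>lborel)" by (subst integral_distr) auto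
  finally show ?thesis by (simp add: mult.commute)
 qed
 have "sq_int A (%x. (\<integral>y. w y * k (?S x - y) \<partial>lborel) - w x)
  <= (\<integral>\<^sup>+x. (\<integral>\<^sup>+z. ennreal (k z * (w (?S x - z) - w x)^2) * indicator A x \<partial>lborel) \<partial>lborel)"
  unfolding sq_int_def
 proof (rule nn_integral_mono)
  fix x
  have i: "integrable lborel (%z. k z * (w (?S x - z) - w x))"
   unfolding right_diff_distrib using intwk k(4) by auto
  have "(\<integral>y. w y * k (?S x - y) \<partial>lborel) - w x = (\<integral>z. k z * (w (?S x - z) - w x) \<partial>lborel)"
   unfolding right_diff_distrib refl using intwk k(4,5) by simp
  then have "ennreal (((\<integral>y. w y * k (?S x - y) \<partial>lborel) - w x)^2) <= (\<integral>\<^sup>+z. ennreal (k z * (w (?S x - z) - w x)^2) \<partial>lborel)"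
   using prob_square_le[OF k(4,2,5) i] by simp
  then show "ennreal (((\<integral>y. w y * k (?S x - y) \<partial>lborel) - w x)^2) * indicator A x
   <= (\<integral>\<^sup>+z. ennreal (k z * (w (?S x - z) - w x)^2) * indicator A x \<partial>lborel)"
   by (subst nn_integral_multc) (auto intro: mult_right_mono)
 qed
 also have "... = (\<integral>\<^sup>+z. (\<integral>\<^sup>+x. ennreal (k z * (w (?S x - z) - w x)^2) * indicator A x \<partial>lborel) \<partial>lborel)"
  by (rule lborel_pair.Fubini') measurable
 also have "... <= (\<integral>\<^sup>+z. ennreal (k z) * ennreal e \<partial>lborel)"
 proof (rule nn_integral_mono)
  fix z :: "real^'n"
  have "(\<integral>\<^sup>+x. ennreal (k z * (w (?S x - z) - w x)^2) * indicator A x \<partial>lborel)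
   = ennreal (k z) * sq_int A (%x. w (?S x - z) - w x)"
   unfolding sq_int_def by (subst nn_integral_cmult[symmetric]) (auto simp: ennreal_mult k(2) mult.assoc)
  also have "... <= ennreal (k z) * ennreal e"
  proof (cases "k z = 0")
   case False
   then have "norm z < t * r" using k(3)[of z] by force
   then have "norm ((1 / t) *\<^sub>R z) <= r" using t by (simp add: field_simps)
   then have "x0 - (1 / t) *\<^sub>R z : cball x0 r" by (simp add: dist_norm)
   from b[OF this] have "sq_int A (%x. w ((1 - t) *\<^sub>R x + t *\<^sub>R (x0 - (1 / t) *\<^sub>R z)) - w x) <= ennreal e" .
   moreover have "(1 - t) *\<^sub>R x + t *\<^sub>R (x0 - (1 / t) *\<^sub>R z) = ?S x - z" for x
    using t by (simp add: scaleR_diff_right)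
   ultimately show ?thesis by (intro mult_left_mono) auto
  qed simp
  finally show "(\<integral>\<^sup>+x. ennreal (k z * (w (?S x - z) - w x)^2) * indicator A x \<partial>lborel) <= ennreal (k z) * ennreal e" .
 qed
 also have "... = ennreal e"
  using k by (simp add: nn_integral_multc nn_integral_eq_integral)
 finally show ?thesis .
qed

section \<open>Weak gradients on star-shaped sets\<close>

lemma interior_star:
 assumes st: "star_ball A x0 r" and x: "x : interior A" and b: "b : cball x0 r" and t: "0 <= t" "t < 1"
 shows "(1 - t) *\<^sub>R x + t *\<^sub>R b : interior A"
proof -
 let ?S = "(%x. t *\<^sub>R b + (1 - t) *\<^sub>R x) ` interior A"
 have "open ?S" using t by (intro open_affinity) auto
 moreover have "?S \<subseteq> A"
 proof
  fix y assume "y : ?S"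
  then obtain x where "x : interior A" "y = t *\<^sub>R b + (1 - t) *\<^sub>R x" by blast
  moreover then have "x : A" using interior_subset by blast
  ultimately show "y : A" using st b t unfolding star_ball_def by (simp add: add.commute)
 qed
 ultimately have "?S \<subseteq> interior A" by (rule interior_maximal[rotated])
 then show ?thesis using x by (simp add: add.commute image_subset_iff)
qed

subsection \<open>Square-integrable functions\<close>

lemma L2_D:
 assumes "f : L2 M"
 shows "f : borel_measurable M" "integrable M (%x. (norm (f x))^2)"
 using assms by (auto simp: L2_def)

lemma L2_I: "f : borel_measurable M ==> integrable M (%x. (norm (f x))^2) ==> f : L2 M"
 by (simp add: L2_def)

lemma L2_norm_square: "(L2_norm M f)^2 = (\<integral>x. (norm (f x))^2 \<partial>M)"
 unfolding L2_norm_def by (rule real_sqrt_pow2) (simp add: integral_nonneg_AE)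

lemma L2_norm_nonneg: "0 <= L2_norm M f"
 unfolding L2_norm_def by (simp add: integral_nonneg_AE)

lemma L2_mult_integrable:
 fixes f g :: "'a => real"
 assumes f: "f : L2 M" and g: "g : L2 M"
 shows "integrable M (%x. f x * g x)"
proof (rule Bochner_Integration.integrable_bound)
 show "integrable M (%x. (norm (f x))^2 + (norm (g x))^2)"
  using L2_D[OF f] L2_D[OF g] by simp
 show "(%x. f x * g x) : borel_measurable M" using L2_D[OF f] L2_D[OF g] by simp
 show "AE x in M. norm (f x * g x) <= norm ((norm (f x))^2 + (norm (g x))^2)"
 proof (rule AE_I2)
  fix x
  have "0 <= (\<bar>f x\<bar> - \<bar>g x\<bar>)^2" by simp
  then have "2 * (\<bar>f x\<bar> * \<bar>g x\<bar>) <= (f x)^2 + (g x)^2" by (simp add: power2_diff)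
  moreover have "0 <= \<bar>f x\<bar> * \<bar>g x\<bar>" by simp
  ultimately have "\<bar>f x\<bar> * \<bar>g x\<bar> <= (f x)^2 + (g x)^2" by linarith
  then show "norm (f x * g x) <= norm ((norm (f x))^2 + (norm (g x))^2)" by (simp add: abs_mult)
 qed
qed

lemma L2_add:
 fixes f g :: "'a => 'b::euclidean_space"
 assumes f: "f : L2 M" and g: "g : L2 M"
 shows "(%x. f x + g x) : L2 M"
  and "(L2_norm M (%x. f x + g x))^2 <= 2 * (L2_norm M f)^2 + 2 * (L2_norm M g)^2"
proof -
 have le: "(norm (f x + g x))^2 <= 2 * (norm (f x))^2 + 2 * (norm (g x))^2" for x
 proof -
  have "(norm (f x + g x))^2 <= (norm (f x) + norm (g x))^2" by (intro power_mono norm_triangle_ineq) simp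
  also have "... <= 2 * (norm (f x))^2 + 2 * (norm (g x))^2" by (rule sum2_square_le)
  finally show ?thesis .
 qed
 have i: "integrable M (%x. 2 * (norm (f x))^2 + 2 * (norm (g x))^2)"
  using L2_D[OF f] L2_D[OF g] by simp
 have m: "(%x. f x + g x) : borel_measurable M" using L2_D[OF f] L2_D[OF g] by simp
 have i2: "integrable M (%x. (norm (f x + g x))^2)"
  by (rule Bochner_Integration.integrable_bound[OF i]) (use m le in auto)
 show "(%x. f x + g x) : L2 M" by (rule L2_I[OF m i2])
 have "(\<integral>x. (norm (f x + g x))^2 \<partial>M) <= (\<integral>x. 2 * (norm (f x))^2 + 2 * (norm (g x))^2 \<partial>M)"
  by (rule integral_mono[OF i2 i le])
 also have "... = 2 * (\<integral>x. (norm (f x))^2 \<partial>M) + 2 * (\<integral>x. (norm (g x))^2 \<partial>M)"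
  using L2_D[OF f] L2_D[OF g] by simp
 finally show "(L2_norm M (%x. f x + g x))^2 <= 2 * (L2_norm M f)^2 + 2 * (L2_norm M g)^2"
  by (simp add: L2_norm_square)
qed

lemma L2_minus:
 assumes "f : L2 M" shows "(%x. - f x) : L2 M" "L2_norm M (%x. - f x) = L2_norm M f"
 using assms by (auto simp: L2_def L2_norm_def)

lemma L2_diff:
 fixes f g :: "'a => 'b::euclidean_space"
 assumes f: "f : L2 M" and g: "g : L2 M"
 shows "(%x. f x - g x) : L2 M"
  and "(L2_norm M (%x. f x - g x))^2 <= 2 * (L2_norm M f)^2 + 2 * (L2_norm M g)^2"
 using L2_add[OF f L2_minus(1)[OF g]] L2_minus(2)[OF g] by simp_all

lemma L2_norm_diff_commute: "L2_norm M (%x. f x - g x) = L2_norm M (%x. g x - f x)"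
 by (simp add: L2_norm_def norm_minus_commute)

lemma L2_vec:
 fixes G :: "'a => real^'n"
 shows "G : L2 M \<longleftrightarrow> (\<forall>i. (%x. G x $ i) : L2 M)" (is "?l \<longleftrightarrow> ?r")
  and "G : L2 M ==> (L2_norm M G)^2 = (\<Sum>i\<in>UNIV. (L2_norm M (%x. G x $ i))^2)"
proof -
 have nsq: "(norm (G x))^2 = (\<Sum>i\<in>UNIV. (norm (G x $ i))^2)" for x
  by (simp add: norm_vec_def L2_set_def sum_nonneg)
 have 1: "(%x. G x $ i) : L2 M" if G: "G : L2 M" for i
 proof (rule L2_I)
  show m: "(%x. G x $ i) : borel_measurable M"
   using measurable_compose[OF L2_D(1)[OF G] borel_measurable_continuous_onI, of "%v. v $ i"]
   by (simp add: continuous_on_component)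
  show "integrable M (%x. (norm (G x $ i))^2)"
  proof (rule Bochner_Integration.integrable_bound[OF L2_D(2)[OF G]])
   show "(%x. (norm (G x $ i))^2) : borel_measurable M" using m by simp
   have "norm ((norm (G x $ i))^2) <= norm ((norm (G x))^2)" for x
    using power_mono[OF component_le_norm_cart[of "G x" i], of 2] by simp
   then show "AE x in M. norm ((norm (G x $ i))^2) <= norm ((norm (G x))^2)" by simp
  qed
 qed
 show "?l \<longleftrightarrow> ?r"
 proof
  assume r: ?r
  have "(%x. \<chi> i. G x $ i) : borel_measurable M"
  proof (rule borel_measurable_euclidean_space[THEN iffD2], rule ballI)
   fix b :: "real^'n" assume "b : Basis"
   then obtain i where "b = axis i 1" by (auto simp: Basis_vec_def)
   then show "(%x. (\<chi> i. G x $ i) \<bullet> b) : borel_measurable M"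
    using L2_D(1)[OF r[rule_format, of i]] by (simp add: inner_axis)
  qed
  then have m: "G : borel_measurable M" by simp
  have "integrable M (%x. \<Sum>i\<in>UNIV. (norm (G x $ i))^2)"
   by (intro Bochner_Integration.integrable_sum L2_D(2)) (use r in blast)
  then show ?l by (intro L2_I[OF m]) (simp only: nsq)
 qed (use 1 in blast)
 assume G: "G : L2 M"
 show "(L2_norm M G)^2 = (\<Sum>i\<in>UNIV. (L2_norm M (%x. G x $ i))^2)"
  unfolding L2_norm_square nsq
  by (rule Bochner_Integration.integral_sum) (use L2_D(2)[OF 1[OF G]] in auto)
qed

subsection \<open>Borel representatives\<close>

lemma open_lebesgue [simp]: "open Om ==> Om : sets lebesgue"
 using borel_open[of Om] by (simp add: sets_completionI_sets)

lemma lebesgue_on_integral_rep: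
 fixes f h :: "real^'n => real"
 assumes Om: "open Om" and h: "h : borel_measurable borel" and f: "f : borel_measurable (lebesgue_on Om)"
  and ae: "AE x in lebesgue_on Om. f x = h x"
 shows "(\<integral>x. f x \<partial>lebesgue_on Om) = (\<integral>x. h x * indicator Om x \<partial>lborel)"
proof -
 have [measurable]: "Om : sets borel" using Om by simp
 have hl: "h : borel_measurable lebesgue" using h by (simp add: measurable_completion)
 have "(\<integral>x. f x \<partial>lebesgue_on Om) = (\<integral>x. h x \<partial>lebesgue_on Om)"
  by (rule integral_cong_AE[OF f measurable_restrict_space1[OF hl] ae])
 also have "... = (\<integral>x. indicator Om x *\<^sub>R h x \<partial>lebesgue)"
  using Om by (subst integral_restrict_space) auto
 also have "... = (\<integral>x. indicator Om x *\<^sub>R h x \<partial>lborel)"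
  by (rule integral_completion) (use h in measurable)
 finally show ?thesis by (simp add: mult.commute)
qed

lemma L2_rep:
 fixes f :: "real^'n => real"
 assumes Om: "open Om" and f: "f : L2 (lebesgue_on Om)"
 shows "\<exists>w. w : borel_measurable borel & (\<forall>x. x \<notin> Om --> w x = 0) & (AE x in lebesgue_on Om. f x = w x)
  & sq_int Om w = ennreal ((L2_norm (lebesgue_on Om) f)^2)"
proof -
 have [measurable]: "Om : sets borel" using Om by simp
 have "(%x. if x : Om then f x else 0) : borel_measurable lebesgue"
  using L2_D(1)[OF f] Om by (intro borel_measurable_if_I) auto
 then obtain g where g: "g : borel_measurable lborel" and ae: "AE x in lborel. (if x : Om then f x else 0) = g x"
  using completion_ex_borel_measurable_real by blast
 have [measurable]: "g : borel_measurable borel" using g by simp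
 define w where "w x = g x * indicator Om x" for x
 have [measurable]: "w : borel_measurable borel" unfolding w_def by measurable
 have ae': "AE x in lebesgue_on Om. f x = w x"
 proof (subst AE_restrict_space_iff)
  show "Om \<inter> space lebesgue : sets lebesgue" using Om by simp
  have "AE x in lborel. x : Om --> f x = w x" using ae
   by eventually_elim (auto simp: w_def)
  then show "AE x in lebesgue. x : Om --> f x = w x" by (rule AE_completion)
 qed
 have int: "integrable (lebesgue_on Om) (%x. (w x)^2)"
 proof (rule integrable_cong_AE_imp[OF L2_D(2)[OF f]])
  show "(%x. (w x)^2) : borel_measurable (lebesgue_on Om)"
   by (intro measurable_restrict_space1 measurable_completion) measurable
  show "AE x in lebesgue_on Om. (norm (f x))^2 = (w x)^2" using ae' by eventually_elim simp
 qed
 then have "integrable lebesgue (%x. indicator Om x *\<^sub>R (w x)\<^sup>2)"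
  using Om by (subst (asm) integrable_restrict_space) auto
 then have "integrable lborel (%x. indicator Om x *\<^sub>R (w x)\<^sup>2)"
  by (subst (asm) integrable_completion) measurable
 then have int': "integrable lborel (%x. (w x)^2 * indicator Om x)" by (simp add: mult.commute)
 have "(L2_norm (lebesgue_on Om) f)^2 = (\<integral>x. (w x)^2 * indicator Om x \<partial>lborel)"
  unfolding L2_norm_square
 proof (rule lebesgue_on_integral_rep[OF Om])
  show "AE x in lebesgue_on Om. (norm (f x))^2 = (w x)^2" using ae' by eventually_elim simp
 qed (use L2_D(1)[OF f] in measurable)
 then have "sq_int Om w = ennreal ((L2_norm (lebesgue_on Om) f)^2)"
  using sq_int_eq_integral[OF int'] by simp
 then show ?thesis using ae' by (intro exI[of _ w]) (auto simp: w_def)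
qed

lemma L2_norm_rep:
 fixes f :: "real^'n => real"
 assumes Om: "open Om" and w [measurable]: "w : borel_measurable borel" and f: "f : borel_measurable (lebesgue_on Om)"
  and ae: "AE x in lebesgue_on Om. f x = w x" and fin: "sq_int Om w <= ennreal e" and e: "0 <= e"
 shows "f : L2 (lebesgue_on Om)" "(L2_norm (lebesgue_on Om) f)^2 <= e"
proof -
 have [measurable]: "Om : sets borel" using Om by simp
 have "sq_int Om w < \<infinity>" using fin by (simp add: le_less_trans)
 then have int: "integrable lborel (%x. (w x)^2 * indicator Om x)"
  by (intro sq_int_finite_integrable) auto
 then have "integrable lborel (%x. indicator Om x *\<^sub>R (w x)\<^sup>2)" by (simp add: mult.commute)
 then have "integrable lebesgue (%x. indicator Om x *\<^sub>R (w x)\<^sup>2)"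
  by (subst integrable_completion) measurable
 then have "integrable (lebesgue_on Om) (%x. (w x)^2)"
  using Om by (subst integrable_restrict_space) auto
 then have "integrable (lebesgue_on Om) (%x. (norm (f x))^2)"
 proof (rule integrable_cong_AE_imp)
  show "AE x in lebesgue_on Om. (w x)^2 = (norm (f x))^2" using ae by eventually_elim simp
 qed (use f in measurable)
 then show "f : L2 (lebesgue_on Om)" by (rule L2_I[OF f])
 have "(L2_norm (lebesgue_on Om) f)^2 = (\<integral>x. (w x)^2 * indicator Om x \<partial>lborel)"
  unfolding L2_norm_square
 proof (rule lebesgue_on_integral_rep[OF Om])
  show "AE x in lebesgue_on Om. (norm (f x))^2 = (w x)^2" using ae by eventually_elim simp
 qed (use f in measurable)
 then show "(L2_norm (lebesgue_on Om) f)^2 <= e"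
  using fin e unfolding sq_int_eq_integral[OF int] by (simp add: ennreal_le_iff)
qed

lemma sq_int_integrable:
 fixes w :: "real^'n => real"
 assumes w [measurable]: "w : borel_measurable borel" and A [measurable]: "A : sets borel" and bA: "bounded A"
  and z: "!!x. x \<notin> A ==> w x = 0" and fin: "sq_int A w < \<infinity>"
 shows "integrable lborel w"
proof (rule Bochner_Integration.integrable_bound)
 have "integrable lborel (indicator A :: real^'n => real)"
  using emeasure_bounded_finite[OF bA] by (intro integrable_real_indicator) auto
 then show "integrable lborel (%x. (w x)^2 * indicator A x + indicator A x)"
  by (intro Bochner_Integration.integrable_add sq_int_finite_integrable fin) auto
 show "AE x in lborel. norm (w x) <= norm ((w x)^2 * indicator A x + indicator A x)"
 proof (rule AE_I2)
  fix x
  have "0 <= (\<bar>w x\<bar> - 1)^2" by simp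
  then have "2 * \<bar>w x\<bar> <= (w x)^2 + 1" by (simp add: power2_diff)
  then have "\<bar>w x\<bar> <= (w x)^2 + 1" by linarith
  then show "norm (w x) <= norm ((w x)^2 * indicator A x + indicator A x)"
   using z[of x] by (cases "x : A") auto
 qed
qed simp

subsection \<open>Uniqueness of weak gradients and density of smooth functions\<close>

lemma kernel_test_function:
 fixes k :: "real^'n => real"
 assumes st: "star_ball A x0 r" and x: "x : interior A" and t: "0 < t" "t <= 1/2"
  and k: "smooth k" "!!x. t * r <= norm x ==> k x = 0"
 shows "(%y. k ((1 - t) *\<^sub>R x + t *\<^sub>R x0 - y)) : test_functions (interior A)"
proof -
 define s where "s = (1 - t) *\<^sub>R x + t *\<^sub>R x0"
 have r: "0 < r" using st by (simp add: star_ball_def)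
 have sm: "smooth (%y. k (s - y))"
  using smooth_affine(1)[OF k(1), of "-1" s] by (simp add: add.commute)
 have "{y. k (s - y) ~= 0} \<subseteq> cball s (t * r)"
  using k(2) by (force simp: dist_norm not_le)
 then have cl: "closure {y. k (s - y) ~= 0} \<subseteq> cball s (t * r)" by (rule closure_minimal) simp
 have "cball s (t * r) \<subseteq> interior A"
 proof
  fix y assume y: "y : cball s (t * r)"
  define b where "b = x0 + (1 / t) *\<^sub>R (y - s)"
  have "norm (y - s) / t <= r" using y t by (simp add: dist_norm norm_minus_commute pos_divide_le_eq mult.commute)
  moreover have "norm ((1 / t) *\<^sub>R (y - s)) = norm (y - s) / t" using t unfolding norm_scaleR by simp
  ultimately have "norm ((1 / t) *\<^sub>R (y - s)) <= r" by (simp only:)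
  then have "b : cball x0 r" by (simp add: b_def dist_norm)
  from interior_star[OF st x this, of t] have "(1 - t) *\<^sub>R x + t *\<^sub>R b : interior A" using t by simp
  moreover have "(1 - t) *\<^sub>R x + t *\<^sub>R b = y" using t by (simp add: b_def s_def algebra_simps)
  ultimately show "y : interior A" by simp
 qed
 with cl have "closure {y. k (s - y) ~= 0} \<subseteq> interior A" by blast
 moreover have "compact (closure {y. k (s - y) ~= 0})"
  using cl bounded_subset[OF bounded_cball] by (simp add: compact_eq_bounded_closed) blast
 ultimately show ?thesis using sm by (simp add: test_functions_def s_def)
qed

text \<open>Dilation by \<open>1 - t\<close> towards \<open>x0\<close> leaves room for a kernel of radius \<open>t * r\<close> inside the domain.\<close>

lemma mollify_L2:
 fixes w :: "real^'n => real"
 assumes st: "star_ball A x0 r" and bA: "bounded A"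
  and w [measurable]: "w : borel_measurable borel" and z: "!!x. x \<notin> interior A ==> w x = 0"
  and fin: "sq_int (interior A) w < \<infinity>" and e: "0 < e"
 shows "\<exists>t0>0. t0 <= 1/2 & (\<forall>t (k :: real^'n => real). 0 < t --> t <= t0 --> smooth k --> (\<forall>x. 0 <= k x) --> (\<forall>x. t * r <= norm x --> k x = 0)
  --> integrable lborel k --> (\<integral>x. k x \<partial>lborel) = 1 -->
  sq_int (interior A) (%x. (\<integral>y. w y * k ((1 - t) *\<^sub>R x + t *\<^sub>R x0 - y) \<partial>lborel) - w x) <= ennreal e)"
proof -
 have r: "0 < r" using st by (simp add: star_ball_def)
 have bi: "bounded (interior A)" using bA interior_subset by (rule bounded_subset)
 have [measurable]: "interior A : sets borel" by simp
 obtain t0 where t0: "0 < t0" "t0 <= 1/2" and dil: "!!t b. 0 <= t ==> t <= t0 ==> norm b <= norm x0 + r ==>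
  (\<forall>x\<in>interior A. (1 - t) *\<^sub>R x + t *\<^sub>R b : interior A) ==>
  sq_int (interior A) (%x. w ((1 - t) *\<^sub>R x + t *\<^sub>R b) - w x) <= ennreal e"
  using dilation_sq_int_tendsto[OF w _ bi fin e, of "norm x0 + r"] by auto
 show ?thesis
 proof (intro exI[of _ t0] conjI allI impI t0)
  fix t and k :: "real^'n => real" assume t: "0 < t" "t <= t0" and k: "smooth k" "\<forall>x. 0 <= k x" "\<forall>x. t * r <= norm x --> k x = 0"
   "integrable lborel k" "(\<integral>x. k x \<partial>lborel) = 1"
  have wi: "integrable lborel w" by (rule sq_int_integrable[OF w _ bi z fin]) simp
  show "sq_int (interior A) (%x. (\<integral>y. w y * k ((1 - t) *\<^sub>R x + t *\<^sub>R x0 - y) \<partial>lborel) - w x) <= ennreal e"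
  proof (rule mollified_dilation_bound[OF w wi _ t(1) r])
   fix b assume b: "b : cball x0 r"
   have "norm b <= norm x0 + r"
    using b norm_triangle_ineq2[of b x0] by (simp add: dist_norm norm_minus_commute)
   then show "sq_int (interior A) (%x. w ((1 - t) *\<^sub>R x + t *\<^sub>R b) - w x) <= ennreal e"
    using interior_star[OF st _ b] t t0 by (intro dil) auto
  qed (use k in auto)
 qed
qed

lemma test_function_L2:
 assumes "ph : test_functions Om" and Om': "open Om'"
 shows "ph : L2 (lebesgue_on Om')"
proof -
 have sm: "smooth ph" and cs: "compact (closure {x. ph x ~= 0})" using assms by (auto simp: test_functions_def)
 have [measurable]: "ph : borel_measurable borel" using sm by (rule smooth_borel)
 have "integrable lborel (%x. indicator (closure {x. ph x ~= 0}) x *\<^sub>R (norm (ph x))\<^sup>2)"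
  by (intro borel_integrable_compact cs continuous_intros smooth_continuous sm)
 moreover have "(%x. indicator (closure {x. ph x ~= 0}) x *\<^sub>R (norm (ph x))\<^sup>2) = (%x. (norm (ph x))^2)"
  using closure_subset[of "{x. ph x ~= 0}"] by (auto simp: indicator_def fun_eq_iff)
 ultimately have "integrable lborel (%x. (norm (ph x))^2)" by simp
 then have "integrable lebesgue (%x. (norm (ph x))^2)"
  by (subst integrable_completion) measurable
 then have "integrable lebesgue (%x. indicator Om' x *\<^sub>R (norm (ph x))\<^sup>2)"
  using Om' by (intro integrable_mult_indicator) auto
 then have "integrable (lebesgue_on Om') (%x. (norm (ph x))^2)"
  using Om' by (subst integrable_restrict_space) auto
 moreover have "ph : borel_measurable (lebesgue_on Om')"
  by (intro measurable_restrict_space1 measurable_completion) simp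
 ultimately show ?thesis by (intro L2_I)
qed

text \<open>As a function of the integration variable, the kernel of a dilated mollification is a test function. So all
mollifications vanish.\<close>

lemma fundamental_lemma:
 fixes v :: "real^'n => real"
 assumes st: "star_ball A x0 r" and bA: "bounded A" and v: "v : L2 (lebesgue_on (interior A))"
  and test: "!!ph. ph : test_functions (interior A) ==> (\<integral>x. v x * ph x \<partial>lebesgue_on (interior A)) = 0"
 shows "AE x in lebesgue_on (interior A). v x = 0"
proof -
 let ?Om = "interior A"
 have r: "0 < r" using st by (simp add: star_ball_def)
 have [measurable]: "?Om : sets borel" by simp
 obtain w where w [measurable]: "w : borel_measurable borel" and z: "!!x. x \<notin> ?Om ==> w x = 0"
  and ae: "AE x in lebesgue_on ?Om. v x = w x" and sq: "sq_int ?Om w = ennreal ((L2_norm (lebesgue_on ?Om) v)^2)"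
  using L2_rep[OF open_interior v] by auto
 have fin: "sq_int ?Om w < \<infinity>" by (simp add: sq)
 have le: "sq_int ?Om w <= 0 + ennreal e" if e: "0 < e" for e
 proof -
  obtain t0 where t0: "0 < t0" "t0 <= 1/2" and mol: "!!t k. 0 < t ==> t <= t0 ==> smooth k ==> (\<forall>x. 0 <= k x) ==> (\<forall>x. t * r <= norm x --> k x = 0)
   ==> integrable lborel k ==> (\<integral>x. k x \<partial>lborel) = 1 ==>
   sq_int ?Om (%x. (\<integral>y. w y * k ((1 - t) *\<^sub>R x + t *\<^sub>R x0 - y) \<partial>lborel) - w x) <= ennreal e"
   using mollify_L2[OF st bA w z fin e] by blast
  obtain k :: "real^'n => real" where k: "smooth k" "\<forall>x. 0 <= k x" "\<forall>x. t0 * r <= norm x --> k x = 0"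
   "integrable lborel k" "(\<integral>x. k x \<partial>lborel) = 1"
   using mollifier_exists[of "t0 * r"] t0 r by auto
  have zero: "(\<integral>y. w y * k ((1 - t0) *\<^sub>R x + t0 *\<^sub>R x0 - y) \<partial>lborel) = 0" if x: "x : ?Om" for x
  proof -
   let ?ph = "%y. k ((1 - t0) *\<^sub>R x + t0 *\<^sub>R x0 - y)"
   have tf: "?ph : test_functions ?Om" by (rule kernel_test_function[OF st x t0(1,2) k(1)]) (use k in auto)
   have [measurable]: "?ph : borel_measurable borel"
    using tf by (intro smooth_borel) (simp add: test_functions_def)
   have "0 = (\<integral>y. v y * ?ph y \<partial>lebesgue_on ?Om)" using test[OF tf] by simp
   also have "... = (\<integral>y. (w y * ?ph y) * indicator ?Om y \<partial>lborel)"
   proof (rule lebesgue_on_integral_rep[OF open_interior])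
    show "AE y in lebesgue_on ?Om. v y * ?ph y = w y * ?ph y" using ae by eventually_elim simp
    show "(%y. v y * ?ph y) : borel_measurable (lebesgue_on ?Om)"
     by (intro borel_measurable_times L2_D(1)[OF v] L2_D(1)[OF test_function_L2[OF tf open_interior]])
   qed measurable
   also have "... = (\<integral>y. w y * ?ph y \<partial>lborel)"
    by (rule Bochner_Integration.integral_cong[OF refl]) (auto simp: indicator_def z)
   finally show ?thesis by simp
  qed
  have "sq_int ?Om w <= sq_int ?Om (%x. (\<integral>y. w y * k ((1 - t0) *\<^sub>R x + t0 *\<^sub>R x0 - y) \<partial>lborel) - w x)"
   by (rule sq_int_mono) (simp add: zero)
  also have "... <= ennreal e" by (rule mol[OF t0(1) order_refl k])
  finally show ?thesis by simp
 qed
 have "sq_int ?Om w <= 0" by (rule ennreal_le_epsilon) (use le in auto)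
 then have "AE x in lborel. ennreal ((w x)^2) * indicator ?Om x = 0"
  unfolding sq_int_def by (subst (asm) le_zero_eq, subst (asm) nn_integral_0_iff_AE) auto
 then have "AE x in lborel. x : ?Om --> w x = 0" by eventually_elim (auto simp: ennreal_eq_0_iff)
 then have "AE x in lebesgue. x : ?Om --> w x = 0" by (rule AE_completion)
 then have "AE x in lebesgue_on ?Om. w x = 0" by (subst AE_restrict_space_iff) auto
 with ae show ?thesis by eventually_elim simp
qed

text \<open>The gradient chosen in the definition of the norm agrees with the given one up to a null set.\<close>

theorem energy_norm_eq:
 fixes v :: "real^'n => real"
 assumes st: "star_ball A x0 r" and bA: "bounded A" and G: "G : L2 (lebesgue_on (interior A))"
  and wg: "is_weak_grad (interior A) v G" and \<epsilon>: "0 <= \<epsilon>"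
 shows "(energy_norm \<epsilon> A v)^2 = (L2_norm (lebesgue_on (interior A)) v)^2 + \<epsilon> * (L2_norm (lebesgue_on (interior A)) G)^2"
proof -
 let ?M = "lebesgue_on (interior A)"
 define G' where "G' = weak_grad A v"
 have "G' : L2 ?M & is_weak_grad (interior A) v G'"
  unfolding G'_def weak_grad_def using G wg by (intro someI[of "%G. G : L2 ?M & is_weak_grad (interior A) v G" G]) simp
 then have G': "G' : L2 ?M" and wg': "is_weak_grad (interior A) v G'" by auto
 have Gi: "(%x. G x $ i) : L2 ?M" and Gi': "(%x. G' x $ i) : L2 ?M" for i
  using G G' by (auto simp: L2_vec(1)[of G] L2_vec(1)[of G'])
 have "AE x in ?M. G x $ i - G' x $ i = 0" for i
 proof (rule fundamental_lemma[OF st bA])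
  show "(%x. G x $ i - G' x $ i) : L2 ?M" by (rule L2_diff(1)[OF Gi Gi'])
  fix ph assume ph: "ph : test_functions (interior A)"
  have "(\<integral>x. (G x $ i - G' x $ i) * ph x \<partial>?M) = (\<integral>x. G x $ i * ph x - G' x $ i * ph x \<partial>?M)"
   by (simp add: left_diff_distrib)
  also have "... = (\<integral>x. G x $ i * ph x \<partial>?M) - (\<integral>x. G' x $ i * ph x \<partial>?M)"
   by (rule Bochner_Integration.integral_diff) (intro L2_mult_integrable Gi Gi' test_function_L2[OF ph open_interior])+
  also have "... = 0"
  proof -
   have "(\<integral>x. v x * partial_deriv i ph x \<partial>?M) = - (\<integral>x. G x $ i * ph x \<partial>?M)"
    using wg ph unfolding is_weak_grad_def by blast
   moreover have "(\<integral>x. v x * partial_deriv i ph x \<partial>?M) = - (\<integral>x. G' x $ i * ph x \<partial>?M)"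
    using wg' ph unfolding is_weak_grad_def by blast
   ultimately show ?thesis by linarith
  qed
  finally show "(\<integral>x. (G x $ i - G' x $ i) * ph x \<partial>?M) = 0" .
 qed
 then have "AE x in ?M. \<forall>i. G x $ i - G' x $ i = 0" by (simp add: AE_all_countable)
 then have "AE x in ?M. (norm (G x))^2 = (norm (G' x))^2"
  by eventually_elim (metis eq_iff_diff_eq_0 vec_eq_iff)
 then have "(L2_norm ?M G')^2 = (L2_norm ?M G)^2"
  unfolding L2_norm_square by (intro integral_cong_AE) (use L2_D(1)[OF G] L2_D(1)[OF G'] in auto)
 moreover have "(energy_norm \<epsilon> A v)^2 = (L2_norm ?M v)^2 + \<epsilon> * (L2_norm ?M G')^2"
  unfolding energy_norm_def G'_def[symmetric] by (rule real_sqrt_pow2) (simp add: \<epsilon>)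
 ultimately show ?thesis by simp
qed

text \<open>The derivative of the mollified dilation is, up to the factor \<open>1 - t\<close>, the mollified dilation of the weak gradient,
because the kernel is a test function.\<close>

theorem smooth_dense_H1:
 fixes u :: "real^'n => real"
 assumes st: "star_ball A x0 r" and bA: "bounded A" and u: "u : L2 (lebesgue_on (interior A))"
  and G: "G : L2 (lebesgue_on (interior A))" and wg: "is_weak_grad (interior A) u G" and e: "0 < e"
 shows "\<exists>ph. smooth ph & (%x. ph x - u x) : L2 (lebesgue_on (interior A)) \<and>
  (%x. grad ph x - G x) : L2 (lebesgue_on (interior A)) \<and>
  (L2_norm (lebesgue_on (interior A)) (%x. ph x - u x))^2 <= e \<and>
  (L2_norm (lebesgue_on (interior A)) (%x. grad ph x - G x))^2 <= e"
proof -
 let ?Om = "interior A" let ?M = "lebesgue_on ?Om"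
 define n where "n = real CARD('n)"
 have n: "0 < n" by (simp add: n_def)
 have r: "0 < r" using st by (simp add: star_ball_def)
 have [measurable]: "?Om : sets borel" by simp
 have bi: "bounded ?Om" using bA interior_subset by (rule bounded_subset)
 have Gi: "(%x. G x $ i) : L2 ?M" for i using G by (simp add: L2_vec(1)[of G])
 obtain w where w [measurable]: "w : borel_measurable borel" and wz: "!!x. x \<notin> ?Om ==> w x = 0"
  and wae: "AE x in ?M. u x = w x" and wsq: "sq_int ?Om w = ennreal ((L2_norm ?M u)^2)"
  using L2_rep[OF open_interior u] by auto
 have "\<forall>i. \<exists>g. g : borel_measurable borel & (\<forall>x. x \<notin> ?Om --> g x = 0) & (AE x in ?M. G x $ i = g x)
  & sq_int ?Om g = ennreal ((L2_norm ?M (%x. G x $ i))^2)"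
  by (intro allI L2_rep[OF open_interior Gi])
 from choice[OF this] obtain g where g': "\<forall>i. g i : borel_measurable borel & (\<forall>x. x \<notin> ?Om --> g i x = 0) & (AE x in ?M. G x $ i = g i x)
  & sq_int ?Om (g i) = ennreal ((L2_norm ?M (%x. G x $ i))^2)" ..
 then have g [measurable]: "!!i. g i : borel_measurable borel" and gz: "!!i x. x \<notin> ?Om ==> g i x = 0"
  and gae: "!!i. AE x in ?M. G x $ i = g i x" and gsq: "!!i. sq_int ?Om (g i) = ennreal ((L2_norm ?M (%x. G x $ i))^2)"
  by auto
 have wfin: "sq_int ?Om w < \<infinity>" by (simp add: wsq)
 have gfin: "sq_int ?Om (g i) < \<infinity>" for i by (simp add: gsq)
 have wi: "integrable lborel w" by (rule sq_int_integrable[OF w _ bi wz wfin]) simp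
 define P where "P t f e \<longleftrightarrow> (\<forall>k. smooth k --> (\<forall>x. 0 <= k x) --> (\<forall>x. t * r <= norm x --> k x = 0)
   --> integrable lborel k --> (\<integral>x. k x \<partial>lborel) = 1 -->
   sq_int ?Om (%x. (\<integral>y. f y * k ((1 - t) *\<^sub>R x + t *\<^sub>R x0 - y) \<partial>lborel) - f x) <= ennreal e)" for t and f :: "real^'n => real" and e
 define e1 where "e1 = e / (4 * n)"
 have e1: "0 < e1" using e n by (simp add: e1_def)
 obtain t1 where t1: "0 < t1" "t1 <= 1/2" and mw: "!!t. 0 < t ==> t <= t1 ==> P t w e"
  using mollify_L2[OF st bA w wz wfin e] unfolding P_def by blast
 have "\<forall>i. \<exists>T>0. \<forall>t. 0 < t --> t <= T --> P t (g i) e1"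
 proof
  fix i show "\<exists>T>0. \<forall>t. 0 < t --> t <= T --> P t (g i) e1"
   using mollify_L2[OF st bA g[of i] gz gfin e1] unfolding P_def by blast
 qed
 from choice[OF this] obtain T where T': "\<forall>i. 0 < T i & (\<forall>t. 0 < t --> t <= T i --> P t (g i) e1)" ..
 then have T: "!!i. 0 < T i" and mg: "!!i t. 0 < t ==> t <= T i ==> P t (g i) e1" by auto
 define B where "B = 1 + (\<Sum>i\<in>UNIV. (L2_norm ?M (%x. G x $ i))^2)"
 have B: "1 <= B" by (simp add: B_def sum_nonneg)
 define t where "t = Min (insert t1 (insert (sqrt (e1 / B)) (range T)))"
 have "0 < t" unfolding t_def using t1 T e1 B by (subst Min_gr_iff) auto
 moreover have tle: "t <= t1" "t <= sqrt (e1 / B)" "t <= T i" for i unfolding t_def by ((rule Min_le; simp))+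
 ultimately have t: "0 < t" "t <= 1/2" using t1 by auto
 have tB: "t^2 * B <= e1"
 proof -
  have "t^2 <= (sqrt (e1 / B))^2" using t tle by (intro power_mono) auto
  then show ?thesis using e1 B by (simp add: field_simps)
 qed
 obtain k :: "real^'n => real" where k: "smooth k" "\<forall>x. 0 <= k x" "\<forall>x. t * r <= norm x --> k x = 0"
  "integrable lborel k" "(\<integral>x. k x \<partial>lborel) = 1"
  using mollifier_exists[of "t * r"] t r by auto
 have tr: "0 < t * r" using t r by simp
 define ph where "ph x = (\<integral>y. w y * k ((1 - t) *\<^sub>R x + t *\<^sub>R x0 - y) \<partial>lborel)" for x
 have sm: "smooth ph" unfolding ph_def by (rule convolution_smooth(1)[OF wi k(1) _ tr]) (use k in auto)
 have [measurable]: "ph : borel_measurable borel" using sm by (rule smooth_borel)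
 have 1: "sq_int ?Om (%x. ph x - w x) <= ennreal e"
  using mw[OF t(1) tle(1)] k unfolding P_def ph_def by blast
 have pd: "partial_deriv i ph x = (1 - t) * (\<integral>y. g i y * k ((1 - t) *\<^sub>R x + t *\<^sub>R x0 - y) \<partial>lborel)" if x: "x : ?Om" for i x
 proof -
  let ?s = "(1 - t) *\<^sub>R x + t *\<^sub>R x0"
  let ?\<psi> = "%y. k (?s - y)"
  have tf: "?\<psi> : test_functions ?Om" by (rule kernel_test_function[OF st x t k(1)]) (use k in auto)
  then have sm\<psi>: "smooth ?\<psi>" by (simp add: test_functions_def)
  have d\<psi>: "partial_deriv i ?\<psi> y = - partial_deriv i k (?s - y)" for y
   using smooth_affine(2)[OF k(1), of i "-1" ?s y] by (simp add: add.commute)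
  have [measurable]: "?\<psi> : borel_measurable borel" "partial_deriv i ?\<psi> : borel_measurable borel"
   using sm\<psi> by (auto intro: smooth_borel smooth_partial_deriv)
  have res: "h : borel_measurable (lebesgue_on ?Om)" if "h : borel_measurable borel" for h :: "real^'n => real"
   using that by (intro measurable_restrict_space1 measurable_completion) simp
  have "(\<integral>y. w y * partial_deriv i k (?s - y) \<partial>lborel) = - (\<integral>y. (w y * partial_deriv i ?\<psi> y) * indicator ?Om y \<partial>lborel)"
   unfolding d\<psi> by (subst Bochner_Integration.integral_minus[symmetric], rule Bochner_Integration.integral_cong[OF refl])
    (auto simp: indicator_def wz)
  also have "(\<integral>y. (w y * partial_deriv i ?\<psi> y) * indicator ?Om y \<partial>lborel) = (\<integral>y. u y * partial_deriv i ?\<psi> y \<partial>?M)"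
  proof (rule lebesgue_on_integral_rep[symmetric, OF open_interior])
   show "AE y in ?M. u y * partial_deriv i ?\<psi> y = w y * partial_deriv i ?\<psi> y" using wae by eventually_elim simp
   show "(%y. u y * partial_deriv i ?\<psi> y) : borel_measurable ?M"
    by (intro borel_measurable_times L2_D(1)[OF u] res) measurable
  qed measurable
  also have "... = - (\<integral>y. G y $ i * ?\<psi> y \<partial>?M)" using wg tf unfolding is_weak_grad_def by blast
  also have "(\<integral>y. G y $ i * ?\<psi> y \<partial>?M) = (\<integral>y. (g i y * ?\<psi> y) * indicator ?Om y \<partial>lborel)"
  proof (rule lebesgue_on_integral_rep[OF open_interior])
   show "AE y in ?M. G y $ i * ?\<psi> y = g i y * ?\<psi> y" using gae[of i] by eventually_elim simp
   show "(%y. G y $ i * ?\<psi> y) : borel_measurable ?M"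
    by (intro borel_measurable_times L2_D(1)[OF Gi] res) measurable
  qed measurable
  also have "... = (\<integral>y. g i y * ?\<psi> y \<partial>lborel)"
   by (rule Bochner_Integration.integral_cong[OF refl]) (auto simp: indicator_def gz)
  finally have "(\<integral>y. w y * partial_deriv i k (?s - y) \<partial>lborel) = (\<integral>y. g i y * ?\<psi> y \<partial>lborel)" by simp
  moreover have "partial_deriv i ph x = (1 - t) * (\<integral>y. w y * partial_deriv i k (?s - y) \<partial>lborel)"
   unfolding ph_def by (rule convolution_smooth(2)[OF wi k(1) _ tr]) (use k in auto)
  ultimately show ?thesis by simp
 qed
 have [measurable]: "partial_deriv i ph : borel_measurable borel" for i
  by (intro smooth_borel smooth_partial_deriv sm)
 have 2: "sq_int ?Om (%x. partial_deriv i ph x - g i x) <= ennreal (e / n)" for i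
 proof -
  define h where "h x = (\<integral>y. g i y * k ((1 - t) *\<^sub>R x + t *\<^sub>R x0 - y) \<partial>lborel)" for x
  have gi: "integrable lborel (g i)" by (rule sq_int_integrable[OF g _ bi gz gfin]) simp
  have "smooth h" unfolding h_def by (rule convolution_smooth(1)[OF gi k(1) _ tr]) (use k in auto)
  then have [measurable]: "h : borel_measurable borel" by (rule smooth_borel)
  have h: "sq_int ?Om (%x. h x - g i x) <= ennreal e1"
   using mg[OF t(1) tle(3), of i] k unfolding P_def h_def by blast
  have "sq_int ?Om (%x. partial_deriv i ph x - g i x) <= sq_int ?Om (%x. (1 - t) * (h x - g i x) + (- t) * g i x)"
  proof (rule sq_int_mono)
   fix x assume "x : ?Om"
   then have "partial_deriv i ph x = (1 - t) * h x" unfolding h_def by (rule pd)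
   then have "partial_deriv i ph x - g i x = (1 - t) * (h x - g i x) + (- t) * g i x"
    by (simp add: algebra_simps)
   then show "(partial_deriv i ph x - g i x)^2 <= ((1 - t) * (h x - g i x) + (- t) * g i x)^2"
    by (simp only: order_refl)
  qed
  also have "... <= 2 * sq_int ?Om (%x. (1 - t) * (h x - g i x)) + 2 * sq_int ?Om (%x. (- t) * g i x)"
   by (rule sq_int_add) measurable
  also have "sq_int ?Om (%x. (1 - t) * (h x - g i x)) <= ennreal 1 * ennreal e1"
  proof -
   have "sq_int ?Om (%x. (1 - t) * (h x - g i x)) = ennreal ((1 - t)^2) * sq_int ?Om (%x. h x - g i x)"
    by (rule sq_int_scale) measurable
   also have "... <= ennreal 1 * ennreal e1"
    using t by (intro mult_mono h ennreal_leI power_le_one) auto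
   finally show ?thesis .
  qed
  also have "sq_int ?Om (%x. (- t) * g i x) = ennreal (t^2 * (L2_norm ?M (%x. G x $ i))^2)"
   by (subst sq_int_scale) (auto simp: gsq ennreal_mult)
  also have "... <= ennreal e1"
  proof (rule ennreal_leI)
   have "(L2_norm ?M (%x. G x $ i))^2 <= (\<Sum>i\<in>UNIV. (L2_norm ?M (%x. G x $ i))^2)"
    by (rule member_le_sum) auto
   then have "t^2 * (L2_norm ?M (%x. G x $ i))^2 <= t^2 * B" by (intro mult_left_mono) (auto simp: B_def)
   then show "t^2 * (L2_norm ?M (%x. G x $ i))^2 <= e1" using tB by linarith
  qed
  finally have "sq_int ?Om (%x. partial_deriv i ph x - g i x) <= 2 * ennreal e1 + 2 * ennreal e1"
   by (simp add: add_mono mult_left_mono)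
  also have "... = ennreal (2 * e1 + 2 * e1)"
   using e1 by (simp only: numeral_times_ennreal) (rule ennreal_plus[symmetric], auto)
  also have "2 * e1 + 2 * e1 = e / n" using n by (simp add: e1_def field_simps)
  finally show ?thesis .
 qed
 have res: "h : borel_measurable ?M" if "h : borel_measurable borel" for h :: "real^'n => real"
  using that by (intro measurable_restrict_space1 measurable_completion) simp
 have u2: "(%x. ph x - u x) : L2 ?M" "(L2_norm ?M (%x. ph x - u x))^2 <= e"
 proof -
  have "AE x in ?M. ph x - u x = ph x - w x" using wae by eventually_elim simp
  moreover have "(%x. ph x - u x) : borel_measurable ?M"
   by (intro borel_measurable_diff res L2_D(1)[OF u]) measurable
  ultimately show "(%x. ph x - u x) : L2 ?M" "(L2_norm ?M (%x. ph x - u x))^2 <= e"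
   using L2_norm_rep[OF open_interior _ _ _ 1] e by auto
 qed
 have g2: "(%x. (grad ph x - G x) $ i) : L2 ?M" "(L2_norm ?M (%x. (grad ph x - G x) $ i))^2 <= e / n" for i
 proof -
  have "AE x in ?M. (grad ph x - G x) $ i = partial_deriv i ph x - g i x" using gae[of i] by eventually_elim simp
  moreover have "(%x. (grad ph x - G x) $ i) : borel_measurable ?M"
   unfolding vector_minus_component grad_nth by (intro borel_measurable_diff res L2_D(1)[OF Gi]) measurable
  ultimately show "(%x. (grad ph x - G x) $ i) : L2 ?M" "(L2_norm ?M (%x. (grad ph x - G x) $ i))^2 <= e / n"
   using L2_norm_rep[OF open_interior _ _ _ 2[of i]] e n by auto
 qed
 have gL: "(%x. grad ph x - G x) : L2 ?M" using g2(1) by (simp add: L2_vec(1)[of "%x. grad ph x - G x"])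
 have "(L2_norm ?M (%x. grad ph x - G x))^2 <= (\<Sum>i\<in>(UNIV::'n set). e / n)"
  unfolding L2_vec(2)[OF gL] by (intro sum_mono g2(2))
 also have "... = e" by (simp add: n_def)
 finally show ?thesis using sm u2 gL by blast
qed

section \<open>Weak gradients of locally Lipschitz functions\<close>

definition locally_lipschitz :: "(real^'n => real) => bool" where
 "locally_lipschitz f \<longleftrightarrow> (\<forall>R. \<exists>L. \<forall>x\<in>cball 0 R. \<forall>y\<in>cball 0 R. \<bar>f x - f y\<bar> <= L * norm (x - y))"

lemma locally_lipschitz_continuous:
 assumes "locally_lipschitz f"
 shows "continuous_on UNIV f"
proof (rule continuous_at_imp_continuous_on, rule ballI)
 fix x :: "real^'a"
 obtain L where L: "!!y z. y : cball 0 (norm x + 1) ==> z : cball 0 (norm x + 1) ==> \<bar>f y - f z\<bar> <= L * norm (y - z)"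
  using assms unfolding locally_lipschitz_def by blast
 have "((%y. f y - f x) \<longlongrightarrow> 0) (at x)"
 proof (rule Lim_null_comparison)
  show "((%y. L * norm (y - x)) \<longlongrightarrow> 0) (at x)" by (auto intro!: tendsto_eq_intros)
  have "\<forall>\<^sub>F y in at x. y : ball x 1" by (intro eventually_at_in_open') auto
  then show "\<forall>\<^sub>F y in at x. norm (f y - f x) <= L * norm (y - x)"
  proof eventually_elim
   fix y assume "y : ball x 1"
   then have "norm (y - x) < 1" by (simp add: dist_norm norm_minus_commute)
   then have "y : cball 0 (norm x + 1)" using norm_triangle_ineq2[of y x] by simp
   then show "norm (f y - f x) <= L * norm (y - x)" using L[of y x] by simp
  qed
 qed
 then have "(f \<longlongrightarrow> f x) (at x)" by (subst Lim_null)
 then show "isCont f x" by (simp add: isCont_def)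
qed

lemma smooth_locally_lipschitz:
 assumes "smooth f"
 shows "locally_lipschitz f"
 unfolding locally_lipschitz_def
proof
 fix R
 have "compact (grad f ` cball 0 R)" by (intro compact_continuous_image continuous_grad assms) auto
 then obtain B where B: "!!x. x : cball 0 R ==> norm (grad f x) <= B"
  using compact_imp_bounded by (fastforce simp: bounded_iff)
 show "\<exists>L. \<forall>x\<in>cball 0 R. \<forall>y\<in>cball 0 R. \<bar>f x - f y\<bar> <= L * norm (x - y)"
 proof (intro exI[of _ B] ballI)
  fix x y :: "real^'a" assume xy: "x : cball 0 R" "y : cball 0 R"
  have "norm (f x - f y) <= B * norm (x - y)"
  proof (rule differentiable_bound[of "cball 0 R" f "%v h. grad f v \<bullet> h"])
   show "(f has_derivative (%h. grad f v \<bullet> h)) (at v within cball 0 R)" for v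
    by (rule has_derivative_at_withinI[OF smooth_has_derivative[OF assms]])
   show "onorm (%h. grad f v \<bullet> h) <= B" if "v : cball 0 R" for v
   proof (rule onorm_le)
    fix h :: "real^'a"
    have "norm (grad f v \<bullet> h) <= norm (grad f v) * norm h" by (simp add: Cauchy_Schwarz_ineq2)
    also have "... <= B * norm h" by (intro mult_right_mono B[OF that]) simp
    finally show "norm (grad f v \<bullet> h) <= B * norm h" .
   qed
  qed (use xy in auto)
  then show "\<bar>f x - f y\<bar> <= B * norm (x - y)" by simp
 qed
qed

lemma locally_lipschitz_add:
 assumes f: "locally_lipschitz f" and g: "locally_lipschitz g"
 shows "locally_lipschitz (%x. f x + g x)"
 unfolding locally_lipschitz_def
proof
 fix R
 obtain L where L: "!!y z. y : cball 0 R ==> z : cball 0 R ==> \<bar>f y - f z\<bar> <= L * norm (y - z)"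
  using f unfolding locally_lipschitz_def by blast
 obtain K where K: "!!y z. y : cball 0 R ==> z : cball 0 R ==> \<bar>g y - g z\<bar> <= K * norm (y - z)"
  using g unfolding locally_lipschitz_def by blast
 show "\<exists>L. \<forall>x\<in>cball 0 R. \<forall>y\<in>cball 0 R. \<bar>(f x + g x) - (f y + g y)\<bar> <= L * norm (x - y)"
 proof (intro exI[of _ "L + K"] ballI)
  fix x y :: "real^'a" assume "x : cball 0 R" "y : cball 0 R"
  from L[OF this] K[OF this] show "\<bar>(f x + g x) - (f y + g y)\<bar> <= (L + K) * norm (x - y)"
   by (simp add: distrib_right abs_le_iff)
 qed
qed

text \<open>For a compactly supported Lipschitz function the integrals of the difference quotients vanish
  by translation invariance, and dominated convergence passes to the derivative.\<close>

lemma integral_partial_deriv_zero: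
 fixes F :: "real^'n => real"
 assumes F [measurable]: "F : borel_measurable borel" and D [measurable]: "D : borel_measurable borel"
  and int: "integrable lborel F" and supp: "!!x. R < norm x ==> F x = 0"
  and lip: "!!x h. \<bar>h\<bar> <= 1 ==> \<bar>F (x + h *\<^sub>R axis i 1) - F x\<bar> <= L * \<bar>h\<bar>"
  and der: "AE x in lborel. (F has_derivative (%h. g x \<bullet> h)) (at x) & D x = g x $ i"
 shows "integrable lborel D" "(\<integral>x. D x \<partial>lborel) = 0"
proof -
 let ?e = "axis i 1 :: real^'n"
 define h where "h k = 1 / real (Suc k)" for k
 have h: "0 < h k" "h k <= 1" "h k ~= 0" for k by (auto simp: h_def)
 define q where "q k x = (F (x + h k *\<^sub>R ?e) - F x) / h k" for k x
 have [measurable]: "q k : borel_measurable borel" for k unfolding q_def by measurable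
 have L0: "0 <= L" using lip[of 1 0] by (simp add: order_trans[OF abs_ge_zero])
 have q_le: "norm (q k x) <= L * indicator (cball 0 (\<bar>R\<bar> + 1)) x" for k x
 proof (cases "norm x <= \<bar>R\<bar> + 1")
  case True
  have "\<bar>F (x + h k *\<^sub>R ?e) - F x\<bar> <= L * h k" using lip[of "h k" x] h[of k] by simp
  then show ?thesis using True h(1)[of k] by (simp add: q_def divide_le_eq)
 next
  case False
  have "norm x - norm (h k *\<^sub>R ?e) <= norm (x + h k *\<^sub>R ?e)" using norm_triangle_ineq2[of x "- (h k *\<^sub>R ?e)"] by simp
  moreover have "norm (h k *\<^sub>R ?e) <= 1" using h[of k] by (simp add: norm_axis_1)
  ultimately have "R < norm (x + h k *\<^sub>R ?e)" using False by linarith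
  then have "F (x + h k *\<^sub>R ?e) = 0" by (rule supp)
  moreover have "F x = 0" using False by (intro supp) linarith
  ultimately show ?thesis using L0 by (simp add: q_def)
 qed
 have bint: "integrable lborel (%x. L * indicator (cball (0::real^'n) (\<bar>R\<bar> + 1)) x)"
  by (intro integrable_mult_right integrable_real_indicator) (auto simp: emeasure_cball)
 have lim: "AE x in lborel. (%k. q k x) \<longlonglongrightarrow> D x"
  using der
 proof eventually_elim
  fix x assume x: "(F has_derivative (%h. g x \<bullet> h)) (at x) & D x = g x $ i"
  have "((%t. x + t *\<^sub>R ?e) has_derivative (%t. t *\<^sub>R ?e)) (at 0)" by (auto intro!: derivative_eq_intros)
  moreover have "(F has_derivative (%h. g x \<bullet> h)) (at (x + 0 *\<^sub>R ?e))" using x by simp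
  ultimately have "((%t. F (x + t *\<^sub>R ?e)) has_derivative (%t. g x \<bullet> (t *\<^sub>R ?e))) (at 0)"
   by (rule has_derivative_compose)
  then have "((%t. F (x + t *\<^sub>R ?e)) has_real_derivative D x) (at 0)"
   unfolding has_field_derivative_def using x by (simp add: inner_axis mult_commute_abs)
  then have "((%t. (F (x + t *\<^sub>R ?e) - F x) / t) \<longlongrightarrow> D x) (at 0)"
   by (simp add: has_field_derivative_iff)
  moreover have "filterlim h (at 0) sequentially"
   unfolding h_def filterlim_at using LIMSEQ_Suc[OF lim_1_over_n[where 'a = real]] by auto
  ultimately show "(%k. q k x) \<longlonglongrightarrow> D x" unfolding q_def by (rule filterlim_compose)
 qed
 have q0: "(\<integral>x. q k x \<partial>lborel) = 0" for k
 proof -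
  have "distr lborel borel (%x. h k *\<^sub>R ?e + x) = (lborel :: (real^'n) measure)" by (rule lborel_distr_plus)
  then have tr: "integrable lborel (%x. F (h k *\<^sub>R ?e + x))" "(\<integral>x. F (h k *\<^sub>R ?e + x) \<partial>lborel) = (\<integral>x. F x \<partial>lborel)"
   using int integrable_distr_eq[of "%x. h k *\<^sub>R ?e + x" lborel borel F] integral_distr[of "%x. h k *\<^sub>R ?e + x" lborel borel F]
   by simp_all
  then show ?thesis using int by (simp add: q_def add.commute)
 qed
 show "integrable lborel D"
  by (rule integrable_dominated_convergence[OF _ _ bint lim]) (use q_le in auto)
 have "(%k. \<integral>x. q k x \<partial>lborel) \<longlonglongrightarrow> (\<integral>x. D x \<partial>lborel)"
  by (rule integral_dominated_convergence[OF _ _ bint lim]) (use q_le in auto)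
 then show "(\<integral>x. D x \<partial>lborel) = 0" by (simp add: q0 LIMSEQ_const_iff)
qed

text \<open>Multiplication with a test function yields a compactly supported Lipschitz function.\<close>

theorem locally_lipschitz_weak_grad:
 fixes f :: "real^'n => real"
 assumes Om: "open Om" and f: "locally_lipschitz f" and G: "G : borel_measurable borel"
  and der: "AE x in lborel. (f has_derivative (%h. G x \<bullet> h)) (at x)"
 shows "is_weak_grad Om f G"
 unfolding is_weak_grad_def
proof (intro ballI allI)
 fix ph i assume ph: "ph : test_functions Om"
 have [measurable]: "Om : sets borel" using Om by simp
 have sm: "smooth ph" and cs: "compact (closure {x. ph x ~= 0})" and sub: "closure {x. ph x ~= 0} \<subseteq> Om"
  using ph by (auto simp: test_functions_def)
 let ?S = "closure {x. ph x ~= 0}"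
 have out: "ph x = 0" "partial_deriv i ph x = 0" if "x \<notin> ?S" for x
 proof -
  show "ph x = 0" using that closure_subset[of "{x. ph x ~= 0}"] by auto
  have "((%_. 0) has_derivative (%_. 0)) (at x)" by (rule has_derivative_const)
  then have "(ph has_derivative (%_. 0)) (at x)"
  proof (rule has_derivative_transform_within_open[where s = "- ?S"])
   show "!!y. y : - ?S ==> 0 = ph y" using closure_subset[of "{x. ph x ~= 0}"] by auto
  qed (use that in auto)
  from partial_deriv_eq[OF this] show "partial_deriv i ph x = 0" by simp
 qed
 obtain R where R: "0 < R" "!!x. x : ?S ==> norm x <= R"
  using compact_imp_bounded[OF cs, unfolded bounded_pos] by blast
 have far: "ph x = 0" if "R < norm x" for x
 proof -
  have "x \<notin> ?S" using R(2)[of x] that by linarith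
  then show ?thesis by (rule out(1))
 qed
 have fc: "continuous_on UNIV f" by (rule locally_lipschitz_continuous[OF f])
 have [measurable]: "f : borel_measurable borel" using fc by (rule borel_measurable_continuous_onI)
 have [measurable]: "ph : borel_measurable borel" "partial_deriv i ph : borel_measurable borel"
  using sm by (auto intro: smooth_borel smooth_partial_deriv)
 have [measurable]: "(%x. G x $ i) : borel_measurable borel"
  using measurable_compose[OF G borel_measurable_continuous_onI, of "%v. v $ i"] by (simp add: continuous_on_component)
 have comp: "integrable lborel (%x. f x * \<psi> x)" if "continuous_on UNIV \<psi>" "!!x. x \<notin> ?S ==> \<psi> x = 0" for \<psi>
 proof -
  have "integrable lborel (%x. indicator ?S x *\<^sub>R (f x * \<psi> x))"
   by (intro borel_integrable_compact cs continuous_on_mult continuous_on_subset[OF fc] continuous_on_subset[OF that(1)]) auto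
  moreover have "(%x. indicator ?S x *\<^sub>R (f x * \<psi> x)) = (%x. f x * \<psi> x)"
   using that(2) by (auto simp: indicator_def fun_eq_iff)
  ultimately show ?thesis by simp
 qed
 let ?F = "%x. f x * ph x" and ?D = "%x. f x * partial_deriv i ph x + G x $ i * ph x"
 have i1: "integrable lborel (%x. f x * partial_deriv i ph x)"
  using out(2) by (intro comp smooth_continuous smooth_partial_deriv sm) auto
 let ?C = "cball 0 (R + 3) :: (real^'n) set"
 obtain L where L: "!!y z. y : ?C ==> z : ?C ==> \<bar>f y - f z\<bar> <= L * norm (y - z)"
  using f unfolding locally_lipschitz_def by blast
 obtain K where K: "!!y z. y : ?C ==> z : ?C ==> \<bar>ph y - ph z\<bar> <= K * norm (y - z)"
  using smooth_locally_lipschitz[OF sm] unfolding locally_lipschitz_def by blast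
 have "compact (f ` ?C)" by (intro compact_continuous_image continuous_on_subset[OF fc]) auto
 then obtain Mf where Mf: "!!x. x : ?C ==> \<bar>f x\<bar> <= Mf"
  using compact_imp_bounded by (fastforce simp: bounded_iff)
 obtain Mp where Mp: "!!x. x : ?C ==> \<bar>ph x\<bar> <= Mp" using smooth_bounded_on_cball[OF sm] by blast
 have lip: "\<bar>?F (x + h *\<^sub>R axis i 1) - ?F x\<bar> <= (\<bar>Mf\<bar> * \<bar>K\<bar> + \<bar>L\<bar> * \<bar>Mp\<bar>) * \<bar>h\<bar>" if h: "\<bar>h\<bar> <= 1" for x h
 proof -
  let ?y = "x + h *\<^sub>R axis i 1"
  have nh: "norm (?y - x) = \<bar>h\<bar>" by (simp add: norm_axis_1)
  show ?thesis
  proof (cases "norm x <= R + 2")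
   case True
   have "norm ?y <= norm x + norm (?y - x)" using norm_triangle_ineq[of x "?y - x"] by simp
   then have C: "x : ?C" "?y : ?C" using True h nh by auto
   have "?F ?y - ?F x = f ?y * (ph ?y - ph x) + (f ?y - f x) * ph x" by (simp add: algebra_simps)
   then have "\<bar>?F ?y - ?F x\<bar> <= \<bar>f ?y\<bar> * \<bar>ph ?y - ph x\<bar> + \<bar>f ?y - f x\<bar> * \<bar>ph x\<bar>"
    using abs_triangle_ineq[of "f ?y * (ph ?y - ph x)" "(f ?y - f x) * ph x"] by (simp only: abs_mult)
   also have "... <= \<bar>Mf\<bar> * (\<bar>K\<bar> * \<bar>h\<bar>) + (\<bar>L\<bar> * \<bar>h\<bar>) * \<bar>Mp\<bar>"
   proof (intro add_mono mult_mono)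
    show "\<bar>f ?y\<bar> <= \<bar>Mf\<bar>" using Mf[OF C(2)] by linarith
    show "\<bar>ph x\<bar> <= \<bar>Mp\<bar>" using Mp[OF C(1)] by linarith
    have "K * \<bar>h\<bar> <= \<bar>K\<bar> * \<bar>h\<bar>" "L * \<bar>h\<bar> <= \<bar>L\<bar> * \<bar>h\<bar>" by (auto intro: mult_right_mono)
    then show "\<bar>ph ?y - ph x\<bar> <= \<bar>K\<bar> * \<bar>h\<bar>" "\<bar>f ?y - f x\<bar> <= \<bar>L\<bar> * \<bar>h\<bar>"
     using K[OF C(2,1)] L[OF C(2,1)] unfolding nh by linarith+
   qed auto
   finally show ?thesis by (simp add: algebra_simps)
  next
   case False
   have "norm x <= norm ?y + norm (?y - x)" using norm_triangle_ineq4[of ?y "?y - x"] by simp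
   then have "R < norm ?y" "R < norm x" using False h nh by auto
   then have "ph ?y = 0" "ph x = 0" by (simp_all add: far)
   then show ?thesis by simp
  qed
 qed
 have dF: "AE x in lborel. (?F has_derivative (%h. (f x *\<^sub>R grad ph x + ph x *\<^sub>R G x) \<bullet> h)) (at x) & ?D x = (f x *\<^sub>R grad ph x + ph x *\<^sub>R G x) $ i"
  using der
 proof eventually_elim
  fix x assume x: "(f has_derivative (%h. G x \<bullet> h)) (at x)"
  have "(?F has_derivative (%h. f x * (grad ph x \<bullet> h) + (G x \<bullet> h) * ph x)) (at x)"
   by (rule has_derivative_mult[OF x smooth_has_derivative[OF sm]])
  then show "(?F has_derivative (%h. (f x *\<^sub>R grad ph x + ph x *\<^sub>R G x) \<bullet> h)) (at x) & ?D x = (f x *\<^sub>R grad ph x + ph x *\<^sub>R G x) $ i"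
   by (simp add: inner_add_left mult.commute)
 qed
 have supp: "?F x = 0" if "R < norm x" for x
  using that by (simp add: far)
 have FI: "integrable lborel ?F" by (intro comp smooth_continuous sm out(1))
 have [measurable]: "?F : borel_measurable borel" "?D : borel_measurable borel" by measurable
 have DI: "integrable lborel ?D" and D0: "(\<integral>x. ?D x \<partial>lborel) = 0"
  using integral_partial_deriv_zero[of ?F ?D R i "\<bar>Mf\<bar> * \<bar>K\<bar> + \<bar>L\<bar> * \<bar>Mp\<bar>" "%x. f x *\<^sub>R grad ph x + ph x *\<^sub>R G x"]
   FI supp lip dF by auto
 have "integrable lborel (%x. ?D x - f x * partial_deriv i ph x)" by (rule Bochner_Integration.integrable_diff[OF DI i1])
 then have i2: "integrable lborel (%x. G x $ i * ph x)" by simp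
 have "(\<integral>x. f x * partial_deriv i ph x \<partial>lborel) = - (\<integral>x. G x $ i * ph x \<partial>lborel)"
  using D0 i1 i2 by simp
 moreover have loc: "(\<integral>x. g x \<partial>lebesgue_on Om) = (\<integral>x. g x \<partial>lborel)"
  if [measurable]: "g : borel_measurable borel" and z: "!!x. x \<notin> ?S ==> g x = 0" for g :: "real^'n => real"
 proof -
  have "(\<integral>x. g x \<partial>lebesgue_on Om) = (\<integral>x. g x * indicator Om x \<partial>lborel)"
   by (rule lebesgue_on_integral_rep[OF Om]) (auto intro!: measurable_restrict_space1 measurable_completion)
  also have "... = (\<integral>x. g x \<partial>lborel)"
   using z sub by (intro Bochner_Integration.integral_cong refl) (auto simp: indicator_def)
  finally show ?thesis .
 qed
 ultimately show "(\<integral>x. f x * partial_deriv i ph x \<partial>lebesgue_on Om) = - (\<integral>x. G x $ i * ph x \<partial>lebesgue_on Om)"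
 proof -
  assume eq: "(\<integral>x. f x * partial_deriv i ph x \<partial>lborel) = - (\<integral>x. G x $ i * ph x \<partial>lborel)"
   and loc: "!!g :: real^'n => real. g : borel_measurable borel ==> (!!x. x \<notin> ?S ==> g x = 0) ==>
    (\<integral>x. g x \<partial>lebesgue_on Om) = (\<integral>x. g x \<partial>lborel)"
  have "(\<integral>x. f x * partial_deriv i ph x \<partial>lebesgue_on Om) = (\<integral>x. f x * partial_deriv i ph x \<partial>lborel)"
  proof (rule loc)
   show "(%x. f x * partial_deriv i ph x) : borel_measurable borel" by measurable
   fix x assume "x \<notin> ?S"
   from out(2)[OF this] show "f x * partial_deriv i ph x = 0" by simp
  qed
  moreover have "(\<integral>x. G x $ i * ph x \<partial>lebesgue_on Om) = (\<integral>x. G x $ i * ph x \<partial>lborel)"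
  proof (rule loc)
   show "(%x. G x $ i * ph x) : borel_measurable borel" by measurable
   fix x assume "x \<notin> ?S"
   from out(1)[OF this] show "G x $ i * ph x = 0" by simp
  qed
  ultimately show ?thesis using eq by (simp only:)
 qed
qed

lemma L2_bounded:
 fixes g :: "real^'n => real"
 assumes Om: "open Om" "bounded Om" and g: "g : borel_measurable borel" and M: "!!x. x : Om ==> \<bar>g x\<bar> <= M"
 shows "g : L2 (lebesgue_on Om)"
proof -
 have [measurable]: "Om : sets borel" using Om by simp
 have "sq_int Om g <= ennreal (\<bar>M\<bar>^2) * emeasure lborel Om"
  using M by (intro sq_int_le_const) (auto intro: order_trans[OF _ abs_ge_self])
 also have "emeasure lborel Om = ennreal (measure lborel Om)"
  using emeasure_bounded_finite[OF Om(2)] by (simp add: emeasure_eq_ennreal_measure)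
 also have "ennreal (\<bar>M\<bar>^2) * ennreal (measure lborel Om) = ennreal (\<bar>M\<bar>^2 * measure lborel Om)"
  by (simp add: ennreal_mult)
 finally have "sq_int Om g <= ennreal (\<bar>M\<bar>^2 * measure lborel Om)" .
 then show ?thesis
  using g by (intro L2_norm_rep(1)[OF Om(1) g _ _ _]) (auto intro!: measurable_restrict_space1 measurable_completion)
qed

lemma L2_norm_sq_int:
 fixes g :: "real^'n => real"
 assumes Om: "open Om" and g [measurable]: "g : borel_measurable borel" and L: "g : L2 (lebesgue_on Om)"
 shows "ennreal ((L2_norm (lebesgue_on Om) g)^2) = sq_int Om g"
proof -
 have [measurable]: "Om : sets borel" using Om by simp
 have "integrable lebesgue (%x. indicator Om x *\<^sub>R (norm (g x))\<^sup>2)"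
  using L2_D(2)[OF L] Om by (subst (asm) integrable_restrict_space) auto
 then have "integrable lborel (%x. indicator Om x *\<^sub>R (norm (g x))\<^sup>2)"
  by (subst (asm) integrable_completion) measurable
 then have i: "integrable lborel (%x. (g x)^2 * indicator Om x)" by (simp add: mult.commute)
 have "(L2_norm (lebesgue_on Om) g)^2 = (\<integral>x. (g x)^2 * indicator Om x \<partial>lborel)"
  unfolding L2_norm_square
  by (rule lebesgue_on_integral_rep[OF Om]) (auto intro!: measurable_restrict_space1 measurable_completion)
 then show ?thesis by (simp add: sq_int_eq_integral[OF i])
qed

section \<open>Geometry of simplices\<close>

lemma simplex_full:
 fixes K :: "(real^'n) set"
 assumes "int CARD('n) simplex K"
 shows "compact K" "convex K" "K ~= {}" "interior K ~= {}"
  "\<exists>C. finite C & \<not> affine_dependent C & card C = Suc CARD('n) & K = convex hull C"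
proof -
 obtain C where C: "\<not> affine_dependent C" "int (card C) = int CARD('n) + 1" "K = convex hull C"
  using assms unfolding simplex_def by auto
 have fin: "finite C" using C(1) by (rule aff_independent_finite)
 then show "\<exists>C. finite C & \<not> affine_dependent C & card C = Suc CARD('n) & K = convex hull C"
  using C by (intro exI[of _ C]) auto
 show "compact K" unfolding C(3) using fin by (rule finite_imp_compact_convex_hull)
 show cv: "convex K" unfolding C(3) by (rule convex_convex_hull)
 show ne: "K ~= {}" using C by auto
 have "aff_dim K = int DIM(real^'n)" using aff_dim_simplex[OF assms] by simp
 then have "affine hull K = UNIV" by (simp only: aff_dim_eq_full)
 then have "interior K = rel_interior K" by (rule rel_interior_interior[symmetric])
 then show "interior K ~= {}" using ne cv rel_interior_eq_empty by blast
qed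

lemma facet_hyperplane:
 fixes K F :: "(real^'n) set"
 assumes K: "int CARD('n) simplex K" and F: "F facet_of K"
 shows "\<exists>a b. norm a = 1 & affine hull F = {x. a \<bullet> x = b}"
proof -
 have "aff_dim F = int (DIM(real^'n) - 1)"
  using F aff_dim_simplex[OF K] by (simp add: facet_of_def of_nat_diff)
 then obtain a b where ab: "a ~= 0" "affine hull F = {x. a \<bullet> x = b}" using aff_dim_eq_hyperplane[of F] by auto
 have "affine hull F = {x. (a /\<^sub>R norm a) \<bullet> x = b / norm a}"
  using ab by (auto simp: field_simps)
 moreover have "norm (a /\<^sub>R norm a) = 1" using ab by simp
 ultimately show ?thesis by blast
qed

lemma facet_opposite_vertex:
 fixes K F :: "(real^'n) set"
 assumes K: "int CARD('n) simplex K" and F: "F facet_of K" and hyp: "affine hull F = {x. a \<bullet> x = b}"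
 shows "\<exists>S u. finite S & card S = CARD('n) & S ~= {} & u \<notin> S & F = convex hull S & K = convex hull (insert u S) & a \<bullet> u ~= b"
proof -
 obtain C where C: "finite C" "\<not> affine_dependent C" "card C = Suc CARD('n)" "K = convex hull C"
  using simplex_full(5)[OF K] by blast
 obtain u where u: "F ~= {}" "u : C" "F = convex hull (C - {u})"
  using F unfolding C(4) facet_of_convex_hull_affine_independent[OF C(2)] by blast
 have "u \<notin> affine hull (C - {u})" using C(2) u(2) unfolding affine_dependent_def by blast
 then have "a \<bullet> u ~= b" using hyp u(3) by auto
 moreover have "insert u (C - {u}) = C" using u(2) by blast
 ultimately show ?thesis using C u
  by (intro exI[of _ "C - {u}"] exI[of _ u]) auto
qed

lemma in_cone_decomp:
 assumes "x : convex hull (insert u S)" "S ~= {}"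
 shows "\<exists>s f. 0 <= s & s <= 1 & f : convex hull S & x = (1 - s) *\<^sub>R f + s *\<^sub>R u"
proof -
 obtain s v f where "0 <= s" "0 <= v" "s + v = 1" "f : convex hull S" "x = s *\<^sub>R u + v *\<^sub>R f"
  using assms by (auto simp: convex_hull_insert)
 moreover from this have "v = 1 - s" by simp
 ultimately show ?thesis by (intro exI[of _ s] exI[of _ f]) (auto simp: add.commute)
qed

text \<open>The situation of a simplex \<open>K\<close> on the positive side of the hyperplane of its facet \<open>F\<close>:
  \<open>u\<close> is the opposite vertex.\<close>

definition cone_over :: "(real^'n) set => real^'n => (real^'n) set => real^'n => real => bool" where
 "cone_over K u F a b \<longleftrightarrow> compact K & convex K & convex F & compact F & F ~= {} & norm a = 1 & affine hull F = {x. a \<bullet> x = b} & b < a \<bullet> u \<and>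
  u : K & F \<subseteq> K & (\<forall>x\<in>K. \<exists>s f. 0 <= s & s <= 1 & f : F & x = (1 - s) *\<^sub>R f + s *\<^sub>R u)"

lemma cone_overI:
 assumes "finite S" "S ~= {}" "F = convex hull S" "K = convex hull (insert u S)" "norm a = 1"
  "affine hull F = {x. a \<bullet> x = b}" "b < a \<bullet> u"
 shows "cone_over K u F a b"
 unfolding cone_over_def
proof (intro conjI ballI)
 show "u : K" "F \<subseteq> K" using assms hull_subset[of "insert u S" convex] hull_mono[of S "insert u S" convex] by auto
 fix x assume "x : K"
 then show "\<exists>s f. 0 <= s & s <= 1 & f : F & x = (1 - s) *\<^sub>R f + s *\<^sub>R u"
  using in_cone_decomp[of x u S] assms by simp
qed (use assms in \<open>auto intro: finite_imp_compact_convex_hull\<close>)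

lemma cone_over_D:
 assumes "cone_over K u F a b"
 shows "compact K" "convex K" "convex F" "compact F" "F ~= {}" "norm a = 1" "affine hull F = {x. a \<bullet> x = b}" "b < a \<bullet> u"
  "u : K" "F \<subseteq> K" "!!f. f : F ==> a \<bullet> f = b"
 using assms hull_subset[of F affine] by (auto simp: cone_over_def)

lemma cone_over_decomp:
 assumes c: "cone_over K u F a b" and x: "x : K"
 shows "\<exists>f\<in>F. 0 <= (a \<bullet> x - b) / (a \<bullet> u - b) & (a \<bullet> x - b) / (a \<bullet> u - b) <= 1 \<and>
  x = (1 - (a \<bullet> x - b) / (a \<bullet> u - b)) *\<^sub>R f + ((a \<bullet> x - b) / (a \<bullet> u - b)) *\<^sub>R u"
proof -
 obtain s f where s: "0 <= s" "s <= 1" "f : F" "x = (1 - s) *\<^sub>R f + s *\<^sub>R u"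
  using c x unfolding cone_over_def by blast
 have "a \<bullet> x - b = s * (a \<bullet> u - b)"
  using cone_over_D(11)[OF c s(3)] by (simp add: s(4) inner_add_right algebra_simps)
 then have "(a \<bullet> x - b) / (a \<bullet> u - b) = s" using cone_over_D(8)[OF c] by simp
 then show ?thesis using s by auto
qed

lemma cone_over_side: "cone_over K u F a b ==> x : K ==> b <= a \<bullet> x"
 using cone_over_decomp[of K u F a b x] cone_over_D(8)[of K u F a b] by (auto simp: zero_le_divide_iff)

text \<open>Projecting along the direction from a point \<open>e\<close> of the facet to the opposite vertex maps the simplex into
  the facet.\<close>

definition oblique :: "real^'n => real^'n => real^'n => real => real^'n => real^'n" where
 "oblique u e a b x = x - ((a \<bullet> x - b) / (a \<bullet> u - b)) *\<^sub>R (u - e)"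

lemma oblique_in_facet:
 assumes c: "cone_over K u F a b" and e: "e : F" and x: "x : K"
 shows "oblique u e a b x : F"
proof -
 let ?s = "(a \<bullet> x - b) / (a \<bullet> u - b)"
 obtain f where f: "f : F" "0 <= ?s" "?s <= 1" "x = (1 - ?s) *\<^sub>R f + ?s *\<^sub>R u"
  using cone_over_decomp[OF c x] by blast
 have "oblique u e a b x = (1 - ?s) *\<^sub>R f + ?s *\<^sub>R e"
  unfolding oblique_def by (subst (1) f(4)) (simp add: algebra_simps)
 moreover have "(1 - ?s) *\<^sub>R f + ?s *\<^sub>R e : F"
  using cone_over_D(3)[OF c] f e by (intro convexD) auto
 ultimately show ?thesis by simp
qed

lemma oblique_hyperplane: "a \<bullet> x = b ==> oblique u e a b x = x"
 by (simp add: oblique_def)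

lemma oblique_affine:
 "oblique u e a b ((1 - t) *\<^sub>R x + t *\<^sub>R y) = (1 - t) *\<^sub>R oblique u e a b x + t *\<^sub>R oblique u e a b y"
proof -
 have "(a \<bullet> ((1 - t) *\<^sub>R x + t *\<^sub>R y) - b) / (a \<bullet> u - b) = (1 - t) * ((a \<bullet> x - b) / (a \<bullet> u - b)) + t * ((a \<bullet> y - b) / (a \<bullet> u - b))"
  unfolding times_divide_eq_right add_divide_distrib[symmetric]
  by (simp add: inner_add_right algebra_simps)
 then show ?thesis unfolding oblique_def by (simp add: algebra_simps)
qed

lemma oblique_dist:
 assumes a: "norm a = 1" and u: "b < a \<bullet> u" and e: "a \<bullet> e = b"
 shows "norm (oblique u e a b x - e) <= (1 + norm (u - e) / (a \<bullet> u - b)) * norm (x - e)"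
proof -
 have "oblique u e a b x - e = (x - e) - ((a \<bullet> (x - e)) / (a \<bullet> u - b)) *\<^sub>R (u - e)"
  using e by (simp add: oblique_def inner_diff_right)
 then have "norm (oblique u e a b x - e) <= norm (x - e) + norm (((a \<bullet> (x - e)) / (a \<bullet> u - b)) *\<^sub>R (u - e))"
  by (metis norm_triangle_ineq4)
 also have "norm (((a \<bullet> (x - e)) / (a \<bullet> u - b)) *\<^sub>R (u - e)) = \<bar>a \<bullet> (x - e)\<bar> * (norm (u - e) / (a \<bullet> u - b))"
  using u by simp
 also have "\<bar>a \<bullet> (x - e)\<bar> * (norm (u - e) / (a \<bullet> u - b)) <= norm (x - e) * (norm (u - e) / (a \<bullet> u - b))"
  using Cauchy_Schwarz_ineq2[of a "x - e"] a u by (intro mult_right_mono) auto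
 finally show ?thesis by (simp add: algebra_simps)
qed

lemma half_ball_in_cone:
 assumes c: "cone_over K u F a b" and e: "e : rel_interior F"
 shows "\<exists>r>0. \<forall>x\<in>cball e r. b <= a \<bullet> x --> x : K"
proof -
 note D = cone_over_D[OF c]
 define \<eta> where "\<eta> = a \<bullet> u - b"
 have \<eta>: "0 < \<eta>" using D(8) by (simp add: \<eta>_def)
 obtain \<rho> where \<rho>: "0 < \<rho>" "cball e \<rho> \<inter> affine hull F \<subseteq> F" using e mem_rel_interior_cball[of e F] by blast
 have eF: "e : F" using e rel_interior_subset by blast
 then have ae: "a \<bullet> e = b" by (rule D(11))
 define D1 where "D1 = 1 + norm (e - u)"
 have D1: "1 <= D1" by (simp add: D1_def)
 define r where "r = min (min (\<eta> / 2) 1) (\<rho> / (1 + 2 * D1 / \<eta>))"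
 have pos: "0 < 1 + 2 * D1 / \<eta>" using D1 \<eta> by (simp add: add_pos_nonneg)
 have r0: "0 < r" using \<eta> \<rho> pos by (simp add: r_def)
 have r: "0 < r" "r <= \<eta> / 2" "r <= 1" "r <= \<rho> / (1 + 2 * D1 / \<eta>)"
  by (rule r0, unfold r_def, rule order_trans[OF min.cobounded1 min.cobounded1],
    rule order_trans[OF min.cobounded1 min.cobounded2], rule min.cobounded2)
 have r4: "r + (2 * r / \<eta>) * D1 <= \<rho>"
  using r(4) pos by (simp add: pos_le_divide_eq algebra_simps)
 show ?thesis
 proof (intro exI[of _ r] conjI ballI impI r(1))
  fix x assume x: "x : cball e r" and ax: "b <= a \<bullet> x"
  have nx: "norm (x - e) <= r" using x by (simp add: dist_norm norm_minus_commute)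
  define s where "s = (a \<bullet> x - b) / \<eta>"
  have "a \<bullet> x - b = a \<bullet> (x - e)" using ae by (simp add: inner_diff_right)
  also have "... <= \<bar>a \<bullet> (x - e)\<bar>" by simp
  also have "... <= norm a * norm (x - e)" by (rule Cauchy_Schwarz_ineq2)
  also have "... <= r" using nx D(6) by simp
  finally have axr: "a \<bullet> x - b <= r" .
  have s3: "s <= r / \<eta>" unfolding s_def by (intro divide_right_mono axr) (use \<eta> in simp)
  have "r / \<eta> <= (\<eta> / 2) / \<eta>" by (intro divide_right_mono r(2)) (use \<eta> in simp)
  also have "(\<eta> / 2) / \<eta> = 1/2" using \<eta> by simp
  finally have s2: "s <= 1/2" using s3 by linarith
  have s1': "0 <= s" unfolding s_def by (intro divide_nonneg_pos) (use ax \<eta> in auto)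
  note s = s1' s2 s3
  define f where "f = x + (s / (1 - s)) *\<^sub>R (x - u)"
  have s1: "s / (1 - s) <= 2 * r / \<eta>" "0 <= s / (1 - s)"
  proof -
   have "s / (1 - s) <= s / (1/2)" using s by (intro divide_left_mono) auto
   also have "... <= 2 * r / \<eta>" using s(3) by simp
   finally show "s / (1 - s) <= 2 * r / \<eta>" .
  qed (use s in auto)
  have "a \<bullet> f = b"
  proof -
   define k where "k = s / (1 - s)"
   have "k * (1 - s) = s" using s by (simp add: k_def)
   then have ks: "k - k * s = s" by (simp add: algebra_simps)
   have ax: "a \<bullet> x = b + s * \<eta>" using \<eta> by (simp add: s_def)
   have au: "a \<bullet> u = b + \<eta>" by (simp add: \<eta>_def)
   have "a \<bullet> f = a \<bullet> x + k * (a \<bullet> x - a \<bullet> u)"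
    unfolding f_def k_def[symmetric] by (simp add: inner_add_right inner_diff_right)
   also have "... = b + s * \<eta> - (k - k * s) * \<eta>" unfolding ax au by (simp add: algebra_simps)
   finally show ?thesis unfolding ks by simp
  qed
  moreover have "f : cball e \<rho>"
  proof -
   have "norm (x - u) <= D1"
   proof -
    have "norm (x - u) <= norm (x - e) + norm (e - u)" using norm_triangle_ineq[of "x - e" "e - u"] by simp
    then show ?thesis using nx r(3) by (simp add: D1_def)
   qed
   then have "norm ((s / (1 - s)) *\<^sub>R (x - u)) <= (2 * r / \<eta>) * D1"
    unfolding norm_scaleR abs_of_nonneg[OF s1(2)]
    by (rule mult_mono[OF s1(1)]) (use r \<eta> in auto)
   moreover have "norm (f - e) <= norm (x - e) + norm ((s / (1 - s)) *\<^sub>R (x - u))"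
    using norm_triangle_ineq[of "x - e" "(s / (1 - s)) *\<^sub>R (x - u)"] by (simp add: f_def algebra_simps)
   ultimately have "norm (f - e) <= \<rho>" using nx r4 by linarith
   then show ?thesis by (simp add: dist_norm norm_minus_commute)
  qed
  ultimately have f: "f : F" using \<rho>(2) D(7) by auto
  have "x = (1 - s) *\<^sub>R f + s *\<^sub>R u"
  proof -
   have "(1 - s) *\<^sub>R f = (1 - s) *\<^sub>R x + s *\<^sub>R (x - u)" using s by (simp add: f_def scaleR_add_right)
   then show ?thesis by (simp add: algebra_simps)
  qed
  moreover have "(1 - s) *\<^sub>R f + s *\<^sub>R u : K" using D(2) f D(9,10) s by (intro convexD) auto
  ultimately show "x : K" by simp
 qed
qed

text \<open>A point of \<open>K\<close> sees every point near \<open>e\<close> through the common facet.\<close>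

lemma star_half:
 assumes c: "cone_over K2 u F a b" and K1: "convex K1" "F \<subseteq> K1" and e: "e : F" and r: "0 < r"
  and h1: "!!y. y : cball e r ==> a \<bullet> y <= b ==> y : K1"
  and h2: "!!y. y : cball e r ==> b <= a \<bullet> y ==> y : K2"
  and hF: "!!y. y : cball e r ==> a \<bullet> y = b ==> y : F"
 shows "\<exists>r'>0. \<forall>x\<in>K2. \<forall>y\<in>cball e r'. \<forall>t\<in>{0..1}. (1 - t) *\<^sub>R x + t *\<^sub>R y : K1 \<union> K2"
proof -
 note D = cone_over_D[OF c]
 define B where "B = 1 + norm (u - e) / (a \<bullet> u - b)"
 have B: "1 <= B" using D(8) by (simp add: B_def)
 define r' where "r' = r / B"
 have r': "0 < r'" "r' <= r" "B * r' = r" using r B by (auto simp: r'_def divide_le_eq mult_le_cancel_left1)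
 show ?thesis
 proof (intro exI[of _ r'] conjI ballI r'(1))
  fix x y t assume x: "x : K2" and y: "y : cball e r'" and t: "t : {0..1::real}"
  have yr: "y : cball e r" using y r'(2) by auto
  show "(1 - t) *\<^sub>R x + t *\<^sub>R y : K1 \<union> K2"
  proof (cases "b <= a \<bullet> y")
   case True
   then have "y : K2" using h2 yr by blast
   then show ?thesis using convexD[OF D(2) x, of y "1 - t" t] t by auto
  next
   case False
   then have yK: "y : K1" using h1 yr by simp
   define al where "al = a \<bullet> x - b"
   define \<beta> where "\<beta> = b - a \<bullet> y"
   have ab: "0 <= al" "0 < \<beta>" using cone_over_side[OF c x] False by (auto simp: al_def \<beta>_def)
   define \<tau> where "\<tau> = al / (al + \<beta>)"
   have \<tau>: "0 <= \<tau>" "\<tau> < 1" using ab by (auto simp: \<tau>_def)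
   define z where "z = (1 - \<tau>) *\<^sub>R x + \<tau> *\<^sub>R y"
   have "a \<bullet> z = b"
   proof -
    have "a \<bullet> z - b = (1 - \<tau>) * al - \<tau> * \<beta>" by (simp add: z_def al_def \<beta>_def inner_add_right algebra_simps)
    also have "... = al - \<tau> * (al + \<beta>)" by (simp add: algebra_simps)
    also have "... = 0" using ab by (simp add: \<tau>_def)
    finally show ?thesis by simp
   qed
   then have "z = oblique u e a b z" by (simp add: oblique_hyperplane)
   also have "... = (1 - \<tau>) *\<^sub>R oblique u e a b x + \<tau> *\<^sub>R oblique u e a b y"
    unfolding z_def by (rule oblique_affine)
   also have "... : F"
   proof -
    have "norm (oblique u e a b y - e) <= B * norm (y - e)"
     unfolding B_def by (rule oblique_dist[OF D(6,8) D(11)[OF e]])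
    also have "... <= B * r'" using y B by (intro mult_left_mono) (auto simp: dist_norm norm_minus_commute)
    finally have "oblique u e a b y : cball e r" using r'(3) by (simp add: dist_norm norm_minus_commute)
    moreover have "a \<bullet> oblique u e a b y = b"
     using D(8) D(11)[OF e] by (simp add: oblique_def inner_diff_right)
    ultimately have "oblique u e a b y : F" by (rule hF)
    then show ?thesis using convexD[OF D(3) oblique_in_facet[OF c e x]] \<tau> by simp
   qed
   finally have zF: "z : F" .
   show ?thesis
   proof (cases "t <= \<tau>")
    case True
    show ?thesis
    proof (cases "\<tau> = 0")
     case True
     then have "t = 0" using \<open>t <= \<tau>\<close> t by simp
     then show ?thesis using x by simp
    next
     case False
     then have \<tau>0: "0 < \<tau>" using \<tau> by simp
     have "(1 - t) *\<^sub>R x + t *\<^sub>R y = (1 - t / \<tau>) *\<^sub>R x + (t / \<tau>) *\<^sub>R z"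
      using \<tau>0 by (simp add: z_def algebra_simps)
     moreover have "(1 - t / \<tau>) *\<^sub>R x + (t / \<tau>) *\<^sub>R z : K2"
      using D(2) x zF D(10) t True \<tau>0 by (intro convexD) auto
     ultimately show ?thesis by simp
    qed
   next
    case False
    define q where "q = (t - \<tau>) / (1 - \<tau>)"
    have q: "0 <= q" "q <= 1" using False t \<tau> by (auto simp: q_def divide_le_eq)
    have q1: "q * (1 - \<tau>) = t - \<tau>" using \<tau> by (simp add: q_def)
    have c1: "(1 - q) * (1 - \<tau>) = 1 - t" "(1 - q) * \<tau> + q = t" using q1 by (simp_all add: algebra_simps)
    have "(1 - q) *\<^sub>R z + q *\<^sub>R y = ((1 - q) * (1 - \<tau>)) *\<^sub>R x + ((1 - q) * \<tau> + q) *\<^sub>R y"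
     by (simp add: z_def algebra_simps)
    then have "(1 - t) *\<^sub>R x + t *\<^sub>R y = (1 - q) *\<^sub>R z + q *\<^sub>R y" unfolding c1 ..
    moreover have "(1 - q) *\<^sub>R z + q *\<^sub>R y : K1"
     using K1 zF yK q by (intro convexD) auto
    ultimately show ?thesis by simp
   qed
  qed
 qed
qed

lemma convex_star_ball: "convex K ==> 0 < r ==> cball x r \<subseteq> K ==> star_ball K x r"
 unfolding star_ball_def by (auto intro!: convexD)

text \<open>Near a point in the relative interior of the common facet each simplex fills a half ball. A segment from one
simplex to a nearby point of the other one therefore crosses the facet and stays in the union.\<close>

theorem simplex_pair:
 fixes K1 K2 E :: "(real^'n) set"
 assumes K1: "int CARD('n) simplex K1" and K2: "int CARD('n) simplex K2" and E: "E = K1 \<inter> K2"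
  and F1: "E facet_of K1" and F2: "E facet_of K2"
 shows "\<exists>a b u1 u2 e r. cone_over K2 u2 E a b & cone_over K1 u1 E (- a) (- b) & e : E & star_ball (K1 \<union> K2) e r"
proof -
 obtain a0 b0 where ab0: "norm a0 = 1" "affine hull E = {x. a0 \<bullet> x = b0}" using facet_hyperplane[OF K2 F2] by blast
 obtain S2 u2 where S2: "finite S2" "S2 ~= {}" "E = convex hull S2" "K2 = convex hull (insert u2 S2)" "a0 \<bullet> u2 ~= b0"
  using facet_opposite_vertex[OF K2 F2 ab0(2)] by blast
 define \<sigma> :: real where "\<sigma> = (if b0 < a0 \<bullet> u2 then 1 else -1)"
 define a where "a = \<sigma> *\<^sub>R a0"
 define b where "b = \<sigma> * b0"
 have \<sigma>: "\<bar>\<sigma>\<bar> = 1" "\<sigma> ~= 0" by (auto simp: \<sigma>_def)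
 have a: "norm a = 1" using ab0 \<sigma> by (simp add: a_def)
 have hyp: "affine hull E = {x. a \<bullet> x = b}" using ab0(2) \<sigma>(2) by (simp add: a_def b_def)
 have u2: "b < a \<bullet> u2" using S2(5) by (auto simp: a_def b_def \<sigma>_def)
 have c2: "cone_over K2 u2 E a b" by (rule cone_overI[OF S2(1-4) a hyp u2])
 obtain S1 u1 where S1: "finite S1" "S1 ~= {}" "E = convex hull S1" "K1 = convex hull (insert u1 S1)" "a \<bullet> u1 ~= b"
  using facet_opposite_vertex[OF K1 F1 hyp] by blast
 have "rel_interior E ~= {}" using cone_over_D(3,5)[OF c2] rel_interior_eq_empty by blast
 then obtain e where e: "e : rel_interior E" by blast
 then have eE: "e : E" using rel_interior_subset by blast
 have ae: "a \<bullet> e = b" by (rule cone_over_D(11)[OF c2 eE])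
 obtain r2 where r2: "0 < r2" "!!x. x : cball e r2 ==> b <= a \<bullet> x ==> x : K2"
  using half_ball_in_cone[OF c2 e] by blast
 have u1: "a \<bullet> u1 < b"
 proof (rule ccontr)
  assume "\<not> a \<bullet> u1 < b"
  then have "b < a \<bullet> u1" using S1(5) by simp
  then have c1: "cone_over K1 u1 E a b" by (rule cone_overI[OF S1(1-4) a hyp])
  obtain r1 where r1: "0 < r1" "!!x. x : cball e r1 ==> b <= a \<bullet> x ==> x : K1"
   using half_ball_in_cone[OF c1 e] by blast
  let ?x = "e + min r1 r2 *\<^sub>R a"
  have ax: "a \<bullet> ?x = b + min r1 r2" using ae a by (simp add: inner_add_right norm_eq_1)
  have "?x : cball e r1" "?x : cball e r2" using r1 r2 a by (auto simp: dist_norm)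
  then have "?x : E" using r1 r2 ax E by auto
  then have "a \<bullet> ?x = b" by (rule cone_over_D(11)[OF c2])
  then show False using ax r1 r2 by simp
 qed
 have hyp': "affine hull E = {x. (- a) \<bullet> x = - b}" using hyp by simp
 have c1: "cone_over K1 u1 E (- a) (- b)" using u1 a by (intro cone_overI[OF S1(1-4) _ hyp']) auto
 obtain r1 where r1: "0 < r1" "!!x. x : cball e r1 ==> a \<bullet> x <= b ==> x : K1"
  using half_ball_in_cone[OF c1 e] by auto
 define r where "r = min r1 r2"
 have r: "0 < r" "!!x. x : cball e r ==> a \<bullet> x <= b ==> x : K1" "!!x. x : cball e r ==> b <= a \<bullet> x ==> x : K2"
  using r1 r2 by (auto simp: r_def)
 then have rE: "!!x. x : cball e r ==> a \<bullet> x = b ==> x : E" using E by auto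
 obtain s2 where s2: "0 < s2" "!!x y t. x : K2 ==> y : cball e s2 ==> t : {0..1} ==> (1 - t) *\<^sub>R x + t *\<^sub>R y : K1 \<union> K2"
  using star_half[OF c2 cone_over_D(2,10)[OF c1] eE r(1) r(2) r(3) rE] by blast
 obtain s1 where s1: "0 < s1" "!!x y t. x : K1 ==> y : cball e s1 ==> t : {0..1} ==> (1 - t) *\<^sub>R x + t *\<^sub>R y : K2 \<union> K1"
  using star_half[OF c1 cone_over_D(2,10)[OF c2] eE r(1)] r rE by auto
 have "star_ball (K1 \<union> K2) e (min s1 s2)"
  unfolding star_ball_def
 proof (intro conjI ballI)
  fix x y t assume "x : K1 \<union> K2" "y : cball e (min s1 s2)" "t : {0..1::real}"
  then show "(1 - t) *\<^sub>R x + t *\<^sub>R y : K1 \<union> K2"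
   using s1(2)[of x y t] s2(2)[of x y t] by auto
 qed (use s1 s2 in simp)
 then show ?thesis using c1 c2 eE by blast
qed

subsection \<open>Size and shape\<close>

lemma cone_height:
 assumes c: "cone_over K u F a b"
 shows "a \<bullet> u - b <= diameter K" and "!!x r. 0 <= r ==> cball x r \<subseteq> K ==> 2 * r <= a \<bullet> u - b"
proof -
 note D = cone_over_D[OF c]
 obtain f where f: "f : F" using D(5) by blast
 have "a \<bullet> u - b = a \<bullet> (u - f)" using D(11)[OF f] by (simp add: inner_diff_right)
 also have "... <= \<bar>a \<bullet> (u - f)\<bar>" by simp
 also have "... <= norm a * norm (u - f)" by (rule Cauchy_Schwarz_ineq2)
 also have "... <= diameter K"
  using diameter_bounded_bound[OF compact_imp_bounded[OF D(1)] D(9), of f] f D(6,10) by (auto simp: dist_norm)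
 finally show "a \<bullet> u - b <= diameter K" .
 fix x r assume r: "0 <= r" and sub: "cball x r \<subseteq> K"
 have top: "a \<bullet> y <= a \<bullet> u" if "y : K" for y
  using cone_over_decomp[OF c that] D(8) by (auto simp: divide_le_eq)
 have "x + r *\<^sub>R a : K" "x - r *\<^sub>R a : K" using sub r D(6) by (auto simp: dist_norm subset_iff)
 then have "a \<bullet> (x + r *\<^sub>R a) <= a \<bullet> u" "b <= a \<bullet> (x - r *\<^sub>R a)" using top cone_over_side[OF c] by blast+
 then show "2 * r <= a \<bullet> u - b" using D(6) by (simp add: inner_add_right inner_diff_right norm_eq_1)
qed

lemma inball_radius:
 fixes K :: "(real^'n) set"
 assumes K: "compact K" "interior K ~= {}"
 shows "0 < inball_diam K" "\<exists>x r. 0 < r & inball_diam K <= 4 * r & cball x r \<subseteq> K"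
proof -
 let ?S = "{diameter (cball x r) | x r. cball x r \<subseteq> K}"
 have bd: "bdd_above ?S"
 proof (rule bdd_aboveI[of _ "diameter K"])
  fix d assume "d : ?S"
  then obtain x r where xr: "d = diameter (cball x r)" "cball x r \<subseteq> K" by blast
  show "d <= diameter K" unfolding xr(1) by (rule diameter_subset[OF xr(2) compact_imp_bounded[OF K(1)]])
 qed
 obtain x r where xr: "0 < r" "cball x r \<subseteq> K"
  using K(2) mem_interior_cball by blast
 have "2 * r : ?S"
 proof -
  have "diameter (cball x r) = 2 * r" using xr(1) by (simp add: diameter_cball)
  then show ?thesis using xr(2) by (metis (mono_tags, lifting) mem_Collect_eq)
 qed
 then have "2 * r <= inball_diam K" unfolding inball_diam_def using bd by (rule cSup_upper)
 then show pos: "0 < inball_diam K" using xr(1) by simp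
 have "inball_diam K / 2 < Sup ?S" using pos by (simp add: inball_diam_def)
 then obtain d where d: "d : ?S" "inball_diam K / 2 < d"
  using less_cSup_iff[OF _ bd] \<open>2 * r : ?S\<close> by blast
 then obtain y s where ys: "cball y s \<subseteq> K" "inball_diam K / 2 < diameter (cball y s)" by blast
 then have "0 < diameter (cball y s)" using pos by simp
 then have "0 < s" "diameter (cball y s) = 2 * s"
  by (auto simp: diameter_cball split: if_splits)
 then show "\<exists>x r. 0 < r & inball_diam K <= 4 * r & cball x r \<subseteq> K" using ys
  by (intro exI[of _ y] exI[of _ s]) auto
qed

section \<open>Slicing constant and surface integrals\<close>

definition slice_const :: "'n::finite itself => real" where
 "slice_const _ = (SOME c. c > 0 & (\<forall>(a::real^'n) b d F. norm a = 1 --> a \<bullet> d > 0 --> F : borel_measurable borel -->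
  ennreal (a \<bullet> d) * (\<integral>\<^sup>+x. \<integral>\<^sup>+t. F (x + t *\<^sub>R d) \<partial>lborel \<partial>hyperplane_measure a b)
   = ennreal c * (\<integral>\<^sup>+x. F x \<partial>lborel)))"

lemma slicing:
 shows slice_const_pos: "0 < slice_const TYPE('n::finite)"
  and slicing_eq: "norm (a::real^'n) = 1 ==> a \<bullet> d > 0 ==> F : borel_measurable borel ==>
   (\<integral>\<^sup>+x. \<integral>\<^sup>+t. F (x + t *\<^sub>R d) \<partial>lborel \<partial>hyperplane_measure a b)
   = ennreal (slice_const TYPE('n) / (a \<bullet> d)) * (\<integral>\<^sup>+x. F x \<partial>lborel)"
proof -
 have S: "0 < slice_const TYPE('n) & (\<forall>(a::real^'n) b d F. norm a = 1 --> a \<bullet> d > 0 --> F : borel_measurable borel -->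
  ennreal (a \<bullet> d) * (\<integral>\<^sup>+x. \<integral>\<^sup>+t. F (x + t *\<^sub>R d) \<partial>lborel \<partial>hyperplane_measure a b)
   = ennreal (slice_const TYPE('n)) * (\<integral>\<^sup>+x. F x \<partial>lborel))"
  unfolding slice_const_def using slicing_exists by (rule someI_ex)
 then show "0 < slice_const TYPE('n)" ..
 assume a: "norm a = 1" and ad: "a \<bullet> d > 0" and F: "F : borel_measurable borel"
 let ?X = "\<integral>\<^sup>+x. \<integral>\<^sup>+t. F (x + t *\<^sub>R d) \<partial>lborel \<partial>hyperplane_measure a b"
 have eq: "ennreal (a \<bullet> d) * ?X = ennreal (slice_const TYPE('n)) * (\<integral>\<^sup>+x. F x \<partial>lborel)"
  using S a ad F by blast
 have "?X = ennreal (1 / (a \<bullet> d) * (a \<bullet> d)) * ?X" using ad by simp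
 also have "... = ennreal (1 / (a \<bullet> d)) * (ennreal (a \<bullet> d) * ?X)"
  using ad by (subst ennreal_mult) (auto simp: mult.assoc)
 also have "... = ennreal (1 / (a \<bullet> d) * slice_const TYPE('n)) * (\<integral>\<^sup>+x. F x \<partial>lborel)"
  unfolding eq using ad S by (subst ennreal_mult) (auto simp: mult.assoc)
 finally show "?X = ennreal (slice_const TYPE('n) / (a \<bullet> d)) * (\<integral>\<^sup>+x. F x \<partial>lborel)" by simp
qed

definition surf_sq :: "(real^'n) set => (real^'n => real) => ennreal" where
 "surf_sq B f = (\<integral>\<^sup>+x. ennreal ((f x)^2) * indicator B x \<partial>hausdorff (CARD('n) - 1))"

lemma surf_sq_hyperplane:
 fixes f :: "real^'n => real"
 assumes [measurable]: "f : borel_measurable borel" "B : sets borel" and B: "!!x. x : B ==> a \<bullet> x = b"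
 shows "surf_sq B f = (\<integral>\<^sup>+x. ennreal ((f x)^2) * indicator B x \<partial>hyperplane_measure a b)"
proof -
 have "indicator {x. a \<bullet> x = b} x * (ennreal ((f x)^2) * indicator B x) = ennreal ((f x)^2) * indicator B x" for x
  using B by (auto simp: indicator_def)
 then show ?thesis unfolding surf_sq_def hyperplane_measure_def
  by (subst nn_integral_density) (auto simp: borel_measurable_indicator)
qed

definition grad_sq_int :: "(real^'n) set => (real^'n => real) => ennreal" where
 "grad_sq_int K f = (\<integral>\<^sup>+x. ennreal ((norm (grad f x))^2) * indicator K x \<partial>lborel)"

section \<open>Trace inequality\<close>

lemma segment_trace:
 fixes f :: "real^'n => real" and N :: real
 assumes sm: "smooth f" and N: "1 <= N"
 shows "ennreal ((f e)^2) <= (\<integral>\<^sup>+s. ennreal ((N + 1) * (f (e + s *\<^sub>R d))^2 + (norm d)^2 * (norm (grad f (e + s *\<^sub>R d)))^2) * indicator {0..1/N} s \<partial>lborel)"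
proof -
 have [measurable]: "f : borel_measurable borel" "grad f : borel_measurable borel"
  using sm by (auto intro: smooth_borel grad_borel)
 let ?p = "%s::real. e + s *\<^sub>R d"
 let ?G = "%s. (1 - N * s) * (f (?p s))^2"
 let ?g = "%s. (1 - N * s) * (2 * f (?p s) * (grad f (?p s) \<bullet> d)) - N * (f (?p s))^2"
 let ?R = "%s. (N + 1) * (f (?p s))^2 + (norm d)^2 * (norm (grad f (?p s)))^2"
 have df: "((%s. f (?p s)) has_real_derivative (grad f (?p s) \<bullet> d)) (at s)" for s
 proof -
  have "(?p has_derivative (%t. t *\<^sub>R d)) (at s)" by (auto intro!: derivative_eq_intros)
  from has_derivative_compose[OF this smooth_has_derivative[OF sm]]
  show ?thesis unfolding has_field_derivative_def by (simp add: mult_commute_abs)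
 qed
 have cont_p: "continuous_on UNIV ?p" by (intro continuous_intros)
 have cf: "continuous_on UNIV (%s. f (?p s))"
  by (rule continuous_on_compose2[OF smooth_continuous[OF sm, of UNIV] cont_p]) auto
 have cg: "continuous_on UNIV (%s. grad f (?p s))"
  by (rule continuous_on_compose2[OF continuous_grad[OF sm, of UNIV] cont_p]) auto
 have cgg: "continuous_on UNIV ?g" by (intro continuous_intros cf cg)
 have hb: "has_bochner_integral lborel (%s. ?g s * indicator {0..1/N} s) (?G (1/N) - ?G 0)"
 proof (rule has_bochner_integral_FTC_Icc_real)
  show "(?G has_real_derivative ?g s) (at s)" for s
   by (auto intro!: derivative_eq_intros df simp: power2_eq_square algebra_simps)
  show "isCont ?g s" for s using cgg by (simp add: continuous_on_eq_continuous_at)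
 qed (use N in simp)
 have iR: "integrable lborel (%s. ?R s * indicator {0..1/N} s)"
 proof -
  have "integrable lborel (%s. indicator {0..1/N} s *\<^sub>R ?R s)"
   by (intro borel_integrable_compact continuous_intros continuous_on_subset[OF cf] continuous_on_subset[OF cg]) auto
  then show ?thesis by (simp add: mult.commute)
 qed
 have R0: "0 <= ?R s" for s using N by simp
 have "(f e)^2 = - (?G (1/N) - ?G 0)" using N by simp
 also have "... = (\<integral>s. - (?g s * indicator {0..1/N} s) \<partial>lborel)"
  using has_bochner_integral_integral_eq[OF hb] by simp
 also have "... <= (\<integral>s. ?R s * indicator {0..1/N} s \<partial>lborel)"
 proof (rule integral_mono[OF _ iR])
  show "integrable lborel (%s. - (?g s * indicator {0..1/N} s))"
   using conjunct1[OF hb[unfolded has_bochner_integral_iff]] by simp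
  fix s
  show "- (?g s * indicator {0..1/N} s) <= ?R s * indicator {0..1/N} s"
  proof (cases "s : {0..1/N}")
   case True
   have w: "0 <= 1 - N * s" "1 - N * s <= 1" using True N by (auto simp: field_simps)
   let ?x = "\<bar>f (?p s)\<bar>" and ?y = "norm (grad f (?p s)) * norm d"
   have "\<bar>f (?p s) * (grad f (?p s) \<bullet> d)\<bar> <= ?x * ?y"
    using Cauchy_Schwarz_ineq2[of "grad f (?p s)" d] by (simp add: abs_mult mult_left_mono)
   moreover have "0 <= (?x - ?y)^2" by simp
   then have "2 * (?x * ?y) <= ?x^2 + ?y^2" by (simp add: power2_diff)
   ultimately have "2 * \<bar>f (?p s) * (grad f (?p s) \<bullet> d)\<bar> <= ?x^2 + ?y^2" by linarith
   moreover have "\<bar>(1 - N * s) * (2 * (f (?p s) * (grad f (?p s) \<bullet> d)))\<bar> <= 1 * (2 * \<bar>f (?p s) * (grad f (?p s) \<bullet> d)\<bar>)"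
    unfolding abs_mult using w by (intro mult_mono) auto
   ultimately have "- ((1 - N * s) * (2 * (f (?p s) * (grad f (?p s) \<bullet> d)))) <= ?x^2 + ?y^2" by linarith
   then have "- ?g s <= ?R s" by (simp add: power_mult_distrib mult.assoc algebra_simps)
   then show ?thesis using True by simp
  qed simp
 qed
 finally have le: "(f e)^2 <= (\<integral>s. ?R s * indicator {0..1/N} s \<partial>lborel)" .
 have "ennreal ((f e)^2) <= ennreal (\<integral>s. ?R s * indicator {0..1/N} s \<partial>lborel)" by (rule ennreal_leI[OF le])
 also have "... = (\<integral>\<^sup>+s. ennreal (?R s * indicator {0..1/N} s) \<partial>lborel)"
  by (rule nn_integral_eq_integral[symmetric, OF iR]) (use R0 in auto)
 also have "... = (\<integral>\<^sup>+s. ennreal (?R s) * indicator {0..1/N} s \<partial>lborel)"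
  by (intro nn_integral_cong) (auto simp: indicator_def)
 finally show ?thesis .
qed

text \<open>Some barycentric coordinate of a point of the facet is at least \<open>1 / n\<close>; it can be traded for weight at
  the opposite vertex. This splits the facet into finitely many pieces from each of which
  one fixed direction leads into the simplex, so that slicing applies.\<close>

lemma facet_pieces:
 fixes S :: "(real^'n) set"
 assumes S: "finite S" "card S = N" "0 < N" and e: "e : convex hull S"
 shows "\<exists>v\<in>S. e + (1 / real N) *\<^sub>R (u - v) : convex hull (insert u S)"
proof -
 obtain l where l: "\<forall>x\<in>S. 0 <= l x" "sum l S = 1" "(\<Sum>x\<in>S. l x *\<^sub>R x) = e"
  using e unfolding convex_hull_finite[OF S(1)] by blast
 have "\<exists>v\<in>S. 1 / real N <= l v"
 proof (rule ccontr)
  assume "\<not> (\<exists>v\<in>S. 1 / real N <= l v)"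
  then have lt: "!!v. v : S ==> l v < 1 / real N" by force
  have "S ~= {}" using S by auto
  then have "sum l S < (\<Sum>v\<in>S. 1 / real N)" using lt S(1) by (intro sum_strict_mono) auto
  also have "... = 1" using S by simp
  finally show False using l(2) by simp
 qed
 then obtain v where v: "v : S" "1 / real N <= l v" by blast
 define m where "m x = (if x = v then l v - 1 / real N else l x)" for x
 have m0: "0 <= m x" if "x : S" for x using l(1) v that by (auto simp: m_def)
 have S': "S = insert v (S - {v})" using v by blast
 have "sum l S = l v + sum l (S - {v})" using S(1) v(1) by (rule sum.remove)
 moreover have "sum m S = m v + sum m (S - {v})" using S(1) v(1) by (rule sum.remove)
 moreover have "sum m (S - {v}) = sum l (S - {v})" by (rule sum.cong) (auto simp: m_def)
 ultimately have sm: "sum m S = 1 - 1 / real N" using l(2) by (simp add: m_def)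
 have "(\<Sum>x\<in>S. l x *\<^sub>R x) = l v *\<^sub>R v + (\<Sum>x\<in>S - {v}. l x *\<^sub>R x)" using S(1) v(1) by (rule sum.remove)
 moreover have "(\<Sum>x\<in>S. m x *\<^sub>R x) = m v *\<^sub>R v + (\<Sum>x\<in>S - {v}. m x *\<^sub>R x)" using S(1) v(1) by (rule sum.remove)
 moreover have "(\<Sum>x\<in>S - {v}. m x *\<^sub>R x) = (\<Sum>x\<in>S - {v}. l x *\<^sub>R x)" by (rule sum.cong) (auto simp: m_def)
 ultimately have mv: "(\<Sum>x\<in>S. m x *\<^sub>R x) = e - (1 / real N) *\<^sub>R v" using l(3) by (simp add: m_def algebra_simps)
 show ?thesis
 proof (cases "N = 1")
  case True
  then have "S = {v}" using S v by (metis card_1_singletonE singletonD)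
  then have "e = v" using e by simp
  then have "e + (1 / real N) *\<^sub>R (u - v) = u" using True by simp
  then show ?thesis using v(1) hull_inc[of u "insert u S" convex] by (intro bexI[of _ v]) auto
 next
  case False
  then have N: "1 < real N" using S by simp
  define q where "q = 1 - 1 / real N"
  have q: "0 < q" using N by (simp add: q_def)
  have "(\<Sum>x\<in>S. (m x / q) *\<^sub>R x) : convex hull S"
   unfolding convex_hull_finite[OF S(1)]
  proof (intro CollectI exI conjI ballI)
   show "0 <= m x / q" if "x : S" for x using m0[OF that] q by simp
   show "sum (%x. m x / q) S = 1" unfolding sum_divide_distrib[symmetric] sm q_def[symmetric] using q by simp
  qed simp
  then have w: "(\<Sum>x\<in>S. (m x / q) *\<^sub>R x) : convex hull (insert u S)"
   using hull_mono[of S "insert u S" convex] by blast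
  have u: "u : convex hull (insert u S)" by (rule hull_inc) simp
  have "q *\<^sub>R (\<Sum>x\<in>S. (m x / q) *\<^sub>R x) + (1 / real N) *\<^sub>R u : convex hull (insert u S)"
   using q N by (intro convexD[OF convex_convex_hull w u]) (auto simp: q_def)
  moreover have "q *\<^sub>R (\<Sum>x\<in>S. (m x / q) *\<^sub>R x) = e - (1 / real N) *\<^sub>R v"
   using q by (simp add: scaleR_sum_right mv)
  ultimately have "e + (1 / real N) *\<^sub>R (u - v) : convex hull (insert u S)"
   by (simp add: algebra_simps)
  then show ?thesis using v(1) by blast
 qed
qed

text \<open>On each piece of the facet integrate \<open>segment_trace\<close> along the direction that leads into the simplex.\<close>

theorem trace_inequality:
 fixes K F :: "(real^'n) set"
 assumes c: "cone_over K u F a b" and S: "finite S" "card S = CARD('n)" "F = convex hull S" "K = convex hull (insert u S)"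
  and sm: "smooth f"
 shows "surf_sq F f <= ennreal (real CARD('n) * slice_const TYPE('n) / (a \<bullet> u - b)) *
  (ennreal (real CARD('n) + 1) * sq_int K f + ennreal ((diameter K)^2) * grad_sq_int K f)"
proof -
 note D = cone_over_D[OF c]
 define N where "N = real CARD('n)"
 have N: "1 <= N" by (simp add: N_def Suc_le_eq)
 define h where "h = diameter K"
 define \<eta> where "\<eta> = a \<bullet> u - b"
 have \<eta>: "0 < \<eta>" using D(8) by (simp add: \<eta>_def)
 define C where "C = slice_const TYPE('n)"
 have C: "0 < C" unfolding C_def by (rule slice_const_pos)
 have [measurable]: "f : borel_measurable borel" "grad f : borel_measurable borel" "K : sets borel"
  using sm D(1) by (auto intro: smooth_borel grad_borel borel_closed compact_imp_closed)
 define P where "P v = F \<inter> {e. e + (1 / N) *\<^sub>R (u - v) : K}" for v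
 have cP: "closed (P v)" for v
 proof -
  have "closed ((%e. e + (1 / N) *\<^sub>R (u - v)) -` K)"
   by (intro closed_vimage compact_imp_closed D(1) continuous_intros)
  from closed_Int[OF compact_imp_closed[OF D(4)] this] show ?thesis by (simp add: P_def vimage_def)
 qed
 then have [measurable]: "P v : sets borel" for v by (rule borel_closed)
 define G where "G x = ennreal ((N + 1) * (f x)^2 + h^2 * (norm (grad f x))^2) * indicator K x" for x
 have [measurable]: "G : borel_measurable borel" unfolding G_def by measurable
 have GI: "(\<integral>\<^sup>+x. G x \<partial>lborel) = ennreal (N + 1) * sq_int K f + ennreal (h^2) * grad_sq_int K f"
 proof -
  have "(\<integral>\<^sup>+x. G x \<partial>lborel) = (\<integral>\<^sup>+x. ennreal (N + 1) * (ennreal ((f x)^2) * indicator K x) + ennreal (h^2) * (ennreal ((norm (grad f x))^2) * indicator K x) \<partial>lborel)"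
   using N by (intro nn_integral_cong) (auto simp: G_def indicator_def ennreal_mult[symmetric] ennreal_plus[symmetric] simp del: ennreal_plus)
  also have "... = ennreal (N + 1) * sq_int K f + ennreal (h^2) * grad_sq_int K f"
   unfolding sq_int_def grad_sq_int_def by (subst nn_integral_add) (auto simp: nn_integral_cmult)
  finally show ?thesis .
 qed
 have piece: "surf_sq (P v) f <= ennreal (C / \<eta>) * (\<integral>\<^sup>+x. G x \<partial>lborel)" if v: "v : S" for v
 proof -
  have vF: "v : F" using v S(3) hull_inc by metis
  have au: "a \<bullet> (u - v) = \<eta>" using D(11)[OF vF] by (simp add: \<eta>_def inner_diff_right)
  have nd: "norm (u - v) <= h"
   using diameter_bounded_bound[OF compact_imp_bounded[OF D(1)] D(9), of v] vF D(10) by (auto simp: dist_norm h_def)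
  have "surf_sq (P v) f = (\<integral>\<^sup>+e. ennreal ((f e)^2) * indicator (P v) e \<partial>hyperplane_measure a b)"
  proof (rule surf_sq_hyperplane)
   show "!!x. x : P v ==> a \<bullet> x = b" by (auto simp: P_def D(11))
  qed measurable
  also have "... <= (\<integral>\<^sup>+e. \<integral>\<^sup>+s. G (e + s *\<^sub>R (u - v)) \<partial>lborel \<partial>hyperplane_measure a b)"
  proof (rule nn_integral_mono)
   fix e
   show "ennreal ((f e)^2) * indicator (P v) e <= (\<integral>\<^sup>+s. G (e + s *\<^sub>R (u - v)) \<partial>lborel)"
   proof (cases "e : P v")
    case True
    then have eK: "e : K" "e + (1 / N) *\<^sub>R (u - v) : K" using D(10) by (auto simp: P_def)
    have inK: "e + s *\<^sub>R (u - v) : K" if s: "s : {0..1/N}" for s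
    proof -
     have "(1 - N * s) *\<^sub>R e + (N * s) *\<^sub>R (e + (1 / N) *\<^sub>R (u - v)) : K"
      using s N by (intro convexD[OF D(2) eK]) (auto simp: field_simps)
     moreover have "(1 - N * s) *\<^sub>R e + (N * s) *\<^sub>R (e + (1 / N) *\<^sub>R (u - v)) = e + s *\<^sub>R (u - v)"
      using N by (simp add: algebra_simps)
     ultimately show ?thesis by simp
    qed
    have "ennreal ((f e)^2) <= (\<integral>\<^sup>+s. ennreal ((N + 1) * (f (e + s *\<^sub>R (u - v)))^2 + (norm (u - v))^2 * (norm (grad f (e + s *\<^sub>R (u - v))))^2) * indicator {0..1/N} s \<partial>lborel)"
     by (rule segment_trace[OF sm N])
    also have "... <= (\<integral>\<^sup>+s. G (e + s *\<^sub>R (u - v)) \<partial>lborel)"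
    proof (rule nn_integral_mono)
     fix s
     have "(norm (u - v))^2 * (norm (grad f (e + s *\<^sub>R (u - v))))^2 <= h^2 * (norm (grad f (e + s *\<^sub>R (u - v))))^2"
      by (intro mult_right_mono power_mono nd) auto
     then have "ennreal ((N + 1) * (f (e + s *\<^sub>R (u - v)))^2 + (norm (u - v))^2 * (norm (grad f (e + s *\<^sub>R (u - v))))^2)
      <= ennreal ((N + 1) * (f (e + s *\<^sub>R (u - v)))^2 + h^2 * (norm (grad f (e + s *\<^sub>R (u - v))))^2)"
      by (intro ennreal_leI) linarith
     then show "ennreal ((N + 1) * (f (e + s *\<^sub>R (u - v)))^2 + (norm (u - v))^2 * (norm (grad f (e + s *\<^sub>R (u - v))))^2) * indicator {0..1/N} s
      <= G (e + s *\<^sub>R (u - v))"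
      using inK[of s] by (auto simp: G_def indicator_def)
    qed
    finally show ?thesis using True by simp
   qed simp
  qed
  also have "... = ennreal (C / \<eta>) * (\<integral>\<^sup>+x. G x \<partial>lborel)"
   using slicing_eq[OF D(6), of "u - v" G b] au \<eta> by (simp add: C_def)
  finally show ?thesis .
 qed
 have "surf_sq F f <= (\<integral>\<^sup>+e. (\<Sum>v\<in>S. ennreal ((f e)^2) * indicator (P v) e) \<partial>hausdorff (CARD('n) - 1))"
  unfolding surf_sq_def
 proof (rule nn_integral_mono)
  fix e
  show "ennreal ((f e)^2) * indicator F e <= (\<Sum>v\<in>S. ennreal ((f e)^2) * indicator (P v) e)"
  proof (cases "e : F")
   case True
   obtain v where v: "v : S" "e + (1 / N) *\<^sub>R (u - v) : K"
    using facet_pieces[OF S(1,2), of e u] True S(3,4) by (auto simp: N_def)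
   then have "ennreal ((f e)^2) * indicator F e = ennreal ((f e)^2) * indicator (P v) e"
    using True by (simp add: P_def)
   also have "... <= (\<Sum>v\<in>S. ennreal ((f e)^2) * indicator (P v) e)"
    using S(1) v(1) by (intro member_le_sum) auto
   finally show ?thesis .
  qed simp
 qed
 also have "... = (\<Sum>v\<in>S. surf_sq (P v) f)"
  unfolding surf_sq_def by (rule nn_integral_sum) measurable
 also have "... <= (\<Sum>v\<in>S. ennreal (C / \<eta>) * (\<integral>\<^sup>+x. G x \<partial>lborel))" by (intro sum_mono piece)
 also have "... = ennreal N * (ennreal (C / \<eta>) * (\<integral>\<^sup>+x. G x \<partial>lborel))"
  using S(2) by (simp add: N_def ennreal_of_nat_eq_real_of_nat)
 also have "... = ennreal (N * C / \<eta>) * (\<integral>\<^sup>+x. G x \<partial>lborel)"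
  using N C \<eta> by (simp add: mult.assoc[symmetric] ennreal_mult[symmetric])
 finally show ?thesis by (simp add: GI N_def C_def \<eta>_def h_def)
qed

section \<open>Poincare inequality\<close>

lemma segment_difference:
 fixes f :: "real^'n => real"
 assumes sm: "smooth f" and h: "norm (x - y) <= h"
 shows "ennreal ((f x - f y)^2) <= ennreal (h^2) * (\<integral>\<^sup>+t. ennreal ((norm (grad f ((1 - t) *\<^sub>R y + t *\<^sub>R x)))^2) * indicator {0..1} t \<partial>lborel)"
proof -
 let ?p = "%t::real. y + t *\<^sub>R (x - y)"
 have p: "(1 - t) *\<^sub>R y + t *\<^sub>R x = ?p t" for t by (simp add: algebra_simps)
 have [measurable]: "f : borel_measurable borel" "grad f : borel_measurable borel"
  using sm by (auto intro: smooth_borel grad_borel)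
 have df: "((%s. f (?p s)) has_real_derivative (grad f (?p s) \<bullet> (x - y))) (at s)" for s
 proof -
  have "(?p has_derivative (%t. t *\<^sub>R (x - y))) (at s)" by (auto intro!: derivative_eq_intros)
  from has_derivative_compose[OF this smooth_has_derivative[OF sm]]
  show ?thesis unfolding has_field_derivative_def by (simp add: mult_commute_abs)
 qed
 have cont_p: "continuous_on UNIV ?p" by (intro continuous_intros)
 have cg: "continuous_on UNIV (%s. grad f (?p s))"
  by (rule continuous_on_compose2[OF continuous_grad[OF sm, of UNIV] cont_p]) auto
 have cgg: "continuous_on UNIV (%s. grad f (?p s) \<bullet> (x - y))" by (intro continuous_intros cg)
 have hb: "has_bochner_integral lborel (%s. (grad f (?p s) \<bullet> (x - y)) * indicator {0..1} s) (f (?p 1) - f (?p 0))"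
  by (rule has_bochner_integral_FTC_Icc_real) (use df cgg in \<open>auto simp: continuous_on_eq_continuous_at\<close>)
 let ?k = "indicator {0..1} :: real => real"
 have e: "f x - f y = (\<integral>s. ?k s * (grad f (?p s) \<bullet> (x - y)) \<partial>lborel)"
  using has_bochner_integral_integral_eq[OF hb] by (simp add: mult.commute)
 have "ennreal ((f x - f y)^2) <= (\<integral>\<^sup>+s. ennreal (?k s * (grad f (?p s) \<bullet> (x - y))^2) \<partial>lborel)"
  unfolding e
 proof (rule prob_square_le)
  show "integrable lborel ?k" by (intro integrable_real_indicator) auto
  show "integrable lborel (%s. ?k s * (grad f (?p s) \<bullet> (x - y)))"
   using conjunct1[OF hb[unfolded has_bochner_integral_iff]] by (simp add: mult.commute)
 qed auto
 also have "... <= (\<integral>\<^sup>+s. ennreal (h^2) * (ennreal ((norm (grad f (?p s)))^2) * indicator {0..1} s) \<partial>lborel)"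
 proof (rule nn_integral_mono)
  fix s
  have "\<bar>grad f (?p s) \<bullet> (x - y)\<bar> <= norm (grad f (?p s)) * h"
   using Cauchy_Schwarz_ineq2[of "grad f (?p s)" "x - y"] mult_left_mono[OF h norm_ge_zero[of "grad f (?p s)"]] by linarith
  then have "\<bar>grad f (?p s) \<bullet> (x - y)\<bar>\<^sup>2 <= (norm (grad f (?p s)) * h)^2" by (rule power_mono) simp
  then have "(grad f (?p s) \<bullet> (x - y))^2 <= h^2 * (norm (grad f (?p s)))^2" by (simp add: power_mult_distrib mult.commute)
  then have "ennreal ((grad f (?p s) \<bullet> (x - y))^2) <= ennreal (h^2) * ennreal ((norm (grad f (?p s)))^2)"
   by (subst ennreal_mult[symmetric]) (auto intro: ennreal_leI)
  then show "ennreal (?k s * (grad f (?p s) \<bullet> (x - y))^2) <= ennreal (h^2) * (ennreal ((norm (grad f (?p s)))^2) * indicator {0..1} s)"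
   by (auto simp: indicator_def)
 qed
 also have "... = ennreal (h^2) * (\<integral>\<^sup>+s. ennreal ((norm (grad f (?p s)))^2) * indicator {0..1} s \<partial>lborel)"
  by (rule nn_integral_cmult) measurable
 finally show ?thesis unfolding p .
qed

text \<open>Joining all pairs of points of a convex set by segments: of the two ends of the segment through a point at
  parameter \<open>t\<close>, the one with weight at least one half is used as integration variable.\<close>

lemma segment_average:
 fixes g :: "real^'n => ennreal"
 assumes g [measurable]: "g : borel_measurable borel" and K [measurable]: "K : sets borel" and cv: "convex K" and t: "t : {0..1}"
 shows "(\<integral>\<^sup>+x. (\<integral>\<^sup>+y. g ((1 - t) *\<^sub>R y + t *\<^sub>R x) * indicator K y * indicator K x \<partial>lborel) \<partial>lborel)
  <= ennreal (2 ^ CARD('n)) * (\<integral>\<^sup>+x. g x * indicator K x \<partial>lborel) * emeasure lborel K"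
proof -
 have half: "(\<integral>\<^sup>+x. (\<integral>\<^sup>+y. g ((1 - t) *\<^sub>R y + t *\<^sub>R x) * indicator K y * indicator K x \<partial>lborel) \<partial>lborel)
  <= ennreal (2 ^ CARD('n)) * (\<integral>\<^sup>+x. g x * indicator K x \<partial>lborel) * emeasure lborel K" if t: "0 <= t" "t <= 1/2" for t
 proof -
  have "(\<integral>\<^sup>+x. (\<integral>\<^sup>+y. g ((1 - t) *\<^sub>R y + t *\<^sub>R x) * indicator K y * indicator K x \<partial>lborel) \<partial>lborel)
   <= (\<integral>\<^sup>+x. ennreal (2 ^ CARD('n)) * (\<integral>\<^sup>+y. g y * indicator K y \<partial>lborel) * indicator K x \<partial>lborel)"
  proof (rule nn_integral_mono)
   fix x
   show "(\<integral>\<^sup>+y. g ((1 - t) *\<^sub>R y + t *\<^sub>R x) * indicator K y * indicator K x \<partial>lborel)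
    <= ennreal (2 ^ CARD('n)) * (\<integral>\<^sup>+y. g y * indicator K y \<partial>lborel) * indicator K x"
   proof (cases "x : K")
    case True
    have "(\<integral>\<^sup>+y. g ((1 - t) *\<^sub>R y + t *\<^sub>R x) * indicator K y \<partial>lborel) <= ennreal (2 ^ CARD('n)) * (\<integral>\<^sup>+y. g y * indicator K y \<partial>lborel)"
     by (rule nn_integral_contraction[OF g K t]) (use t True in \<open>auto intro!: convexD[OF cv]\<close>)
    then show ?thesis using True by simp
   qed simp
  qed
  also have "... = ennreal (2 ^ CARD('n)) * (\<integral>\<^sup>+x. g x * indicator K x \<partial>lborel) * emeasure lborel K"
   by (subst nn_integral_cmult) auto
  finally show ?thesis .
 qed
 show ?thesis
 proof (cases "t <= 1/2")
  case True then show ?thesis using half[of t] t by simp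
 next
  case False
  have "(\<integral>\<^sup>+x. (\<integral>\<^sup>+y. g ((1 - t) *\<^sub>R y + t *\<^sub>R x) * indicator K y * indicator K x \<partial>lborel) \<partial>lborel)
   = (\<integral>\<^sup>+y. (\<integral>\<^sup>+x. g ((1 - t) *\<^sub>R y + t *\<^sub>R x) * indicator K y * indicator K x \<partial>lborel) \<partial>lborel)"
   by (rule lborel_pair.Fubini') measurable
  also have "... = (\<integral>\<^sup>+x. (\<integral>\<^sup>+y. g ((1 - (1 - t)) *\<^sub>R y + (1 - t) *\<^sub>R x) * indicator K y * indicator K x \<partial>lborel) \<partial>lborel)"
   by (intro nn_integral_cong) (simp add: mult_ac add.commute)
  also have "... <= ennreal (2 ^ CARD('n)) * (\<integral>\<^sup>+x. g x * indicator K x \<partial>lborel) * emeasure lborel K"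
   by (rule half) (use False t in auto)
  finally show ?thesis .
 qed
qed

text \<open>Integrate the gradient along the segment that joins two points, and average over all pairs of points.\<close>

theorem poincare_inequality:
 fixes K :: "(real^'n) set"
 assumes K: "compact K" "convex K" "interior K ~= {}" and sm: "smooth f"
 shows "\<exists>m. sq_int K (%x. f x - m) <= ennreal ((diameter K)^2 * 2 ^ CARD('n)) * grad_sq_int K f"
proof -
 define h where "h = diameter K"
 define V where "V = measure lborel K"
 have [measurable]: "f : borel_measurable borel" "grad f : borel_measurable borel" "K : sets borel"
  using sm K(1) by (auto intro: smooth_borel grad_borel borel_closed compact_imp_closed)
 have finK: "emeasure lborel K < \<infinity>" by (rule emeasure_bounded_finite[OF compact_imp_bounded[OF K(1)]])
 then have eV: "emeasure lborel K = ennreal V" by (simp add: V_def emeasure_eq_ennreal_measure)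
 have V: "0 < V"
 proof -
  obtain x r where xr: "0 < r" "cball x r \<subseteq> K" using K(3) mem_interior_cball by blast
  have "0 < emeasure lborel (cball x r)" using xr(1) by (simp add: emeasure_cball ennreal_zero_less_mult_iff)
  also have "... <= emeasure lborel K" by (intro emeasure_mono xr) auto
  finally show ?thesis unfolding eV by simp
 qed
 define k where "k y = indicator K y / V" for y
 have ik: "integrable lborel k"
  unfolding k_def by (intro integrable_divide integrable_real_indicator finK) auto
 have k1: "(\<integral>y. k y \<partial>lborel) = 1" using V by (simp add: k_def V_def)
 have ikf: "integrable lborel (%y. k y * f y)"
 proof -
  have "integrable lborel (%y. indicator K y *\<^sub>R f y)"
   by (intro borel_integrable_compact K(1) smooth_continuous sm)
  then have "integrable lborel (%y. (indicator K y *\<^sub>R f y) / V)" by (rule integrable_divide)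
  then show ?thesis by (simp add: k_def)
 qed
 define m where "m = (\<integral>y. k y * f y \<partial>lborel)"
 define g where "g x = ennreal ((norm (grad f x))^2)" for x
 have [measurable]: "g : borel_measurable borel" "k : borel_measurable borel" unfolding g_def k_def by measurable
 have k0: "0 <= k y" for y using V by (simp add: k_def)
 have pt: "ennreal ((f x - m)^2) <= (\<integral>\<^sup>+y. ennreal (k y * (f x - f y)^2) \<partial>lborel)" for x
 proof -
  have ii: "integrable lborel (%y. k y * (f x - f y))" unfolding right_diff_distrib using ik ikf by simp
  have "f x - m = (\<integral>y. k y * (f x - f y) \<partial>lborel)"
   unfolding right_diff_distrib m_def using ik ikf k1 by simp
  then show ?thesis using prob_square_le[OF ik k0 k1 ii] by simp
 qed
 have diff: "ennreal (k y * (f x - f y)^2) * indicator K x \<le>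
   ennreal (h^2 / V) * (\<integral>\<^sup>+t. g ((1 - t) *\<^sub>R y + t *\<^sub>R x) * indicator K y * indicator K x * indicator {0..1} t \<partial>lborel)" for x y
 proof (cases "x : K & y : K")
  case True
  then have "norm (x - y) <= h"
   using diameter_bounded_bound[OF compact_imp_bounded[OF K(1)], of x y] by (simp add: h_def dist_norm)
  from segment_difference[OF sm this]
  have sd: "ennreal ((f x - f y)^2) <= ennreal (h^2) * (\<integral>\<^sup>+t. g ((1 - t) *\<^sub>R y + t *\<^sub>R x) * indicator {0..1} t \<partial>lborel)"
   by (simp add: g_def)
  have "ennreal (k y * (f x - f y)^2) * indicator K x = ennreal (1 / V) * ennreal ((f x - f y)^2)"
   using True V by (simp add: k_def ennreal_mult[symmetric])
  also have "... <= ennreal (1 / V) * (ennreal (h^2) * (\<integral>\<^sup>+t. g ((1 - t) *\<^sub>R y + t *\<^sub>R x) * indicator {0..1} t \<partial>lborel))"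
   by (intro mult_left_mono sd) simp
  also have "... = ennreal (h^2 / V) * (\<integral>\<^sup>+t. g ((1 - t) *\<^sub>R y + t *\<^sub>R x) * indicator {0..1} t \<partial>lborel)"
   using V by (simp add: mult.assoc[symmetric] ennreal_mult[symmetric])
  finally show ?thesis using True by simp
 next
  case False
  then show ?thesis by (auto simp: k_def)
 qed
 have "sq_int K (%x. f x - m) <= (\<integral>\<^sup>+x. (\<integral>\<^sup>+y. ennreal (k y * (f x - f y)^2) * indicator K x \<partial>lborel) \<partial>lborel)"
  unfolding sq_int_def
 proof (rule nn_integral_mono)
  fix x
  show "ennreal ((f x - m)^2) * indicator K x <= (\<integral>\<^sup>+y. ennreal (k y * (f x - f y)^2) * indicator K x \<partial>lborel)"
   using pt[of x] by (subst nn_integral_multc) (auto intro: mult_right_mono)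
 qed
 also have "... <= (\<integral>\<^sup>+x. (\<integral>\<^sup>+y. ennreal (h^2 / V) * (\<integral>\<^sup>+t. g ((1 - t) *\<^sub>R y + t *\<^sub>R x) * indicator K y * indicator K x * indicator {0..1} t \<partial>lborel) \<partial>lborel) \<partial>lborel)"
  by (intro nn_integral_mono diff)
 also have "... = ennreal (h^2 / V) * (\<integral>\<^sup>+x. (\<integral>\<^sup>+y. (\<integral>\<^sup>+t. g ((1 - t) *\<^sub>R y + t *\<^sub>R x) * indicator K y * indicator K x * indicator {0..1::real} t \<partial>lborel) \<partial>lborel) \<partial>lborel)"
  by (simp add: nn_integral_cmult)
 also have "(\<integral>\<^sup>+x. (\<integral>\<^sup>+y. (\<integral>\<^sup>+t. g ((1 - t) *\<^sub>R y + t *\<^sub>R x) * indicator K y * indicator K x * indicator {0..1::real} t \<partial>lborel) \<partial>lborel) \<partial>lborel)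
  = (\<integral>\<^sup>+x. (\<integral>\<^sup>+t. (\<integral>\<^sup>+y. g ((1 - t) *\<^sub>R y + t *\<^sub>R x) * indicator K y * indicator K x * indicator {0..1::real} t \<partial>lborel) \<partial>lborel) \<partial>lborel)"
  by (intro nn_integral_cong lborel_pair.Fubini') measurable
 also have "... = (\<integral>\<^sup>+t. (\<integral>\<^sup>+x. (\<integral>\<^sup>+y. g ((1 - t) *\<^sub>R y + t *\<^sub>R x) * indicator K y * indicator K x * indicator {0..1::real} t \<partial>lborel) \<partial>lborel) \<partial>lborel)"
  by (rule lborel_pair.Fubini') measurable
 also have "... <= (\<integral>\<^sup>+t. ennreal (2 ^ CARD('n)) * (\<integral>\<^sup>+x. g x * indicator K x \<partial>lborel) * emeasure lborel K * indicator {0..1::real} t \<partial>lborel)"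
 proof (rule nn_integral_mono)
  fix t :: real
  show "(\<integral>\<^sup>+x. (\<integral>\<^sup>+y. g ((1 - t) *\<^sub>R y + t *\<^sub>R x) * indicator K y * indicator K x * indicator {0..1} t \<partial>lborel) \<partial>lborel)
   <= ennreal (2 ^ CARD('n)) * (\<integral>\<^sup>+x. g x * indicator K x \<partial>lborel) * emeasure lborel K * indicator {0..1} t"
   using segment_average[of g K t] K(2) by (cases "t : {0..1}") auto
 qed
 also have "... = ennreal (2 ^ CARD('n)) * (\<integral>\<^sup>+x. g x * indicator K x \<partial>lborel) * emeasure lborel K"
  by (subst nn_integral_cmult) auto
 finally have "sq_int K (%x. f x - m) <= ennreal (h^2 / V) * (ennreal (2 ^ CARD('n)) * grad_sq_int K f * ennreal V)"
  by (simp add: mult_left_mono eV grad_sq_int_def g_def)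
 also have "... = ennreal (h^2 / V * 2 ^ CARD('n) * V) * grad_sq_int K f"
  using V by (simp only: ennreal_mult divide_nonneg_pos zero_le_power2 mult_nonneg_nonneg zero_le_power zero_le_numeral less_imp_le mult_ac)
 also have "h^2 / V * 2 ^ CARD('n) * V = h^2 * 2 ^ CARD('n)" using V by simp
 finally show ?thesis by (auto simp: h_def)
qed

section \<open>Extending a jump\<close>

text \<open>The extension is constant along lines parallel to \<open>u - e\<close>. Slicing along this direction leaves the integral
over the facet and a factor for the height.\<close>

lemma oblique_extension_bound:
 fixes K F :: "(real^'n) set"
 assumes c: "cone_over K u F a b" and e: "e : F" and q [measurable]: "q : borel_measurable borel"
 shows "sq_int K (%x. q (oblique u e a b x)) <= ennreal ((a \<bullet> u - b) / slice_const TYPE('n)) * surf_sq F q"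
proof -
 note D = cone_over_D[OF c]
 define \<eta> where "\<eta> = a \<bullet> u - b"
 have \<eta>: "0 < \<eta>" using D(8) by (simp add: \<eta>_def)
 define C where "C = slice_const TYPE('n)"
 have C: "0 < C" unfolding C_def by (rule slice_const_pos)
 have au: "a \<bullet> (u - e) = \<eta>" using D(11)[OF e] by (simp add: \<eta>_def inner_diff_right)
 have [measurable]: "K : sets borel" "F : sets borel" using D by (auto intro: borel_closed compact_imp_closed)
 have [measurable]: "oblique u e a b : borel_measurable borel"
  unfolding oblique_def[abs_def] by (intro borel_measurable_continuous_onI continuous_intros) (use \<eta> \<eta>_def in auto)
 define G where "G x = ennreal ((q (oblique u e a b x))^2) * indicator K x" for x
 have [measurable]: "G : borel_measurable borel" unfolding G_def by measurable
 have "ennreal (C / \<eta>) * sq_int K (%x. q (oblique u e a b x)) = (\<integral>\<^sup>+x. \<integral>\<^sup>+t. G (x + t *\<^sub>R (u - e)) \<partial>lborel \<partial>hyperplane_measure a b)"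
  using slicing_eq[OF D(6), of "u - e" G b] au \<eta> by (simp add: C_def sq_int_def G_def)
 also have "... <= (\<integral>\<^sup>+x. ennreal ((q x)^2) * indicator F x \<partial>hyperplane_measure a b)"
 proof (rule nn_integral_mono_AE)
  show "AE x in hyperplane_measure a b. (\<integral>\<^sup>+t. G (x + t *\<^sub>R (u - e)) \<partial>lborel) <= ennreal ((q x)^2) * indicator F x"
   using AE_hyperplane_measure[of a b]
  proof eventually_elim
   fix x assume x: "a \<bullet> x = b"
   have s: "(a \<bullet> (x + t *\<^sub>R (u - e)) - b) / (a \<bullet> u - b) = t" for t
    using x au \<eta> by (simp add: inner_add_right \<eta>_def)
   have o: "oblique u e a b (x + t *\<^sub>R (u - e)) = x" for t
    unfolding oblique_def s by simp
   have "G (x + t *\<^sub>R (u - e)) <= (ennreal ((q x)^2) * indicator F x) * indicator {0..1} t" for t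
   proof (cases "x + t *\<^sub>R (u - e) : K")
    case True
    have "x : F" using oblique_in_facet[OF c e True] by (simp add: o)
    moreover have "0 <= t" "t <= 1" using cone_over_decomp[OF c True] unfolding s by blast+
    ultimately show ?thesis using True by (simp add: G_def o)
   qed (simp add: G_def)
   then have "(\<integral>\<^sup>+t. G (x + t *\<^sub>R (u - e)) \<partial>lborel) <= (\<integral>\<^sup>+t. (ennreal ((q x)^2) * indicator F x) * indicator {0..1::real} t \<partial>lborel)"
    by (rule nn_integral_mono)
   also have "... = ennreal ((q x)^2) * indicator F x"
    by (subst nn_integral_cmult) auto
   finally show "(\<integral>\<^sup>+t. G (x + t *\<^sub>R (u - e)) \<partial>lborel) <= ennreal ((q x)^2) * indicator F x" .
  qed
 qed
 also have "... = surf_sq F q" by (rule surf_sq_hyperplane[symmetric]) (auto simp: D(11))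
 finally have "ennreal (\<eta> / C) * (ennreal (C / \<eta>) * sq_int K (%x. q (oblique u e a b x))) <= ennreal (\<eta> / C) * surf_sq F q"
  by (rule mult_left_mono) simp
 also have "ennreal (\<eta> / C) * (ennreal (C / \<eta>) * sq_int K (%x. q (oblique u e a b x))) = sq_int K (%x. q (oblique u e a b x))"
  using C \<eta> by (simp add: mult.assoc[symmetric] ennreal_mult[symmetric])
 finally show ?thesis by (simp add: \<eta>_def C_def)
qed

lemma oblique_poly:
 assumes "p : polys l"
 shows "(%x. p (oblique u e a b x)) : polys l"
proof (rule polys_affine_comp[OF assms])
 fix i
 have "(%x. oblique u e a b x $ i) = (%x. x $ i - ((\<Sum>j\<in>UNIV. a $ j * x $ j) - b) * ((u - e) $ i / (a \<bullet> u - b)))"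
  by (rule ext) (simp add: oblique_def inner_vec_def[of a])
 also have "... : polys (Suc 0)"
 proof -
  have "(%x. (\<Sum>j\<in>UNIV. a $ j * x $ j) - b) : polys (Suc 0)"
   by (rule polys_diff[OF polys_sum polys_const]) (simp_all add: polys_cmult polys_coord)
  from polys_diff[OF polys_coord polys_cmult[OF this, of "(u - e) $ i / (a \<bullet> u - b)"], of i]
  show ?thesis by (simp only: mult.commute)
 qed
 finally show "(%x. oblique u e a b x $ i) : polys (Suc 0)" .
qed

section \<open>Norms of smooth functions on a simplex\<close>

definition nsq :: "(real^'n) set => (real^'n => real) => real" where
 "nsq K f = enn2real (sq_int K f)"

definition gsq :: "(real^'n) set => (real^'n => real) => real" where
 "gsq K f = enn2real (grad_sq_int K f)"

definition bsq :: "(real^'n) set => (real^'n => real) => real" where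
 "bsq B f = enn2real (surf_sq B f)"

lemma nsq_nonneg [simp]: "0 <= nsq K f" and gsq_nonneg [simp]: "0 <= gsq K f" and bsq_nonneg [simp]: "0 <= bsq B f"
 by (simp_all add: nsq_def gsq_def bsq_def)

lemma smooth_bounded_on_bounded:
 assumes "smooth f" "bounded A"
 shows "\<exists>M\<ge>0. \<forall>x\<in>A. \<bar>f x\<bar> <= M"
proof -
 obtain R where R: "!!x. x : A ==> norm x <= R" using assms(2) bounded_iff by blast
 obtain M where "\<forall>y\<in>cball 0 R. \<bar>f y\<bar> <= M" using smooth_bounded_on_cball[OF assms(1)] by blast
 then have "\<forall>x\<in>A. \<bar>f x\<bar> <= \<bar>M\<bar>" using R by force
 then show ?thesis by (intro exI[of _ "\<bar>M\<bar>"]) auto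
qed

lemma grad_bounded_on_bounded:
 assumes "smooth f" "bounded A"
 shows "\<exists>M\<ge>0. \<forall>x\<in>A. norm (grad f x) <= M"
proof -
 obtain R where R: "!!x. x : A ==> norm x <= R" using assms(2) bounded_iff by blast
 have "compact (grad f ` cball 0 R)" by (intro compact_continuous_image continuous_grad assms) auto
 then obtain M where M: "\<forall>y\<in>grad f ` cball 0 R. norm y <= M" using compact_imp_bounded bounded_iff by blast
 then have "\<forall>x\<in>A. norm (grad f x) <= \<bar>M\<bar>" using R by force
 then show ?thesis by (intro exI[of _ "\<bar>M\<bar>"]) auto
qed

lemma nn_integral_bounded_finite:
 assumes A: "A : sets M" "emeasure M A < \<infinity>" and b: "!!x. x : A ==> g x <= (c::real)"
 shows "(\<integral>\<^sup>+x. ennreal (g x) * indicator A x \<partial>M) < \<infinity>"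
proof -
 have "(\<integral>\<^sup>+x. ennreal (g x) * indicator A x \<partial>M) <= (\<integral>\<^sup>+x. ennreal c * indicator A x \<partial>M)"
  using b by (intro nn_integral_mono) (auto simp: indicator_def intro: ennreal_leI)
 also have "... = ennreal c * emeasure M A" using A by (simp add: nn_integral_cmult)
 also have "... < \<infinity>" using A by (simp add: ennreal_mult_less_top)
 finally show ?thesis .
qed

lemma smooth_sq_int_finite:
 assumes K: "compact K" and sm: "smooth f"
 shows "sq_int K f = ennreal (nsq K f)" "grad_sq_int K f = ennreal (gsq K f)"
proof -
 have b: "bounded K" and s: "K : sets lborel" using K by (auto intro: compact_imp_bounded borel_closed compact_imp_closed)
 obtain M where M: "!!x. x : K ==> \<bar>f x\<bar> <= M" using smooth_bounded_on_bounded[OF sm b] by blast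
 obtain L where L: "!!x. x : K ==> norm (grad f x) <= L" using grad_bounded_on_bounded[OF sm b] by blast
 have "sq_int K f < \<infinity>" unfolding sq_int_def
 proof (rule nn_integral_bounded_finite[OF s emeasure_bounded_finite[OF b]])
  show "(f x)^2 <= M^2" if "x : K" for x using power_mono[OF M[OF that] abs_ge_zero, of 2] by simp
 qed
 then show "sq_int K f = ennreal (nsq K f)" by (simp add: nsq_def)
 have "grad_sq_int K f < \<infinity>" unfolding grad_sq_int_def
 proof (rule nn_integral_bounded_finite[OF s emeasure_bounded_finite[OF b]])
  show "(norm (grad f x))^2 <= L^2" if "x : K" for x using power_mono[OF L[OF that] norm_ge_zero, of 2] by simp
 qed
 then show "grad_sq_int K f = ennreal (gsq K f)" by (simp add: gsq_def)
qed

lemma smooth_surf_sq_finite: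
 fixes B :: "(real^'n) set"
 assumes B: "compact B" "emeasure (hausdorff (CARD('n) - 1)) B < \<infinity>" and sm: "smooth f"
 shows "surf_sq B f = ennreal (bsq B f)"
proof -
 have b: "bounded B" and s: "B : sets (hausdorff (CARD('n) - 1))" using B(1) by (auto intro: compact_imp_bounded borel_closed compact_imp_closed)
 obtain M where M: "!!x. x : B ==> \<bar>f x\<bar> <= M" using smooth_bounded_on_bounded[OF sm b] by blast
 have "surf_sq B f < \<infinity>" unfolding surf_sq_def
 proof (rule nn_integral_bounded_finite[OF s B(2)])
  show "(f x)^2 <= M^2" if "x : B" for x using power_mono[OF M[OF that] abs_ge_zero, of 2] by simp
 qed
 then show ?thesis by (simp add: bsq_def)
qed

lemma nsq_add:
 assumes K: "compact K" and f: "smooth f" and g: "smooth g"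
 shows "nsq K (%x. f x + g x) <= 2 * nsq K f + 2 * nsq K g"
proof -
 have "sq_int K (%x. f x + g x) <= 2 * sq_int K f + 2 * sq_int K g"
  using f g K by (intro sq_int_add smooth_borel) (auto intro: borel_closed compact_imp_closed)
 then have "ennreal (nsq K (%x. f x + g x)) <= 2 * ennreal (nsq K f) + 2 * ennreal (nsq K g)"
  by (simp only: smooth_sq_int_finite(1)[OF K f] smooth_sq_int_finite(1)[OF K g] smooth_sq_int_finite(1)[OF K smooth_add[OF f g]])
 also have "... = ennreal (2 * nsq K f + 2 * nsq K g)"
  by (simp only: numeral_times_ennreal) (rule ennreal_plus[symmetric], simp_all)
 finally show ?thesis by (subst (asm) ennreal_le_iff) (simp_all del: ennreal_plus)
qed

lemma gsq_add:
 assumes K: "compact K" and f: "smooth f" and g: "smooth g"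
 shows "gsq K (%x. f x + g x) <= 2 * gsq K f + 2 * gsq K g"
proof -
 have [measurable]: "K : sets borel" "grad f : borel_measurable borel" "grad g : borel_measurable borel"
  using K f g by (auto intro: borel_closed compact_imp_closed grad_borel)
 have gr: "grad (%x. f x + g x) x = grad f x + grad g x" for x
  by (simp add: vec_eq_iff partial_deriv_add[OF f g])
 have "grad_sq_int K (%x. f x + g x)
  <= (\<integral>\<^sup>+x. 2 * (ennreal ((norm (grad f x))^2) * indicator K x) + 2 * (ennreal ((norm (grad g x))^2) * indicator K x) \<partial>lborel)"
  unfolding grad_sq_int_def
 proof (rule nn_integral_mono)
  fix x
  have "(norm (grad f x + grad g x))^2 <= (norm (grad f x) + norm (grad g x))^2" by (intro power_mono norm_triangle_ineq) simp
  also have "... <= 2 * (norm (grad f x))^2 + 2 * (norm (grad g x))^2" by (rule sum2_square_le)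
  finally have "ennreal ((norm (grad f x + grad g x))^2) <= ennreal (2 * (norm (grad f x))^2 + 2 * (norm (grad g x))^2)" by (rule ennreal_leI)
  also have "... = 2 * ennreal ((norm (grad f x))^2) + 2 * ennreal ((norm (grad g x))^2)"
   by (simp add: ennreal_plus ennreal_mult)
  finally show "ennreal ((norm (grad (%x. f x + g x) x))^2) * indicator K x
   <= 2 * (ennreal ((norm (grad f x))^2) * indicator K x) + 2 * (ennreal ((norm (grad g x))^2) * indicator K x)"
   by (simp add: indicator_def gr)
 qed
 also have "... = 2 * grad_sq_int K f + 2 * grad_sq_int K g"
  unfolding grad_sq_int_def by (simp add: nn_integral_add nn_integral_cmult)
 finally have "ennreal (gsq K (%x. f x + g x)) <= 2 * ennreal (gsq K f) + 2 * ennreal (gsq K g)"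
  by (simp only: smooth_sq_int_finite(2)[OF K f] smooth_sq_int_finite(2)[OF K g] smooth_sq_int_finite(2)[OF K smooth_add[OF f g]])
 also have "... = ennreal (2 * gsq K f + 2 * gsq K g)"
  by (simp only: numeral_times_ennreal) (rule ennreal_plus[symmetric], simp_all)
 finally show ?thesis by (subst (asm) ennreal_le_iff) (simp_all del: ennreal_plus)
qed

lemma smooth_minus: "smooth f ==> smooth (%x. - f x)"
 using smooth_diff[OF smooth_const, of f 0] by simp

lemma grad_minus: "smooth f ==> grad (%x. - f x) x = - grad f x"
proof -
 assume f: "smooth f"
 have "((%x. - f x) has_derivative (%h. - (grad f x \<bullet> h))) (at x)"
  by (intro has_derivative_minus smooth_has_derivative f)
 then show ?thesis by (simp add: vec_eq_iff partial_deriv_eq inner_axis)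
qed

lemma nsq_gsq_diff:
 assumes K: "compact K" and f: "smooth f" and g: "smooth g"
 shows "nsq K (%x. f x - g x) <= 2 * nsq K f + 2 * nsq K g"
  and "gsq K (%x. f x - g x) <= 2 * gsq K f + 2 * gsq K g"
proof -
 have "nsq K (%x. - g x) = nsq K g" by (simp add: nsq_def sq_int_def)
 then show "nsq K (%x. f x - g x) <= 2 * nsq K f + 2 * nsq K g"
  using nsq_add[OF K f smooth_minus[OF g]] by simp
 have "gsq K (%x. - g x) = gsq K g" by (simp add: gsq_def grad_sq_int_def grad_minus[OF g])
 then show "gsq K (%x. f x - g x) <= 2 * gsq K f + 2 * gsq K g"
  using gsq_add[OF K f smooth_minus[OF g]] by simp
qed

section \<open>The boundary of a simplex\<close>

lemma simplex_facets:
 fixes K :: "(real^'n) set"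
 assumes K: "int CARD('n) simplex K"
 shows "\<exists>FF. finite FF & card FF <= Suc CARD('n) & frontier K = \<Union>FF \<and>
  (\<forall>F\<in>FF. \<exists>u a b S. cone_over K u F a b & finite S & card S = CARD('n) & F = convex hull S & K = convex hull (insert u S))"
proof -
 obtain C where C: "finite C" "\<not> affine_dependent C" "card C = Suc CARD('n)" "K = convex hull C"
  using simplex_full(5)[OF K] by blast
 let ?FF = "(%v. convex hull (C - {v})) ` C"
 have fr: "frontier K = \<Union>?FF" unfolding C(4) by (subst frontier_of_convex_hull) (auto simp: C(3))
 have "\<exists>u a b S. cone_over K u F a b & finite S & card S = CARD('n) & F = convex hull S & K = convex hull (insert u S)"
  if F: "F : ?FF" for F
 proof -
  obtain v where v: "v : C" "F = convex hull (C - {v})" using F by blast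
  have cS: "card (C - {v}) = CARD('n)" using C v by simp
  then have ne: "C - {v} ~= {}" by (metis card.empty zero_less_card_finite less_irrefl)
  then have "F facet_of K" unfolding C(4) facet_of_convex_hull_affine_independent[OF C(2)] using v by auto
  then obtain a b where ab: "norm a = 1" "affine hull F = {x. a \<bullet> x = b}" using facet_hyperplane[OF K] by blast
  have "v \<notin> affine hull (C - {v})" using C(2) v(1) unfolding affine_dependent_def by blast
  then have av: "a \<bullet> v ~= b" using ab(2) v(2) by auto
  define \<sigma> :: real where "\<sigma> = (if b < a \<bullet> v then 1 else -1)"
  have \<sigma>: "\<bar>\<sigma>\<bar> = 1" "\<sigma> ~= 0" by (auto simp: \<sigma>_def)
  have KS: "K = convex hull (insert v (C - {v}))" using v(1) C(4) by (simp add: insert_absorb)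
  have "cone_over K v F (\<sigma> *\<^sub>R a) (\<sigma> * b)"
  proof (rule cone_overI[OF _ ne v(2) KS])
   show "norm (\<sigma> *\<^sub>R a) = 1" using \<sigma> ab(1) by simp
   show "affine hull F = {x. (\<sigma> *\<^sub>R a) \<bullet> x = \<sigma> * b}" using ab(2) \<sigma>(2) by simp
   show "\<sigma> * b < (\<sigma> *\<^sub>R a) \<bullet> v" using av by (auto simp: \<sigma>_def)
  qed (use C in simp)
  then show ?thesis using cS KS v(2) C(1) by (intro exI[of _ v] exI[of _ "\<sigma> *\<^sub>R a"] exI[of _ "\<sigma> * b"] exI[of _ "C - {v}"]) simp
 qed
 moreover have "card ?FF <= Suc CARD('n)" using card_image_le[OF C(1), of "%v. convex hull (C - {v})"] C(3) by simp
 ultimately show ?thesis using C(1) fr by (intro exI[of _ ?FF]) blast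
qed

definition facet_const :: "'n::finite itself => real" where
 "facet_const _ = unit_ball_vol (real (CARD('n) - 1)) * (4 * real CARD('n)) ^ (CARD('n) - 1)"

lemma facet_const_pos: "0 < facet_const TYPE('n::finite)"
 unfolding facet_const_def by (intro mult_pos_pos zero_less_power) auto

lemma facet_area_le:
 fixes K F :: "(real^'n) set"
 assumes c: "cone_over K u F a b"
 shows "emeasure (hausdorff (CARD('n) - 1)) F <= ennreal (facet_const TYPE('n) * diameter K ^ (CARD('n) - 1))"
proof -
 note D = cone_over_D[OF c]
 obtain e where e: "e : F" using D(5) by blast
 have h: "0 < diameter K" using cone_height(1)[OF c] D(8) by linarith
 have "F \<subseteq> {x. a \<bullet> x = b} \<inter> cball e (diameter K)"
 proof
  fix x assume x: "x : F"
  have "dist e x <= diameter K"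
   using diameter_bounded_bound[OF compact_imp_bounded[OF D(1)], of e x] e x D(10) by auto
  then show "x : {x. a \<bullet> x = b} \<inter> cball e (diameter K)" using D(11)[OF x] by simp
 qed
 then have "hausdorff_outer (CARD('n) - 1) F <= hausdorff_outer (CARD('n) - 1) ({x. a \<bullet> x = b} \<inter> cball e (diameter K))"
  by (rule hausdorff_outer_mono)
 also have "... <= ennreal (unit_ball_vol (real (CARD('n) - 1)) * (4 * real CARD('n) * diameter K) ^ (CARD('n) - 1))"
  by (rule hausdorff_hyperplane_ball_le[OF h D(6)])
 finally show ?thesis
  using D(4) by (simp add: emeasure_hausdorff borel_closed compact_imp_closed facet_const_def power_mult_distrib mult.assoc)
qed

text \<open>The area is positive because, by the extension bound for the constant one, a facet of area zero would force the
simplex to have volume zero.\<close>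

lemma boundary_area:
 fixes K :: "(real^'n) set"
 assumes K: "int CARD('n) simplex K"
 shows "emeasure (hausdorff (CARD('n) - 1)) (frontier K) < \<infinity>"
  and "measure (hausdorff (CARD('n) - 1)) (frontier K) <= real (Suc CARD('n)) * (facet_const TYPE('n) * diameter K ^ (CARD('n) - 1))"
  and "0 < measure (hausdorff (CARD('n) - 1)) (frontier K)"
proof -
 let ?H = "hausdorff (CARD('n) - 1) :: (real^'n) measure"
 let ?B = "facet_const TYPE('n) * diameter K ^ (CARD('n) - 1)"
 note S = simplex_full[OF K]
 have B: "0 <= ?B" using facet_const_pos[where 'n='n] diameter_ge_0[OF compact_imp_bounded[OF S(1)]] by simp
 from simplex_facets[OF K] obtain FF where FF0: "finite FF & card FF <= Suc CARD('n) & frontier K = \<Union>FF \<and>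
  (\<forall>F\<in>FF. \<exists>u a b S. cone_over K u F a b & finite S & card S = CARD('n) & F = convex hull S & K = convex hull (insert u S))" ..
 note FF = FF0[THEN conjunct1] FF0[THEN conjunct2, THEN conjunct1] FF0[THEN conjunct2, THEN conjunct2, THEN conjunct1]
 note co = bspec[OF FF0[THEN conjunct2, THEN conjunct2, THEN conjunct2]]
 have mF: "F : sets ?H" if "F : FF" for F
 proof -
  from co[OF that] obtain u a b where "cone_over K u F a b" by (elim exE conjE)
  then have "closed F" using cone_over_D(4) compact_imp_closed by blast
  then show ?thesis by (simp add: borel_closed)
 qed
 have "emeasure ?H (frontier K) <= (\<Sum>F\<in>FF. emeasure ?H F)"
  unfolding FF(3) using emeasure_subadditive_finite[OF FF(1), of "%F. F" ?H] mF by (simp add: image_subset_iff subset_iff)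
 also have "... <= (\<Sum>F\<in>FF. ennreal ?B)"
 proof (rule sum_mono)
  fix F assume "F : FF"
  from co[OF this] obtain u a b where "cone_over K u F a b" by (elim exE conjE)
  then show "emeasure ?H F <= ennreal ?B" by (rule facet_area_le)
 qed
 also have "... = of_nat (card FF) * ennreal ?B" by simp
 also have "... <= of_nat (Suc CARD('n)) * ennreal ?B" using FF(2) by (intro mult_right_mono of_nat_mono) auto
 also have "... = ennreal (real (Suc CARD('n)) * ?B)"
  using B by (simp only: ennreal_of_nat_eq_real_of_nat) (rule ennreal_mult[symmetric], simp_all)
 finally have le: "emeasure ?H (frontier K) <= ennreal (real (Suc CARD('n)) * ?B)" .
 then show fin: "emeasure ?H (frontier K) < \<infinity>" by (rule le_less_trans) simp
 have "0 <= real (Suc CARD('n)) * ?B" using B by simp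
 then show "measure ?H (frontier K) <= real (Suc CARD('n)) * ?B"
  unfolding measure_def using enn2real_mono[OF le] by (simp del: of_nat_Suc)
 have "FF ~= {}"
 proof
  assume "FF = {}"
  then have "frontier K = {}" using FF(3) by simp
  then show False using S(3) compact_imp_bounded[OF S(1)] not_bounded_UNIV unfolding frontier_eq_empty by blast
 qed
 then obtain F where F: "F : FF" by blast
 obtain u a b where c: "cone_over K u F a b" using co[OF F] by (elim exE conjE)
 note D = cone_over_D[OF c]
 obtain e where e: "e : F" using D(5) by blast
 have "0 < emeasure lborel K"
 proof -
  obtain x r where xr: "0 < r" "cball x r \<subseteq> K" using S(4) mem_interior_cball by blast
  have "0 < emeasure lborel (cball x r)" using xr(1) by (simp add: emeasure_cball ennreal_zero_less_mult_iff)
  also have "... <= emeasure lborel K" using S(1) by (intro emeasure_mono xr) (auto intro: borel_closed compact_imp_closed)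
  finally show ?thesis .
 qed
 also have "emeasure lborel K = sq_int K (%x. (%_. 1) (oblique u e a b x))"
  using S(1) by (simp add: sq_int_def borel_closed compact_imp_closed)
 also have "... <= ennreal ((a \<bullet> u - b) / slice_const TYPE('n)) * surf_sq F (%_. 1)"
  by (rule oblique_extension_bound[OF c e]) simp
 finally have "0 < surf_sq F (%_. 1)" by (simp add: ennreal_zero_less_mult_iff)
 then have "0 < emeasure ?H F" using mF[OF F] by (simp add: surf_sq_def)
 also have "... <= emeasure ?H (frontier K)" 
 proof (rule emeasure_mono)
  show "F \<subseteq> frontier K" unfolding FF(3) using F by blast
  show "frontier K : sets ?H" by (simp add: borel_closed)
 qed
 finally show "0 < measure ?H (frontier K)"
  using fin by (simp add: measure_def enn2real_positive_iff)
qed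

lemma surface_sq:
 fixes K :: "(real^'n) set"
 assumes K: "int CARD('n) simplex K" and sm: "smooth f"
 shows "f : L2 (surface_on K)" "(L2_norm (surface_on K) f)^2 = bsq (frontier K) f" "surf_sq (frontier K) f = ennreal (bsq (frontier K) f)"
proof -
 let ?H = "hausdorff (CARD('n) - 1) :: (real^'n) measure"
 have cf: "compact (frontier K)" using simplex_full(1)[OF K] by (rule compact_frontier)
 have fr [measurable]: "frontier K : sets borel" by (simp add: borel_closed)
 have [measurable]: "f : borel_measurable borel" using sm by (rule smooth_borel)
 show s: "surf_sq (frontier K) f = ennreal (bsq (frontier K) f)"
  by (rule smooth_surf_sq_finite[OF cf boundary_area(1)[OF K] sm])
 have m: "f : borel_measurable (surface_on K)" unfolding surface_on_def by (rule measurable_restrict_space1) measurable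
 have e: "(\<integral>\<^sup>+x. ennreal ((norm (f x))^2) \<partial>surface_on K) = surf_sq (frontier K) f"
  unfolding surface_on_def surf_sq_def by (subst nn_integral_restrict_space) auto
 have i: "integrable (surface_on K) (%x. (norm (f x))^2)"
  by (rule integrableI_bounded) (use m e s in auto)
 then show "f : L2 (surface_on K)" by (rule L2_I[OF m])
 have "ennreal (\<integral>x. (norm (f x))^2 \<partial>surface_on K) = (\<integral>\<^sup>+x. ennreal ((norm (f x))^2) \<partial>surface_on K)"
  by (rule nn_integral_eq_integral[OF i, symmetric]) simp
 then have "ennreal (\<integral>x. (norm (f x))^2 \<partial>surface_on K) = ennreal (bsq (frontier K) f)" using e s by simp
 then have "(\<integral>x. (norm (f x))^2 \<partial>surface_on K) = bsq (frontier K) f"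
  by (subst (asm) ennreal_inj) (auto intro: integral_nonneg_AE)
 then show "(L2_norm (surface_on K) f)^2 = bsq (frontier K) f" unfolding L2_norm_square .
qed

text \<open>The constant may depend on the simplex: this serves only the existence of traces and the passage from smooth to
general functions.\<close>

lemma boundary_trace:
 fixes K :: "(real^'n) set"
 assumes K: "int CARD('n) simplex K"
 shows "\<exists>C\<ge>0. \<forall>f. smooth f --> bsq (frontier K) f <= C * (nsq K f + gsq K f)"
proof -
 note S = simplex_full[OF K]
 from simplex_facets[OF K] obtain FF where FF0: "finite FF & card FF <= Suc CARD('n) & frontier K = \<Union>FF \<and>
  (\<forall>F\<in>FF. \<exists>u a b S. cone_over K u F a b & finite S & card S = CARD('n) & F = convex hull S & K = convex hull (insert u S))" ..
 note FF = FF0[THEN conjunct1] FF0[THEN conjunct2, THEN conjunct1] FF0[THEN conjunct2, THEN conjunct2, THEN conjunct1]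
 note co = bspec[OF FF0[THEN conjunct2, THEN conjunct2, THEN conjunct2]]
 have mF: "F : sets borel" if "F : FF" for F
 proof -
  from co[OF that] obtain u a b where "cone_over K u F a b" by (elim exE conjE)
  then have "closed F" using cone_over_D(4) compact_imp_closed by blast
  then show ?thesis by (simp add: borel_closed)
 qed
 define n1 where "n1 = real CARD('n) + 1"
 define d2 where "d2 = (diameter K)^2"
 have nd: "0 <= n1" "0 <= d2" by (simp_all add: n1_def d2_def)
 have fa: "\<forall>F\<in>FF. \<exists>c\<ge>0. \<forall>f. smooth f --> surf_sq F f <= ennreal (c * (nsq K f + gsq K f))"
 proof
  fix F assume "F : FF"
  obtain u a b T where c: "cone_over K u F a b" "finite T" "card T = CARD('n)" "F = convex hull T" "K = convex hull (insert u T)"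
   using co[OF \<open>F : FF\<close>] by (elim exE conjE)
  define A where "A = real CARD('n) * slice_const TYPE('n) / (a \<bullet> u - b)"
  have A: "0 <= A" using cone_over_D(8)[OF c(1)] slice_const_pos[where 'n='n] by (simp add: A_def)
  show "\<exists>c\<ge>0. \<forall>f. smooth f --> surf_sq F f <= ennreal (c * (nsq K f + gsq K f))"
  proof (intro exI[of _ "A * (n1 + d2)"] conjI allI impI)
   show "0 <= A * (n1 + d2)" using A nd by simp
   fix f :: "real^'n => real" assume sm: "smooth f"
   have "surf_sq F f <= ennreal A * (ennreal n1 * ennreal (nsq K f) + ennreal d2 * ennreal (gsq K f))"
    using trace_inequality[OF c sm] unfolding smooth_sq_int_finite[OF S(1) sm] A_def n1_def d2_def .
   also have "... = ennreal (A * (n1 * nsq K f + d2 * gsq K f))"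
   proof -
    have "ennreal A * (ennreal n1 * ennreal (nsq K f) + ennreal d2 * ennreal (gsq K f)) = ennreal A * ennreal (n1 * nsq K f + d2 * gsq K f)"
     using nd by (subst ennreal_plus) (simp_all add: ennreal_mult del: ennreal_plus)
    then show ?thesis using A nd by (simp add: ennreal_mult del: ennreal_plus)
   qed
   also have "... <= ennreal (A * (n1 + d2) * (nsq K f + gsq K f))"
   proof (rule ennreal_leI)
    have "n1 * nsq K f + d2 * gsq K f <= (n1 + d2) * (nsq K f + gsq K f)" using nd by (simp add: algebra_simps)
    then show "A * (n1 * nsq K f + d2 * gsq K f) <= A * (n1 + d2) * (nsq K f + gsq K f)"
     using A by (simp add: mult.assoc mult_left_mono)
   qed
   finally show "surf_sq F f <= ennreal (A * (n1 + d2) * (nsq K f + gsq K f))" .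
  qed
 qed
 from bchoice[OF fa] obtain c where c0: "\<forall>F\<in>FF. 0 <= c F & (\<forall>f. smooth f --> surf_sq F f <= ennreal (c F * (nsq K f + gsq K f)))" ..
 have c: "!!F. F : FF ==> 0 <= c F" "!!F f. F : FF ==> smooth f ==> surf_sq F f <= ennreal (c F * (nsq K f + gsq K f))"
  using c0 by simp_all
 have "bsq (frontier K) f <= (\<Sum>F\<in>FF. c F) * (nsq K f + gsq K f)" if sm: "smooth f" for f
 proof -
  have [measurable]: "f : borel_measurable borel" using sm by (rule smooth_borel)
  have "surf_sq (frontier K) f <= (\<integral>\<^sup>+x. (\<Sum>F\<in>FF. ennreal ((f x)^2) * indicator F x) \<partial>hausdorff (CARD('n) - 1))"
   unfolding surf_sq_def
  proof (rule nn_integral_mono)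
   fix x
   show "ennreal ((f x)^2) * indicator (frontier K) x <= (\<Sum>F\<in>FF. ennreal ((f x)^2) * indicator F x)"
   proof (cases "x : frontier K")
    case True
    then obtain F where F: "F : FF" "x : F" using FF(3) by blast
    then have "ennreal ((f x)^2) * indicator (frontier K) x = ennreal ((f x)^2) * indicator F x" using True by simp
    also have "... <= (\<Sum>F\<in>FF. ennreal ((f x)^2) * indicator F x)"
     using FF(1) F(1) by (intro member_le_sum) auto
    finally show ?thesis .
   qed simp
  qed
  also have "... = (\<Sum>F\<in>FF. surf_sq F f)"
   unfolding surf_sq_def by (rule nn_integral_sum) (use mF in \<open>auto intro!: borel_measurable_times_ennreal borel_measurable_indicator\<close>)
  also have "... <= (\<Sum>F\<in>FF. ennreal (c F * (nsq K f + gsq K f)))" by (intro sum_mono c sm)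
  also have "... = ennreal (\<Sum>F\<in>FF. c F * (nsq K f + gsq K f))" by (rule sum_ennreal) (simp add: c(1))
  also have "(\<Sum>F\<in>FF. c F * (nsq K f + gsq K f)) = (\<Sum>F\<in>FF. c F) * (nsq K f + gsq K f)" by (rule sum_distrib_right[symmetric])
  finally have "ennreal (bsq (frontier K) f) <= ennreal ((\<Sum>F\<in>FF. c F) * (nsq K f + gsq K f))"
   unfolding surface_sq(3)[OF K sm] .
  then show ?thesis using c(1) by (simp add: ennreal_le_iff sum_nonneg)
 qed
 then show ?thesis using c(1) by (intro exI[of _ "\<Sum>F\<in>FF. c F"]) (auto intro: sum_nonneg)
qed

section \<open>Completeness of L2\<close>

text \<open>Rapid convergence gives convergence almost everywhere, and Fatou's lemma identifies the limit.\<close>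

lemma L2_fast_Cauchy:
 fixes f :: "nat => 'a => real"
 assumes f: "!!k. f k : L2 M" and step: "!!k. (L2_norm M (%x. f k x - f (Suc k) x))^2 <= (1/8) ^ k"
 shows "\<exists>g\<in>L2 M. (%k. L2_norm M (%x. f k x - g x)) \<longlonglongrightarrow> 0"
proof -
 have [measurable]: "f k : borel_measurable M" for k using L2_D(1)[OF f] .
 have far: "(L2_norm M (%x. f k x - f (k + i) x))^2 <= 4 * (1/8) ^ k" for i k
 proof (induction i arbitrary: k)
  case 0 show ?case by (simp add: L2_norm_def)
 next
  case (Suc i)
  have "(L2_norm M (%x. (f k x - f (Suc k) x) + (f (Suc k) x - f (Suc k + i) x)))^2
   <= 2 * (L2_norm M (%x. f k x - f (Suc k) x))^2 + 2 * (L2_norm M (%x. f (Suc k) x - f (Suc k + i) x))^2"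
   by (rule L2_add(2)[OF L2_diff(1)[OF f f] L2_diff(1)[OF f f]])
  also have "... <= 2 * (1/8) ^ k + 2 * (4 * (1/8) ^ Suc k)"
   by (intro add_mono mult_left_mono step Suc.IH) auto
  also have "... <= 4 * (1/8) ^ k" by simp
  finally show ?case by simp
 qed
 define d where "d k x = \<bar>f k x - f (Suc k) x\<bar>" for k x
 have [measurable]: "d k : borel_measurable M" for k unfolding d_def by measurable
 have nsd: "(\<integral>\<^sup>+x. ennreal ((f k x - f m x)^2) \<partial>M) = ennreal ((L2_norm M (%x. f k x - f m x))^2)" for k m
  unfolding L2_norm_square using nn_integral_eq_integral[OF L2_D(2)[OF L2_diff(1)[OF f[of k] f[of m]]]] by simp
 have "(\<integral>\<^sup>+x. (\<Sum>k. ennreal (2 ^ k * (d k x)^2)) \<partial>M) = (\<Sum>k. \<integral>\<^sup>+x. ennreal (2 ^ k * (d k x)^2) \<partial>M)"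
  by (rule nn_integral_suminf) measurable
 also have "... <= (\<Sum>k. ennreal ((1/4) ^ k))"
 proof (rule suminf_le)
  fix k
  have "(\<integral>\<^sup>+x. ennreal (2 ^ k * (d k x)^2) \<partial>M) = ennreal (2 ^ k) * (\<integral>\<^sup>+x. ennreal ((f k x - f (Suc k) x)^2) \<partial>M)"
   by (subst nn_integral_cmult[symmetric]) (auto simp: d_def ennreal_mult)
  also have "... <= ennreal (2 ^ k) * ennreal ((1/8) ^ k)"
   unfolding nsd by (intro mult_left_mono ennreal_leI step) simp
  also have "... = ennreal ((1/4) ^ k)"
   by (simp add: ennreal_mult[symmetric] power_mult_distrib[symmetric])
  finally show "(\<integral>\<^sup>+x. ennreal (2 ^ k * (d k x)^2) \<partial>M) <= ennreal ((1/4) ^ k)" .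
 qed auto
 also have "... = ennreal (\<Sum>k. (1/4) ^ k)" by (rule suminf_ennreal2) auto
 finally have "(\<integral>\<^sup>+x. (\<Sum>k. ennreal (2 ^ k * (d k x)^2)) \<partial>M) ~= \<infinity>" by (auto simp: top_unique)
 then have ae: "AE x in M. (\<Sum>k. ennreal (2 ^ k * (d k x)^2)) ~= \<infinity>"
  by (intro nn_integral_PInf_AE) measurable
 define g where "g x = lim (%k. f k x)" for x
 have [measurable]: "g : borel_measurable M" unfolding g_def by (rule borel_measurable_lim_metric) measurable
 have conv: "AE x in M. (%k. f k x) \<longlonglongrightarrow> g x"
  using ae
 proof eventually_elim
  fix x assume fin: "(\<Sum>k. ennreal (2 ^ k * (d k x)^2)) ~= \<infinity>"
  have "summable (%k. 2 ^ k * (d k x)^2)"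
   by (rule summable_suminf_not_top) (use fin in auto)
  then have s1: "summable (%k. 2 ^ k * (d k x)^2 + (1/2) ^ k)" by (intro summable_add summable_geometric) auto
  have "summable (%k. norm (f (Suc k) x - f k x))"
  proof (rule summable_comparison_test_ev[OF _ s1])
   have "norm (norm (f (Suc k) x - f k x)) <= 2 ^ k * (d k x)^2 + (1/2) ^ k" for k
   proof -
    define q :: real where "q = 2 ^ k"
    have q: "0 < q" "(1/2) ^ k = 1 / q" by (simp_all add: q_def power_one_over)
    (* weighting the square by 2^k makes the differences themselves summable *)
    have "0 <= (q * d k x - 1)^2" by simp
    then have "2 * (q * d k x) <= q^2 * (d k x)^2 + 1" by (simp add: power2_diff power_mult_distrib)
    moreover have "0 <= q * d k x" using q by (simp add: d_def)
    ultimately have "q * d k x <= q * (q * (d k x)^2) + 1" by (simp add: power2_eq_square mult.assoc)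
    also have "... = q * (q * (d k x)^2 + 1 / q)" using q by (simp add: distrib_left)
    finally have "d k x <= q * (d k x)^2 + 1 / q" using q by simp
    then show ?thesis unfolding q(2) by (simp add: d_def q_def abs_minus_commute)
   qed
   then show "\<forall>\<^sub>F k in sequentially. norm (norm (f (Suc k) x - f k x)) <= 2 ^ k * (d k x)^2 + (1/2) ^ k" by simp
  qed
  then have "summable (%k. f (Suc k) x - f k x)" by (rule summable_norm_cancel)
  then have "convergent (%n. \<Sum>k<n. f (Suc k) x - f k x)" by (simp add: summable_iff_convergent)
  then have "convergent (%n. f n x - f 0 x)" by (subst (asm) sum_lessThan_telescope)
  then have "convergent (%n. (f n x - f 0 x) + f 0 x)" by (intro convergent_add convergent_const)
  then have "convergent (%n. f n x)" by simp
  then show "(%k. f k x) \<longlonglongrightarrow> g x" unfolding g_def by (simp add: convergent_LIMSEQ_iff)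
 qed
 have lim: "(\<integral>\<^sup>+x. ennreal ((f k x - g x)^2) \<partial>M) <= ennreal (4 * (1/8) ^ k)" for k
 proof -
  have "(\<integral>\<^sup>+x. ennreal ((f k x - g x)^2) \<partial>M) = (\<integral>\<^sup>+x. liminf (%m. ennreal ((f k x - f m x)^2)) \<partial>M)"
  proof (rule nn_integral_cong_AE)
   show "AE x in M. ennreal ((f k x - g x)^2) = liminf (%m. ennreal ((f k x - f m x)^2))"
    using conv
   proof eventually_elim
    fix x assume "(%k. f k x) \<longlonglongrightarrow> g x"
    then have "(%m. ennreal ((f k x - f m x)^2)) \<longlonglongrightarrow> ennreal ((f k x - g x)^2)"
     by (intro tendsto_ennrealI tendsto_intros)
    then show "ennreal ((f k x - g x)^2) = liminf (%m. ennreal ((f k x - f m x)^2))"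
     by (intro lim_imp_Liminf[symmetric]) auto
   qed
  qed
  also have "... <= liminf (%m. \<integral>\<^sup>+x. ennreal ((f k x - f m x)^2) \<partial>M)"
   by (rule nn_integral_liminf) measurable
  also have "... <= liminf (%m::nat. ennreal (4 * (1/8) ^ k))"
  proof (rule Liminf_mono)
   show "\<forall>\<^sub>F m in sequentially. (\<integral>\<^sup>+x. ennreal ((f k x - f m x)^2) \<partial>M) <= ennreal (4 * (1/8) ^ k)"
    unfolding eventually_sequentially
   proof (intro exI[of _ k] allI impI)
    fix m assume "k <= m"
    then obtain i where "m = k + i" using le_Suc_ex by blast
    then show "(\<integral>\<^sup>+x. ennreal ((f k x - f m x)^2) \<partial>M) <= ennreal (4 * (1/8) ^ k)"
     unfolding nsd using far[of k i] by (simp add: ennreal_leI)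
   qed
  qed
  also have "... = ennreal (4 * (1/8) ^ k)" by (rule Liminf_const) simp
  finally show ?thesis .
 qed
 have i: "integrable M (%x. (norm (f k x - g x))^2)" for k
 proof (rule integrableI_bounded)
  show "(\<integral>\<^sup>+x. ennreal (norm ((norm (f k x - g x))^2)) \<partial>M) < \<infinity>"
   using lim[of k] by (simp add: le_less_trans)
 qed measurable
 have fg: "(%x. f k x - g x) : L2 M" for k by (rule L2_I[OF _ i]) measurable
 have "(%x. f 0 x - (f 0 x - g x)) : L2 M" by (rule L2_diff(1)[OF f fg])
 then have gL: "g : L2 M" by simp
 have n: "(L2_norm M (%x. f k x - g x))^2 <= 4 * (1/8) ^ k" for k
 proof -
  have "ennreal (\<integral>x. (norm (f k x - g x))^2 \<partial>M) <= ennreal (4 * (1/8) ^ k)"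
   using lim[of k] nn_integral_eq_integral[OF i[of k]] by simp
  then show ?thesis by (simp add: L2_norm_square ennreal_le_iff)
 qed
 have "(%k. (L2_norm M (%x. f k x - g x))^2) \<longlonglongrightarrow> 0"
 proof (rule Lim_null_comparison)
  show "\<forall>\<^sub>F k in sequentially. norm ((L2_norm M (%x. f k x - g x))^2) <= 4 * (1/8) ^ k" using n by simp
  show "(%k. 4 * (1/8::real) ^ k) \<longlonglongrightarrow> 0" by (intro tendsto_mult_right_zero LIMSEQ_power_zero) simp
 qed
 then have "(%k. sqrt ((L2_norm M (%x. f k x - g x))^2)) \<longlonglongrightarrow> sqrt 0" by (rule tendsto_real_sqrt)
 then have "(%k. L2_norm M (%x. f k x - g x)) \<longlonglongrightarrow> 0" by (simp add: L2_norm_nonneg)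
 then show ?thesis using gL by blast
qed

section \<open>Gluing polynomials across a facet\<close>

text \<open>The size \<open>h\<close> is common to both simplices of a pair, and \<open>s\<close> bounds its ratio to the radius of an inscribed ball.\<close>

definition fat :: "real => real => (real^'n) set => bool" where
 "fat s h K \<longleftrightarrow> (\<exists>x r. 0 < r & cball x r \<subseteq> K & diameter K <= h & h <= s * r)"

lemma fat_pos: "compact K ==> fat s h K ==> 0 < h"
proof -
 assume K: "compact K" "fat s h K"
 then obtain x r where r: "0 < r" "cball x r \<subseteq> K" "diameter K <= h" by (auto simp: fat_def)
 have "diameter (cball x r) <= diameter K" using r(2) compact_imp_bounded[OF K(1)] by (rule diameter_subset)
 then show ?thesis using r by simp
qed

definition area_volume_ratio :: "(real^'n) set => real" where
 "area_volume_ratio K = measure lebesgue K / measure (hausdorff (CARD('n) - 1)) (frontier K)"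

definition weight_const :: "'n::finite itself => real" where
 "weight_const _ = real (Suc CARD('n)) * facet_const TYPE('n) / unit_ball_vol (real CARD('n))"

lemma weight_const_nonneg: "0 <= weight_const TYPE('n::finite)"
 unfolding weight_const_def using facet_const_pos[where 'n='n] by (intro divide_nonneg_nonneg mult_nonneg_nonneg) auto

text \<open>The ratio of volume to area is at least of the order of the diameter for simplices that contain a ball of
comparable size.\<close>

lemma area_volume_lower_bound:
 fixes K :: "(real^'n) set"
 assumes K: "int CARD('n) simplex K" and f: "fat s h K"
 shows "h <= weight_const TYPE('n) * s ^ CARD('n) * area_volume_ratio K"
proof -
 let ?N = "CARD('n)" and ?v = "unit_ball_vol (real CARD('n))"
 let ?V = "measure lebesgue K" and ?A = "measure (hausdorff (CARD('n) - 1)) (frontier K)"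
 let ?c = "real (Suc CARD('n)) * facet_const TYPE('n)"
 obtain x r where r: "0 < r" "cball x r \<subseteq> K" "diameter K <= h" "h <= s * r" using f by (auto simp: fat_def)
 have h: "0 < h" using fat_pos[OF simplex_full(1)[OF K] f] .
 have v: "0 < ?v" by simp
 have c: "0 <= ?c" using facet_const_pos[where 'n='n] by simp
 have A: "0 < ?A" by (rule boundary_area(3)[OF K])
 have "measure lebesgue (cball x r) <= ?V"
  by (rule measure_mono_fmeasurable[OF r(2) _ lmeasurable_compact[OF simplex_full(1)[OF K]]]) simp
 then have V: "?v * r ^ ?N <= ?V" using r(1) by (simp add: content_cball)
 have d: "0 <= diameter K" using simplex_full(1)[OF K] by (intro diameter_ge_0 compact_imp_bounded)
 have "?A <= ?c * diameter K ^ (?N - 1)" using boundary_area(2)[OF K] by (simp only: mult.assoc)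
 also have "... <= ?c * h ^ (?N - 1)" by (intro mult_left_mono power_mono r d c)
 finally have "h * ?A <= h * (?c * h ^ (?N - 1))" using h by (intro mult_left_mono) auto
 also have "... = ?c * h ^ ?N" by (simp add: power_eq_if)
 also have "... <= ?c * (s * r) ^ ?N" using r h by (intro mult_left_mono power_mono c) auto
 also have "... = ?c * s ^ ?N / ?v * (?v * r ^ ?N)" using less_imp_neq[OF v] by (simp add: power_mult_distrib)
 also have "... <= ?c * s ^ ?N / ?v * ?V"
 proof (rule mult_left_mono[OF V])
  have "0 < s * r" using h r by linarith
  then have "0 < s" using r(1) by (simp add: zero_less_mult_iff)
  show "0 <= ?c * s ^ ?N / ?v" 
   by (rule divide_nonneg_pos[OF mult_nonneg_nonneg[OF c zero_le_power[OF less_imp_le[OF \<open>0 < s\<close>]]] v])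
 qed
 finally have "h * ?A <= weight_const TYPE('n) * s ^ ?N * ?V" by (simp add: weight_const_def)
 then show ?thesis using A by (simp add: area_volume_ratio_def pos_le_divide_eq)
qed

text \<open>A polynomial is controlled on the whole simplex by its restriction to an inscribed ball.\<close>

lemma polys_gradient_bound:
 fixes s :: real
 shows "\<exists>C\<ge>0. \<forall>(K :: (real^'n) set) w h. compact K --> w : polys l --> fat s h K --> h^2 * gsq K w <= C * nsq K w"
proof -
 let ?N = "CARD('n)"
 obtain C0 where C0: "0 < C0" and inv: "\<forall>(p :: real^'n => real) x r y. p : polys l --> 0 < r --> y : cball x (s * r) -->
  r ^ ?N * (r * norm (grad p y))^2 <= C0 * (\<integral>z. (p z)^2 * indicator (cball x r) z \<partial>lborel)"
  using polys_inverse_inequality[where 'n='n, of l s] by (elim exE conjE)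
 define v where "v = unit_ball_vol (real ?N)"
 have v: "0 <= v" by (simp add: v_def)
 show ?thesis
 proof (intro exI[of _ "C0 * v * \<bar>s\<bar> ^ (?N + 2)"] conjI allI impI)
  show "0 <= C0 * v * \<bar>s\<bar> ^ (?N + 2)" using C0 v by simp
  fix K :: "(real^'n) set" and w :: "real^'n => real" and h assume K: "compact K" and w: "w : polys l" and f: "fat s h K"
  obtain x r where r: "0 < r" "cball x r \<subseteq> K" "diameter K <= h" "h <= s * r" using f by (auto simp: fat_def)
  have h: "0 < h" by (rule fat_pos[OF K f])
  have sm: "smooth w" using w by (rule polys_smooth)
  have [measurable]: "w : borel_measurable borel" using sm by (rule smooth_borel)
  have Ks [measurable]: "K : sets borel" using K by (intro borel_closed compact_imp_closed)
  have xK: "x : K" using r by auto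
  have Kc: "dist x y <= h" if "y : K" for y
   using diameter_bounded_bound[OF compact_imp_bounded[OF K] xK that] r(3) by simp
  have I: "(\<integral>z. (w z)^2 * indicator (cball x r) z \<partial>lborel) <= nsq K w"
  proof -
   have i: "integrable lborel (%z. (w z)^2 * indicator (cball x r) z)"
    by (rule sq_int_finite_integrable) (use smooth_sq_int_finite(1)[OF compact_cball sm] in auto)
   have "sq_int (cball x r) w <= sq_int K w" unfolding sq_int_def
    using r(2) by (intro nn_integral_mono) (auto simp: indicator_def)
   then show ?thesis unfolding sq_int_eq_integral[OF i] smooth_sq_int_finite(1)[OF K sm]
    by (subst (asm) ennreal_le_iff) simp_all
  qed
  define M where "M = C0 * nsq K w / r ^ (?N + 2)"
  have M: "0 <= M" using C0 r(1) by (simp add: M_def)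
  have b: "(norm (grad w y))^2 <= M" if y: "y : K" for y
  proof -
   have "y : cball x (s * r)" using Kc[OF y] r(4) by simp
   with w r(1) inv have "r ^ ?N * (r * norm (grad w y))^2 <= C0 * (\<integral>z. (w z)^2 * indicator (cball x r) z \<partial>lborel)" by simp
   also have "... <= C0 * nsq K w" using C0 I by simp
   finally have "r ^ ?N * (r * norm (grad w y))^2 <= C0 * nsq K w" .
   moreover have "r ^ ?N * (r * norm (grad w y))^2 = (norm (grad w y))^2 * r ^ (?N + 2)"
    unfolding power_add power_mult_distrib by (simp only: ac_simps)
   ultimately show ?thesis unfolding M_def using r(1) by (simp only: pos_le_divide_eq zero_less_power)
  qed
  have "grad_sq_int K w <= (\<integral>\<^sup>+y. ennreal M * indicator (cball x h) y \<partial>lborel)"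
   unfolding grad_sq_int_def using b Kc by (intro nn_integral_mono) (auto simp: indicator_def intro: ennreal_leI)
  also have "... = ennreal M * emeasure lborel (cball x h)" by (rule nn_integral_cmult_indicator) simp
  also have "... = ennreal (M * (v * h ^ ?N))" using h M v by (simp add: emeasure_cball ennreal_mult v_def)
  finally have "gsq K w <= M * (v * h ^ ?N)" unfolding smooth_sq_int_finite(2)[OF K sm]
   using M v h by (subst (asm) ennreal_le_iff) simp_all
  then have "h^2 * gsq K w <= h^2 * (M * (v * h ^ ?N))" by (intro mult_left_mono) auto
  also have "... = C0 * v * nsq K w / r ^ (?N + 2) * h ^ (?N + 2)"
   unfolding M_def power_add by (simp only: times_divide_eq_left times_divide_eq_right ac_simps)
  also have "... <= C0 * v * nsq K w / r ^ (?N + 2) * (\<bar>s\<bar> * r) ^ (?N + 2)"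
  proof (intro mult_left_mono power_mono)
   show "h <= \<bar>s\<bar> * r" using r(1,4) mult_right_mono[OF abs_ge_self, of r s] by linarith
  qed (use h C0 v r(1) in simp_all)
  also have "... = C0 * v * \<bar>s\<bar> ^ (?N + 2) * nsq K w"
   using r(1) unfolding power_mult_distrib by simp
  finally show "h^2 * gsq K w <= C0 * v * \<bar>s\<bar> ^ (?N + 2) * nsq K w" .
 qed
qed

lemma facet_surf_sq:
 fixes K :: "(real^'n) set"
 assumes c: "cone_over K u F a b" and sm: "smooth f"
 shows "surf_sq F f = ennreal (bsq F f)"
 by (rule smooth_surf_sq_finite[OF cone_over_D(4)[OF c] le_less_trans[OF facet_area_le[OF c]] sm]) simp

text \<open>Extending a polynomial from a facet constantly along a direction into the simplex costs a factor \<open>h\<close>.\<close>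

lemma extension_bound:
 fixes s :: real
 shows "\<exists>C\<ge>0. \<forall>(K :: (real^'n) set) u F a b e q h. cone_over K u F a b --> e : F --> q : polys l --> fat s h K -->
  nsq K (%x. q (oblique u e a b x)) <= C * (h * bsq F q) & h^2 * gsq K (%x. q (oblique u e a b x)) <= C * (h * bsq F q)"
proof -
 obtain C1 where C1: "0 <= C1" and gb: "\<forall>(K :: (real^'n) set) w h. compact K --> w : polys l --> fat s h K --> h^2 * gsq K w <= C1 * nsq K w"
  using polys_gradient_bound[where 'n='n, of l s] by (elim exE conjE)
 define c where "c = slice_const TYPE('n)"
 have c: "0 < c" unfolding c_def by (rule slice_const_pos)
 show ?thesis
 proof (intro exI[of _ "(1 + C1) / c"] conjI allI impI)
  show "0 <= (1 + C1) / c" using C1 c by simp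
  fix K :: "(real^'n) set" and u F a b e and q :: "real^'n => real" and h assume co: "cone_over K u F a b" and e: "e : F" and q: "q : polys l" and f: "fat s h K"
  let ?w = "%x. q (oblique u e a b x)"
  note D = cone_over_D[OF co]
  have wp: "?w : polys l" using q by (rule oblique_poly)
  have h: "0 < h" by (rule fat_pos[OF D(1) f])
  have \<eta>: "0 < a \<bullet> u - b" "a \<bullet> u - b <= h" using D(8) cone_height(1)[OF co] f by (auto simp: fat_def)
  have "sq_int K ?w <= ennreal ((a \<bullet> u - b) / c) * surf_sq F q"
   unfolding c_def by (rule oblique_extension_bound[OF co e smooth_borel[OF polys_smooth[OF q]]])
  also have "... = ennreal ((a \<bullet> u - b) / c * bsq F q)"
   unfolding facet_surf_sq[OF co polys_smooth[OF q]] using \<eta> c by (intro ennreal_mult[symmetric]) auto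
  finally have "nsq K ?w <= (a \<bullet> u - b) / c * bsq F q"
   unfolding smooth_sq_int_finite(1)[OF D(1) polys_smooth[OF wp]] using \<eta> c by (subst (asm) ennreal_le_iff) simp_all
  also have "... <= h / c * bsq F q" using \<eta> c by (intro mult_right_mono divide_right_mono) auto
  finally have n: "nsq K ?w <= h / c * bsq F q" .
  have B: "0 <= h / c * bsq F q" using h c by simp
  have "h / c * bsq F q <= (1 + C1) * (h / c * bsq F q)" using mult_right_mono[of 1 "1 + C1", OF _ B] C1 by simp
  with n show "nsq K ?w <= (1 + C1) / c * (h * bsq F q)" by simp
  have "h^2 * gsq K ?w <= C1 * nsq K ?w" using gb D(1) wp f by blast
  also have "... <= C1 * (h / c * bsq F q)" using n C1 by (rule mult_left_mono)
  also have "... <= (1 + C1) * (h / c * bsq F q)" using B by (intro mult_right_mono) auto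
  finally show "h^2 * gsq K ?w <= (1 + C1) / c * (h * bsq F q)" by simp
 qed
qed

lemma facet_cone:
 fixes K F :: "(real^'n) set"
 assumes K: "int CARD('n) simplex K" and F: "F facet_of K"
 shows "\<exists>u a b S. cone_over K u F a b & finite S & card S = CARD('n) & F = convex hull S & K = convex hull (insert u S)"
proof -
 obtain a b where ab: "norm a = 1" "affine hull F = {x. a \<bullet> x = b}" using facet_hyperplane[OF K F] by (elim exE conjE)
 obtain S u where S: "finite S" "card S = CARD('n)" "S ~= {}" "F = convex hull S" "K = convex hull (insert u S)" "a \<bullet> u ~= b"
  using facet_opposite_vertex[OF K F ab(2)] by (elim exE conjE)
 define \<sigma> :: real where "\<sigma> = (if b < a \<bullet> u then 1 else -1)"
 have \<sigma>: "\<bar>\<sigma>\<bar> = 1" "\<sigma> ~= 0" by (auto simp: \<sigma>_def)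
 have "cone_over K u F (\<sigma> *\<^sub>R a) (\<sigma> * b)"
 proof (rule cone_overI[OF S(1,3,4,5)])
  show "norm (\<sigma> *\<^sub>R a) = 1" using \<sigma> ab(1) by simp
  show "affine hull F = {x. (\<sigma> *\<^sub>R a) \<bullet> x = \<sigma> * b}" using ab(2) \<sigma>(2) by simp
  show "\<sigma> * b < (\<sigma> *\<^sub>R a) \<bullet> u" using S(6) by (auto simp: \<sigma>_def)
 qed
 then show ?thesis using S by (intro exI[of _ u] exI[of _ "\<sigma> *\<^sub>R a"] exI[of _ "\<sigma> * b"] exI[of _ S] conjI) auto
qed

definition trace_const :: "'n::finite itself => real" where
 "trace_const _ = real CARD('n) * slice_const TYPE('n) * (real CARD('n) + 1)"

lemma trace_const_nonneg: "0 <= trace_const TYPE('n::finite)"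
 unfolding trace_const_def using slice_const_pos[where 'n='n] by simp

text \<open>The height over the facet is at least the diameter of the inscribed ball, so it may be replaced by \<open>h\<close>.\<close>

lemma scaled_trace:
 fixes K :: "(real^'n) set"
 assumes K: "int CARD('n) simplex K" and F: "F facet_of K" and f: "fat s h K" and sm: "smooth f"
 shows "h * bsq F f <= trace_const TYPE('n) * s * (nsq K f + h^2 * gsq K f)"
proof -
 obtain u a b S where co: "cone_over K u F a b" and S: "finite S" "card S = CARD('n)" "F = convex hull S" "K = convex hull (insert u S)"
  using facet_cone[OF K F] by (elim exE conjE)
 note D = cone_over_D[OF co]
 obtain x r where r: "0 < r" "cball x r \<subseteq> K" "diameter K <= h" "h <= s * r" using f by (auto simp: fat_def)
 have h: "0 < h" by (rule fat_pos[OF D(1) f])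
 have s: "0 < s" using h r by (metis less_le_trans zero_less_mult_pos2)
 define n where "n = real CARD('n)"
 define c where "c = slice_const TYPE('n)"
 define \<eta> where "\<eta> = a \<bullet> u - b"
 have n: "0 < n" by (simp add: n_def)
 have c: "0 < c" unfolding c_def by (rule slice_const_pos)
 have \<eta>: "2 * r <= \<eta>" unfolding \<eta>_def using r by (intro cone_height(2)[OF co]) auto
 have \<eta>0: "0 < \<eta>" using \<eta> r(1) by linarith
 have d: "0 <= diameter K" using D(1) by (intro diameter_ge_0 compact_imp_bounded)
 have "surf_sq F f <= ennreal (n * c / \<eta>) * (ennreal (n + 1) * ennreal (nsq K f) + ennreal ((diameter K)^2) * ennreal (gsq K f))"
  using trace_inequality[OF co S sm] unfolding smooth_sq_int_finite[OF D(1) sm] n_def c_def \<eta>_def .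
 also have "... = ennreal (n * c / \<eta>) * ennreal ((n + 1) * nsq K f + (diameter K)^2 * gsq K f)"
  using n by (subst ennreal_plus) (simp_all add: ennreal_mult del: ennreal_plus)
 also have "... = ennreal (n * c / \<eta> * ((n + 1) * nsq K f + (diameter K)^2 * gsq K f))"
  using n c \<eta>0 by (intro ennreal_mult[symmetric]) auto
 finally have "bsq F f <= n * c / \<eta> * ((n + 1) * nsq K f + (diameter K)^2 * gsq K f)"
  unfolding facet_surf_sq[OF co sm] using n c \<eta>0 by (subst (asm) ennreal_le_iff) simp_all
 also have "... <= n * c / \<eta> * ((n + 1) * (nsq K f + h^2 * gsq K f))"
 proof (rule mult_left_mono)
  have "(diameter K)^2 * gsq K f <= h^2 * gsq K f" using r(3) d by (intro mult_right_mono power_mono) auto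
  also have "... <= (n + 1) * (h^2 * gsq K f)" using n mult_right_mono[of 1 "n + 1" "h^2 * gsq K f"] by simp
  finally show "(n + 1) * nsq K f + (diameter K)^2 * gsq K f <= (n + 1) * (nsq K f + h^2 * gsq K f)" by (simp add: distrib_left)
 qed (use n c \<eta>0 in simp)
 finally have "h * bsq F f <= h * (n * c / \<eta> * ((n + 1) * (nsq K f + h^2 * gsq K f)))" using h by (intro mult_left_mono) auto
 also have "... = (h / \<eta>) * (n * c * (n + 1) * (nsq K f + h^2 * gsq K f))" by simp
 also have "... <= s * (n * c * (n + 1) * (nsq K f + h^2 * gsq K f))"
 proof (rule mult_right_mono)
  have "r <= \<eta>" using \<eta> r(1) by linarith
  then have "h <= s * \<eta>" using r(4) s mult_left_mono[of r \<eta> s] by linarith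
  then show "h / \<eta> <= s" using \<eta>0 by (simp add: pos_divide_le_eq)
 qed (use n c in simp)
 finally show ?thesis by (simp add: trace_const_def n_def c_def mult_ac)
qed

lemma facet_subset_frontier:
 fixes K :: "(real^'n) set"
 assumes "compact K" "F facet_of K"
 shows "F \<subseteq> frontier K"
proof -
 have "F face_of K" "F ~= K" using assms(2) by (auto simp: facet_of_def)
 then have "F \<inter> interior K = {}" "F \<subseteq> K" by (auto simp: face_of_disjoint_interior face_of_imp_subset)
 then show ?thesis using assms(1) by (auto simp: frontier_def compact_imp_closed)
qed

lemma grad_shift: "smooth f ==> grad (%x. f x - m) x = grad f x"
proof -
 assume f: "smooth f"
 have "((%x. f x - m) has_derivative (%h. grad f x \<bullet> h - 0)) (at x)"
  by (intro has_derivative_diff has_derivative_const smooth_has_derivative f)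
 then show ?thesis by (simp add: vec_eq_iff partial_deriv_eq inner_axis)
qed

definition smooth_local_sq :: "real => (real^'n) set => (real^'n => real) => real" where
 "smooth_local_sq \<epsilon> K f = nsq K f + \<epsilon> * gsq K f + area_volume_ratio K * bsq (frontier K) f"

text \<open>For \<open>\<epsilon> \<le> h\<^sup>2\<close> the boundary term on the right controls the facet term on the left, because the ratio of volume to
  area is of the order \<open>h\<close>. For \<open>\<epsilon> \<ge> h\<^sup>2\<close> the gradient alone controls everything, after \<open>p\<close> has been shifted by a
  constant so that the Poincare inequality applies.\<close>

lemma facet_local_estimate:
 fixes s :: real
 assumes s: "0 <= s"
 shows "\<exists>C\<ge>0. \<forall>(K :: (real^'n) set) F ph p \<epsilon> h. int CARD('n) simplex K --> F facet_of K --> fat s h K --> smooth ph -->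
  p : polys l --> 0 < \<epsilon> --> (\<exists>q\<in>polys l. nsq K (%x. ph x - q x) + \<epsilon> * gsq K (%x. ph x - q x) + (h + \<epsilon> / h) * bsq F (%x. ph x - q x)
   <= C * smooth_local_sq \<epsilon> K (%x. ph x - p x))"
proof -
 define Cw where "Cw = weight_const TYPE('n) * s ^ CARD('n)"
 define Ct where "Ct = trace_const TYPE('n) * s"
 define P where "P = (2::real) ^ CARD('n)"
 have C: "0 <= Cw" "0 <= Ct" "0 <= P" using weight_const_nonneg[where 'n='n] trace_const_nonneg[where 'n='n] s by (simp_all add: Cw_def Ct_def P_def)
 define C where "C = 1 + 2 * Cw + (P + 1) * (1 + 2 * Ct)"
 have CC: "1 + 2 * Cw <= C" "(P + 1) * (1 + 2 * Ct) <= C" "0 <= C" using C by (simp_all add: C_def)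
 show ?thesis
 proof (intro exI[of _ C] conjI allI impI)
  show "0 <= C" by (rule CC(3))
  fix K :: "(real^'n) set" and F and ph p :: "real^'n => real" and \<epsilon> h assume K: "int CARD('n) simplex K" and F: "F facet_of K" and f: "fat s h K"
   and sm: "smooth ph" and p: "p : polys l" and \<epsilon>: "0 < (\<epsilon>::real)"
  note S = simplex_full[OF K]
  have h: "0 < h" by (rule fat_pos[OF S(1) f])
  have d: "0 <= diameter K" "diameter K <= h" using S(1) f by (auto intro: diameter_ge_0 compact_imp_bounded simp: fat_def)
  obtain u a b T where co: "cone_over K u F a b" using facet_cone[OF K F] by (elim exE conjE)
  define g where "g = (%x. ph x - p x)"
  have gs: "smooth g" unfolding g_def by (rule smooth_diff[OF sm polys_smooth[OF p]])
  define w where "w = area_volume_ratio K"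
  have w: "0 <= w" by (simp add: w_def area_volume_ratio_def)
  define B where "B = bsq (frontier K) g"
  have B: "0 <= B" by (simp add: B_def)
  have L: "smooth_local_sq \<epsilon> K g = nsq K g + \<epsilon> * gsq K g + w * B" by (simp add: smooth_local_sq_def w_def B_def)
  have e0: "0 <= \<epsilon> * gsq K g" using \<epsilon> by simp
  have L0: "0 <= smooth_local_sq \<epsilon> K g" unfolding L using e0 w B by simp
  show "\<exists>q\<in>polys l. nsq K (%x. ph x - q x) + \<epsilon> * gsq K (%x. ph x - q x) + (h + \<epsilon> / h) * bsq F (%x. ph x - q x)
   <= C * smooth_local_sq \<epsilon> K (%x. ph x - p x)"
  proof (cases "\<epsilon> <= h^2")
   case True
   have bF: "bsq F g <= B"
   proof -
    have "surf_sq F g <= surf_sq (frontier K) g" unfolding surf_sq_def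
     using facet_subset_frontier[OF S(1) F] by (intro nn_integral_mono) (auto simp: indicator_def)
    then show ?thesis unfolding facet_surf_sq[OF co gs] surface_sq(3)[OF K gs] B_def by (subst (asm) ennreal_le_iff) simp_all
   qed
   have "\<epsilon> / h <= h" using True h by (simp add: pos_divide_le_eq power2_eq_square)
   then have "(h + \<epsilon> / h) * bsq F g <= (2 * h) * B" using bF h \<epsilon> by (intro mult_mono) auto
   also have "... <= (2 * (Cw * w)) * B"
    using area_volume_lower_bound[OF K f] B unfolding Cw_def w_def by (intro mult_right_mono mult_left_mono) auto
   finally have "nsq K g + \<epsilon> * gsq K g + (h + \<epsilon> / h) * bsq F g <= (nsq K g + \<epsilon> * gsq K g) + 2 * Cw * (w * B)" by (simp add: mult_ac)
   also have "... <= (1 + 2 * Cw) * (nsq K g + \<epsilon> * gsq K g + w * B)"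
   proof -
    have "0 <= 2 * Cw * (nsq K g + \<epsilon> * gsq K g)" "0 <= w * B" using C(1) e0 w B by simp_all
    then show ?thesis by (simp add: algebra_simps)
   qed
   also have "... <= C * smooth_local_sq \<epsilon> K g" unfolding L[symmetric] using CC(1) L0 by (rule mult_right_mono)
   finally show ?thesis using p unfolding g_def by blast
  next
   case False
   obtain m where m: "sq_int K (%x. g x - m) <= ennreal ((diameter K)^2 * 2 ^ CARD('n)) * grad_sq_int K g"
    using poincare_inequality[OF S(1,2,4) gs] by blast
   define g' where "g' = (%x. g x - m)"
   have g's: "smooth g'" unfolding g'_def by (intro smooth_diff gs smooth_const)
   have gg: "gsq K g' = gsq K g" unfolding g'_def gsq_def grad_sq_int_def by (simp add: grad_shift[OF gs])
   define X where "X = gsq K g"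
   have X: "0 <= X" by (simp add: X_def)
   have "ennreal (nsq K g') <= ennreal ((diameter K)^2 * P) * ennreal X"
    using m unfolding g'_def[symmetric] smooth_sq_int_finite[OF S(1) gs] smooth_sq_int_finite(1)[OF S(1) g's] P_def X_def .
   also have "... = ennreal ((diameter K)^2 * P * X)" using C(3) X by (intro ennreal_mult[symmetric]) auto
   finally have "nsq K g' <= (diameter K)^2 * P * X" using C(3) X by (subst (asm) ennreal_le_iff) simp_all
   also have "... <= h^2 * P * X" using d C(3) X by (intro mult_right_mono power_mono) auto
   finally have n1: "nsq K g' <= P * (h^2 * X)" by (simp add: mult_ac)
   have h2: "h^2 * X <= \<epsilon> * X" using False X by (intro mult_right_mono) auto
   have n2: "nsq K g' <= P * (\<epsilon> * X)" using n1 mult_left_mono[OF h2 C(3)] by linarith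
   have "h * bsq F g' <= Ct * (nsq K g' + h^2 * X)"
    using scaled_trace[OF K F f g's] unfolding gg Ct_def X_def .
   also have "... <= Ct * ((P + 1) * (h^2 * X))" using n1 C(2) by (intro mult_left_mono) (simp_all add: distrib_right)
   finally have b1: "h * bsq F g' <= Ct * ((P + 1) * (h^2 * X))" .
   have "h <= \<epsilon> / h" using False h by (simp add: pos_le_divide_eq power2_eq_square)
   then have "(h + \<epsilon> / h) * bsq F g' <= (2 * (\<epsilon> / h)) * bsq F g'" by (intro mult_right_mono) auto
   also have "... = 2 * \<epsilon> / h^2 * (h * bsq F g')" using h by (simp add: power2_eq_square)
   also have "... <= 2 * \<epsilon> / h^2 * (Ct * ((P + 1) * (h^2 * X)))" using b1 h \<epsilon> by (intro mult_left_mono) auto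
   also have "... = 2 * Ct * (P + 1) * (\<epsilon> * X)" using h by (simp add: mult_ac)
   finally have "nsq K g' + \<epsilon> * gsq K g' + (h + \<epsilon> / h) * bsq F g' <= P * (\<epsilon> * X) + \<epsilon> * X + 2 * Ct * (P + 1) * (\<epsilon> * X)"
    using n2 unfolding gg X_def by linarith
   also have "... = (P + 1) * (1 + 2 * Ct) * (\<epsilon> * X)" by (simp add: algebra_simps)
   also have "... <= (P + 1) * (1 + 2 * Ct) * smooth_local_sq \<epsilon> K g"
    unfolding L X_def using C w B by (intro mult_left_mono) auto
   also have "... <= C * smooth_local_sq \<epsilon> K g" using CC(2) L0 by (rule mult_right_mono)
   finally have fin: "nsq K g' + \<epsilon> * gsq K g' + (h + \<epsilon> / h) * bsq F g' <= C * smooth_local_sq \<epsilon> K g" .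
   have "g' = (%x. ph x - (p x + m))" by (simp add: g'_def g_def fun_eq_iff)
   moreover have "(%x. p x + m) : polys l" by (intro polys_add p polys_const)
   ultimately show ?thesis using fin unfolding g_def by (intro bexI[of _ "%x. p x + m"]) simp_all
  qed
 qed
qed

lemma bsq_diff:
 fixes K :: "(real^'n) set"
 assumes c: "cone_over K u F a b" and f: "smooth f" and g: "smooth g"
 shows "bsq F (%x. f x - g x) <= 2 * bsq F f + 2 * bsq F g"
proof -
 have [measurable]: "F : sets borel" "f : borel_measurable borel" "g : borel_measurable borel"
  using cone_over_D(4)[OF c] f g by (auto intro: borel_closed compact_imp_closed smooth_borel)
 have "surf_sq F (%x. f x - g x) <= (\<integral>\<^sup>+x. 2 * (ennreal ((f x)^2) * indicator F x) + 2 * (ennreal ((g x)^2) * indicator F x) \<partial>hausdorff (CARD('n) - 1))"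
  unfolding surf_sq_def
 proof (rule nn_integral_mono)
  fix x
  have "ennreal ((f x - g x)^2) <= ennreal (2 * (f x)^2 + 2 * (g x)^2)"
   using sum2_square_le[of "f x" "- g x"] by (intro ennreal_leI) simp
  also have "... = 2 * ennreal ((f x)^2) + 2 * ennreal ((g x)^2)" by (simp add: ennreal_plus ennreal_mult)
  finally show "ennreal ((f x - g x)^2) * indicator F x <= 2 * (ennreal ((f x)^2) * indicator F x) + 2 * (ennreal ((g x)^2) * indicator F x)"
   by (simp add: indicator_def)
 qed
 also have "... = 2 * surf_sq F f + 2 * surf_sq F g"
  unfolding surf_sq_def by (subst nn_integral_add) (auto simp: nn_integral_cmult)
 finally have "ennreal (bsq F (%x. f x - g x)) <= 2 * ennreal (bsq F f) + 2 * ennreal (bsq F g)"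
  by (simp only: facet_surf_sq[OF c f] facet_surf_sq[OF c g] facet_surf_sq[OF c smooth_diff[OF f g]])
 also have "... = ennreal (2 * bsq F f + 2 * bsq F g)"
  by (simp only: numeral_times_ennreal) (rule ennreal_plus[symmetric], simp_all)
 finally show ?thesis by (subst (asm) ennreal_le_iff) (simp_all del: ennreal_plus)
qed

text \<open>The jump of the two polynomials on the common facet is extended obliquely into the second simplex and
  subtracted there.\<close>

theorem conforming_estimate:
 fixes s :: real
 assumes s: "0 <= s"
 shows "\<exists>C\<ge>0. \<forall>(K1 :: (real^'n) set) K2 E a b u e ph p1 p2 \<epsilon> h. int CARD('n) simplex K1 --> int CARD('n) simplex K2 -->
  E facet_of K1 --> E facet_of K2 --> cone_over K2 u E a b --> e : E --> fat s h K1 --> fat s h K2 --> smooth ph -->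
  p1 : polys l --> p2 : polys l --> 0 < \<epsilon> --> (\<exists>q1\<in>polys l. \<exists>q2\<in>polys l. (\<forall>x. a \<bullet> x = b --> q1 x = q2 x) \<and>
   nsq K1 (%x. ph x - q1 x) + \<epsilon> * gsq K1 (%x. ph x - q1 x) + (nsq K2 (%x. ph x - q2 x) + \<epsilon> * gsq K2 (%x. ph x - q2 x))
   <= C * (smooth_local_sq \<epsilon> K1 (%x. ph x - p1 x) + smooth_local_sq \<epsilon> K2 (%x. ph x - p2 x)))"
proof -
 obtain Ce where Ce: "0 <= Ce" and ext: "\<forall>(K :: (real^'n) set) u F a b e q h. cone_over K u F a b --> e : F --> q : polys l --> fat s h K -->
  nsq K (%x. q (oblique u e a b x)) <= Ce * (h * bsq F q) & h^2 * gsq K (%x. q (oblique u e a b x)) <= Ce * (h * bsq F q)"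
  using extension_bound[where 'n='n, of l s] by (elim exE conjE)
 obtain Cl where Cl: "0 <= Cl" and loc: "\<forall>(K :: (real^'n) set) F ph p \<epsilon> h. int CARD('n) simplex K --> F facet_of K --> fat s h K --> smooth ph -->
  p : polys l --> 0 < \<epsilon> --> (\<exists>q\<in>polys l. nsq K (%x. ph x - q x) + \<epsilon> * gsq K (%x. ph x - q x) + (h + \<epsilon> / h) * bsq F (%x. ph x - q x)
   <= Cl * smooth_local_sq \<epsilon> K (%x. ph x - p x))"
  using facet_local_estimate[where 'n='n, OF s, of l] by (elim exE conjE)
 show ?thesis
 proof (intro exI[of _ "(2 + 4 * Ce) * Cl"] conjI allI impI)
  show "0 <= (2 + 4 * Ce) * Cl" using Ce Cl by simp
  fix K1 K2 :: "(real^'n) set" and E a b u e and ph p1 p2 :: "real^'n => real" and \<epsilon> h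
  assume K1: "int CARD('n) simplex K1" and K2: "int CARD('n) simplex K2" and F1: "E facet_of K1" and F2: "E facet_of K2"
   and co: "cone_over K2 u E a b" and e: "e : E" and f1: "fat s h K1" and f2: "fat s h K2" and sm: "smooth ph"
   and p1: "p1 : polys l" and p2: "p2 : polys l" and \<epsilon>: "0 < (\<epsilon>::real)"
  let ?L1 = "smooth_local_sq \<epsilon> K1 (%x. ph x - p1 x)" and ?L2 = "smooth_local_sq \<epsilon> K2 (%x. ph x - p2 x)"
  note c2 = simplex_full(1)[OF K2]
  have h: "0 < h" by (rule fat_pos[OF c2 f2])
  from loc[rule_format, OF K1 F1 f1 sm p1 \<epsilon>] obtain q1 where q1: "q1 : polys l"
   and T1: "nsq K1 (%x. ph x - q1 x) + \<epsilon> * gsq K1 (%x. ph x - q1 x) + (h + \<epsilon> / h) * bsq E (%x. ph x - q1 x) <= Cl * ?L1" ..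
  from loc[rule_format, OF K2 F2 f2 sm p2 \<epsilon>] obtain q2 where q2: "q2 : polys l"
   and T2: "nsq K2 (%x. ph x - q2 x) + \<epsilon> * gsq K2 (%x. ph x - q2 x) + (h + \<epsilon> / h) * bsq E (%x. ph x - q2 x) <= Cl * ?L2" ..
  define j where "j = (%x. q1 x - q2 x)"
  have j: "j : polys l" unfolding j_def by (intro polys_diff q1 q2)
  define w where "w = (%x. j (oblique u e a b x))"
  have w: "w : polys l" unfolding w_def by (rule oblique_poly[OF j])
  define g1 where "g1 = (%x. ph x - q1 x)"
  define g2 where "g2 = (%x. ph x - q2 x)"
  have gs: "smooth g1" "smooth g2" unfolding g1_def g2_def
   by (rule smooth_diff[OF sm polys_smooth[OF q1]], rule smooth_diff[OF sm polys_smooth[OF q2]])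
  have jj: "j = (%x. g2 x - g1 x)" by (simp add: j_def g1_def g2_def fun_eq_iff)
  define k where "k = h + \<epsilon> / h"
  have k: "0 <= k" using h \<epsilon> by (simp add: k_def)
  have \<beta>: "bsq E j <= 2 * bsq E g2 + 2 * bsq E g1" unfolding jj by (rule bsq_diff[OF co gs(2,1)])
  have wn: "nsq K2 w <= Ce * (h * bsq E j)" and wg0: "h^2 * gsq K2 w <= Ce * (h * bsq E j)"
   using ext[rule_format, OF co e j f2] unfolding w_def by simp_all
  have "h * gsq K2 w <= Ce * bsq E j"
   using wg0 h by (simp add: power2_eq_square mult.left_commute[of Ce] mult.assoc)
  then have "gsq K2 w <= Ce * bsq E j / h" using h by (simp add: pos_le_divide_eq mult.commute)
  then have "\<epsilon> * gsq K2 w <= \<epsilon> * (Ce * bsq E j / h)" using \<epsilon> by (intro mult_left_mono) auto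
  then have "nsq K2 w + \<epsilon> * gsq K2 w <= Ce * (h * bsq E j) + \<epsilon> * (Ce * bsq E j / h)" using wn by linarith
  also have "... = Ce * (k * bsq E j)" using h by (simp add: k_def field_simps)
  also have "... <= Ce * (k * (2 * bsq E g2 + 2 * bsq E g1))" using \<beta> k Ce by (intro mult_left_mono) auto
  finally have W: "nsq K2 w + \<epsilon> * gsq K2 w <= 2 * (Ce * (k * bsq E g1)) + 2 * (Ce * (k * bsq E g2))" by (simp add: algebra_simps)
  let ?g = "%x. g2 x - w x"
  have N: "nsq K2 ?g <= 2 * nsq K2 g2 + 2 * nsq K2 w" and G: "gsq K2 ?g <= 2 * gsq K2 g2 + 2 * gsq K2 w"
   using nsq_gsq_diff[OF c2 gs(2) polys_smooth[OF w]] by simp_all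
  define A1 where "A1 = nsq K1 g1 + \<epsilon> * gsq K1 g1"
  define A2 where "A2 = nsq K2 g2 + \<epsilon> * gsq K2 g2"
  have A: "0 <= A1" "0 <= A2" using \<epsilon> by (simp_all add: A1_def A2_def)
  have B: "0 <= k * bsq E g1" "0 <= k * bsq E g2" using k by simp_all
  have "\<epsilon> * gsq K2 ?g <= \<epsilon> * (2 * gsq K2 g2 + 2 * gsq K2 w)" using G \<epsilon> by (intro mult_left_mono) auto
  then have "A1 + (nsq K2 ?g + \<epsilon> * gsq K2 ?g) <= A1 + 2 * A2 + 2 * (nsq K2 w + \<epsilon> * gsq K2 w)"
   using N unfolding A2_def by (simp add: algebra_simps)
  also have "... <= 2 * A1 + 2 * A2 + 4 * Ce * (k * bsq E g1) + 4 * Ce * (k * bsq E g2)"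
   using W A by simp
  also have "... <= (2 + 4 * Ce) * (A1 + k * bsq E g1) + (2 + 4 * Ce) * (A2 + k * bsq E g2)"
  proof -
   have "0 <= 4 * Ce * A1" "0 <= 4 * Ce * A2" using A Ce by simp_all
   then show ?thesis using B by (simp add: algebra_simps)
  qed
  also have "... <= (2 + 4 * Ce) * (Cl * ?L1) + (2 + 4 * Ce) * (Cl * ?L2)"
   using T1 T2 Ce unfolding A1_def A2_def g1_def g2_def k_def by (intro add_mono mult_left_mono) auto
  finally have fin: "A1 + (nsq K2 ?g + \<epsilon> * gsq K2 ?g) <= (2 + 4 * Ce) * Cl * (?L1 + ?L2)" by (simp add: algebra_simps)
  have ge: "?g = (%x. ph x - (q2 x + w x))" by (simp add: g2_def fun_eq_iff)
  show "\<exists>q1\<in>polys l. \<exists>q2\<in>polys l. (\<forall>x. a \<bullet> x = b --> q1 x = q2 x) \<and>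
   nsq K1 (%x. ph x - q1 x) + \<epsilon> * gsq K1 (%x. ph x - q1 x) + (nsq K2 (%x. ph x - q2 x) + \<epsilon> * gsq K2 (%x. ph x - q2 x))
   <= (2 + 4 * Ce) * Cl * (?L1 + ?L2)"
  proof (rule bexI[OF _ q1], rule bexI[of _ "%x. q2 x + w x"], intro conjI allI impI)
   show "q1 x = q2 x + w x" if "a \<bullet> x = b" for x using that by (simp add: w_def oblique_hyperplane j_def)
   show "nsq K1 (%x. ph x - q1 x) + \<epsilon> * gsq K1 (%x. ph x - q1 x) + (nsq K2 (%x. ph x - (q2 x + w x)) + \<epsilon> * gsq K2 (%x. ph x - (q2 x + w x)))
    <= (2 + 4 * Ce) * Cl * (?L1 + ?L2)" using fin unfolding A1_def g1_def ge .
  qed (rule polys_add[OF q2 w])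
 qed
qed

section \<open>Smooth functions and weak gradients on subdomains\<close>

lemma smooth_in_L2: "open Om ==> bounded Om ==> smooth f ==> f : L2 (lebesgue_on Om)"
proof -
 assume Om: "open Om" "bounded Om" and f: "smooth f"
 obtain M where "\<forall>x\<in>Om. \<bar>f x\<bar> <= M" using smooth_bounded_on_bounded[OF f Om(2)] by blast
 then show ?thesis by (intro L2_bounded[OF Om smooth_borel[OF f]]) blast
qed

lemma grad_in_L2: "open Om ==> bounded Om ==> smooth f ==> grad f : L2 (lebesgue_on Om)"
 unfolding L2_vec(1)[of "grad f"] by (simp add: smooth_in_L2 smooth_partial_deriv)

lemma AE_not_in_closed_negligible:
 fixes S :: "(real^'n) set"
 assumes "closed S" "negligible S"
 shows "AE x in lborel. x \<notin> S"
proof (rule AE_not_in)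
 have "S : sets lborel" using assms(1) by (simp add: borel_closed)
 then show "S : null_sets lborel" using assms(2) unfolding negligible_iff_null_sets by (simp add: null_sets_completion_iff)
qed

lemma gsq_sum:
 assumes K: "compact K" and sm: "smooth f"
 shows "gsq K f = (\<Sum>i\<in>UNIV. nsq K (partial_deriv i f))"
proof -
 have [measurable]: "K : sets borel" "partial_deriv i f : borel_measurable borel" for i
  using K sm by (auto intro: borel_closed compact_imp_closed smooth_borel smooth_partial_deriv)
 have n: "(norm (grad f x))^2 = (\<Sum>i\<in>UNIV. (partial_deriv i f x)^2)" for x
  unfolding power2_norm_eq_inner inner_vec_def by (simp add: power2_eq_square)
 have e: "(\<Sum>i\<in>UNIV. ennreal ((partial_deriv i f x)^2)) = ennreal ((norm (grad f x))^2)" for x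
  unfolding n by (rule sum_ennreal) simp
 have "grad_sq_int K f = (\<integral>\<^sup>+x. (\<Sum>i\<in>UNIV. ennreal ((partial_deriv i f x)^2) * indicator K x) \<partial>lborel)"
  unfolding grad_sq_int_def e[symmetric] sum_distrib_right ..
 also have "... = (\<Sum>i\<in>UNIV. sq_int K (partial_deriv i f))"
  unfolding sq_int_def by (rule nn_integral_sum) measurable
 also have "... = (\<Sum>i\<in>UNIV. ennreal (nsq K (partial_deriv i f)))"
  by (intro sum.cong refl smooth_sq_int_finite(1)[OF K] smooth_partial_deriv sm)
 also have "... = ennreal (\<Sum>i\<in>UNIV. nsq K (partial_deriv i f))" by (rule sum_ennreal) simp
 finally show ?thesis unfolding smooth_sq_int_finite(2)[OF K sm] by (subst (asm) ennreal_inj) (simp_all add: sum_nonneg)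
qed

lemma smooth_L2_norm:
 fixes K :: "(real^'n) set"
 assumes K: "compact K" "convex K" and sm: "smooth f"
 shows "(L2_norm (lebesgue_on (interior K)) f)^2 = nsq K f"
  and "(L2_norm (lebesgue_on (interior K)) (grad f))^2 = gsq K f"
proof -
 have b: "bounded (interior K)" using compact_imp_bounded[OF K(1)] interior_subset by (rule bounded_subset)
 have main: "(L2_norm (lebesgue_on (interior K)) g)^2 = nsq K g" if g: "smooth g" for g :: "real^'n => real"
 proof -
  have "ennreal ((L2_norm (lebesgue_on (interior K)) g)^2) = sq_int (interior K) g"
   by (rule L2_norm_sq_int[OF open_interior smooth_borel[OF g] smooth_in_L2[OF open_interior b g]])
  also have "... = sq_int K g" unfolding sq_int_def
  proof (rule nn_integral_cong_AE)
   have "AE x in lborel. x \<notin> frontier K"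
    by (rule AE_not_in_closed_negligible[OF frontier_closed negligible_convex_frontier[OF K(2)]])
   then show "AE x in lborel. ennreal ((g x)^2) * indicator (interior K) x = ennreal ((g x)^2) * indicator K x"
   proof eventually_elim
    case (elim x)
    have "x : interior K \<longleftrightarrow> x : K"
     using elim K(1) interior_subset[of K] by (auto simp: frontier_def compact_imp_closed)
    then show ?case by (simp add: indicator_def)
   qed
  qed
  also have "... = ennreal (nsq K g)" by (rule smooth_sq_int_finite(1)[OF K(1) g])
  finally show ?thesis by (subst (asm) ennreal_inj) simp_all
 qed
 then show "(L2_norm (lebesgue_on (interior K)) f)^2 = nsq K f" using sm .
 have "(L2_norm (lebesgue_on (interior K)) (grad f))^2 = (\<Sum>i\<in>UNIV. (L2_norm (lebesgue_on (interior K)) (%x. grad f x $ i))^2)"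
  by (rule L2_vec(2)[OF grad_in_L2[OF open_interior b sm]])
 also have "... = (\<Sum>i\<in>UNIV. nsq K (partial_deriv i f))" by (simp add: main smooth_partial_deriv sm)
 finally show "(L2_norm (lebesgue_on (interior K)) (grad f))^2 = gsq K f" by (simp add: gsq_sum[OF K(1) sm])
qed

lemma is_weak_grad_diff:
 fixes u v :: "real^'n => real"
 assumes Om: "open Om" "bounded Om" and u: "u : L2 (lebesgue_on Om)" "G : L2 (lebesgue_on Om)" "is_weak_grad Om u G"
  and v: "v : L2 (lebesgue_on Om)" "H : L2 (lebesgue_on Om)" "is_weak_grad Om v H"
 shows "is_weak_grad Om (%x. u x - v x) (%x. G x - H x)"
 unfolding is_weak_grad_def
proof (intro ballI allI)
 fix ph i assume ph: "ph : test_functions Om"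
 let ?M = "lebesgue_on Om"
 have sm: "smooth ph" using ph by (simp add: test_functions_def)
 note p = smooth_in_L2[OF Om sm] smooth_in_L2[OF Om smooth_partial_deriv[OF sm, of i]]
 have c: "(%x. G x $ i) : L2 ?M" "(%x. H x $ i) : L2 ?M" using u(2) v(2) by (simp_all add: L2_vec(1)[of G] L2_vec(1)[of H])
 have "(\<integral>x. (u x - v x) * partial_deriv i ph x \<partial>?M) = (\<integral>x. u x * partial_deriv i ph x - v x * partial_deriv i ph x \<partial>?M)"
  by (simp add: left_diff_distrib)
 also have "... = (\<integral>x. u x * partial_deriv i ph x \<partial>?M) - (\<integral>x. v x * partial_deriv i ph x \<partial>?M)"
  by (rule Bochner_Integration.integral_diff) (intro L2_mult_integrable u v p)+
 also have "... = - (\<integral>x. G x $ i * ph x \<partial>?M) - - (\<integral>x. H x $ i * ph x \<partial>?M)"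
  using u(3) v(3) ph unfolding is_weak_grad_def by simp
 also have "... = - ((\<integral>x. G x $ i * ph x \<partial>?M) - (\<integral>x. H x $ i * ph x \<partial>?M))" by simp
 also have "(\<integral>x. G x $ i * ph x \<partial>?M) - (\<integral>x. H x $ i * ph x \<partial>?M) = (\<integral>x. G x $ i * ph x - H x $ i * ph x \<partial>?M)"
  by (rule Bochner_Integration.integral_diff[symmetric]) (intro L2_mult_integrable c p)+
 also have "... = (\<integral>x. (G x - H x) $ i * ph x \<partial>?M)" by (simp add: left_diff_distrib)
 finally show "(\<integral>x. (u x - v x) * partial_deriv i ph x \<partial>?M) = - (\<integral>x. (G x - H x) $ i * ph x \<partial>?M)" .
qed

lemma smooth_weak_grad: "open Om ==> smooth f ==> is_weak_grad Om f (grad f)"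
 by (rule locally_lipschitz_weak_grad[OF _ smooth_locally_lipschitz grad_borel]) (auto intro: smooth_has_derivative)

text \<open>A test function of the smaller set, and its derivatives, vanish off that set.\<close>

lemma weak_grad_restrict:
 fixes u :: "real^'n => real"
 assumes Om: "open Om" "open Om'" "Om' \<subseteq> Om" and w: "is_weak_grad Om u G"
 shows "is_weak_grad Om' u G"
 unfolding is_weak_grad_def
proof (intro ballI allI)
 fix ph i assume ph: "ph : test_functions Om'"
 let ?S = "closure {x. ph x ~= 0}"
 have S: "?S \<subseteq> Om'" and ph2: "ph : test_functions Om" using ph Om(3) by (auto simp: test_functions_def)
 have out: "ph x = 0" "partial_deriv i ph x = 0" if "x \<notin> Om'" for x
 proof -
  have xS: "x \<notin> ?S" using that S by blast
  then show "ph x = 0" using closure_subset[of "{x. ph x ~= 0}"] by auto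
  have "((%_. 0) has_derivative (%_. 0)) (at x)" by (rule has_derivative_const)
  then have "(ph has_derivative (%_. 0)) (at x)"
  proof (rule has_derivative_transform_within_open[where s = "- ?S"])
   show "!!y. y : - ?S ==> 0 = ph y" using closure_subset[of "{x. ph x ~= 0}"] by auto
  qed (use xS in auto)
  from partial_deriv_eq[OF this] show "partial_deriv i ph x = 0" by simp
 qed
 have eq: "(\<integral>x. f x \<partial>lebesgue_on Om') = (\<integral>x. f x \<partial>lebesgue_on Om)" if f: "!!x. x \<notin> Om' ==> f x = 0" for f :: "real^'n => real"
 proof -
  have e: "(%x. indicator Om' x *\<^sub>R f x) = (%x. indicator Om x *\<^sub>R f x)"
  proof
   show "indicator Om' x *\<^sub>R f x = indicator Om x *\<^sub>R f x" for x using f[of x] Om(3) by (auto simp: indicator_def)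
  qed
  have m: "Om \<inter> space lebesgue : sets lebesgue" "Om' \<inter> space lebesgue : sets lebesgue" using Om(1,2) by simp_all
  show ?thesis unfolding integral_restrict_space[OF m(1)] integral_restrict_space[OF m(2)] e ..
 qed
 have "(\<integral>x. u x * partial_deriv i ph x \<partial>lebesgue_on Om') = (\<integral>x. u x * partial_deriv i ph x \<partial>lebesgue_on Om)" by (rule eq) (simp add: out)
 also have "... = - (\<integral>x. G x $ i * ph x \<partial>lebesgue_on Om)" using w ph2 unfolding is_weak_grad_def by blast
 also have "(\<integral>x. G x $ i * ph x \<partial>lebesgue_on Om) = (\<integral>x. G x $ i * ph x \<partial>lebesgue_on Om')" by (rule eq[symmetric]) (simp add: out)
 finally show "(\<integral>x. u x * partial_deriv i ph x \<partial>lebesgue_on Om') = - (\<integral>x. G x $ i * ph x \<partial>lebesgue_on Om')" .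
qed

lemma L2_restrict:
 fixes f :: "real^'n => 'b::euclidean_space"
 assumes Om: "open Om" "open Om'" "Om' \<subseteq> Om" and f: "f : L2 (lebesgue_on Om)"
 shows "f : L2 (lebesgue_on Om')" "(L2_norm (lebesgue_on Om') f)^2 <= (L2_norm (lebesgue_on Om) f)^2"
proof -
 let ?g = "%x. (norm (f x))^2"
 have i: "integrable lebesgue (%x. indicator Om x *\<^sub>R ?g x)"
  using L2_D(2)[OF f] Om(1) by (subst (asm) integrable_restrict_space) auto
 have e: "indicator Om' x *\<^sub>R (indicator Om x *\<^sub>R ?g x) = indicator Om' x *\<^sub>R ?g x" for x
  using Om(3) by (auto simp: indicator_def)
 have i': "integrable lebesgue (%x. indicator Om' x *\<^sub>R ?g x)"
  using integrable_mult_indicator[OF _ i, of Om'] Om(2) unfolding e by simp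
 then have "integrable (lebesgue_on Om') ?g" using Om(2) by (subst integrable_restrict_space) auto
 then show "f : L2 (lebesgue_on Om')" by (intro L2_I measurable_restrict_mono[OF L2_D(1)[OF f] Om(3)])
 have "(\<integral>x. indicator Om' x *\<^sub>R ?g x \<partial>lebesgue) <= (\<integral>x. indicator Om x *\<^sub>R ?g x \<partial>lebesgue)"
  using Om(3) by (intro integral_mono[OF i' i]) (auto simp: indicator_def)
 then show "(L2_norm (lebesgue_on Om') f)^2 <= (L2_norm (lebesgue_on Om) f)^2"
  unfolding L2_norm_square using Om(1,2) by (simp add: integral_restrict_space)
qed

lemma energy_norm_smooth_diff:
 fixes u :: "real^'n => real"
 assumes st: "star_ball A x0 r" and b: "bounded A" and u: "u : L2 (lebesgue_on (interior A))" "G : L2 (lebesgue_on (interior A))"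
  "is_weak_grad (interior A) u G" and sm: "smooth \<psi>" and \<epsilon>: "0 <= \<epsilon>"
 shows "(energy_norm \<epsilon> A (%x. \<psi> x - u x))^2 = (L2_norm (lebesgue_on (interior A)) (%x. \<psi> x - u x))^2
   + \<epsilon> * (L2_norm (lebesgue_on (interior A)) (%x. grad \<psi> x - G x))^2"
  and "(energy_norm \<epsilon> A (%x. u x - \<psi> x))^2 = (L2_norm (lebesgue_on (interior A)) (%x. \<psi> x - u x))^2
   + \<epsilon> * (L2_norm (lebesgue_on (interior A)) (%x. grad \<psi> x - G x))^2"
proof -
 have bi: "bounded (interior A)" using b interior_subset by (rule bounded_subset)
 note p = smooth_in_L2[OF open_interior bi sm] grad_in_L2[OF open_interior bi sm] smooth_weak_grad[OF open_interior sm]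
 show "(energy_norm \<epsilon> A (%x. \<psi> x - u x))^2 = (L2_norm (lebesgue_on (interior A)) (%x. \<psi> x - u x))^2
   + \<epsilon> * (L2_norm (lebesgue_on (interior A)) (%x. grad \<psi> x - G x))^2"
  by (rule energy_norm_eq[OF st b L2_diff(1)[OF p(2) u(2)] is_weak_grad_diff[OF open_interior bi p u] \<epsilon>])
 have "(energy_norm \<epsilon> A (%x. u x - \<psi> x))^2 = (L2_norm (lebesgue_on (interior A)) (%x. u x - \<psi> x))^2
   + \<epsilon> * (L2_norm (lebesgue_on (interior A)) (%x. G x - grad \<psi> x))^2"
  by (rule energy_norm_eq[OF st b L2_diff(1)[OF u(2) p(2)] is_weak_grad_diff[OF open_interior bi u p] \<epsilon>])
 then show "(energy_norm \<epsilon> A (%x. u x - \<psi> x))^2 = (L2_norm (lebesgue_on (interior A)) (%x. \<psi> x - u x))^2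
   + \<epsilon> * (L2_norm (lebesgue_on (interior A)) (%x. grad \<psi> x - G x))^2"
  by (simp add: L2_norm_diff_commute[of _ u] L2_norm_diff_commute[of _ G])
qed

section \<open>Existence and stability of traces\<close>

lemma simplex_star_ball: "int CARD('n) simplex (K :: (real^'n) set) ==> \<exists>x r. star_ball K x r"
proof -
 assume K: "int CARD('n) simplex K"
 obtain x r where "0 < r" "cball x r \<subseteq> K" using simplex_full(4)[OF K] mem_interior_cball by blast
 then show ?thesis using convex_star_ball[OF simplex_full(2)[OF K]] by blast
qed

lemma energy_norm_nonneg: "0 <= \<epsilon> ==> 0 <= energy_norm \<epsilon> A v"
 by (simp add: energy_norm_def)

lemma tendsto_zero_of_square:
 fixes a :: "nat => real"
 assumes "!!k. 0 <= a k" "(%k. (a k)^2) \<longlonglongrightarrow> 0"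
 shows "a \<longlonglongrightarrow> 0"
 using tendsto_real_sqrt[OF assms(2)] assms(1) by simp

text \<open>The restrictions to the boundary of a rapidly converging sequence of smooth functions form a Cauchy sequence.\<close>

lemma trace_exists:
 fixes K :: "(real^'n) set"
 assumes K: "int CARD('n) simplex K" and u: "u : L2 (lebesgue_on (interior K))" "G : L2 (lebesgue_on (interior K))"
  "is_weak_grad (interior K) u G"
 shows "is_trace K u (bdry_trace K u)"
proof -
 let ?M = "lebesgue_on (interior K)"
 note S = simplex_full[OF K]
 obtain x r where st: "star_ball K x r" using simplex_star_ball[OF K] by blast
 note b = compact_imp_bounded[OF S(1)]
 obtain C where C: "0 <= C" "\<forall>f. smooth f --> bsq (frontier K) f <= C * (nsq K f + gsq K f)"
  using boundary_trace[OF K] by (elim exE conjE)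
 (* the boundary trace inequality turns differences of this size into (1/8)^k *)
 define e where "e k = (1/8) ^ k / (8 * C + 1)" for k :: nat
 have e: "0 < e k" for k using C by (simp add: e_def add_nonneg_pos)
 have es: "e (Suc k) <= e k" for k unfolding e_def using C by (intro divide_right_mono power_decreasing) auto
 have "\<forall>k. \<exists>ph. smooth ph & (%x. ph x - u x) : L2 ?M & (%x. grad ph x - G x) : L2 ?M \<and>
  (L2_norm ?M (%x. ph x - u x))^2 <= e k & (L2_norm ?M (%x. grad ph x - G x))^2 <= e k"
  by (intro allI smooth_dense_H1[OF st b u e])
 from choice[OF this] obtain ph where ph: "\<forall>k. smooth (ph k) & (%x. ph k x - u x) : L2 ?M & (%x. grad (ph k) x - G x) : L2 ?M \<and>
  (L2_norm ?M (%x. ph k x - u x))^2 <= e k & (L2_norm ?M (%x. grad (ph k) x - G x))^2 <= e k" ..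
 have sm: "smooth (ph k)" and L: "(%x. ph k x - u x) : L2 ?M" "(%x. grad (ph k) x - G x) : L2 ?M"
  and n: "(L2_norm ?M (%x. ph k x - u x))^2 <= e k" "(L2_norm ?M (%x. grad (ph k) x - G x))^2 <= e k" for k
  using ph by simp_all
 have "\<exists>g\<in>L2 (surface_on K). (%k. L2_norm (surface_on K) (%x. ph k x - g x)) \<longlonglongrightarrow> 0"
 proof (rule L2_fast_Cauchy)
  show "ph k : L2 (surface_on K)" for k by (rule surface_sq(1)[OF K sm])
  fix k
  define d where "d = (%x. ph k x - ph (Suc k) x)"
  have d: "smooth d" unfolding d_def by (rule smooth_diff[OF sm sm])
  have "nsq K d = (L2_norm ?M (%x. (ph k x - u x) - (ph (Suc k) x - u x)))^2"
   using smooth_L2_norm(1)[OF S(1,2) d] by (simp add: d_def)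
  also have "... <= 2 * (L2_norm ?M (%x. ph k x - u x))^2 + 2 * (L2_norm ?M (%x. ph (Suc k) x - u x))^2"
   by (rule L2_diff(2)[OF L(1) L(1)])
  also have "... <= 4 * e k" using n(1)[of k] n(1)[of "Suc k"] es[of k] by linarith
  finally have n4: "nsq K d <= 4 * e k" .
  have gd: "grad d = (%x. (grad (ph k) x - G x) - (grad (ph (Suc k)) x - G x))"
   unfolding d_def fun_eq_iff by (simp add: grad_diff[OF sm sm])
  have "gsq K d = (L2_norm ?M (%x. (grad (ph k) x - G x) - (grad (ph (Suc k)) x - G x)))^2"
   unfolding smooth_L2_norm(2)[OF S(1,2) d, symmetric] gd by simp
  also have "... <= 2 * (L2_norm ?M (%x. grad (ph k) x - G x))^2 + 2 * (L2_norm ?M (%x. grad (ph (Suc k)) x - G x))^2"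
   by (rule L2_diff(2)[OF L(2) L(2)])
  also have "... <= 4 * e k" using n(2)[of k] n(2)[of "Suc k"] es[of k] by linarith
  finally have g4: "gsq K d <= 4 * e k" .
  have "(L2_norm (surface_on K) d)^2 <= C * (nsq K d + gsq K d)" using surface_sq(2)[OF K d] C(2) d by simp
  also have "... <= C * (8 * e k)" using n4 g4 C(1) by (intro mult_left_mono) auto
  also have "... = (8 * C) / (8 * C + 1) * (1/8) ^ k" by (simp add: e_def)
  also have "... <= 1 * (1/8) ^ k" using C(1) by (intro mult_right_mono) (simp_all add: divide_le_eq)
  finally show "(L2_norm (surface_on K) (%x. ph k x - ph (Suc k) x))^2 <= (1/8) ^ k" by (simp add: d_def)
 qed
 then obtain g where g: "g : L2 (surface_on K)" "(%k. L2_norm (surface_on K) (%x. ph k x - g x)) \<longlonglongrightarrow> 0" ..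
 have "(%k. energy_norm 1 K (%x. ph k x - u x)) \<longlonglongrightarrow> 0"
 proof (rule tendsto_zero_of_square)
  show "(%k. (energy_norm 1 K (%x. ph k x - u x))^2) \<longlonglongrightarrow> 0"
  proof (rule Lim_null_comparison)
   show "\<forall>\<^sub>F k in sequentially. norm ((energy_norm 1 K (%x. ph k x - u x))^2) <= 2 * e k"
   proof (intro always_eventually allI)
    fix k
    have "(energy_norm 1 K (%x. ph k x - u x))^2 <= 2 * e k"
     using energy_norm_smooth_diff(1)[OF st b u sm[of k] zero_le_one] n[of k] by linarith
    then show "norm ((energy_norm 1 K (%x. ph k x - u x))^2) <= 2 * e k" by simp
   qed
   have "(%k. (1/8::real) ^ k) \<longlonglongrightarrow> 0" by (intro LIMSEQ_power_zero) simp
   from tendsto_mult_right_zero[OF this, of "2 / (8 * C + 1)"] show "(%k. 2 * e k) \<longlonglongrightarrow> 0" by (simp add: e_def)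
  qed
 qed (simp add: energy_norm_nonneg)
 with g(2) sm have "\<exists>ph. (\<forall>k. smooth (ph k)) & (%k. energy_norm 1 K (%x. ph k x - u x)) \<longlonglongrightarrow> 0 \<and>
   (%k. L2_norm (surface_on K) (%x. ph k x - g x)) \<longlonglongrightarrow> 0" by (intro exI[of _ ph] conjI allI)
 moreover have "u : H1 K" using u unfolding H1_def by blast
 ultimately have "is_trace K u g" using g(1) unfolding is_trace_def by (intro conjI)
 then show ?thesis unfolding bdry_trace_def by (rule someI[of "is_trace K u"])
qed

text \<open>Compare with the smooth functions that define the trace, and pass to the limit.\<close>

lemma trace_close:
 fixes K :: "(real^'n) set"
 assumes K: "int CARD('n) simplex K" and u: "u : L2 (lebesgue_on (interior K))" "G : L2 (lebesgue_on (interior K))"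
  "is_weak_grad (interior K) u G" and sm: "smooth ph"
  and C: "0 <= C" "\<forall>f. smooth f --> bsq (frontier K) f <= C * (nsq K f + gsq K f)"
 shows "bdry_trace K u : L2 (surface_on K)"
  and "(L2_norm (surface_on K) (%x. ph x - bdry_trace K u x))^2
   <= 4 * C * ((L2_norm (lebesgue_on (interior K)) (%x. ph x - u x))^2 + (L2_norm (lebesgue_on (interior K)) (%x. grad ph x - G x))^2)"
proof -
 let ?M = "lebesgue_on (interior K)" and ?S = "surface_on K"
 note S = simplex_full[OF K]
 obtain x r where st: "star_ball K x r" using simplex_star_ball[OF K] by blast
 note b = compact_imp_bounded[OF S(1)]
 have bi: "bounded (interior K)" using b interior_subset by (rule bounded_subset)
 define T where "T = bdry_trace K u"
 from trace_exists[OF K u] obtain \<psi> where T: "T : L2 ?S" and ps: "\<forall>k. smooth (\<psi> k)"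
  and p1: "(%k. energy_norm 1 K (%x. \<psi> k x - u x)) \<longlonglongrightarrow> 0" and p2: "(%k. L2_norm ?S (%x. \<psi> k x - T x)) \<longlonglongrightarrow> 0"
  unfolding is_trace_def T_def[symmetric] by (elim exE conjE)
 show "bdry_trace K u : L2 ?S" using T by (simp add: T_def)
 have ps: "smooth (\<psi> k)" for k using ps by simp
 have L: "(%x. f x - u x) : L2 ?M" "(%x. grad f x - G x) : L2 ?M" if "smooth f" for f
  using L2_diff(1)[OF smooth_in_L2[OF open_interior bi that] u(1)] L2_diff(1)[OF grad_in_L2[OF open_interior bi that] u(2)] by simp_all
 define D where "D = (L2_norm ?M (%x. ph x - u x))^2 + (L2_norm ?M (%x. grad ph x - G x))^2"
 define \<tau> where "\<tau> k = L2_norm ?S (%x. \<psi> k x - T x)" for k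
 define \<theta> where "\<theta> k = energy_norm 1 K (%x. \<psi> k x - u x)" for k
 have le: "(L2_norm ?S (%x. ph x - T x))^2 <= 4 * C * D + (4 * C * (\<theta> k)^2 + 2 * (\<tau> k)^2)" for k
 proof -
  define d where "d = (%x. ph x - \<psi> k x)"
  have d: "smooth d" unfolding d_def by (rule smooth_diff[OF sm ps])
  have "nsq K d = (L2_norm ?M (%x. (ph x - u x) - (\<psi> k x - u x)))^2"
   using smooth_L2_norm(1)[OF S(1,2) d] by (simp add: d_def)
  also have "... <= 2 * (L2_norm ?M (%x. ph x - u x))^2 + 2 * (L2_norm ?M (%x. \<psi> k x - u x))^2"
   by (rule L2_diff(2)[OF L(1)[OF sm] L(1)[OF ps]])
  finally have n: "nsq K d <= ..." .
  have gd: "grad d = (%x. (grad ph x - G x) - (grad (\<psi> k) x - G x))"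
   unfolding d_def fun_eq_iff by (simp add: grad_diff[OF sm ps])
  have "gsq K d = (L2_norm ?M (%x. (grad ph x - G x) - (grad (\<psi> k) x - G x)))^2"
   unfolding smooth_L2_norm(2)[OF S(1,2) d, symmetric] gd by simp
  also have "... <= 2 * (L2_norm ?M (%x. grad ph x - G x))^2 + 2 * (L2_norm ?M (%x. grad (\<psi> k) x - G x))^2"
   by (rule L2_diff(2)[OF L(2)[OF sm] L(2)[OF ps]])
  finally have g: "gsq K d <= ..." .
  have \<theta>: "(\<theta> k)^2 = (L2_norm ?M (%x. \<psi> k x - u x))^2 + (L2_norm ?M (%x. grad (\<psi> k) x - G x))^2"
   using energy_norm_smooth_diff(1)[OF st b u ps, of 1] by (simp add: \<theta>_def)
  have "(L2_norm ?S d)^2 <= C * (nsq K d + gsq K d)" using surface_sq(2)[OF K d] C(2) d by simp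
  also have "... <= C * (2 * D + 2 * (\<theta> k)^2)" using n g C(1) unfolding \<theta> D_def by (intro mult_left_mono) auto
  finally have s: "(L2_norm ?S d)^2 <= C * (2 * D + 2 * (\<theta> k)^2)" .
  have "(L2_norm ?S (%x. d x + (\<psi> k x - T x)))^2 <= 2 * (L2_norm ?S d)^2 + 2 * (\<tau> k)^2"
   unfolding \<tau>_def by (rule L2_add(2)[OF surface_sq(1)[OF K d] L2_diff(1)[OF surface_sq(1)[OF K ps] T]])
  also have "... <= 2 * (C * (2 * D + 2 * (\<theta> k)^2)) + 2 * (\<tau> k)^2" using s by simp
  finally show ?thesis by (simp add: d_def algebra_simps)
 qed
 have "(%k. 4 * C * D + (4 * C * (\<theta> k)^2 + 2 * (\<tau> k)^2)) \<longlonglongrightarrow> 4 * C * D + (4 * C * 0^2 + 2 * 0^2)"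
  using p1 p2 unfolding \<theta>_def[symmetric] \<tau>_def[symmetric] by (intro tendsto_intros)
 then have "(L2_norm ?S (%x. ph x - T x))^2 <= 4 * C * D + (4 * C * 0^2 + 2 * 0^2)"
  by (rule LIMSEQ_le_const) (use le in blast)
 then show "(L2_norm ?S (%x. ph x - bdry_trace K u x))^2
   <= 4 * C * ((L2_norm ?M (%x. ph x - u x))^2 + (L2_norm ?M (%x. grad ph x - G x))^2)" by (simp add: T_def D_def)
qed

section \<open>Continuous piecewise polynomials\<close>

definition glue :: "real^'n => real => (real^'n => 'b) => (real^'n => 'b) => real^'n => 'b" where
 "glue a b f g x = (if a \<bullet> x <= b then f x else g x)"

text \<open>Where \<open>a \<bullet> x \<le> b\<close>, the map \<open>\<lambda>x. x + max (b - a \<bullet> x) 0 *\<^sub>R a\<close> is the projection onto the hyperplane, and elsewhere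
  it is the identity. It turns the glued function into a composition of Lipschitz maps.\<close>

lemma glue_locally_lipschitz:
 fixes a :: "real^'n"
 assumes a: "norm a = 1" and f: "smooth f" and g: "smooth g" and eq: "!!x. a \<bullet> x = b ==> f x = g x"
 shows "locally_lipschitz (glue a b f g)"
proof -
 define \<kappa> where "\<kappa> x = x + max (b - a \<bullet> x) 0 *\<^sub>R a" for x
 define p where "p = (%x. g x - f x)"
 have aa: "a \<bullet> a = 1" using a by (simp add: norm_eq_1)
 have gl: "glue a b f g = (%x. f x + p (\<kappa> x))"
 proof
  fix x show "glue a b f g x = f x + p (\<kappa> x)"
  proof (cases "a \<bullet> x <= b")
   case True
   then have "a \<bullet> \<kappa> x = b" by (simp add: \<kappa>_def inner_add_right aa)
   then show ?thesis using eq True by (simp add: glue_def p_def)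
  next
   case False then show ?thesis by (simp add: glue_def p_def \<kappa>_def)
  qed
 qed
 have lip: "norm (\<kappa> x - \<kappa> y) <= 2 * norm (x - y)" for x y
 proof -
  have "\<bar>max (b - a \<bullet> x) 0 - max (b - a \<bullet> y) 0\<bar> <= \<bar>a \<bullet> x - a \<bullet> y\<bar>" by (auto simp: max_def)
  also have "... = \<bar>a \<bullet> (x - y)\<bar>" by (simp add: inner_diff_right)
  also have "... <= norm (x - y)" using Cauchy_Schwarz_ineq2[of a "x - y"] a by simp
  finally have m: "\<bar>max (b - a \<bullet> x) 0 - max (b - a \<bullet> y) 0\<bar> <= norm (x - y)" .
  have "\<kappa> x - \<kappa> y = (x - y) + (max (b - a \<bullet> x) 0 - max (b - a \<bullet> y) 0) *\<^sub>R a" by (simp add: \<kappa>_def algebra_simps)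
  then have "norm (\<kappa> x - \<kappa> y) <= norm (x - y) + norm ((max (b - a \<bullet> x) 0 - max (b - a \<bullet> y) 0) *\<^sub>R a)" by (metis norm_triangle_ineq)
  then show ?thesis using m a by simp
 qed
 have "locally_lipschitz (%x. p (\<kappa> x))" unfolding locally_lipschitz_def
 proof
  fix R :: real
  have pl: "locally_lipschitz p" unfolding p_def by (rule smooth_locally_lipschitz[OF smooth_diff[OF g f]])
  let ?R = "norm (\<kappa> 0) + 2 * R"
  obtain L where L: "\<forall>x\<in>cball 0 ?R. \<forall>y\<in>cball 0 ?R. \<bar>p x - p y\<bar> <= L * norm (x - y)"
   using pl unfolding locally_lipschitz_def by blast
  have in': "\<kappa> x : cball 0 ?R" if "x : cball 0 R" for x
  proof -
   have "norm (\<kappa> x) <= norm (\<kappa> 0) + norm (\<kappa> x - \<kappa> 0)" using norm_triangle_ineq[of "\<kappa> 0" "\<kappa> x - \<kappa> 0"] by simp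
   then show ?thesis using lip[of x 0] that by simp
  qed
  show "\<exists>L. \<forall>x\<in>cball 0 R. \<forall>y\<in>cball 0 R. \<bar>p (\<kappa> x) - p (\<kappa> y)\<bar> <= L * norm (x - y)"
  proof (intro exI ballI)
   fix x y :: "real^'n" assume xy: "x : cball 0 R" "y : cball 0 R"
   have "\<bar>p (\<kappa> x) - p (\<kappa> y)\<bar> <= L * norm (\<kappa> x - \<kappa> y)" using L in'[OF xy(1)] in'[OF xy(2)] by blast
   also have "... <= \<bar>L\<bar> * norm (\<kappa> x - \<kappa> y)" by (intro mult_right_mono) auto
   also have "... <= \<bar>L\<bar> * (2 * norm (x - y))" using lip by (intro mult_left_mono) auto
   finally show "\<bar>p (\<kappa> x) - p (\<kappa> y)\<bar> <= (2 * \<bar>L\<bar>) * norm (x - y)" by simp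
  qed
 qed
 then show ?thesis unfolding gl by (rule locally_lipschitz_add[OF smooth_locally_lipschitz[OF f]])
qed

lemma AE_not_hyperplane:
 fixes a :: "real^'n"
 assumes "norm a = 1"
 shows "AE x in lborel. a \<bullet> x ~= b"
proof -
 have "a ~= 0" using assms by auto
 then have "AE x in lborel. x \<notin> {x. a \<bullet> x = b}"
  by (intro AE_not_in_closed_negligible closed_hyperplane negligible_hyperplane) simp
 then show ?thesis by simp
qed

lemma glue_borel:
 fixes f g :: "real^'n => 'b::euclidean_space"
 assumes [measurable]: "f : borel_measurable borel" "g : borel_measurable borel"
 shows "glue a b f g : borel_measurable borel"
proof -
 have [measurable]: "{x. a \<bullet> x <= b} : sets borel" by (simp add: borel_closed closed_halfspace_le)
 have "(%x. if x : {x. a \<bullet> x <= b} then f x else g x) : borel_measurable borel" by measurable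
 then show ?thesis by (simp add: glue_def[abs_def])
qed

lemma glue_weak_grad:
 fixes a :: "real^'n"
 assumes a: "norm a = 1" and f: "smooth f" and g: "smooth g" and eq: "!!x. a \<bullet> x = b ==> f x = g x" and Om: "open Om"
 shows "is_weak_grad Om (glue a b f g) (glue a b (grad f) (grad g))"
proof (rule locally_lipschitz_weak_grad[OF Om glue_locally_lipschitz[OF a f g eq] glue_borel[OF grad_borel[OF f] grad_borel[OF g]]])
 show "AE x in lborel. (glue a b f g has_derivative (%h. glue a b (grad f) (grad g) x \<bullet> h)) (at x)"
  using AE_not_hyperplane[OF a, of b]
 proof eventually_elim
  case (elim x)
  show ?case
  proof (cases "a \<bullet> x < b")
   case True
   have "(glue a b f g has_derivative (%h. grad f x \<bullet> h)) (at x)"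
    by (rule has_derivative_transform_within_open[OF smooth_has_derivative[OF f] open_halfspace_lt[of a b]])
     (use True in \<open>auto simp: glue_def\<close>)
   then show ?thesis using True by (simp add: glue_def)
  next
   case False
   then have gt: "b < a \<bullet> x" using elim by simp
   have "(glue a b f g has_derivative (%h. grad g x \<bullet> h)) (at x)"
    by (rule has_derivative_transform_within_open[OF smooth_has_derivative[OF g] open_halfspace_gt[of b a]])
     (use gt in \<open>auto simp: glue_def\<close>)
   then show ?thesis using gt by (simp add: glue_def)
  qed
 qed
qed

lemma piecewise_L2:
 fixes F :: "real^'n => real"
 assumes K: "compact K1" "compact K2" and f: "smooth f1" "smooth f2" and Om: "open Om" and F [measurable]: "F : borel_measurable borel"
  and ae: "AE x in lborel. x : Om --> x : K1 & F x = f1 x \<or> x : K2 & F x = f2 x"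
 shows "F : L2 (lebesgue_on Om)" "(L2_norm (lebesgue_on Om) F)^2 <= nsq K1 f1 + nsq K2 f2"
proof -
 have [measurable]: "K1 : sets borel" "K2 : sets borel" "f1 : borel_measurable borel" "f2 : borel_measurable borel"
  using K f by (auto intro: borel_closed compact_imp_closed smooth_borel)
 have "sq_int Om F <= (\<integral>\<^sup>+x. ennreal ((f1 x)^2) * indicator K1 x + ennreal ((f2 x)^2) * indicator K2 x \<partial>lborel)"
  unfolding sq_int_def
 proof (rule nn_integral_mono_AE)
  show "AE x in lborel. ennreal ((F x)^2) * indicator Om x <= ennreal ((f1 x)^2) * indicator K1 x + ennreal ((f2 x)^2) * indicator K2 x"
   using ae by eventually_elim (auto simp: indicator_def)
 qed
 also have "... = sq_int K1 f1 + sq_int K2 f2" unfolding sq_int_def by (rule nn_integral_add) measurable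
 also have "... = ennreal (nsq K1 f1 + nsq K2 f2)" using K f by (simp add: smooth_sq_int_finite(1))
 finally have le: "sq_int Om F <= ennreal (nsq K1 f1 + nsq K2 f2)" .
 have m: "F : borel_measurable (lebesgue_on Om)" using F by (intro measurable_restrict_space1 measurable_completion) simp
 show "F : L2 (lebesgue_on Om)" "(L2_norm (lebesgue_on Om) F)^2 <= nsq K1 f1 + nsq K2 f2"
  using L2_norm_rep[OF Om F m _ le] by simp_all
qed

text \<open>The weak gradient of the glued function is the piecewise one, so that both parts of the norm split into
integrals over the two simplices.\<close>

theorem glued_error:
 fixes K1 K2 E :: "(real^'n) set"
 assumes c2: "cone_over K2 u2 E a b" and c1: "cone_over K1 u1 E (- a) (- b)" and st: "star_ball (K1 \<union> K2) e r"
  and u: "u : L2 (lebesgue_on (interior (K1 \<union> K2)))" "G : L2 (lebesgue_on (interior (K1 \<union> K2)))" "is_weak_grad (interior (K1 \<union> K2)) u G"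
  and sm: "smooth ph" and q1: "q1 : polys l" and q2: "q2 : polys l" and eq0: "\<forall>x. a \<bullet> x = b --> q1 x = q2 x" and \<epsilon>: "0 <= \<epsilon>"
 shows "\<exists>Q\<in>cont_pw_polys l K1 K2. (energy_norm \<epsilon> (K1 \<union> K2) (%x. u x - Q x))^2
  <= 2 * ((L2_norm (lebesgue_on (interior (K1 \<union> K2))) (%x. ph x - u x))^2 + \<epsilon> * (L2_norm (lebesgue_on (interior (K1 \<union> K2))) (%x. grad ph x - G x))^2)
  + 2 * (nsq K1 (%x. ph x - q1 x) + \<epsilon> * gsq K1 (%x. ph x - q1 x) + (nsq K2 (%x. ph x - q2 x) + \<epsilon> * gsq K2 (%x. ph x - q2 x)))"
proof -
 have eq: "!!x. a \<bullet> x = b ==> q1 x = q2 x" using eq0 by simp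
 define Om where "Om = interior (K1 \<union> K2)"
 let ?M = "lebesgue_on Om"
 have K: "compact K1" "compact K2" and a: "norm a = 1" using cone_over_D(1)[OF c1] cone_over_D(1,6)[OF c2] by auto
 have b: "bounded (K1 \<union> K2)" using K by (simp add: compact_imp_bounded)
 have Om: "open Om" "bounded Om" "Om \<subseteq> K1 \<union> K2" using b interior_subset by (auto simp: Om_def intro: bounded_subset)
 have s1: "a \<bullet> x <= b" if "x : K1" for x using cone_over_side[OF c1 that] by simp
 have s2: "b <= a \<bullet> x" if "x : K2" for x using cone_over_side[OF c2 that] .
 have qs: "smooth q1" "smooth q2" using q1 q2 by (auto intro: polys_smooth)
 define Q where "Q = glue a b q1 q2"
 define H where "H = glue a b (grad q1) (grad q2)"
 have Q1: "Q x = q1 x" if "x : K1" for x using s1[OF that] by (simp add: Q_def glue_def)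
 have Q2: "Q x = q2 x" if "x : K2" for x using s2[OF that] eq[of x] by (auto simp: Q_def glue_def)
 have ll: "locally_lipschitz Q" unfolding Q_def by (rule glue_locally_lipschitz[OF a qs eq])
 have "continuous_on (K1 \<union> K2) Q" using locally_lipschitz_continuous[OF ll] by (rule continuous_on_subset) simp
 then have Qc: "Q : cont_pw_polys l K1 K2" using Q1 Q2 q1 q2 by (auto simp: cont_pw_polys_def)
 have wg: "is_weak_grad Om Q H" unfolding Q_def H_def by (rule glue_weak_grad[OF a qs eq Om(1)])
 have [measurable]: "Q : borel_measurable borel" "H : borel_measurable borel" unfolding Q_def H_def
  by (intro glue_borel smooth_borel grad_borel qs)+
 have [measurable]: "ph : borel_measurable borel" "grad ph : borel_measurable borel" using sm by (auto intro: grad_borel)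
 have Hi [measurable]: "(%x. H x $ i) : borel_measurable borel" for i
  using measurable_compose[OF _ borel_measurable_continuous_onI, of H borel "%v. v $ i"] by (simp add: continuous_on_component)
 have [measurable]: "partial_deriv i ph : borel_measurable borel" for i using sm by (intro smooth_borel smooth_partial_deriv)
 have aeQ: "AE x in lborel. x : Om --> x : K1 & f x - Q x = f x - q1 x \<or> x : K2 & f x - Q x = f x - q2 x" for f :: "real^'n => real"
  using Om(3) Q1 Q2 by (intro AE_I2) auto
 have aeH: "AE x in lborel. x : Om --> x : K1 & H x = grad q1 x \<or> x : K2 & H x = grad q2 x"
  using AE_not_hyperplane[OF a, of b]
 proof eventually_elim
  case (elim x)
  show ?case
  proof
   assume "x : Om"
   then consider "x : K1" | "x : K2" using Om(3) by blast
   then show "x : K1 & H x = grad q1 x \<or> x : K2 & H x = grad q2 x"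
    using s1[of x] s2[of x] elim by cases (auto simp: H_def glue_def)
  qed
 qed
 let ?g1 = "%x. ph x - q1 x" and ?g2 = "%x. ph x - q2 x"
 have gs: "smooth ?g1" "smooth ?g2" using smooth_diff[OF sm qs(1)] smooth_diff[OF sm qs(2)] by simp_all
 have d: "(%x. ph x - Q x) : L2 ?M" "(L2_norm ?M (%x. ph x - Q x))^2 <= nsq K1 ?g1 + nsq K2 ?g2"
  using piecewise_L2[OF K gs Om(1) _ aeQ[of ph]] by simp_all
 have pph: "ph : L2 ?M" "grad ph : L2 ?M" by (rule smooth_in_L2[OF Om(1,2) sm], rule grad_in_L2[OF Om(1,2) sm])
 have QL: "Q : L2 ?M" using L2_diff(1)[OF pph(1) d(1)] by simp
 have pd: "partial_deriv i ?g1 = (%x. partial_deriv i ph x - grad q1 x $ i)" "partial_deriv i ?g2 = (%x. partial_deriv i ph x - grad q2 x $ i)" for i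
  using grad_diff[OF sm qs(1)] grad_diff[OF sm qs(2)] by (simp_all add: fun_eq_iff vec_eq_iff)
 have D: "(%x. (grad ph x - H x) $ i) : L2 ?M"
  "(L2_norm ?M (%x. (grad ph x - H x) $ i))^2 <= nsq K1 (partial_deriv i ?g1) + nsq K2 (partial_deriv i ?g2)" for i
 proof -
  have ae: "AE x in lborel. x : Om --> x : K1 & (grad ph x - H x) $ i = partial_deriv i ?g1 x \<or> x : K2 & (grad ph x - H x) $ i = partial_deriv i ?g2 x"
   using aeH unfolding pd by eventually_elim auto
  have m: "(%x. (grad ph x - H x) $ i) : borel_measurable borel" by simp
  show "(%x. (grad ph x - H x) $ i) : L2 ?M"
   "(L2_norm ?M (%x. (grad ph x - H x) $ i))^2 <= nsq K1 (partial_deriv i ?g1) + nsq K2 (partial_deriv i ?g2)"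
   using piecewise_L2[OF K smooth_partial_deriv[OF gs(1)] smooth_partial_deriv[OF gs(2)] Om(1) m ae] by simp_all
 qed
 have DL: "(%x. grad ph x - H x) : L2 ?M" unfolding L2_vec(1)[of "%x. grad ph x - H x"] using D(1) by blast
 have HL: "H : L2 ?M" using L2_diff(1)[OF pph(2) DL] by simp
 have "(L2_norm ?M (%x. grad ph x - H x))^2 = (\<Sum>i\<in>UNIV. (L2_norm ?M (%x. (grad ph x - H x) $ i))^2)" by (rule L2_vec(2)[OF DL])
 also have "... <= (\<Sum>i\<in>UNIV. nsq K1 (partial_deriv i ?g1) + nsq K2 (partial_deriv i ?g2))" by (intro sum_mono D(2))
 also have "... = gsq K1 ?g1 + gsq K2 ?g2" by (simp add: gsq_sum[OF K(1) gs(1)] gsq_sum[OF K(2) gs(2)] sum.distrib)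
 finally have dg: "(L2_norm ?M (%x. grad ph x - H x))^2 <= gsq K1 ?g1 + gsq K2 ?g2" .
 note u' = u[folded Om_def]
 have "(energy_norm \<epsilon> (K1 \<union> K2) (%x. u x - Q x))^2 = (L2_norm ?M (%x. u x - Q x))^2 + \<epsilon> * (L2_norm ?M (%x. G x - H x))^2"
  unfolding Om_def
  by (rule energy_norm_eq[OF st b L2_diff(1)[OF u'(2) HL, unfolded Om_def] is_weak_grad_diff[OF Om(1,2) u' QL HL wg, unfolded Om_def] \<epsilon>])
 moreover have "(L2_norm ?M (%x. u x - Q x))^2 <= 2 * (L2_norm ?M (%x. ph x - u x))^2 + 2 * (nsq K1 ?g1 + nsq K2 ?g2)"
  using L2_diff(2)[OF d(1) L2_diff(1)[OF pph(1) u'(1)]] d(2) by simp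
 moreover have "(L2_norm ?M (%x. G x - H x))^2 <= 2 * (L2_norm ?M (%x. grad ph x - G x))^2 + 2 * (gsq K1 ?g1 + gsq K2 ?g2)"
  using L2_diff(2)[OF DL L2_diff(1)[OF pph(2) u'(2)]] dg by simp
 then have "\<epsilon> * (L2_norm ?M (%x. G x - H x))^2 <= \<epsilon> * (2 * (L2_norm ?M (%x. grad ph x - G x))^2 + 2 * (gsq K1 ?g1 + gsq K2 ?g2))"
  using \<epsilon> by (rule mult_left_mono)
 ultimately have "(energy_norm \<epsilon> (K1 \<union> K2) (%x. u x - Q x))^2 <= 2 * ((L2_norm ?M (%x. ph x - u x))^2 + \<epsilon> * (L2_norm ?M (%x. grad ph x - G x))^2)
  + 2 * (nsq K1 ?g1 + \<epsilon> * gsq K1 ?g1 + (nsq K2 ?g2 + \<epsilon> * gsq K2 ?g2))" by (simp add: algebra_simps)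
 then show ?thesis using Qc unfolding Om_def by blast
qed

section \<open>The error of the best approximation\<close>

definition local_error_sq :: "real => (real^'n) set => (real^'n => real) => (real^'n => real) => real" where
 "local_error_sq \<epsilon> K u P = (energy_norm \<epsilon> K (%x. u x - P x))^2
  + area_volume_ratio K * (L2_norm (surface_on K) (%x. bdry_trace K u x - P x))^2"

lemma area_volume_ratio_nonneg: "0 <= area_volume_ratio K"
 by (simp add: area_volume_ratio_def)

text \<open>Replacing \<open>u\<close> by a smooth approximation changes the local error by an amount that tends to zero; its constant may
depend on \<open>\<epsilon>\<close> and on the simplex.\<close>

lemma smooth_local_sq_le:
 fixes K :: "(real^'n) set"
 assumes K: "int CARD('n) simplex K" and u: "u : L2 (lebesgue_on (interior K))" "G : L2 (lebesgue_on (interior K))"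
  "is_weak_grad (interior K) u G" and sm: "smooth ph" and p: "p : polys l" and \<epsilon>: "0 <= \<epsilon>"
  and C: "0 <= C" "\<forall>f. smooth f --> bsq (frontier K) f <= C * (nsq K f + gsq K f)"
  and dl: "(L2_norm (lebesgue_on (interior K)) (%x. ph x - u x))^2 <= dl" "(L2_norm (lebesgue_on (interior K)) (%x. grad ph x - G x))^2 <= dl"
 shows "smooth_local_sq \<epsilon> K (%x. ph x - p x) <= 2 * local_error_sq \<epsilon> K u p + (2 * (1 + \<epsilon>) + 16 * area_volume_ratio K * C) * dl"
proof -
 let ?M = "lebesgue_on (interior K)" and ?S = "surface_on K"
 note S = simplex_full[OF K]
 obtain x r where st: "star_ball K x r" using simplex_star_ball[OF K] by blast
 note b = compact_imp_bounded[OF S(1)]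
 have bi: "bounded (interior K)" using b interior_subset by (rule bounded_subset)
 have ps: "smooth p" using p by (rule polys_smooth)
 define f where "f = (%x. ph x - p x)"
 have fs: "smooth f" unfolding f_def by (rule smooth_diff[OF sm ps])
 define T where "T = bdry_trace K u"
 define w where "w = area_volume_ratio K"
 have w: "0 <= w" by (simp add: w_def area_volume_ratio_nonneg)
 have L: "(%x. f x - u x) : L2 ?M" "(%x. grad f x - G x) : L2 ?M" if "smooth f" for f
  using L2_diff(1)[OF smooth_in_L2[OF open_interior bi that] u(1)] L2_diff(1)[OF grad_in_L2[OF open_interior bi that] u(2)] by simp_all
 define A where "A = (L2_norm ?M (%x. p x - u x))^2"
 define B where "B = (L2_norm ?M (%x. grad p x - G x))^2"
 define D where "D = (L2_norm ?S (%x. T x - p x))^2"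
 have "nsq K f = (L2_norm ?M (%x. (ph x - u x) - (p x - u x)))^2"
  using smooth_L2_norm(1)[OF S(1,2) fs] by (simp add: f_def)
 also have "... <= 2 * (L2_norm ?M (%x. ph x - u x))^2 + 2 * A"
  unfolding A_def by (rule L2_diff(2)[OF L(1)[OF sm] L(1)[OF ps]])
 finally have n: "nsq K f <= 2 * dl + 2 * A" using dl(1) by linarith
 have gd: "grad f = (%x. (grad ph x - G x) - (grad p x - G x))"
  unfolding f_def fun_eq_iff by (simp add: grad_diff[OF sm ps])
 have "gsq K f = (L2_norm ?M (%x. (grad ph x - G x) - (grad p x - G x)))^2"
  unfolding smooth_L2_norm(2)[OF S(1,2) fs, symmetric] gd by simp
 also have "... <= 2 * (L2_norm ?M (%x. grad ph x - G x))^2 + 2 * B"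
  unfolding B_def by (rule L2_diff(2)[OF L(2)[OF sm] L(2)[OF ps]])
 finally have "gsq K f <= 2 * dl + 2 * B" using dl(2) by linarith
 then have g: "\<epsilon> * gsq K f <= \<epsilon> * (2 * dl + 2 * B)" using \<epsilon> by (rule mult_left_mono)
 note tc = trace_close[OF K u sm C, folded T_def]
 have "(L2_norm ?S (%x. ph x - T x))^2 <= 4 * C * ((L2_norm ?M (%x. ph x - u x))^2 + (L2_norm ?M (%x. grad ph x - G x))^2)"
  by (rule tc(2))
 also have "... <= 4 * C * (dl + dl)" using dl C(1) by (intro mult_left_mono add_mono) auto
 finally have t: "(L2_norm ?S (%x. ph x - T x))^2 <= 8 * C * dl" by simp
 have "bsq (frontier K) f = (L2_norm ?S (%x. (ph x - T x) + (T x - p x)))^2"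
  using surface_sq(2)[OF K fs] by (simp add: f_def)
 also have "... <= 2 * (L2_norm ?S (%x. ph x - T x))^2 + 2 * D"
  unfolding D_def by (rule L2_add(2)[OF L2_diff(1)[OF surface_sq(1)[OF K sm] tc(1)] L2_diff(1)[OF tc(1) surface_sq(1)[OF K ps]]])
 finally have "bsq (frontier K) f <= 16 * C * dl + 2 * D" using t by linarith
 then have bb: "w * bsq (frontier K) f <= w * (16 * C * dl + 2 * D)" using w by (rule mult_left_mono)
 have "local_error_sq \<epsilon> K u p = A + \<epsilon> * B + w * D"
  using energy_norm_smooth_diff(2)[OF st b u ps \<epsilon>] by (simp add: local_error_sq_def A_def B_def D_def T_def w_def)
 then show ?thesis using n g bb unfolding smooth_local_sq_def f_def[symmetric] w_def[symmetric] by (simp add: algebra_simps)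
qed

lemma simplex_pair_fat:
 fixes K1 K2 :: "(real^'n) set"
 assumes K1: "int CARD('n) simplex K1" and K2: "int CARD('n) simplex K2"
 defines "h \<equiv> max (diameter K1) (diameter K2)"
 shows "fat (4 * \<bar>shape_const K1 K2\<bar>) h K1" "fat (4 * \<bar>shape_const K1 K2\<bar>) h K2"
proof -
 let ?\<sigma> = "shape_const K1 K2"
 define \<rho> where "\<rho> = min (inball_diam K1) (inball_diam K2)"
 note S1 = simplex_full[OF K1] and S2 = simplex_full[OF K2]
 have \<rho>: "0 < \<rho>" using inball_radius(1)[OF S1(1,4)] inball_radius(1)[OF S2(1,4)] by (simp add: \<rho>_def)
 then have h: "h = ?\<sigma> * \<rho>" unfolding shape_const_def h_def \<rho>_def[symmetric] by simp
 have main: "fat (4 * \<bar>?\<sigma>\<bar>) h K" if K: "int CARD('n) simplex K" "\<rho> <= inball_diam K" "diameter K <= h" for K :: "(real^'n) set"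
 proof -
  obtain x r where r: "0 < r" "inball_diam K <= 4 * r" "cball x r \<subseteq> K"
   using inball_radius(2)[OF simplex_full(1,4)[OF K(1)]] by (elim exE conjE)
  have "h <= \<bar>?\<sigma>\<bar> * \<rho>" unfolding h using \<rho> by (intro mult_right_mono) auto
  also have "... <= \<bar>?\<sigma>\<bar> * (4 * r)" using r(2) K(2) by (intro mult_left_mono) auto
  finally have "h <= 4 * \<bar>?\<sigma>\<bar> * r" by simp
  then show ?thesis using r K(3) unfolding fat_def by blast
 qed
 show "fat (4 * \<bar>?\<sigma>\<bar>) h K1" "fat (4 * \<bar>?\<sigma>\<bar>) h K2"
  by (rule main; simp add: K1 K2 \<rho>_def h_def)+
qed

text \<open>Apply the estimate for smooth functions to approximations of \<open>u\<close>; all terms that depend on the approximation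
vanish in the limit.\<close>

lemma best_approx_sq_bound:
 fixes \<sigma> :: real
 shows "\<exists>C\<ge>0. \<forall>\<epsilon> (K1 :: (real^'n) set) K2 E u P p1 p2. shape_const K1 K2 = \<sigma> --> \<epsilon> > 0 --> int CARD('n) simplex K1 -->
  int CARD('n) simplex K2 --> E = K1 \<inter> K2 --> E facet_of K1 --> E facet_of K2 --> u : H1 (K1 \<union> K2) --> best_approx \<epsilon> l K1 K2 u P -->
  p1 : polys l --> p2 : polys l -->
  (energy_norm \<epsilon> (K1 \<union> K2) (%x. u x - P x))^2 <= C * (local_error_sq \<epsilon> K1 u p1 + local_error_sq \<epsilon> K2 u p2)"
proof -
 have s: "0 <= 4 * \<bar>\<sigma>\<bar>" by simp
 obtain C where C: "0 <= C" and conf: "\<forall>(K1 :: (real^'n) set) K2 E a b u e ph p1 p2 \<epsilon> h. int CARD('n) simplex K1 --> int CARD('n) simplex K2 -->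
  E facet_of K1 --> E facet_of K2 --> cone_over K2 u E a b --> e : E --> fat (4 * \<bar>\<sigma>\<bar>) h K1 --> fat (4 * \<bar>\<sigma>\<bar>) h K2 --> smooth ph -->
  p1 : polys l --> p2 : polys l --> 0 < \<epsilon> --> (\<exists>q1\<in>polys l. \<exists>q2\<in>polys l. (\<forall>x. a \<bullet> x = b --> q1 x = q2 x) \<and>
   nsq K1 (%x. ph x - q1 x) + \<epsilon> * gsq K1 (%x. ph x - q1 x) + (nsq K2 (%x. ph x - q2 x) + \<epsilon> * gsq K2 (%x. ph x - q2 x))
   <= C * (smooth_local_sq \<epsilon> K1 (%x. ph x - p1 x) + smooth_local_sq \<epsilon> K2 (%x. ph x - p2 x)))"
  using conforming_estimate[where 'n='n, OF s, of l] by (elim exE conjE)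
 show ?thesis
 proof (intro exI[of _ "4 * C"] conjI allI impI)
  show "0 <= 4 * C" using C by simp
  fix \<epsilon> :: real and K1 K2 E :: "(real^'n) set" and u P p1 p2 :: "real^'n => real"
  assume sc: "shape_const K1 K2 = \<sigma>" and \<epsilon>: "\<epsilon> > 0" and K1: "int CARD('n) simplex K1" and K2: "int CARD('n) simplex K2"
   and E: "E = K1 \<inter> K2" and F1: "E facet_of K1" and F2: "E facet_of K2" and u: "u : H1 (K1 \<union> K2)" and P: "best_approx \<epsilon> l K1 K2 u P"
   and p1: "p1 : polys l" and p2: "p2 : polys l"
  let ?\<omega> = "K1 \<union> K2" let ?Om = "interior ?\<omega>" let ?M = "lebesgue_on ?Om"
  let ?X = "energy_norm \<epsilon> ?\<omega> (%x. u x - P x)"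
  let ?Y1 = "local_error_sq \<epsilon> K1 u p1" and ?Y2 = "local_error_sq \<epsilon> K2 u p2"
  from simplex_pair[OF K1 K2 E F1 F2] obtain a b u1 u2 e r
   where pair: "cone_over K2 u2 E a b & cone_over K1 u1 E (- a) (- b) & e : E & star_ball ?\<omega> e r" by (elim exE)
  have c2: "cone_over K2 u2 E a b" and c1: "cone_over K1 u1 E (- a) (- b)" and e: "e : E" and st: "star_ball ?\<omega> e r"
   by (simp_all only: pair)
  have b: "bounded ?\<omega>" using simplex_full(1)[OF K1] simplex_full(1)[OF K2] by (simp add: compact_imp_bounded)
  obtain G where uL: "u : L2 ?M" and GL: "G : L2 ?M" and wg: "is_weak_grad ?Om u G" using u unfolding H1_def by blast
  have sub: "interior K1 \<subseteq> ?Om" "interior K2 \<subseteq> ?Om" by (rule interior_mono, rule Un_upper1, rule interior_mono, rule Un_upper2)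
  note u1 = L2_restrict(1)[OF open_interior open_interior sub(1) uL] L2_restrict(1)[OF open_interior open_interior sub(1) GL]
   weak_grad_restrict[OF open_interior open_interior sub(1) wg]
  note u2 = L2_restrict(1)[OF open_interior open_interior sub(2) uL] L2_restrict(1)[OF open_interior open_interior sub(2) GL]
   weak_grad_restrict[OF open_interior open_interior sub(2) wg]
  define h where "h = max (diameter K1) (diameter K2)"
  have f: "fat (4 * \<bar>\<sigma>\<bar>) h K1" "fat (4 * \<bar>\<sigma>\<bar>) h K2" using simplex_pair_fat[OF K1 K2] unfolding sc h_def by simp_all
  obtain B1 where B1: "0 <= B1" "\<forall>f. smooth f --> bsq (frontier K1) f <= B1 * (nsq K1 f + gsq K1 f)"
   using boundary_trace[OF K1] by (elim exE conjE)
  obtain B2 where B2: "0 <= B2" "\<forall>f. smooth f --> bsq (frontier K2) f <= B2 * (nsq K2 f + gsq K2 f)"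
   using boundary_trace[OF K2] by (elim exE conjE)
  define M1 where "M1 = 2 * (1 + \<epsilon>) + 16 * area_volume_ratio K1 * B1"
  define M2 where "M2 = 2 * (1 + \<epsilon>) + 16 * area_volume_ratio K2 * B2"
  define N where "N = 2 * (1 + \<epsilon>) + 2 * C * (M1 + M2)"
  have M: "0 <= M1" "0 <= M2" using \<epsilon> B1(1) B2(1) area_volume_ratio_nonneg[of K1] area_volume_ratio_nonneg[of K2] by (simp_all add: M1_def M2_def)
  have N: "0 < N" unfolding N_def using \<epsilon> C M by (intro add_pos_nonneg mult_nonneg_nonneg) auto
  show "?X^2 <= 4 * C * (?Y1 + ?Y2)"
  proof (rule field_le_epsilon)
   fix \<eta> :: real assume \<eta>: "0 < \<eta>"
   (* N collects the coefficients of all terms that depend on the smooth approximation *)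
   define dl where "dl = \<eta> / N"
   have dl: "0 < dl" "N * dl = \<eta>" using \<eta> N by (simp_all add: dl_def)
   obtain ph where sm: "smooth ph" and L: "(%x. ph x - u x) : L2 ?M" "(%x. grad ph x - G x) : L2 ?M"
    and n: "(L2_norm ?M (%x. ph x - u x))^2 <= dl" "(L2_norm ?M (%x. grad ph x - G x))^2 <= dl"
    using smooth_dense_H1[OF st b uL GL wg dl(1)] by (elim exE conjE)
   obtain q1 q2 where q: "q1 : polys l" "q2 : polys l" and eq: "\<forall>x. a \<bullet> x = b --> q1 x = q2 x"
    and le: "nsq K1 (%x. ph x - q1 x) + \<epsilon> * gsq K1 (%x. ph x - q1 x) + (nsq K2 (%x. ph x - q2 x) + \<epsilon> * gsq K2 (%x. ph x - q2 x))
     <= C * (smooth_local_sq \<epsilon> K1 (%x. ph x - p1 x) + smooth_local_sq \<epsilon> K2 (%x. ph x - p2 x))"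
    using conf[rule_format, OF K1 K2 F1 F2 c2 e f sm p1 p2 \<epsilon>] by (elim bexE conjE)
   have "smooth_local_sq \<epsilon> K1 (%x. ph x - p1 x) <= 2 * ?Y1 + M1 * dl" unfolding M1_def
    by (rule smooth_local_sq_le[OF K1 u1 sm p1 less_imp_le[OF \<epsilon>] B1
     order_trans[OF L2_restrict(2)[OF open_interior open_interior sub(1) L(1)] n(1)]
     order_trans[OF L2_restrict(2)[OF open_interior open_interior sub(1) L(2)] n(2)]])
   moreover have "smooth_local_sq \<epsilon> K2 (%x. ph x - p2 x) <= 2 * ?Y2 + M2 * dl" unfolding M2_def
    by (rule smooth_local_sq_le[OF K2 u2 sm p2 less_imp_le[OF \<epsilon>] B2
     order_trans[OF L2_restrict(2)[OF open_interior open_interior sub(2) L(1)] n(1)]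
     order_trans[OF L2_restrict(2)[OF open_interior open_interior sub(2) L(2)] n(2)]])
   ultimately have "smooth_local_sq \<epsilon> K1 (%x. ph x - p1 x) + smooth_local_sq \<epsilon> K2 (%x. ph x - p2 x) <= 2 * (?Y1 + ?Y2) + (M1 + M2) * dl"
    by (simp add: algebra_simps)
   from mult_left_mono[OF this C] have le2: "C * (smooth_local_sq \<epsilon> K1 (%x. ph x - p1 x) + smooth_local_sq \<epsilon> K2 (%x. ph x - p2 x))
    <= C * (2 * (?Y1 + ?Y2) + (M1 + M2) * dl)" .
   obtain Q where Q: "Q : cont_pw_polys l K1 K2" and X: "(energy_norm \<epsilon> ?\<omega> (%x. u x - Q x))^2
     <= 2 * ((L2_norm ?M (%x. ph x - u x))^2 + \<epsilon> * (L2_norm ?M (%x. grad ph x - G x))^2)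
     + 2 * (nsq K1 (%x. ph x - q1 x) + \<epsilon> * gsq K1 (%x. ph x - q1 x) + (nsq K2 (%x. ph x - q2 x) + \<epsilon> * gsq K2 (%x. ph x - q2 x)))"
    using glued_error[OF c2 c1 st uL GL wg sm q eq less_imp_le[OF \<epsilon>]] by (elim bexE)
   have "?X <= energy_norm \<epsilon> ?\<omega> (%x. u x - Q x)" using P Q unfolding best_approx_def by blast
   then have XQ: "?X^2 <= (energy_norm \<epsilon> ?\<omega> (%x. u x - Q x))^2" using \<epsilon> by (intro power_mono energy_norm_nonneg) auto
   have ed: "\<epsilon> * (L2_norm ?M (%x. grad ph x - G x))^2 <= \<epsilon> * dl" using n(2) \<epsilon> by (intro mult_left_mono) auto
   have "?X^2 <= 2 * (dl + \<epsilon> * dl) + 2 * (C * (2 * (?Y1 + ?Y2) + (M1 + M2) * dl))"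
    by (rule order_trans[OF XQ order_trans[OF X add_mono[OF mult_left_mono[OF add_mono[OF n(1) ed]] mult_left_mono[OF order_trans[OF le le2]]]]]) simp_all
   also have "... = 4 * C * (?Y1 + ?Y2) + N * dl" by (simp add: N_def algebra_simps)
   finally show "?X^2 <= 4 * C * (?Y1 + ?Y2) + \<eta>" unfolding dl(2) .
  qed
 qed
qed

text \<open>Both infima may be taken separately because the two polynomials are independent of each other.\<close>

lemma best_approx_bound:
 fixes \<sigma> :: real
 shows "\<exists>c. \<forall>\<epsilon> (K1 :: (real^'n) set) K2 E u P. shape_const K1 K2 = \<sigma> --> \<epsilon> > 0 --> int CARD('n) simplex K1 -->
  int CARD('n) simplex K2 --> E = K1 \<inter> K2 --> E facet_of K1 --> E facet_of K2 --> u : H1 (K1 \<union> K2) --> best_approx \<epsilon> l K1 K2 u P -->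
  energy_norm \<epsilon> (K1 \<union> K2) (%x. u x - P x) <= c * (\<Sum>K\<in>{K1, K2}. local_error \<epsilon> l K u)"
proof -
 obtain C where C: "0 <= C" and bd: "\<forall>\<epsilon> (K1 :: (real^'n) set) K2 E u P p1 p2. shape_const K1 K2 = \<sigma> --> \<epsilon> > 0 --> int CARD('n) simplex K1 -->
  int CARD('n) simplex K2 --> E = K1 \<inter> K2 --> E facet_of K1 --> E facet_of K2 --> u : H1 (K1 \<union> K2) --> best_approx \<epsilon> l K1 K2 u P -->
  p1 : polys l --> p2 : polys l -->
  (energy_norm \<epsilon> (K1 \<union> K2) (%x. u x - P x))^2 <= C * (local_error_sq \<epsilon> K1 u p1 + local_error_sq \<epsilon> K2 u p2)"
  using best_approx_sq_bound[where 'n='n, of \<sigma> l] by (elim exE conjE)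
 (* one is added so that division by c is possible *)
 define c where "c = sqrt C + 1"
 have c: "0 < c" "sqrt C <= c" using C by (simp_all add: c_def add_nonneg_pos)
 show ?thesis
 proof (intro exI[of _ c] allI impI)
  fix \<epsilon> :: real and K1 K2 E :: "(real^'n) set" and u P :: "real^'n => real"
  assume as: "shape_const K1 K2 = \<sigma>" "\<epsilon> > 0" "int CARD('n) simplex K1" "int CARD('n) simplex K2"
   "E = K1 \<inter> K2" "E facet_of K1" "E facet_of K2" "u : H1 (K1 \<union> K2)" "best_approx \<epsilon> l K1 K2 u P"
  let ?X = "energy_norm \<epsilon> (K1 \<union> K2) (%x. u x - P x)"
  let ?Y = "%K p. sqrt (local_error_sq \<epsilon> K u p)"
  have Y0: "0 <= local_error_sq \<epsilon> K u p" for K p by (simp add: local_error_sq_def area_volume_ratio_nonneg)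
  have X: "?X / c <= ?Y K1 p1 + ?Y K2 p2" if p: "p1 : polys l" "p2 : polys l" for p1 p2
  proof -
   have "?X^2 <= C * (local_error_sq \<epsilon> K1 u p1 + local_error_sq \<epsilon> K2 u p2)" by (rule bd[rule_format, OF as p])
   then have "?X <= sqrt (C * (local_error_sq \<epsilon> K1 u p1 + local_error_sq \<epsilon> K2 u p2))" by (rule real_le_rsqrt)
   also have "... = sqrt C * sqrt (local_error_sq \<epsilon> K1 u p1 + local_error_sq \<epsilon> K2 u p2)" by (rule real_sqrt_mult)
   also have "... <= c * (?Y K1 p1 + ?Y K2 p2)"
    using c C by (intro mult_mono sqrt_add_le_add_sqrt Y0) (auto simp: Y0)
   finally show ?thesis using c(1) by (simp add: pos_divide_le_eq mult.commute)
  qed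
  have ne: "polys l ~= ({} :: (real^'n => real) set)" using polys_const[of 0 l] by blast
  have le: "local_error \<epsilon> l K u = (INF p\<in>polys l. ?Y K p)" for K
   by (simp add: local_error_def local_error_sq_def area_volume_ratio_def)
  have "?X / c - local_error \<epsilon> l K2 u <= local_error \<epsilon> l K1 u"
   unfolding le[of K1]
  proof (rule cINF_greatest[OF ne])
   fix p1 :: "real^'n => real" assume p1: "p1 : polys l"
   have "?X / c - ?Y K1 p1 <= local_error \<epsilon> l K2 u" unfolding le[of K2]
   proof (rule cINF_greatest[OF ne])
    fix p2 :: "real^'n => real" assume "p2 : polys l"
    from X[OF p1 this] show "?X / c - ?Y K1 p1 <= ?Y K2 p2" by linarith
   qed
   then show "?X / c - local_error \<epsilon> l K2 u <= ?Y K1 p1" by linarith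
  qed
  then have "?X / c <= local_error \<epsilon> l K1 u + local_error \<epsilon> l K2 u" by linarith
  moreover have "K1 ~= K2" using as(5,6) by auto
  ultimately show "?X <= c * (\<Sum>K\<in>{K1, K2}. local_error \<epsilon> l K u)" using c(1) by (simp add: pos_divide_le_eq mult.commute)
 qed
qed

theorem proposition6p4:
  shows "\<exists>C :: nat \<Rightarrow> real \<Rightarrow> real.
    \<forall>(l :: nat) (\<epsilon> :: real) (K1 :: (real^'n::finite) set) (K2 :: (real^'n) set) (E :: (real^'n) set)
      (u :: real^'n \<Rightarrow> real) (P\<^sub>E :: real^'n \<Rightarrow> real).
      l \<ge> 1 \<longrightarrow> \<epsilon> > 0 \<longrightarrow>
      int CARD('n) simplex K1 \<longrightarrow> int CARD('n) simplex K2 \<longrightarrow>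
      E = K1 \<inter> K2 \<longrightarrow> E facet_of K1 \<longrightarrow> E facet_of K2 \<longrightarrow>
      u \<in> H1 (K1 \<union> K2) \<longrightarrow> best_approx \<epsilon> l K1 K2 u P\<^sub>E \<longrightarrow>
      energy_norm \<epsilon> (K1 \<union> K2) (\<lambda>x. u x - P\<^sub>E x)
        \<le> C l (shape_const K1 K2) * (\<Sum>K\<in>{K1, K2}. local_error \<epsilon> l K u)"
proof -
  let ?P = "\<lambda>l \<sigma> c. \<forall>\<epsilon> (K1 :: (real^'n) set) K2 E u P. shape_const K1 K2 = \<sigma> \<longrightarrow> \<epsilon> > 0 \<longrightarrow> int CARD('n) simplex K1 \<longrightarrow>
     int CARD('n) simplex K2 \<longrightarrow> E = K1 \<inter> K2 \<longrightarrow> E facet_of K1 \<longrightarrow> E facet_of K2 \<longrightarrow> u \<in> H1 (K1 \<union> K2) \<longrightarrow> best_approx \<epsilon> l K1 K2 u P \<longrightarrow>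
     energy_norm \<epsilon> (K1 \<union> K2) (\<lambda>x. u x - P x) \<le> c * (\<Sum>K\<in>{K1, K2}. local_error \<epsilon> l K u)"
  have "\<exists>f. \<forall>\<sigma>. ?P l \<sigma> (f \<sigma>)" for l
    by (rule choice) (rule allI, rule best_approx_bound)
  then have "\<forall>l. \<exists>f. \<forall>\<sigma>. ?P l \<sigma> (f \<sigma>)" by (rule allI)
  from choice[OF this] obtain C where C: "\<forall>l \<sigma>. ?P l \<sigma> (C l \<sigma>)" ..
  show ?thesis
  proof (intro exI[of _ C] allI impI)
    fix l :: nat and \<epsilon> :: real and K1 K2 E :: "(real^'n) set" and u P :: "real^'n \<Rightarrow> real"
    assume "\<epsilon> > 0" "int CARD('n) simplex K1" "int CARD('n) simplex K2" "E = K1 \<inter> K2" "E facet_of K1" "E facet_of K2"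
      "u \<in> H1 (K1 \<union> K2)" "best_approx \<epsilon> l K1 K2 u P"
    then show "energy_norm \<epsilon> (K1 \<union> K2) (\<lambda>x. u x - P x) \<le> C l (shape_const K1 K2) * (\<Sum>K\<in>{K1, K2}. local_error \<epsilon> l K u)"
      by (rule C[rule_format, OF refl])
  qed
qed

end
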